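(* Let $\Theta=(\theta_i)_{i\ge 0}$ be a sequence in $[0,\infty)$ with $\sum_{i\ge 0}\theta_i^2=1$ and $\theta_1\ge\theta_2\ge\cdots$. Let $(\mathcal T,d_{\mathcal T})$ be the $\Theta$-ICRT equipped with its uniform angle function, and let $(\mathcal L,d_{\mathcal L})$ be its looptree. Then almost surely $d_{\mathcal L}$ is finite on $\mathcal T\times[0,1]$, and $(\mathcal L,d_{\mathcal L})$ is compact (as a pseudo-metric space).
   Context: Notation: $\mathbb N=\{1,2,\dots\}$, $\mathbb R^+=[0,\infty)$. ICRT. Let $(X_i)_{i\in\mathbb N}$ be independent exponential random variables of parameters $(\theta_i)_{i\in\mathbb N}$ ($X_i=+\infty$ if $\theta_i=0$; such indices contribute nothing to the sums below). Let $\mu=\theta_0^2\,dx+\sum_{i\ge1}\theta_i\delta_{X_i}$ on $\mathbb R^+$; $\mu_l$ is the restriction of $\mu$ to $[0,l]$ and $\mathfrak p_l=\mu_l/\mu[0,l]$. Given $\mu$, let $Y_1<Y_2<\cdots$ be the points of a Poisson point process on $\mathbb R^+$ of rate $\mu[0,l]\,dl$; given $(\mu,(Y_i))$, let $(Z_i)_{i\in\mathbb N}$ be independent with laws $(\mathfrak p_{Y_i})_{i\in\mathbb N}$. Put $Y_0=Z_0=0$. Define $d_{\mathcal T}$ on $\mathbb R^+$ inductively: for $i\ge0$ and $x\le y\le Y_{i+1}$, if $x\le Y_i<y$ then $d_{\mathcal T}(x,y)=d_{\mathcal T}(x,Z_i)+(y-Y_i)$, and if $x,y\in(Y_i,Y_{i+1}]$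 then $d_{\mathcal T}(x,y)=y-x$. The $\Theta$-ICRT $(\mathcal T,d_{\mathcal T})$ is the completion of $(\mathbb R^+,d_{\mathcal T})$, an $\mathbb R$-tree rooted at $0$. Angle function. An angle function on an $\mathbb R$-tree $\mathcal T$ rooted at $\rho$ is $u:\mathcal T^2\to[0,1]$ with $u_{x,\rho}=u_{x,x}=0$ for all $x$, and, for all $x$ and $y,z\ne x$: $u_{x,y}=u_{x,z}$ iff $y,z$ are in the same connected component of $\mathcal T\setminus\{x\}$. Let $(U_{X,i})_{i\in\mathbb N},(U_{Z,i})_{i\in\mathbb N}$ be independent uniform variables on $[0,1]$, independent of the rest. The uniform angle function $U$ on the ICRT is the (a.s. well defined) unique angle function such that, for all $i\in\mathbb N$, $U_{X_i,Y_a}=U_{X,i}$ with $a=\inf\{a:Y_a>X_i\}$; $U_{Z_i,Y_{i+1}}=U_{Z,i}$; and for every $x\in\mathbb R^+\setminus\bigcup_i\{X_i,Y_i\}$, $U_{x,Y_a}=1/2$ with $a=\inf\{a:Y_a>x\}$. Looptree. For $x,y\in\mathcal T$, $v\in[0,1]$, let $U_{x,y,v}=U_{x,y}$ if $x\ne y$ and $U_{x,y,v}=v$ if $x=y$. Let $\mathfrak c$ be the distance on the torus $[0,1]$ (i.e. $\mathfrak c(a,b)=\min(|a-b|,1-|a-b|)$). On $\mathcal T\times[0,1]$ set $$d_{\mathcal L}((x,u),(y,v))=\frac{\theta_0^2}{4}d_{\mathcal T}(x,y)+\sum_{i\in\mathbb N}\theta_i\,\mathfrak c(U_{X_i,x,u},U_{X_i,y,v}).$$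 $(\mathcal L,d_{\mathcal L})$ is the completion of the pseudo-metric space $(\mathcal T\times[0,1],d_{\mathcal L})$ (obtained by adding limit points only for Cauchy sequences without limit in $\mathcal T\times[0,1]$). *)

theory Defs
  imports "HOL-Probability.Probability"
begin

section \<open>Pseudo-metric spaces\<close>

definition pseudometric_on :: "'p set \<Rightarrow> ('p \<Rightarrow> 'p \<Rightarrow> real) \<Rightarrow> bool" where
  "pseudometric_on S d \<longleftrightarrow>
     (\<forall>p\<in>S. \<forall>q\<in>S. 0 \<le> d p q \<and> d p q = d q p) \<and> (\<forall>p\<in>S. d p p = 0) \<and>
     (\<forall>p\<in>S. \<forall>q\<in>S. \<forall>r\<in>S. d p r \<le> d p q + d q r)"

definition pm_topology :: "'p set \<Rightarrow> ('p \<Rightarrow> 'p \<Rightarrow> real) \<Rightarrow> 'p topology" where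
  "pm_topology S d =
     topology (\<lambda>U. U \<subseteq> S \<and> (\<forall>p\<in>U. \<exists>r>0. {q\<in>S. d p q < r} \<subseteq> U))"

lemma pm_topology_eq_mtopology:
  assumes "Metric_space S d"
  shows "pm_topology S d = Metric_space.mtopology S d"
proof -
  interpret Metric_space S d by fact
  have ball: "{q\<in>S. d p q < r} = mball p r" if "p \<in> S" for p r
    using that by (simp add: mball_def)
  have "(U \<subseteq> S \<and> (\<forall>p\<in>U. \<exists>r>0. {q\<in>S. d p q < r} \<subseteq> U)) = mopen U" for U
  proof (cases "U \<subseteq> S")
    case True
    then have "(\<forall>p\<in>U. \<exists>r>0. {q\<in>S. d p q < r} \<subseteq> U) \<longleftrightarrow> (\<forall>p\<in>U. \<exists>r>0. mball p r \<subseteq> U)"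
      by (intro ball_cong refl) (metis ball subsetD)
    with True show ?thesis
      unfolding mopen_def by blast
  qed (simp add: mopen_def)
  then show ?thesis
    unfolding pm_topology_def mtopology_def by simp
qed

definition compact_pseudometric_space :: "'p set \<Rightarrow> ('p \<Rightarrow> 'p \<Rightarrow> real) \<Rightarrow> bool" where
  "compact_pseudometric_space S d \<longleftrightarrow>
     pseudometric_on S d \<and> compact_space (pm_topology S d)"

text \<open>
  Completion of a pseudo-metric space (S, d).  The points of S are kept (as \<^term>\<open>Inl\<close>); one
  limit point is added (as \<^term>\<open>Inr\<close>) for each class of equivalent Cauchy sequences that have
  no limit in S.  Points of S at distance 0 are not identified.  If d is a metric, this is
  the usual metric completion.
\<close>

definition Cauchy_seqs :: "'p set \<Rightarrow> ('p \<Rightarrow> 'p \<Rightarrow> real) \<Rightarrow> (nat \<Rightarrow> 'p) set" where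
  "Cauchy_seqs S d =
     {s. (\<forall>n. s n \<in> S) \<and> (\<forall>e>0. \<exists>N. \<forall>m\<ge>N. \<forall>n\<ge>N. d (s m) (s n) < e)}"

definition nonconvergent_Cauchy_seqs :: "'p set \<Rightarrow> ('p \<Rightarrow> 'p \<Rightarrow> real) \<Rightarrow> (nat \<Rightarrow> 'p) set" where
  "nonconvergent_Cauchy_seqs S d =
     {s \<in> Cauchy_seqs S d. \<not> (\<exists>p\<in>S. (\<lambda>n. d (s n) p) \<longlonglongrightarrow> 0)}"

definition Cauchy_equiv :: "'p set \<Rightarrow> ('p \<Rightarrow> 'p \<Rightarrow> real) \<Rightarrow> ((nat \<Rightarrow> 'p) \<times> (nat \<Rightarrow> 'p)) set" where
  "Cauchy_equiv S d =
     {(s, t). s \<in> nonconvergent_Cauchy_seqs S d \<and> t \<in> nonconvergent_Cauchy_seqs S d \<and>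
              (\<lambda>n. d (s n) (t n)) \<longlonglongrightarrow> 0}"

type_synonym 'p completion_point = "'p + (nat \<Rightarrow> 'p) set"

definition completion_carrier :: "'p set \<Rightarrow> ('p \<Rightarrow> 'p \<Rightarrow> real) \<Rightarrow> 'p completion_point set" where
  "completion_carrier S d =
     Inl ` S \<union> Inr ` (nonconvergent_Cauchy_seqs S d // Cauchy_equiv S d)"

primrec approx_seq :: "'p completion_point \<Rightarrow> nat \<Rightarrow> 'p" where
  "approx_seq (Inl p) = (\<lambda>_. p)"
| "approx_seq (Inr C) = (SOME s. s \<in> C)"

definition completion_dist ::
  "('p \<Rightarrow> 'p \<Rightarrow> real) \<Rightarrow> 'p completion_point \<Rightarrow> 'p completion_point \<Rightarrow> real" where
  "completion_dist d p q = lim (\<lambda>n. d (approx_seq p n) (approx_seq q n))"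


section \<open>The tree, its uniform angle function and its looptree, for given values of the variables\<close>

text \<open>
  Sequences are indexed by \<^typ>\<open>nat\<close>; the index set of X, U_X, U_Z is \<^term>\<open>{1::nat..}\<close>, and
  \<open>y 0 = z 0 = 0\<close>.  The values \<open>x i\<close> are real; an index i with \<open>\<theta> i = 0\<close> stands for
  \<open>x i = \<infinity>\<close>, the number \<open>x i\<close> is then irrelevant: it is excluded below by \<^term>\<open>atoms \<theta>\<close> or by a
  factor \<open>\<theta> i\<close>.
\<close>

definition atoms :: "(nat \<Rightarrow> real) \<Rightarrow> nat set" where
  "atoms \<theta> = {i. 1 \<le> i \<and> 0 < \<theta> i}"

definition icrt_mu :: "(nat \<Rightarrow> real) \<Rightarrow> (nat \<Rightarrow> real) \<Rightarrow> real measure" where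
  "icrt_mu \<theta> x = measure_of UNIV (sets borel)
     (\<lambda>B. ennreal ((\<theta> 0)\<^sup>2) * emeasure lborel (B \<inter> {0..})
          + (\<Sum>i. ennreal (\<theta> (Suc i)) * indicator B (x (Suc i))))"

lemma sets_icrt_mu [simp, measurable_cong]: "sets (icrt_mu \<theta> x) = sets borel"
  unfolding icrt_mu_def
  using sets.sigma_sets_eq[of "borel :: real measure"] by (simp add: sets_measure_of)

lemma space_icrt_mu [simp]: "space (icrt_mu \<theta> x) = UNIV"
  using sets_eq_imp_space_eq[OF sets_icrt_mu] by simp

lemma emeasure_icrt_mu:
  assumes "B \<in> sets borel"
  shows "emeasure (icrt_mu \<theta> x) B = ennreal ((\<theta> 0)\<^sup>2) * emeasure lborel (B \<inter> {0..})
          + (\<Sum>i. ennreal (\<theta> (Suc i)) * indicator B (x (Suc i)))"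
    (is "_ = ?f B")
proof (rule emeasure_measure_of[OF icrt_mu_def])
  show "sets borel \<subseteq> Pow (UNIV :: real set)" by simp
  show "B \<in> sets (icrt_mu \<theta> x)" using assms by simp
  show "positive (sets (icrt_mu \<theta> x)) ?f" by (simp add: positive_def)
  show "countably_additive (sets (icrt_mu \<theta> x)) ?f"
  proof (rule countably_additiveI)
    fix A :: "nat \<Rightarrow> real set"
    assume A: "range A \<subseteq> sets (icrt_mu \<theta> x)" and dis: "disjoint_family A"
    have m: "A n \<in> sets borel" for n using A by auto
    have "(\<Sum>n. emeasure lborel (A n \<inter> {0..})) = emeasure lborel (\<Union>n. A n \<inter> {0..})"
      using dis m by (intro suminf_emeasure) (auto simp: disjoint_family_on_def)
    then have 1: "(\<Sum>n. emeasure lborel (A n \<inter> {0..})) = emeasure lborel ((\<Union>n. A n) \<inter> {0..})"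
      by simp
    have 2: "(\<Sum>n. \<Sum>i. ennreal (\<theta> (Suc i)) * indicator (A n) (x (Suc i)))
        = (\<Sum>i. ennreal (\<theta> (Suc i)) * indicator (\<Union>n. A n) (x (Suc i)))"
    proof -
      have "(\<Sum>n. \<Sum>i. ennreal (\<theta> (Suc i)) * indicator (A n) (x (Suc i)))
          = (\<Sum>i. \<Sum>n. ennreal (\<theta> (Suc i)) * indicator (A n) (x (Suc i)))"
        using nn_integral_suminf[of "\<lambda>i n. ennreal (\<theta> (Suc i)) * indicator (A n) (x (Suc i))" "count_space UNIV"]
        by (simp add: nn_integral_count_space_nat)
      then show ?thesis using dis
        by (simp add: suminf_indicator)
    qed
    show "(\<Sum>n. ?f (A n)) = ?f (\<Union>n. A n)"
      by (simp add: suminf_add[symmetric] 1 2)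
  qed
qed

text \<open>The law of a point chosen according to \<open>\<mu>\<close> restricted to [0,l] and normalised.\<close>

definition icrt_p :: "(nat \<Rightarrow> real) \<Rightarrow> (nat \<Rightarrow> real) \<Rightarrow> real \<Rightarrow> real measure" where
  "icrt_p \<theta> x l = uniform_measure (icrt_mu \<theta> x) {0..l}"

definition icrt_rate :: "(nat \<Rightarrow> real) \<Rightarrow> (nat \<Rightarrow> real) \<Rightarrow> real measure" where
  "icrt_rate \<theta> x = density lborel (\<lambda>l. emeasure (icrt_mu \<theta> x) {0..l})"

text \<open>\<open>pre_dist_upto y z n\<close> is the distance on \<open>[0, y n]\<close>.\<close>

primrec pre_dist_upto ::
  "(nat \<Rightarrow> real) \<Rightarrow> (nat \<Rightarrow> real) \<Rightarrow> nat \<Rightarrow> real \<Rightarrow> real \<Rightarrow> real" where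
  "pre_dist_upto y z 0 s t = 0"
| "pre_dist_upto y z (Suc i) s t =
     (if s \<le> y i \<and> t \<le> y i then pre_dist_upto y z i s t
      else if s \<le> y i then pre_dist_upto y z i s (z i) + (t - y i)
      else if t \<le> y i then pre_dist_upto y z i t (z i) + (s - y i)
      else \<bar>s - t\<bar>)"

definition pre_dist :: "(nat \<Rightarrow> real) \<Rightarrow> (nat \<Rightarrow> real) \<Rightarrow> real \<Rightarrow> real \<Rightarrow> real" where
  "pre_dist y z s t = pre_dist_upto y z (LEAST n. s \<le> y n \<and> t \<le> y n) s t"

type_synonym tree_point = "real completion_point"

definition icrt :: "(nat \<Rightarrow> real) \<Rightarrow> (nat \<Rightarrow> real) \<Rightarrow> tree_point set" where
  "icrt y z = completion_carrier {0..} (pre_dist y z)"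

definition icrt_dist ::
  "(nat \<Rightarrow> real) \<Rightarrow> (nat \<Rightarrow> real) \<Rightarrow> tree_point \<Rightarrow> tree_point \<Rightarrow> real" where
  "icrt_dist y z = completion_dist (pre_dist y z)"

text \<open>
  Angle functions are required to be extensional (\<^const>\<open>PiE\<close>), so that uniqueness of an angle
  function on T is uniqueness of a HOL function.
\<close>

definition angle_function ::
  "'p set \<Rightarrow> ('p \<Rightarrow> 'p \<Rightarrow> real) \<Rightarrow> 'p \<Rightarrow> ('p \<times> 'p \<Rightarrow> real) \<Rightarrow> bool" where
  "angle_function T d \<rho> u \<longleftrightarrow>
     u \<in> (T \<times> T \<rightarrow>\<^sub>E {0..1}) \<and>
     (\<forall>p\<in>T. u (p, \<rho>) = 0 \<and> u (p, p) = 0) \<and>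
     (\<forall>p\<in>T. \<forall>q\<in>T - {p}. \<forall>r\<in>T - {p}.
        u (p, q) = u (p, r) \<longleftrightarrow>
        connected_component_of (subtopology (pm_topology T d) (T - {p})) q r)"

definition next_point :: "(nat \<Rightarrow> real) \<Rightarrow> real \<Rightarrow> tree_point" where
  "next_point y t = Inl (y (LEAST a. t < y a))"

definition uniform_angle_conditions ::
  "(nat \<Rightarrow> real) \<Rightarrow> (nat \<Rightarrow> real) \<Rightarrow> (nat \<Rightarrow> real) \<Rightarrow> (nat \<Rightarrow> real) \<Rightarrow> (nat \<Rightarrow> real) \<Rightarrow> (nat \<Rightarrow> real)
    \<Rightarrow> (tree_point \<times> tree_point \<Rightarrow> real) \<Rightarrow> bool" where
  "uniform_angle_conditions \<theta> x y z ux uz u \<longleftrightarrow>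
     (\<forall>i\<in>atoms \<theta>. u (Inl (x i), next_point y (x i)) = ux i) \<and>
     (\<forall>i\<ge>1. u (Inl (z i), Inl (y (Suc i))) = uz i) \<and>
     (\<forall>t\<in>{0..} - (x ` atoms \<theta> \<union> y ` {1..}). u (Inl t, next_point y t) = 1/2)"

definition uniform_angle ::
  "(nat \<Rightarrow> real) \<Rightarrow> (nat \<Rightarrow> real) \<Rightarrow> (nat \<Rightarrow> real) \<Rightarrow> (nat \<Rightarrow> real) \<Rightarrow> (nat \<Rightarrow> real) \<Rightarrow> (nat \<Rightarrow> real)
    \<Rightarrow> tree_point \<times> tree_point \<Rightarrow> real" where
  "uniform_angle \<theta> x y z ux uz =
     (THE u. angle_function (icrt y z) (icrt_dist y z) (Inl 0) u \<and>
             uniform_angle_conditions \<theta> x y z ux uz u)"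

definition torus_dist :: "real \<Rightarrow> real \<Rightarrow> real" where
  "torus_dist a b = min \<bar>a - b\<bar> (1 - \<bar>a - b\<bar>)"

definition angle3 :: "('p \<times> 'p \<Rightarrow> real) \<Rightarrow> 'p \<Rightarrow> 'p \<Rightarrow> real \<Rightarrow> real" where
  "angle3 u p q v = (if p \<noteq> q then u (p, q) else v)"

definition pre_looptree :: "(nat \<Rightarrow> real) \<Rightarrow> (nat \<Rightarrow> real) \<Rightarrow> (tree_point \<times> real) set" where
  "pre_looptree y z = icrt y z \<times> {0..1}"

text \<open>The sum may a priori be infinite, hence the extended values.\<close>

definition pre_looptree_dist ::
  "(nat \<Rightarrow> real) \<Rightarrow> (nat \<Rightarrow> real) \<Rightarrow> (nat \<Rightarrow> real) \<Rightarrow> (nat \<Rightarrow> real)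
    \<Rightarrow> (tree_point \<times> tree_point \<Rightarrow> real) \<Rightarrow> tree_point \<times> real \<Rightarrow> tree_point \<times> real \<Rightarrow> ennreal" where
  "pre_looptree_dist \<theta> x y z U = (\<lambda>(p, u) (q, v).
     ennreal ((\<theta> 0)\<^sup>2 / 4 * icrt_dist y z p q) +
     (\<Sum>i. ennreal (\<theta> (Suc i) *
        torus_dist (angle3 U (Inl (x (Suc i))) p u) (angle3 U (Inl (x (Suc i))) q v))))"

definition looptree ::
  "(nat \<Rightarrow> real) \<Rightarrow> (nat \<Rightarrow> real) \<Rightarrow> (nat \<Rightarrow> real) \<Rightarrow> (nat \<Rightarrow> real)
    \<Rightarrow> (tree_point \<times> tree_point \<Rightarrow> real) \<Rightarrow> (tree_point \<times> real) completion_point set" where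
  "looptree \<theta> x y z U =
     completion_carrier (pre_looptree y z) (\<lambda>p q. enn2real (pre_looptree_dist \<theta> x y z U p q))"

definition looptree_dist ::
  "(nat \<Rightarrow> real) \<Rightarrow> (nat \<Rightarrow> real) \<Rightarrow> (nat \<Rightarrow> real) \<Rightarrow> (nat \<Rightarrow> real)
    \<Rightarrow> (tree_point \<times> tree_point \<Rightarrow> real)
    \<Rightarrow> (tree_point \<times> real) completion_point \<Rightarrow> (tree_point \<times> real) completion_point \<Rightarrow> real" where
  "looptree_dist \<theta> x y z U =
     completion_dist (\<lambda>p q. enn2real (pre_looptree_dist \<theta> x y z U p q))"


section \<open>The random variables\<close>

definition generated_by :: "'a measure \<Rightarrow> ('a \<Rightarrow> real) set \<Rightarrow> 'a measure" where
  "generated_by M V = sigma (space M) {f -` B \<inter> space M | f B. f \<in> V \<and> B \<in> sets borel}"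

text \<open>
  Conditionally on F, the points \<open>Y 1, Y 2, \<dots>\<close> form a Poisson point process with intensity
  measure \<open>\<nu>\<close> (which is finite on bounded sets): the numbers of points in disjoint bounded
  Borel sets are independent Poisson variables.  The Poisson weights are spelled out because
  \<^const>\<open>poisson_pmf\<close> excludes the parameter 0.
\<close>

definition conditional_Poisson_process ::
  "'a measure \<Rightarrow> 'a measure \<Rightarrow> (nat \<Rightarrow> 'a \<Rightarrow> real) \<Rightarrow> ('a \<Rightarrow> real measure) \<Rightarrow> bool" where
  "conditional_Poisson_process M F Y \<nu> \<longleftrightarrow>
     (\<forall>(J :: nat set) B n.
        finite J \<and> (\<forall>j\<in>J. B j \<in> sets borel \<and> bounded (B j)) \<and> disjoint_family_on B J \<longrightarrow>
        (AE \<omega> in M.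
           real_cond_exp M F
             (indicat_real {\<omega> \<in> space M. \<forall>j\<in>J.
                finite {i. 1 \<le> i \<and> Y i \<omega> \<in> B j} \<and> card {i. 1 \<le> i \<and> Y i \<omega> \<in> B j} = n j}) \<omega>
           = (\<Prod>j\<in>J. measure (\<nu> \<omega>) (B j) ^ n j / fact (n j) * exp (- measure (\<nu> \<omega>) (B j)))))"

text \<open>Conditionally on F, the variables \<open>Z 1, Z 2, \<dots>\<close> are independent and \<open>Z i\<close> has law \<open>p i\<close>.\<close>

definition conditionally_independent_with_laws ::
  "'a measure \<Rightarrow> 'a measure \<Rightarrow> (nat \<Rightarrow> 'a \<Rightarrow> real) \<Rightarrow> (nat \<Rightarrow> 'a \<Rightarrow> real measure) \<Rightarrow> bool" where
  "conditionally_independent_with_laws M F Z p \<longleftrightarrow>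
     (\<forall>J B. finite J \<and> J \<subseteq> {1..} \<and> (\<forall>j\<in>J. B j \<in> sets borel) \<longrightarrow>
        (AE \<omega> in M.
           real_cond_exp M F (indicat_real {\<omega> \<in> space M. \<forall>j\<in>J. Z j \<omega> \<in> B j}) \<omega>
           = (\<Prod>j\<in>J. measure (p j \<omega>) (B j))))"

locale icrt_variables = prob_space M
  for M :: "'a measure" +
  fixes \<theta> :: "nat \<Rightarrow> real"
    and X Y Z UX UZ :: "nat \<Rightarrow> 'a \<Rightarrow> real"
  assumes X_indep: "indep_vars (\<lambda>_. borel) X (atoms \<theta>)"
    and X_law: "\<And>i. i \<in> atoms \<theta> \<Longrightarrow> distributed M lborel (X i) (exponential_density (\<theta> i))"
    and Y_measurable: "\<And>i. random_variable borel (Y i)"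
    and Y_0: "\<And>\<omega>. \<omega> \<in> space M \<Longrightarrow> Y 0 \<omega> = 0"
    and Y_increasing: "AE \<omega> in M. 0 \<le> Y 1 \<omega> \<and> (\<forall>i\<ge>1. Y i \<omega> < Y (Suc i) \<omega>)"
    and Y_law: "conditional_Poisson_process M (generated_by M (X ` atoms \<theta>)) Y
                  (\<lambda>\<omega>. icrt_rate \<theta> (\<lambda>i. X i \<omega>))"
    and Z_measurable: "\<And>i. random_variable borel (Z i)"
    and Z_0: "\<And>\<omega>. \<omega> \<in> space M \<Longrightarrow> Z 0 \<omega> = 0"
    and Z_law: "conditionally_independent_with_laws M
                  (generated_by M (X ` atoms \<theta> \<union> Y ` {1..})) Z
                  (\<lambda>i \<omega>. icrt_p \<theta> (\<lambda>j. X j \<omega>) (Y i \<omega>))"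
    and U_indep: "indep_vars (\<lambda>_. borel) (case_sum UX UZ) (Inl ` {1..} \<union> Inr ` {1..})"
    and U_law: "\<And>i. 1 \<le> i \<Longrightarrow> distr M borel (UX i) = uniform_measure lborel {0..1}"
               "\<And>i. 1 \<le> i \<Longrightarrow> distr M borel (UZ i) = uniform_measure lborel {0..1}"
    and U_indep_rest:
      "indep_set (sets (generated_by M (UX ` {1..} \<union> UZ ` {1..})))
                 (sets (generated_by M (X ` atoms \<theta> \<union> Y ` {1..} \<union> Z ` {1..})))"

end

theory Submission
  imports Defs "HOL-Real_Asymp.Real_Asymp"
begin

text \<open>
  Two points of one branch are at looptree distance at most the \<open>\<mu>\<close>-mass of the segment between
  them.  Hence finiteness and total boundedness follow once the total mass of the branches of
  index at least \<open>n\<close> in one line of descent tends to 0 with \<open>n\<close>, uniformly over all lines.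

  Consider the branches that start in \<open>[2^k, 2^(k+1))\<close>, and let \<open>m\<close> be the mean of \<open>\<mu>[0,2^k]\<close>.  As
  the rate of \<open>Y\<close> is at least \<open>m / 4\<close> there, these branches are shorter than \<open>2 k\<^sup>2 / m\<close>, and by a
  Chernoff bound their masses are at most \<open>4 k\<^sup>2 / 2^k\<close>.  Given \<open>X\<close> and \<open>Y\<close>, a branch is glued to the
  branch \<open>c\<close> with probability at most the mass of \<open>c\<close> divided by \<open>\<mu>[0,2^k]\<close>, and the sum of these
  bounds over the scale is at most \<open>16 k\<^sup>2\<close>; summing over all chains, a line of descent contains
  at most \<open>k\<^sup>3\<close> of these branches, except on an event of summable probability.  So it
  collects a mass at most \<open>4 k^5 / 2^k\<close> at scale \<open>k\<close>, which is summable.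
\<close>

section \<open>Completions of pseudo-metric spaces\<close>

text \<open>The lengths of the branches cannot be summed over the scales: near 2^k they are of order
  1 / m up to powers of k, and m stays bounded when \<open>\<theta> 0 = 0\<close> and \<theta> is
  summable. Masses behave better. The mean of \<mu>[0,l] is concave in l and vanishes at 0, so the
  mean density of \<mu> at l is at most this mean divided by l; a branch near 2^k thus has a mass of
  order 2^-k whatever the growth of m.

  The powers of k pay for union bounds: exp (- c k^2) beats the roughly 4^k cells of length k^2 / m
  in a scale, and exp (- k^3) beats 16^k exp (48 k^2), where 16^k bounds the number of branch points
  and 48 is 3 times the constant 16 of the sum over the scale.

  The angle function is given by a definite description, so no estimate can start before it is known
  explicitly. It is written down through a combinatorial code of the components seen from a point;
  showing that this code is the topological notion takes connected balls and geodesics in the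
  completed tree.\<close>

lemma tendsto_0_squeeze:
  fixes f g :: "nat \<Rightarrow> real"
  assumes "\<And>n. 0 \<le> f n" "\<And>n. f n \<le> g n" "g \<longlonglongrightarrow> 0"
  shows "f \<longlonglongrightarrow> 0"
  by (rule real_tendsto_sandwich[OF _ _ tendsto_const assms(3)])
    (simp_all add: assms(1,2))

text \<open>An added point is used only through \<open>approx_seq_Inr\<close>; unfolding it would
  replace its sequence by a bare choice.\<close>

declare approx_seq.simps(2) [simp del]

locale pseudometric_space =
  fixes S :: "'p set" and d :: "'p \<Rightarrow> 'p \<Rightarrow> real"
  assumes pm: "pseudometric_on S d"
begin

lemma nonneg: "p \<in> S \<Longrightarrow> q \<in> S \<Longrightarrow> 0 \<le> d p q"
  and commute: "p \<in> S \<Longrightarrow> q \<in> S \<Longrightarrow> d p q = d q p"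
  and zero: "p \<in> S \<Longrightarrow> d p p = 0"
  and triangle: "p \<in> S \<Longrightarrow> q \<in> S \<Longrightarrow> r \<in> S \<Longrightarrow> d p r \<le> d p q + d q r"
  using pm unfolding pseudometric_on_def by blast+

lemma abs_diff_le:
  assumes "p \<in> S" "q \<in> S" "p' \<in> S" "q' \<in> S"
  shows "\<bar>d p q - d p' q'\<bar> \<le> d p p' + d q q'"
proof -
  have "d p q \<le> d p p' + (d p' q' + d q' q)"
    using triangle[of p p' q] triangle[of p' q' q] assms by auto
  moreover have "d p' q' \<le> d p' p + (d p q + d q q')"
    using triangle[of p' p q'] triangle[of p q q'] assms by auto
  ultimately show ?thesis using commute assms by (auto simp: abs_le_iff)
qed

lemma Cauchy_seqsD:
  assumes "s \<in> Cauchy_seqs S d"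
  shows "s n \<in> S" "e > 0 \<Longrightarrow> \<exists>N. \<forall>m\<ge>N. \<forall>n\<ge>N. d (s m) (s n) < e"
  using assms unfolding Cauchy_seqs_def by auto

lemma const_Cauchy_seqs: "p \<in> S \<Longrightarrow> (\<lambda>_. p) \<in> Cauchy_seqs S d"
  unfolding Cauchy_seqs_def by (auto simp: zero)

text \<open>The quadrangle inequality makes the real sequence Cauchy, so the \<open>lim\<close> in
  \<open>completion_dist\<close> is a true limit.\<close>

lemma convergent_dist:
  assumes s: "s \<in> Cauchy_seqs S d" and t: "t \<in> Cauchy_seqs S d"
  shows "convergent (\<lambda>n. d (s n) (t n))"
proof -
  have "Cauchy (\<lambda>n. d (s n) (t n))"
  proof (rule metric_CauchyI)
    fix e :: real assume "e > 0"
    then have e2: "e/2 > 0" by simp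
    obtain N1 where N1: "\<And>m n. m \<ge> N1 \<Longrightarrow> n \<ge> N1 \<Longrightarrow> d (s m) (s n) < e/2"
      using Cauchy_seqsD(2)[OF s e2] by blast
    obtain N2 where N2: "\<And>m n. m \<ge> N2 \<Longrightarrow> n \<ge> N2 \<Longrightarrow> d (t m) (t n) < e/2"
      using Cauchy_seqsD(2)[OF t e2] by blast
    show "\<exists>M. \<forall>m\<ge>M. \<forall>n\<ge>M. dist (d (s m) (t m)) (d (s n) (t n)) < e"
    proof (intro exI[of _ "max N1 N2"] allI impI)
      fix m n assume "m \<ge> max N1 N2" "n \<ge> max N1 N2"
      then show "dist (d (s m) (t m)) (d (s n) (t n)) < e"
        using abs_diff_le[of "s m" "t m" "s n" "t n"] N1[of m n] N2[of m n]
          Cauchy_seqsD(1)[OF s] Cauchy_seqsD(1)[OF t]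
        by (auto simp: dist_real_def)
    qed
  qed
  then show ?thesis by (simp add: Cauchy_convergent_iff)
qed

lemma equiv_Cauchy_equiv: "equiv (nonconvergent_Cauchy_seqs S d) (Cauchy_equiv S d)"
proof (rule equivI)
  show "Cauchy_equiv S d \<subseteq> nonconvergent_Cauchy_seqs S d \<times> nonconvergent_Cauchy_seqs S d"
    unfolding Cauchy_equiv_def by auto
  have mem: "\<forall>n. s n \<in> S" if "s \<in> nonconvergent_Cauchy_seqs S d" for s
    using that unfolding nonconvergent_Cauchy_seqs_def using Cauchy_seqsD(1) by auto
  show "refl_on (nonconvergent_Cauchy_seqs S d) (Cauchy_equiv S d)"
    unfolding refl_on_def Cauchy_equiv_def using mem zero by auto
  show "sym (Cauchy_equiv S d)"
  proof (rule symI)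
    fix s t assume st: "(s, t) \<in> Cauchy_equiv S d"
    then have "d (s n) (t n) = d (t n) (s n)" for n
      using mem commute unfolding Cauchy_equiv_def by blast
    then show "(t, s) \<in> Cauchy_equiv S d" using st unfolding Cauchy_equiv_def by simp
  qed
  show "trans (Cauchy_equiv S d)"
  proof (rule transI)
    fix s t u assume st: "(s, t) \<in> Cauchy_equiv S d" and tu: "(t, u) \<in> Cauchy_equiv S d"
    then have m: "s n \<in> S" "t n \<in> S" "u n \<in> S" for n
      using mem unfolding Cauchy_equiv_def by auto
    have "(\<lambda>n. d (s n) (t n) + d (t n) (u n)) \<longlonglongrightarrow> 0 + 0"
      using st tu unfolding Cauchy_equiv_def by (intro tendsto_add) auto
    then have "(\<lambda>n. d (s n) (u n)) \<longlonglongrightarrow> 0"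
      by (intro tendsto_0_squeeze[of "\<lambda>n. d (s n) (u n)" "\<lambda>n. d (s n) (t n) + d (t n) (u n)"]
            nonneg triangle m) simp
    then show "(s, u) \<in> Cauchy_equiv S d"
      using st tu unfolding Cauchy_equiv_def by auto
  qed
qed

abbreviation "CS \<equiv> completion_carrier S d"
abbreviation "cd \<equiv> completion_dist d"

lemma Inl_in_completion_iff [simp]: "Inl p \<in> CS \<longleftrightarrow> p \<in> S"
  unfolding completion_carrier_def by auto

lemma completion_cases:
  assumes "p \<in> CS"
  obtains a where "p = Inl a" "a \<in> S"
  | C where "p = Inr C" "C \<in> nonconvergent_Cauchy_seqs S d // Cauchy_equiv S d"
  using assms unfolding completion_carrier_def by auto

lemma approx_seq_Inr:
  assumes "Inr C \<in> CS"
  shows "approx_seq (Inr C) \<in> C" "approx_seq (Inr C) \<in> nonconvergent_Cauchy_seqs S d"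
proof -
  have C: "C \<in> nonconvergent_Cauchy_seqs S d // Cauchy_equiv S d"
    using assms unfolding completion_carrier_def by auto
  then show 1: "approx_seq (Inr C) \<in> C"
    using in_quotient_imp_non_empty[OF equiv_Cauchy_equiv C] by (simp add: approx_seq.simps(2) some_in_eq)
  show "approx_seq (Inr C) \<in> nonconvergent_Cauchy_seqs S d"
    using in_quotient_imp_subset[OF equiv_Cauchy_equiv C] 1 by auto
qed

lemma approx_seq_Cauchy: "p \<in> CS \<Longrightarrow> approx_seq p \<in> Cauchy_seqs S d"
  by (erule completion_cases)
     (use approx_seq_Inr(2) const_Cauchy_seqs in
       \<open>auto simp: nonconvergent_Cauchy_seqs_def completion_carrier_def\<close>)

lemma approx_seq_in: "p \<in> CS \<Longrightarrow> approx_seq p n \<in> S"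
  using approx_seq_Cauchy Cauchy_seqsD(1) by blast

lemma completion_dist_tendsto:
  assumes "p \<in> CS" "q \<in> CS"
  shows "(\<lambda>n. d (approx_seq p n) (approx_seq q n)) \<longlonglongrightarrow> cd p q"
  using convergent_dist[OF approx_seq_Cauchy[OF assms(1)] approx_seq_Cauchy[OF assms(2)]]
  unfolding completion_dist_def by (simp add: convergent_LIMSEQ_iff)

lemma completion_dist_Inl [simp]: "cd (Inl a) (Inl b) = d a b"
  unfolding completion_dist_def by (simp add: limI)

lemma pseudometric_completion: "pseudometric_on CS cd"
proof -
  have "0 \<le> cd p q" if "p \<in> CS" "q \<in> CS" for p q
    using completion_dist_tendsto[OF that]
    by (rule LIMSEQ_le_const) (use that approx_seq_in nonneg in auto)
  moreover have "cd p q = cd q p" if "p \<in> CS" "q \<in> CS" for p q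
    unfolding completion_dist_def using that by (simp add: commute approx_seq_in)
  moreover have "cd p p = 0" if "p \<in> CS" for p
    unfolding completion_dist_def using that by (simp add: zero approx_seq_in limI)
  moreover have "cd p r \<le> cd p q + cd q r" if "p \<in> CS" "q \<in> CS" "r \<in> CS" for p q r
    by (rule LIMSEQ_le[OF completion_dist_tendsto[OF that(1,3)]
          tendsto_add[OF completion_dist_tendsto[OF that(1,2)] completion_dist_tendsto[OF that(2,3)]]])
       (use that approx_seq_in triangle in auto)
  ultimately show ?thesis unfolding pseudometric_on_def by auto
qed

lemma completion_approx:
  assumes p: "p \<in> CS" and e: "e > 0"
  shows "\<exists>N. \<forall>n\<ge>N. cd p (Inl (approx_seq p n)) < e"
proof -
  obtain N where N: "\<And>m n. m \<ge> N \<Longrightarrow> n \<ge> N \<Longrightarrow> d (approx_seq p m) (approx_seq p n) < e/2"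
    using Cauchy_seqsD(2)[OF approx_seq_Cauchy[OF p], of "e/2"] e by auto
  have "cd p (Inl (approx_seq p n)) < e" if "n \<ge> N" for n
  proof -
    have "cd p (Inl (approx_seq p n)) \<le> e/2"
    proof (rule LIMSEQ_le_const2[OF completion_dist_tendsto])
      show "\<exists>M. \<forall>m\<ge>M. d (approx_seq p m) (approx_seq (Inl (approx_seq p n)) m) \<le> e/2"
        using N that by (intro exI[of _ N]) (auto intro: less_imp_le)
    qed (use p approx_seq_in in auto)
    then show ?thesis using e by auto
  qed
  then show ?thesis by blast
qed

lemma completion_dense:
  assumes p: "p \<in> CS" and e: "e > 0"
  obtains a where "a \<in> S" "cd p (Inl a) < e"
  using completion_approx[OF assms] approx_seq_in[OF p] by blast

text \<open>Approximating \<open>s n\<close> by a point \<open>a n\<close> of S up to 1 / (n + 1)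
  leaves a Cauchy sequence in S. Either it converges in S, or its equivalence class is one of the
  added points and is its limit.\<close>

lemma completion_complete:
  assumes s: "s \<in> Cauchy_seqs CS cd"
  shows "\<exists>p\<in>CS. (\<lambda>n. cd (s n) p) \<longlonglongrightarrow> 0"
proof -
  interpret C: pseudometric_space CS cd
    by (rule pseudometric_space.intro, rule pseudometric_completion)
  have sC: "s n \<in> CS" for n using C.Cauchy_seqsD(1)[OF s] .
  have "\<exists>a\<in>S. cd (s n) (Inl a) < inverse (real (Suc n))" for n
    using completion_dense[OF sC[of n], of "inverse (real (Suc n))"]
    by (metis inverse_positive_iff_positive of_nat_0_less_iff zero_less_Suc)
  then obtain a where aS: "\<And>n. a n \<in> S" and a: "\<And>n. cd (s n) (Inl (a n)) < inverse (real (Suc n))"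
    by metis
  have a0: "(\<lambda>n. cd (s n) (Inl (a n))) \<longlonglongrightarrow> 0"
    by (rule tendsto_0_squeeze[OF C.nonneg less_imp_le[OF a] LIMSEQ_inverse_real_of_nat])
       (simp_all add: sC aS)
  have aC: "a \<in> Cauchy_seqs S d"
    unfolding Cauchy_seqs_def
  proof (intro CollectI conjI allI impI)
    fix e :: real assume e: "e > 0"
    obtain N1 where N1: "\<And>m n. m \<ge> N1 \<Longrightarrow> n \<ge> N1 \<Longrightarrow> cd (s m) (s n) < e/3"
      using C.Cauchy_seqsD(2)[OF s, of "e/3"] e by auto
    obtain N2 where N2: "\<And>n. n \<ge> N2 \<Longrightarrow> cd (s n) (Inl (a n)) < e/3"
      using order_tendstoD(2)[OF a0, of "e/3"] e by (auto simp: eventually_sequentially)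
    show "\<exists>N. \<forall>m\<ge>N. \<forall>n\<ge>N. d (a m) (a n) < e"
    proof (intro exI[of _ "max N1 N2"] allI impI)
      fix m n assume mn: "m \<ge> max N1 N2" "n \<ge> max N1 N2"
      have "\<bar>cd (Inl (a m)) (Inl (a n)) - cd (s m) (s n)\<bar> \<le> cd (Inl (a m)) (s m) + cd (Inl (a n)) (s n)"
        by (rule C.abs_diff_le) (auto simp: sC aS)
      then show "d (a m) (a n) < e"
        using N1[of m n] N2[of m] N2[of n] mn C.commute[of "Inl (a m)" "s m"]
          C.commute[of "Inl (a n)" "s n"] sC aS by auto
    qed
  qed (rule aS)
  have key: "\<exists>p\<in>CS. (\<lambda>n. cd (Inl (a n)) p) \<longlonglongrightarrow> 0"
  proof (cases "\<exists>p\<in>S. (\<lambda>n. d (a n) p) \<longlonglongrightarrow> 0")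
    case True
    then obtain p where "p \<in> S" "(\<lambda>n. d (a n) p) \<longlonglongrightarrow> 0" by blast
    then show ?thesis by (intro bexI[of _ "Inl p"]) simp_all
  next
    case False
    then have aN: "a \<in> nonconvergent_Cauchy_seqs S d"
      using aC unfolding nonconvergent_Cauchy_seqs_def by auto
    define A where "A = Cauchy_equiv S d `` {a}"
    have A: "Inr A \<in> CS"
      unfolding completion_carrier_def A_def using quotientI[OF aN] by auto
    have "approx_seq (Inr A) \<in> A" by (rule approx_seq_Inr(1)[OF A])
    \<comment> \<open>The sequence chosen for the class need not be \<open>a\<close> itself, only an
      equivalent one.\<close>
    then have lim: "(\<lambda>n. d (a n) (approx_seq (Inr A) n)) \<longlonglongrightarrow> 0"
      unfolding A_def Cauchy_equiv_def by auto
    have "(\<lambda>n. cd (Inl (a n)) (Inr A)) \<longlonglongrightarrow> 0"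
    proof (rule LIMSEQ_I)
      fix e :: real assume e: "e > 0"
      obtain N1 where N1: "\<And>n. n \<ge> N1 \<Longrightarrow> d (a n) (approx_seq (Inr A) n) < e/2"
        using order_tendstoD(2)[OF lim, of "e/2"] e by (auto simp: eventually_sequentially)
      obtain N2 where N2: "\<And>n. n \<ge> N2 \<Longrightarrow> cd (Inr A) (Inl (approx_seq (Inr A) n)) < e/2"
        using completion_approx[OF A, of "e/2"] e by auto
      show "\<exists>N. \<forall>n\<ge>N. norm (cd (Inl (a n)) (Inr A) - 0) < e"
      proof (intro exI[of _ "max N1 N2"] allI impI)
        fix n assume n: "n \<ge> max N1 N2"
        have "cd (Inl (a n)) (Inr A) \<le> cd (Inl (a n)) (Inl (approx_seq (Inr A) n))
            + cd (Inl (approx_seq (Inr A) n)) (Inr A)"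
          by (rule C.triangle) (use aS A approx_seq_in in auto)
        moreover have "cd (Inl (approx_seq (Inr A) n)) (Inr A) = cd (Inr A) (Inl (approx_seq (Inr A) n))"
          by (rule C.commute) (use A approx_seq_in in auto)
        ultimately show "norm (cd (Inl (a n)) (Inr A) - 0) < e"
          using n N1[of n] N2[of n] C.nonneg[of "Inl (a n)" "Inr A"] aS A
          by simp
      qed
    qed
    with A show ?thesis by blast
  qed
  then obtain p where p: "p \<in> CS" "(\<lambda>n. cd (Inl (a n)) p) \<longlonglongrightarrow> 0" by blast
  have "(\<lambda>n. cd (s n) p) \<longlonglongrightarrow> 0"
  proof (rule tendsto_0_squeeze)
    show "(\<lambda>n. cd (s n) (Inl (a n)) + cd (Inl (a n)) p) \<longlonglongrightarrow> 0"
      using tendsto_add[OF a0 p(2)] by simp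
    show "0 \<le> cd (s n) p" for n using C.nonneg sC p by blast
    show "cd (s n) p \<le> cd (s n) (Inl (a n)) + cd (Inl (a n)) p" for n
      by (rule C.triangle) (simp_all add: sC p aS)
  qed
  with p(1) show ?thesis by blast
qed

text \<open>The case to settle is an added point at distance 0 from a point of S: its sequence would
  converge in S, but only classes of nonconvergent sequences are added. The distance is cut off to 0
  outside the carrier because \<open>Metric_space\<close> asks for nonnegativity and symmetry on the
  whole type.\<close>

lemma completion_metric:
  assumes pos: "\<And>p q. p \<in> S \<Longrightarrow> q \<in> S \<Longrightarrow> d p q = 0 \<Longrightarrow> p = q"
  shows "Metric_space CS (\<lambda>p q. if p \<in> CS \<and> q \<in> CS then cd p q else 0)"
    and "p \<in> CS \<Longrightarrow> q \<in> CS \<Longrightarrow> cd p q = 0 \<Longrightarrow> p = q"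
proof -
  interpret C: pseudometric_space CS cd
    by (rule pseudometric_space.intro, rule pseudometric_completion)
  have Inl_Inr: False if "a \<in> S" "Inr B \<in> CS" "cd (Inl a) (Inr B) = 0" for a B
  proof -
    have "(\<lambda>n. d (approx_seq (Inr B) n) a) \<longlonglongrightarrow> 0"
      using completion_dist_tendsto[of "Inr B" "Inl a"] C.commute[of "Inl a" "Inr B"] that
      by simp
    then show False
      using approx_seq_Inr(2)[OF that(2)] that(1) unfolding nonconvergent_Cauchy_seqs_def by blast
  qed
  have eq: "p = q" if p: "p \<in> CS" and q: "q \<in> CS" and 0: "cd p q = 0" for p q
  proof (cases p; cases q)
    fix a b assume "p = Inl a" "q = Inl b"
    then show ?thesis using that pos by auto
  next
    fix a B assume "p = Inl a" "q = Inr B"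
    then show ?thesis using that Inl_Inr by auto
  next
    fix A b assume "p = Inr A" "q = Inl b"
    then show ?thesis using that Inl_Inr C.commute[OF p q] by auto
  next
    fix A B assume AB: "p = Inr A" "q = Inr B"
    have "(\<lambda>n. d (approx_seq (Inr A) n) (approx_seq (Inr B) n)) \<longlonglongrightarrow> 0"
      using completion_dist_tendsto[OF p q] 0 AB by simp
    then have "(approx_seq (Inr A), approx_seq (Inr B)) \<in> Cauchy_equiv S d"
      unfolding Cauchy_equiv_def using approx_seq_Inr p q AB by auto
    moreover have "A \<in> nonconvergent_Cauchy_seqs S d // Cauchy_equiv S d"
      "B \<in> nonconvergent_Cauchy_seqs S d // Cauchy_equiv S d"
      using p q AB unfolding completion_carrier_def by auto
    ultimately have "A = B"
      using quotient_eqI[OF equiv_Cauchy_equiv] approx_seq_Inr(1) p q AB by metis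
    then show ?thesis using AB by simp
  qed
  show "Metric_space CS (\<lambda>p q. if p \<in> CS \<and> q \<in> CS then cd p q else 0)"
  proof
    fix p q r
    show "0 \<le> (if p \<in> CS \<and> q \<in> CS then cd p q else 0)" using C.nonneg by auto
    show "(if p \<in> CS \<and> q \<in> CS then cd p q else 0) = (if q \<in> CS \<and> p \<in> CS then cd q p else 0)"
      using C.commute[of p q] by auto
    show "((if p \<in> CS \<and> q \<in> CS then cd p q else 0) = 0) = (p = q)" if "p \<in> CS" "q \<in> CS"
      using that eq C.zero[of q] by auto
    show "(if p \<in> CS \<and> r \<in> CS then cd p r else 0)
        \<le> (if p \<in> CS \<and> q \<in> CS then cd p q else 0) + (if q \<in> CS \<and> r \<in> CS then cd q r else 0)"
      if "p \<in> CS" "q \<in> CS" "r \<in> CS"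
      using that C.triangle[of p q r] by auto
  qed
  show "p \<in> CS \<Longrightarrow> q \<in> CS \<Longrightarrow> cd p q = 0 \<Longrightarrow> p = q" by (rule eq)
qed

section \<open>Topology and compactness of pseudo-metric spaces\<close>

lemma openin_pm_topology:
  "openin (pm_topology S d) U \<longleftrightarrow> U \<subseteq> S \<and> (\<forall>p\<in>U. \<exists>r>0. {q\<in>S. d p q < r} \<subseteq> U)"
proof -
  have "istopology (\<lambda>U. U \<subseteq> S \<and> (\<forall>p\<in>U. \<exists>r>0. {q\<in>S. d p q < r} \<subseteq> U))"
    unfolding istopology_def
  proof (intro conjI allI impI)
    fix U V assume U: "U \<subseteq> S \<and> (\<forall>p\<in>U. \<exists>r>0. {q\<in>S. d p q < r} \<subseteq> U)"
      and V: "V \<subseteq> S \<and> (\<forall>p\<in>V. \<exists>r>0. {q\<in>S. d p q < r} \<subseteq> V)"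
    show "U \<inter> V \<subseteq> S" using U by auto
    show "\<forall>p\<in>U \<inter> V. \<exists>r>0. {q \<in> S. d p q < r} \<subseteq> U \<inter> V"
    proof
      fix p assume p: "p \<in> U \<inter> V"
      obtain r where "r > 0" "{q\<in>S. d p q < r} \<subseteq> U" using U p by blast
      moreover obtain r' where "r' > 0" "{q\<in>S. d p q < r'} \<subseteq> V" using V p by blast
      ultimately show "\<exists>r>0. {q \<in> S. d p q < r} \<subseteq> U \<inter> V"
        by (intro exI[of _ "min r r'"]) auto
    qed
  next
    fix K assume "\<forall>U\<in>K. U \<subseteq> S \<and> (\<forall>p\<in>U. \<exists>r>0. {q \<in> S. d p q < r} \<subseteq> U)"
    note K = this
    show "\<Union>K \<subseteq> S" using K by blast
    show "\<forall>p\<in>\<Union>K. \<exists>r>0. {q \<in> S. d p q < r} \<subseteq> \<Union>K"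
    proof
      fix p assume "p \<in> \<Union>K"
      then obtain U where U: "U \<in> K" "p \<in> U" by blast
      then obtain r where "r > 0" "{q \<in> S. d p q < r} \<subseteq> U" using K by blast
      with U show "\<exists>r>0. {q \<in> S. d p q < r} \<subseteq> \<Union>K" by blast
    qed
  qed
  then show ?thesis
    unfolding pm_topology_def by (simp add: topology_inverse')
qed

lemma topspace_pm_topology: "topspace (pm_topology S d) = S"
proof (rule subset_antisym)
  show "topspace (pm_topology S d) \<subseteq> S"
    by (metis openin_pm_topology openin_topspace)
  have "openin (pm_topology S d) S"
    unfolding openin_pm_topology by (auto intro: exI[of _ 1])
  then show "S \<subseteq> topspace (pm_topology S d)" by (rule openin_subset)
qed

text \<open>Reduces to the theorem on complete and totally bounded metric spaces: an open cover is
  traced on a set of representatives, and a finite subcover of the trace is lifted back.\<close>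

lemma compact_pm_topology:
  assumes complete: "\<And>s. s \<in> Cauchy_seqs S d \<Longrightarrow> \<exists>p\<in>S. (\<lambda>n. d (s n) p) \<longlonglongrightarrow> 0"
    and tb: "\<And>e. e > 0 \<Longrightarrow> \<exists>K. finite K \<and> K \<subseteq> S \<and> (\<forall>p\<in>S. \<exists>q\<in>K. d p q < e)"
  shows "compact_space (pm_topology S d)"
proof -
  \<comment> \<open>One representative for each class of points at distance 0 gives a metric space.\<close>
  define f where "f p = (SOME q. q \<in> S \<and> d p q = 0)" for p
  have f: "f p \<in> S" "d p (f p) = 0" if "p \<in> S" for p
    using someI[of "\<lambda>q. q \<in> S \<and> d p q = 0" p] that zero unfolding f_def by auto
  have f_eq: "f p = f q" if "p \<in> S" "q \<in> S" "d p q = 0" for p q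
  proof -
    have "d p r = d q r" if "r \<in> S" for r
      using abs_diff_le[of p r q r] zero[of r] that \<open>p \<in> S\<close> \<open>q \<in> S\<close> \<open>d p q = 0\<close> by auto
    then have "(\<lambda>r. r \<in> S \<and> d p r = 0) = (\<lambda>r. r \<in> S \<and> d q r = 0)" by auto
    then show ?thesis unfolding f_def by simp
  qed
  define R where "R = f ` S"
  have RS: "R \<subseteq> S" using f R_def by auto
  have dR: "d (f p) (f q) = d p q" if "p \<in> S" "q \<in> S" for p q
    using abs_diff_le[of p q "f p" "f q"] f that by auto
  have Rpos: "p = q" if "p \<in> R" "q \<in> R" "d p q = 0" for p q
    using that f_eq dR unfolding R_def by auto
  define dr where "dr p q = (if p \<in> R \<and> q \<in> R then d p q else 0)" for p q
  interpret M: Metric_space R dr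
  proof
    fix p q r
    show "0 \<le> dr p q" using nonneg RS unfolding dr_def by auto
    show "dr p q = dr q p" using commute[of p q] RS unfolding dr_def by auto
    show "(dr p q = 0) = (p = q)" if "p \<in> R" "q \<in> R"
      using that Rpos zero[of q] RS unfolding dr_def by auto
    show "dr p r \<le> dr p q + dr q r" if "p \<in> R" "q \<in> R" "r \<in> R"
      using that triangle[of p q r] RS unfolding dr_def by auto
  qed
  have mc: "M.mcomplete"
    unfolding M.mcomplete_def
  proof (intro allI impI)
    fix s assume s: "M.MCauchy s"
    then have "s \<in> Cauchy_seqs S d"
      unfolding M.MCauchy_def Cauchy_seqs_def using RS by (auto simp: dr_def range_subsetD)
    then obtain p where p: "p \<in> S" "(\<lambda>n. d (s n) p) \<longlonglongrightarrow> 0" using complete by blast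
    have sR: "s n \<in> R" for n using s unfolding M.MCauchy_def by auto
    have "d (s n) p = dr (s n) (f p)" for n
      using abs_diff_le[of "s n" p "s n" "f p"] f[OF p(1)] sR[of n] p(1) RS zero
      unfolding dr_def R_def by auto
    then have "limitin M.mtopology s (f p) sequentially"
      unfolding M.limitin_metric_dist_null using p f sR by (auto simp: R_def)
    then show "\<exists>x. limitin M.mtopology s x sequentially" by blast
  qed
  have mt: "M.mtotally_bounded R"
    unfolding M.mtotally_bounded_def
  proof (intro allI impI)
    fix e :: real assume "e > 0"
    then obtain K where K: "finite K" "K \<subseteq> S" "\<And>p. p \<in> S \<Longrightarrow> \<exists>q\<in>K. d p q < e"
      using tb by meson
    show "\<exists>K. finite K \<and> K \<subseteq> R \<and> R \<subseteq> (\<Union>x\<in>K. M.mball x e)"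
    proof (intro exI conjI)
      show "finite (f ` K)" using K by simp
      show "f ` K \<subseteq> R" using K R_def by auto
      show "R \<subseteq> (\<Union>x\<in>f ` K. M.mball x e)"
      proof
        fix p assume p: "p \<in> R"
        then obtain q where q: "q \<in> K" "d p q < e" using K RS by blast
        have qS: "q \<in> S" and fq: "f q \<in> R" and pS: "p \<in> S" using q K p RS unfolding R_def by auto
        have "dr (f q) p < e"
          using q abs_diff_le[OF pS qS pS f(1)[OF qS]] commute[OF f(1)[OF qS] pS] zero[OF pS] f(2)[OF qS] fq p
          unfolding dr_def by simp
        then show "p \<in> (\<Union>x\<in>f ` K. M.mball x e)"
          using q p fq by (auto simp: M.mball_def)
      qed
    qed
  qed
  have cpt: "compact_space M.mtopology"
    using M.compact_space_eq_mcomplete_mtotally_bounded mc mt by simp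
  show ?thesis
    unfolding compact_space_alt topspace_pm_topology
  proof (intro allI impI)
    fix \<U> assume U: "(\<forall>U\<in>\<U>. openin (pm_topology S d) U) \<and> S \<subseteq> \<Union>\<U>"
    have ball: "\<exists>r>0. {q\<in>S. d p q < r} \<subseteq> U" if "U \<in> \<U>" "p \<in> U" for U p
      using U that unfolding openin_pm_topology by blast
    have op: "openin M.mtopology (U \<inter> R)" if UU: "U \<in> \<U>" for U
      unfolding M.openin_mtopology
    proof (intro conjI allI impI)
      fix p assume p: "p \<in> U \<inter> R"
      then obtain r where "r > 0" "{q\<in>S. d p q < r} \<subseteq> U"
        using ball[OF UU] by blast
      then show "\<exists>r>0. M.mball p r \<subseteq> U \<inter> R"
        using p RS by (intro exI[of _ r]) (auto simp: M.mball_def dr_def)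
    qed auto
    have cov: "topspace M.mtopology \<subseteq> \<Union>((\<lambda>U. U \<inter> R) ` \<U>)"
      using U RS by auto
    have "\<exists>\<F>. finite \<F> \<and> \<F> \<subseteq> (\<lambda>U. U \<inter> R) ` \<U> \<and> topspace M.mtopology \<subseteq> \<Union>\<F>"
      using cpt[unfolded compact_space_alt, rule_format, of "(\<lambda>U. U \<inter> R) ` \<U>"] op cov by blast
    then obtain \<F> where F: "finite \<F>" "\<F> \<subseteq> (\<lambda>U. U \<inter> R) ` \<U>" "R \<subseteq> \<Union>\<F>"
      by auto
    obtain \<G> where G: "\<G> \<subseteq> \<U>" "finite \<G>" "\<F> = (\<lambda>U. U \<inter> R) ` \<G>"
      using finite_subset_image[OF F(1,2)] by blast
    \<comment> \<open>Open sets are saturated: one that contains \<open>f p\<close> contains every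
      point at distance 0 from it, in particular p.\<close>
    have "S \<subseteq> \<Union>\<G>"
    proof
      fix p assume p: "p \<in> S"
      then have "f p \<in> R" unfolding R_def by auto
      then obtain W where W: "W \<in> \<G>" "f p \<in> W" using F G by auto
      then obtain r where r: "r > 0" "{q\<in>S. d (f p) q < r} \<subseteq> W"
        using ball[of W "f p"] G(1) by blast
      have "d (f p) p = 0" using f[OF p] commute[OF f(1)[OF p] p] by simp
      then have "p \<in> W" using r p by auto
      then show "p \<in> \<Union>\<G>" using W by auto
    qed
    then show "\<exists>\<F>. finite \<F> \<and> \<F> \<subseteq> \<U> \<and> S \<subseteq> \<Union>\<F>" using G by blast
  qed
qed

text \<open>S is dense in its completion, so a finite net of S is a net of the completion for twice
  the radius.\<close>

theorem compact_completion:
  assumes tb: "\<And>e. e > 0 \<Longrightarrow> \<exists>K. finite K \<and> K \<subseteq> S \<and> (\<forall>p\<in>S. \<exists>q\<in>K. d p q < e)"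
  shows "compact_pseudometric_space CS cd"
proof -
  interpret C: pseudometric_space CS cd
    by (rule pseudometric_space.intro, rule pseudometric_completion)
  have "compact_space (pm_topology CS cd)"
  proof (rule C.compact_pm_topology)
    fix e :: real assume e: "e > 0"
    obtain K where K: "finite K" "K \<subseteq> S" "\<And>p. p \<in> S \<Longrightarrow> \<exists>q\<in>K. d p q < e/2"
      using tb[of "e/2"] e by auto
    show "\<exists>K. finite K \<and> K \<subseteq> CS \<and> (\<forall>p\<in>CS. \<exists>q\<in>K. cd p q < e)"
    proof (intro exI conjI ballI)
      show "finite (Inl ` K)" "Inl ` K \<subseteq> CS" using K by auto
      fix p assume p: "p \<in> CS"
      obtain a where a: "a \<in> S" "cd p (Inl a) < e/2" using completion_dense[OF p, of "e/2"] e by auto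
      obtain q where q: "q \<in> K" "d a q < e/2" using K a by blast
      have "cd p (Inl q) \<le> cd p (Inl a) + cd (Inl a) (Inl q)"
        by (rule C.triangle) (use p a q K in auto)
      then show "\<exists>q\<in>Inl ` K. cd p q < e" using a q by (intro bexI[of _ "Inl q"]) auto
    qed
  qed (rule completion_complete)
  then show ?thesis
    unfolding compact_pseudometric_space_def using pseudometric_completion by blast
qed

end

section \<open>The stick-breaking tree\<close>

text \<open>One value of the random data. The bounds on \<open>z\<close> at index 0 force
  \<open>z 0 = 0\<close>, so the initial stick is glued to the root just as every later stick i is
  glued to \<open>z i\<close>.\<close>

locale stick_breaking =
  fixes y z :: "nat \<Rightarrow> real"
  assumes y0: "y 0 = 0" and y_mono: "strict_mono y" and y_unbounded: "\<And>t. \<exists>n. t < y n"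
    and z_range: "\<And>i. 0 \<le> z i \<and> z i \<le> y i"
begin

abbreviation "\<delta> \<equiv> pre_dist y z"

lemma y_less_iff [simp]: "y i < y j \<longleftrightarrow> i < j"
  using strict_mono_less[OF y_mono] .

lemma y_le_iff [simp]: "y i \<le> y j \<longleftrightarrow> i \<le> j"
  using strict_mono_less_eq[OF y_mono] .

lemma y_nonneg: "0 \<le> y i"
  using y_le_iff[of 0 i] y0 by simp

lemma z0: "z 0 = 0"
  using z_range[of 0] y0 by simp

text \<open>Stick i is open at \<open>y i\<close> and closed at \<open>y (Suc i)\<close>. The label
  0 lies on no stick; the \<open>LEAST\<close> puts it into branch 0.\<close>

definition branch :: "real \<Rightarrow> nat" where
  "branch t = (LEAST i. t \<le> y (Suc i))"

lemma branch_eq: "y i < t \<Longrightarrow> t \<le> y (Suc i) \<Longrightarrow> branch t = i"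
  unfolding branch_def
proof (rule Least_equality)
  fix j assume "y i < t" "t \<le> y (Suc i)" "t \<le> y (Suc j)"
  then have "y i < y (Suc j)" by linarith
  then show "i \<le> j" by simp
qed

lemma le_y_branch: "t \<le> y (Suc (branch t))"
proof -
  obtain n where "t < y n" using y_unbounded by blast
  then have "t \<le> y (Suc n)" using y_le_iff[of n "Suc n"] by linarith
  then show ?thesis unfolding branch_def by (rule LeastI)
qed

lemma y_branch_less:
  assumes "0 < t" shows "y (branch t) < t"
proof (cases "branch t")
  case 0
  then show ?thesis using assms y0 by simp
next
  case (Suc i)
  then have "\<not> t \<le> y (Suc i)" unfolding branch_def using not_less_Least[of i "\<lambda>i. t \<le> y (Suc i)"] by simp
  then show ?thesis using Suc by simp
qed

lemma branch_cases:
  assumes "0 \<le> t"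
  obtains "t = 0" | i where "y i < t" "t \<le> y (Suc i)"
  using assms that(1) that(2)[OF y_branch_less le_y_branch] by (cases "t = 0") simp_all

lemma branch_le: "t \<le> y (Suc i) \<Longrightarrow> branch t \<le> i"
  unfolding branch_def by (rule Least_le)

lemma branch_z_less: "1 \<le> i \<Longrightarrow> branch (z i) < i"
  using branch_le[of "z i" "i - 1"] z_range[of i] by (cases i) auto

lemma branch_z_le: "branch (z i) \<le> i"
  using branch_z_less[of i] branch_le[of "z 0" 0] z0 y_nonneg by (cases "i = 0") auto

text \<open>Later levels of the recursion leave old values untouched, so any level above both labels
  may replace the \<open>LEAST\<close> in \<open>pre_dist\<close>.\<close>

lemma pre_dist_eq_upto:
  assumes "s \<le> y n" "t \<le> y n"
  shows "\<delta> s t = pre_dist_upto y z n s t"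
proof -
  define N where "N = (LEAST n. s \<le> y n \<and> t \<le> y n)"
  have N: "s \<le> y N" "t \<le> y N" "N \<le> n"
    using LeastI[of "\<lambda>n. s \<le> y n \<and> t \<le> y n" n] Least_le[of "\<lambda>n. s \<le> y n \<and> t \<le> y n" n] assms
    unfolding N_def by auto
  have "pre_dist_upto y z m s t = pre_dist_upto y z N s t" if "N \<le> m" for m
    using that
  proof (induction m rule: dec_induct)
    case (step m)
    then have "y N \<le> y m" by simp
    then have "s \<le> y m" "t \<le> y m" using N by linarith+
    then show ?case using step.IH by simp
  qed simp
  then show ?thesis using N(3) unfolding pre_dist_def N_def[symmetric] by metis
qed

lemma pre_dist_commute: "\<delta> s t = \<delta> t s"
proof -
  have "pre_dist_upto y z n s t = pre_dist_upto y z n t s" for n s t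
    by (induction n arbitrary: s t) auto
  moreover have "(LEAST n. s \<le> y n \<and> t \<le> y n) = (LEAST n. t \<le> y n \<and> s \<le> y n)"
    by (simp add: conj_commute)
  ultimately show ?thesis unfolding pre_dist_def by metis
qed

lemma pre_dist_same:
  assumes "y i < s" "s \<le> y (Suc i)" "y i < t" "t \<le> y (Suc i)"
  shows "\<delta> s t = \<bar>s - t\<bar>"
  using pre_dist_eq_upto[of s "Suc i" t] assms by simp

lemma pre_dist_step:
  assumes "s \<le> y i" "y i < t" "t \<le> y (Suc i)"
  shows "\<delta> s t = \<delta> s (z i) + (t - y i)"
  using pre_dist_eq_upto[of s "Suc i" t] pre_dist_eq_upto[of s i "z i"] assms z_range[of i] by simp

lemma pre_dist_step':
  assumes "s \<le> y i" "y i < t" "t \<le> y (Suc i)"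
  shows "\<delta> t s = \<delta> (z i) s + (t - y i)"
  using pre_dist_step[OF assms] pre_dist_commute by simp

lemma pre_dist_zero_zero: "\<delta> 0 0 = 0"
  using pre_dist_eq_upto[of 0 0 0] y0 by simp

text \<open>Induction along the construction: at a point of stick i the claim is available on all of
  [0, \<open>y i\<close>], in particular at \<open>z i\<close>.\<close>

lemma interval_induct [consumes 1, case_names 0 Suc]:
  assumes "0 \<le> s"
    and "\<And>s. s = 0 \<Longrightarrow> P s"
    and "\<And>i s. (\<And>r. 0 \<le> r \<Longrightarrow> r \<le> y i \<Longrightarrow> P r) \<Longrightarrow> y i < s \<Longrightarrow> s \<le> y (Suc i) \<Longrightarrow> P s"
  shows "P s"
proof -
  have "P r" if "0 \<le> r" "r \<le> y n" for r n
    using that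
  proof (induction n arbitrary: r)
    case 0
    then show ?case using y0 assms(2) by simp
  next
    case (Suc n)
    show ?case
    proof (cases "r \<le> y n")
      case True
      then show ?thesis using Suc.IH Suc.prems(1) by blast
    next
      case False
      then show ?thesis using assms(3)[of n r] Suc.IH Suc.prems(2) by simp
    qed
  qed
  then show ?thesis using y_unbounded[of s] assms(1) less_imp_le by blast
qed

lemma pre_dist_self: "0 \<le> s \<Longrightarrow> \<delta> s s = 0"
  by (erule branch_cases) (simp_all add: pre_dist_zero_zero pre_dist_same)

text \<open>Positivity and the triangle inequality go through one induction: when s is an old label
  and r, t lie on the new stick, the inequality rests on the nonnegativity of the old distance from
  \<open>z n\<close> to s.\<close>

lemma pre_dist_facts:
  assumes "0 \<le> r" "r \<le> y n" "0 \<le> s" "s \<le> y n" "0 \<le> t" "t \<le> y n"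
  shows "0 \<le> \<delta> r s \<and> (\<delta> r s = 0 \<longrightarrow> r = s) \<and> \<delta> r t \<le> \<delta> r s + \<delta> s t"
  using assms
proof (induction n arbitrary: r s t)
  case 0
  then have "r = 0" "s = 0" "t = 0" using y0 by auto
  then show ?case using pre_dist_zero_zero by simp
next
  case (Suc n)
  note zr = z_range[of n]
  have low: "0 \<le> \<delta> r s" "\<delta> r s = 0 \<Longrightarrow> r = s" "\<delta> r t \<le> \<delta> r s + \<delta> s t"
    if "0 \<le> r" "r \<le> y n" "0 \<le> s" "s \<le> y n" "0 \<le> t" "t \<le> y n" for r s t
    using Suc.IH[OF that] by auto
  note st = pre_dist_step[of _ n] pre_dist_step'[of _ n] pre_dist_same[of n]
  have "0 \<le> \<delta> r s \<and> (\<delta> r s = 0 \<longrightarrow> r = s)"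
  proof -
    consider "r \<le> y n" "s \<le> y n" | "r \<le> y n" "y n < s" | "y n < r" "s \<le> y n" | "y n < r" "y n < s"
      by linarith
    then show ?thesis
    proof cases
      case 1 then show ?thesis using low(1,2)[of r s s] Suc.prems by auto
    next
      case 2 then show ?thesis using low(1)[of r "z n" r] zr st(1)[of r s] Suc.prems by auto
    next
      case 3 then show ?thesis using low(1)[of "z n" s s] zr st(2)[of s r] Suc.prems by auto
    next
      case 4 then show ?thesis using st(3)[of r s] Suc.prems by auto
    qed
  qed
  moreover have "\<delta> r t \<le> \<delta> r s + \<delta> s t"
  proof -
    consider "r \<le> y n" "s \<le> y n" "t \<le> y n" | "r \<le> y n" "s \<le> y n" "y n < t"
      | "r \<le> y n" "y n < s" "t \<le> y n" | "r \<le> y n" "y n < s" "y n < t"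
      | "y n < r" "s \<le> y n" "t \<le> y n" | "y n < r" "s \<le> y n" "y n < t"
      | "y n < r" "y n < s" "t \<le> y n" | "y n < r" "y n < s" "y n < t"
      unfolding not_le[symmetric] by blast
    then show ?thesis
    proof cases
      case 1 then show ?thesis using low(3)[of r s t] Suc.prems by simp
    next
      case 2 then show ?thesis using low(3)[of r s "z n"] zr Suc.prems st(1)[of r t] st(1)[of s t] by simp
    next
      case 3
      then have "\<delta> r s = \<delta> r (z n) + (s - y n)" "\<delta> s t = \<delta> (z n) t + (s - y n)"
        using st Suc.prems by simp_all
      then show ?thesis using 3 low(3)[of r "z n" t] zr Suc.prems by simp
    next
      case 4
      then have "\<delta> r s = \<delta> r (z n) + (s - y n)" "\<delta> r t = \<delta> r (z n) + (t - y n)" "\<delta> s t = \<bar>s - t\<bar>"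
        using st Suc.prems by simp_all
      then show ?thesis by auto
    next
      case 5
      then have "\<delta> r s = \<delta> (z n) s + (r - y n)" "\<delta> r t = \<delta> (z n) t + (r - y n)"
        using st Suc.prems by simp_all
      then show ?thesis using 5 low(3)[of "z n" s t] zr Suc.prems by simp
    next
      case 6
      then have "\<delta> r s = \<delta> (z n) s + (r - y n)" "\<delta> s t = \<delta> s (z n) + (t - y n)" "\<delta> r t = \<bar>r - t\<bar>"
        using st Suc.prems by simp_all
      moreover have "0 \<le> \<delta> (z n) s" "0 \<le> \<delta> s (z n)"
        using 6 low(1)[of "z n" s s] low(1)[of s "z n" s] zr Suc.prems by simp_all
      ultimately show ?thesis using 6 by linarith
    next
      case 7
      then have "\<delta> r s = \<bar>r - s\<bar>" "\<delta> s t = \<delta> (z n) t + (s - y n)" "\<delta> r t = \<delta> (z n) t + (r - y n)"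
        using st Suc.prems by simp_all
      then show ?thesis by auto
    next
      case 8 then show ?thesis using st(3)[of r s] st(3)[of r t] st(3)[of s t] Suc.prems by auto
    qed
  qed
  ultimately show ?case by blast
qed

lemma common_level:
  obtains n where "r \<le> y n" "s \<le> y n" "t \<le> y n"
proof -
  obtain n where "max r (max s t) < y n" using y_unbounded by blast
  then show ?thesis using that[of n] by simp
qed

sublocale T0: pseudometric_space "{0..}" \<delta>
proof
  have "0 \<le> \<delta> p q \<and> \<delta> p q = \<delta> q p \<and> \<delta> p r \<le> \<delta> p q + \<delta> q r" if "0 \<le> p" "0 \<le> q" "0 \<le> r" for p q r
  proof -
    obtain n where "p \<le> y n" "q \<le> y n" "r \<le> y n" using common_level by blast
    then show ?thesis using pre_dist_facts[of p n q r] that pre_dist_commute[of p q] by simp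
  qed
  then show "pseudometric_on {0..} \<delta>" unfolding pseudometric_on_def using pre_dist_self by auto
qed

lemma pre_dist_eq_0:
  assumes "0 \<le> p" "0 \<le> q" "\<delta> p q = 0"
  shows "p = q"
proof -
  obtain n where "p \<le> y n" "q \<le> y n" by (rule common_level[of p q q])
  then show ?thesis using pre_dist_facts[of p n q q] assms by auto
qed


subsection \<open>Components of the complement of a point\<close>

text \<open>
  \<open>code s t\<close> tells which component of the tree without \<open>s\<close> contains \<open>t\<close>: \<^const>\<open>None\<close> for the
  component of the root, \<open>Some 0\<close> for the continuation of the segment of \<open>s\<close>, \<open>Some i\<close> for the
  part glued to \<open>s = z i\<close>.  As \<open>z 0 = 0\<close>, the two meanings of \<open>Some 0\<close> agree for \<open>s = 0\<close>.
\<close>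

primrec code_upto :: "nat \<Rightarrow> real \<Rightarrow> real \<Rightarrow> nat option" where
  "code_upto 0 s t = None"
| "code_upto (Suc i) s t =
     (if t \<le> y i then code_upto i s t
      else if s \<le> y i then (if z i = s then Some i else code_upto i s (z i))
      else if s < t then Some 0 else None)"

definition code :: "real \<Rightarrow> real \<Rightarrow> nat option" where
  "code s t = code_upto (LEAST n. t \<le> y n) s t"

lemma code_eq_upto:
  assumes "t \<le> y n"
  shows "code s t = code_upto n s t"
proof -
  define N where "N = (LEAST n. t \<le> y n)"
  have N: "t \<le> y N" "N \<le> n"
    using LeastI[of "\<lambda>n. t \<le> y n" n] Least_le[of "\<lambda>n. t \<le> y n" n] assms
    unfolding N_def by auto
  have "code_upto m s t = code_upto N s t" if "N \<le> m" for m
    using that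
  proof (induction m rule: dec_induct)
    case (step m)
    then have "y N \<le> y m" by simp
    then have "t \<le> y m" using N by linarith
    then show ?case using step.IH by simp
  qed simp
  then show ?thesis using N(2) unfolding code_def N_def[symmetric] by metis
qed

lemma code_0: "code s 0 = None"
  using code_eq_upto[of 0 0] y0 by simp

lemma code_step:
  assumes "y i < t" "t \<le> y (Suc i)"
  shows "code s t = (if s \<le> y i then (if z i = s then Some i else code s (z i))
      else if s < t then Some 0 else None)"
  using code_eq_upto[of t "Suc i"] code_eq_upto[of "z i" i] assms z_range[of i] by simp

text \<open>The way from t to the root only visits labels up to t, hence it cannot pass s unless t =
  s, where \<open>None\<close> is a mere convention.\<close>

lemma code_above:
  assumes "0 \<le> t" "t \<le> s" shows "code s t = None"
  using assms
proof (induction t rule: interval_induct)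
  case 0
  then show ?case by (simp add: code_0)
next
  case (Suc i t)
  then show ?case by (simp add: code_step)
qed

lemma code_branch:
  assumes "0 \<le> t" "code s t = Some (Suc i)"
  shows "z (Suc i) = s"
  using assms
proof (induction t rule: interval_induct)
  case 0
  then show ?case by (simp add: code_0)
next
  case (Suc j t)
  then show ?case using Suc.IH[of "z j"] z_range[of j] by (auto simp: code_step split: if_splits)
qed

text \<open>Metric form of lying in different components: the geodesic passes through s.
  \<open>same_component_code\<close> turns it into a topological separation.\<close>

lemma code_separates:
  assumes "0 \<le> s" "0 \<le> t" "0 \<le> t'" "t \<noteq> s" "t' \<noteq> s" "code s t \<noteq> code s t'"
  shows "\<delta> t t' = \<delta> t s + \<delta> s t'"
proof -
  have *: "\<delta> t t' = \<delta> t s + \<delta> s t'"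
    if "0 \<le> t" "0 \<le> t'" "t \<le> y n" "t' \<le> y n" "t \<noteq> s" "t' \<noteq> s" "code s t \<noteq> code s t'" for n t t'
    using that
  proof (induction n arbitrary: t t')
    case 0
    then show ?case using y0 by simp
  next
    case (Suc n)
    note zr = z_range[of n]
    \<comment> \<open>Exactly one of the two points lies on the new stick; the mirrored case follows
      by the symmetry of the distance.\<close>
    have mixed: "\<delta> t t' = \<delta> t s + \<delta> s t'"
      if t: "0 \<le> t" "t \<le> y n" "t \<noteq> s" and t': "y n < t'" "t' \<le> y (Suc n)" "t' \<noteq> s"
        and c: "code s t \<noteq> code s t'" for t t'
    proof (cases "s \<le> y n")
      case True
      have d: "\<delta> t t' = \<delta> t (z n) + (t' - y n)" "\<delta> s t' = \<delta> s (z n) + (t' - y n)"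
        using pre_dist_step t t' True by auto
      show ?thesis
      proof (cases "z n = s")
        case True
        then show ?thesis using d pre_dist_self[OF assms(1)] by simp
      next
        case False
        then have "code s t \<noteq> code s (z n)" using c code_step[OF t'(1,2), of s] True by simp
        then have "\<delta> t (z n) = \<delta> t s + \<delta> s (z n)"
          using Suc.IH[of t "z n"] t zr False by auto
        then show ?thesis using d by simp
      qed
    next
      case False
      have "code s t = None" using code_above t False by auto
      then have "s < t'" using c code_step[OF t'(1,2), of s] False by (auto split: if_splits)
      then show ?thesis
        using pre_dist_step[of t n t'] pre_dist_step[of t n s] pre_dist_same[of n s t'] t t' False by auto
    qed
    consider "t \<le> y n" "t' \<le> y n" | "t \<le> y n" "y n < t'" | "y n < t" "t' \<le> y n"
      | "y n < t" "y n < t'" by linarith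
    then show ?case
    proof cases
      case 1
      then show ?thesis using Suc.IH[of t t'] Suc.prems by simp
    next
      case 2
      then show ?thesis using mixed[of t t'] Suc.prems by simp
    next
      case 3
      then have "\<delta> t' t = \<delta> t' s + \<delta> s t" using mixed[of t' t] Suc.prems by simp
      then show ?thesis by (simp add: pre_dist_commute)
    next
      case 4
      then have "code s t = (if s \<le> y n then (if z n = s then Some n else code s (z n))
          else if s < t then Some 0 else None)"
        "code s t' = (if s \<le> y n then (if z n = s then Some n else code s (z n))
          else if s < t' then Some 0 else None)"
        using code_step Suc.prems by auto
      \<comment> \<open>On one common stick the codes can only differ if s lies strictly between the
        two points.\<close>
      then have "y n < s" "s < t \<and> t' < s \<or> s < t' \<and> t < s"
        using Suc.prems by (auto split: if_splits)
      then show ?thesis using pre_dist_same[of n] Suc.prems 4 by auto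
    qed
  qed
  obtain n where "t \<le> y n" "t' \<le> y n" using common_level[of t t' t'] by blast
  then show ?thesis using *[of t t' n] assms by simp
qed

end

section \<open>Connected subsets of pseudo-metric spaces\<close>

context pseudometric_space
begin

abbreviation "\<tau> \<equiv> pm_topology S d"

lemma openin_pm_topologyD:
  assumes "openin \<tau> U" "p \<in> U"
  obtains e where "0 < e" "{q\<in>S. d p q < e} \<subseteq> U"
  using assms unfolding openin_pm_topology by blast

lemma openin_ball: "p \<in> S \<Longrightarrow> openin \<tau> {q\<in>S. d p q < r}"
  unfolding openin_pm_topology
proof (intro conjI ballI)
  fix q assume p: "p \<in> S" and q: "q \<in> {q\<in>S. d p q < r}"
  show "\<exists>e>0. {q'\<in>S. d q q' < e} \<subseteq> {q\<in>S. d p q < r}"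
  proof (intro exI[of _ "r - d p q"] conjI subsetI)
    fix q' assume "q' \<in> {q'\<in>S. d q q' < r - d p q}"
    then show "q' \<in> {q\<in>S. d p q < r}" using triangle[of p q q'] p q by auto
  qed (use q in auto)
qed auto

lemma connectedin_Lipschitz_image:
  fixes f :: "real \<Rightarrow> 'p"
  assumes S: "f ` {a..b} \<subseteq> S"
    and L: "\<And>r r'. r \<in> {a..b} \<Longrightarrow> r' \<in> {a..b} \<Longrightarrow> d (f r) (f r') \<le> \<bar>r - r'\<bar>"
  shows "connectedin \<tau> (f ` {a..b})"
proof (rule connectedin_continuous_map_image)
  show "continuous_map (top_of_set {a..b}) \<tau> f"
    unfolding continuous_map_def
  proof (intro conjI allI impI)
    show "f \<in> topspace (top_of_set {a..b}) \<rightarrow> topspace \<tau>"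
      using S by (auto simp: topspace_pm_topology)
    fix U assume U: "openin \<tau> U"
    show "openin (top_of_set {a..b}) {r \<in> topspace (top_of_set {a..b}). f r \<in> U}"
      unfolding openin_euclidean_subtopology_iff
    proof (intro conjI ballI)
      fix r assume r: "r \<in> {r \<in> topspace (top_of_set {a..b}). f r \<in> U}"
      then have fr: "f r \<in> U" "r \<in> {a..b}" by auto
      obtain e where e: "e > 0" "{q\<in>S. d (f r) q < e} \<subseteq> U"
        by (rule openin_pm_topologyD[OF U fr(1)])
      have "f r' \<in> U" if "r' \<in> {a..b}" "dist r' r < e" for r'
      proof -
        have "d (f r) (f r') < e"
          using L[OF fr(2) that(1)] that(2) by (simp add: dist_real_def abs_minus_commute)
        then show ?thesis using e(2) S that(1) by blast
      qed
      then show "\<exists>e>0. \<forall>r'\<in>{a..b}. dist r' r < e \<longrightarrow>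
          r' \<in> {r \<in> topspace (top_of_set {a..b}). f r \<in> U}"
        using e(1) by auto
    qed auto
  qed
  show "connectedin (top_of_set {a..b}) {a..b}"
    by (simp add: connectedin_subtopology)
qed

lemma connectedin_dense:
  assumes A: "connectedin \<tau> A" "A \<subseteq> B" and B: "B \<subseteq> S"
    and dense: "\<And>q e. q \<in> B \<Longrightarrow> 0 < e \<Longrightarrow> \<exists>a\<in>A. d q a < e"
  shows "connectedin \<tau> B"
proof (rule connectedin_intermediate_closure_of[OF A])
  show "B \<subseteq> \<tau> closure_of A"
  proof
    fix q assume q: "q \<in> B"
    have "\<exists>a. a \<in> A \<and> a \<in> U" if U: "q \<in> U" "openin \<tau> U" for U
    proof -
      obtain e where e: "e > 0" "{q'\<in>S. d q q' < e} \<subseteq> U"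
        by (rule openin_pm_topologyD[OF U(2,1)])
      obtain a where "a \<in> A" "d q a < e" using dense[OF q e(1)] by blast
      then show ?thesis using e(2) A(2) B by blast
    qed
    then show "q \<in> \<tau> closure_of A"
      unfolding in_closure_of using q B by (auto simp: topspace_pm_topology)
  qed
qed

lemma connected_component_avoidI:
  assumes "connectedin \<tau> K" "q \<in> K" "r \<in> K" "p \<notin> K"
  shows "connected_component_of (subtopology \<tau> (S - {p})) q r"
proof -
  have "K \<subseteq> S" using connectedin_subset_topspace[OF assms(1)] by (simp add: topspace_pm_topology)
  then have "connectedin (subtopology \<tau> (S - {p})) K"
    using assms by (auto simp: connectedin_subtopology)
  then show ?thesis using assms unfolding connected_component_of_def by blast
qed

end

section \<open>Connected components in the completed tree\<close>

context stick_breaking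
begin

abbreviation "T \<equiv> icrt y z"
abbreviation "dT \<equiv> icrt_dist y z"
abbreviation "same_component p \<equiv>
  connected_component_of (subtopology (pm_topology T dT) (T - {p}))"

sublocale T: pseudometric_space T dT
  unfolding icrt_def icrt_dist_def
  by (rule pseudometric_space.intro, rule T0.pseudometric_completion)

lemma Inl_in_T [simp]: "Inl t \<in> T \<longleftrightarrow> 0 \<le> t"
  unfolding icrt_def by simp

lemma dT_Inl [simp]: "dT (Inl s) (Inl t) = \<delta> s t"
  unfolding icrt_dist_def by simp

lemma dT_pos:
  assumes "p \<in> T" "q \<in> T" "p \<noteq> q" shows "0 < dT p q"
proof -
  have "dT p q \<noteq> 0"
  proof
    assume "dT p q = 0"
    then have "p = q"
      unfolding icrt_dist_def
      by (rule T0.completion_metric(2)[rotated 3])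
         (use assms pre_dist_eq_0 in \<open>simp_all add: icrt_def\<close>)
    then show False using assms(3) by simp
  qed
  then show ?thesis using T.nonneg[OF assms(1,2)] by simp
qed

lemma T_dense:
  assumes "p \<in> T" "0 < e"
  obtains t where "0 \<le> t" "dT p (Inl t) < e"
  using T0.completion_dense[of p e] assms unfolding icrt_def icrt_dist_def by auto

lemma same_component_refl:
  "q \<in> T \<Longrightarrow> q \<noteq> p \<Longrightarrow> same_component p q q"
  by (simp add: connected_component_of_refl T.topspace_pm_topology)

lemma same_component_sym: "same_component p q r \<Longrightarrow> same_component p r q"
  by (simp add: connected_component_of_sym)

lemma same_component_trans:
  "same_component p q r \<Longrightarrow> same_component p r r' \<Longrightarrow> same_component p q r'"
  by (rule connected_component_of_trans)

text \<open>A stick as a closed path: the parameter \<open>y i\<close> is sent to the attachment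
  point, because the label \<open>y i\<close> itself is the tip of the preceding stick.\<close>

definition seg :: "nat \<Rightarrow> real \<Rightarrow> tree_point" where
  "seg i r = Inl (if r = y i then z i else r)"

lemma seg_connected:
  assumes "y i \<le> a" "b \<le> y (Suc i)"
  shows "connectedin T.\<tau> (seg i ` {a..b})"
proof (rule T.connectedin_Lipschitz_image)
  have "0 \<le> r" if "y i \<le> r" for r using that y_nonneg[of i] by linarith
  then show "seg i ` {a..b} \<subseteq> T" using assms z_range[of i] by (auto simp: seg_def)
  fix r r' assume r: "r \<in> {a..b}" "r' \<in> {a..b}"
  consider "r = y i" "r' = y i" | "r = y i" "y i < r'" | "y i < r" "r' = y i" | "y i < r" "y i < r'"
    using r assms by (auto simp: less_le)
  then show "dT (seg i r) (seg i r') \<le> \<bar>r - r'\<bar>"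
  proof cases
    case 1
    then show ?thesis using pre_dist_self z_range[of i] by (simp add: seg_def)
  next
    case 2
    then have "\<delta> (z i) r' = \<delta> (z i) (z i) + (r' - y i)"
      using pre_dist_step[of "z i" i r'] z_range[of i] r assms by simp
    then show ?thesis using 2 pre_dist_self[of "z i"] z_range[of i] by (simp add: seg_def)
  next
    case 3
    then have "\<delta> r (z i) = \<delta> (z i) (z i) + (r - y i)"
      using pre_dist_step'[of "z i" i r] z_range[of i] r assms by simp
    then show ?thesis using 3 pre_dist_self[of "z i"] z_range[of i] by (simp add: seg_def)
  next
    case 4
    then show ?thesis using pre_dist_same[of i r r'] r assms by (simp add: seg_def)
  qed
qed

lemma seg_same_component:
  assumes "y i < a" "a \<le> b" "b \<le> y (Suc i)" "s < a \<or> b < s"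
  shows "same_component (Inl s) (Inl a) (Inl b)"
proof (rule T.connected_component_avoidI[OF seg_connected[of i a b]])
  show "Inl a \<in> seg i ` {a..b}" "Inl b \<in> seg i ` {a..b}"
    using assms by (auto simp: seg_def image_iff intro: bexI[of _ a] bexI[of _ b])
  show "Inl s \<notin> seg i ` {a..b}" using assms by (auto simp: seg_def)
qed (use assms in auto)

lemma attach_same_component:
  assumes "y i < a" "a \<le> y (Suc i)" "s \<le> y i \<or> a < s" "s \<noteq> z i"
  shows "same_component (Inl s) (Inl a) (Inl (z i))"
proof (rule T.connected_component_avoidI[OF seg_connected[of i "y i" a]])
  show "Inl a \<in> seg i ` {y i..a}"
    using assms by (auto simp: seg_def image_iff intro: bexI[of _ a])
  show "Inl (z i) \<in> seg i ` {y i..a}"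
    using assms by (auto simp: seg_def image_iff intro: bexI[of _ "y i"])
  show "Inl s \<notin> seg i ` {y i..a}" using assms by (auto simp: seg_def split: if_splits)
qed (use assms in auto)

text \<open>A label in the component with code c. These are the root and the points at which
  \<open>uniform_angle_conditions\<close> prescribes angles, which is what makes the uniqueness of
  the angle function provable.\<close>

definition code_ref :: "real \<Rightarrow> nat option \<Rightarrow> real" where
  "code_ref s c = (case c of None \<Rightarrow> 0 | Some i \<Rightarrow>
     if i = 0 then y (LEAST a. s < y a) else y (Suc i))"

lemma next_point_eq:
  assumes "y i \<le> s" "s < y (Suc i)"
  shows "(LEAST a. s < y a) = Suc i"
proof (rule Least_equality)
  fix a assume "s < y a"
  then have "y i < y a" using assms by linarith
  then show "Suc i \<le> a" by simp
qed (use assms in simp)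

text \<open>Equal codes imply the same component, since both points are joined to one reference
  point. The joining paths run along sticks and avoid s.\<close>

lemma same_component_ref:
  assumes "0 \<le> t" "t \<noteq> s" "0 \<le> s"
  shows "same_component (Inl s) (Inl t) (Inl (code_ref s (code s t)))"
  using assms
proof (induction t rule: interval_induct)
  case (0 t)
  then show ?case by (simp add: code_0 code_ref_def same_component_refl)
next
  case (Suc i t)
  note t = Suc.hyps(1,2) and c = code_step[OF Suc.hyps(1,2), of s]
  consider "s \<le> y i" "z i = s" | "s \<le> y i" "z i \<noteq> s" | "y i < s" "s < t" | "t < s"
    using Suc.prems by linarith
  then show ?case
  proof cases
    case 1
    \<comment> \<open>For i = 0 the point s is \<open>z 0 = 0\<close>, and both meanings of
      \<open>Some 0\<close> lead to \<open>y 1\<close>.\<close>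
    have "code_ref s (Some i) = y (Suc i)"
    proof (cases "i = 0")
      case True
      then have "s = 0" using 1 z0 by simp
      then show ?thesis using next_point_eq[of 0 s] True y0 y_less_iff[of 0 "Suc 0"]
        by (simp add: code_ref_def)
    qed (simp add: code_ref_def)
    then show ?thesis using 1 c seg_same_component[of i t "y (Suc i)" s] t by simp
  next
    case 2
    have "same_component (Inl s) (Inl (z i)) (Inl (code_ref s (code s (z i))))"
      using Suc.IH[of "z i"] z_range[of i] 2 Suc.prems by simp
    moreover have "same_component (Inl s) (Inl t) (Inl (z i))"
      using attach_same_component[of i t s] t 2 by auto
    ultimately show ?thesis
      using 2 c same_component_trans[of "Inl s" "Inl t" "Inl (z i)"] by simp
  next
    case 3
    then have "code_ref s (code s t) = y (Suc i)"
      using c next_point_eq[of i s] t by (simp add: code_ref_def)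
    then show ?thesis using seg_same_component[of i t "y (Suc i)" s] t 3 by simp
  next
    case 4
    have zi: "z i < s" using z_range[of i] 4 t by linarith
    have "code s t = None" "code s (z i) = None"
      using code_above[of t s] code_above[of "z i" s] 4 z_range[of i] zi t y_nonneg[of i] by auto
    moreover have "same_component (Inl s) (Inl (z i)) (Inl (code_ref s (code s (z i))))"
      using Suc.IH[of "z i"] z_range[of i] Suc.prems zi by simp
    moreover have "same_component (Inl s) (Inl t) (Inl (z i))"
      using attach_same_component[of i t s] t 4 zi by auto
    ultimately show ?thesis
      using same_component_trans[of "Inl s" "Inl t" "Inl (z i)"] by simp
  qed
qed

text \<open>A connected set on which the distances to both ends add up stands in for the geodesic.
  It stays within distance \<open>\<delta> a b\<close> of a, from which the connectedness of balls
  follows.\<close>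

lemma geodesic_upto:
  assumes "0 \<le> a" "a \<le> y n" "0 \<le> b" "b \<le> y n"
  shows "\<exists>P. P \<subseteq> {0..y n} \<and> a \<in> P \<and> b \<in> P \<and> connectedin T.\<tau> (Inl ` P) \<and>
    (\<forall>r\<in>P. \<delta> a r + \<delta> r b = \<delta> a b)"
  using assms
proof (induction n arbitrary: a b)
  case 0
  then have ab: "a = 0" "b = 0" using y0 by auto
  have "connectedin T.\<tau> (Inl ` {0})" by (simp add: T.topspace_pm_topology)
  then show ?case using ab pre_dist_zero_zero y0 by (intro exI[of _ "{0}"]) simp
next
  case (Suc n)
  note zr = z_range[of n] and yn = y_nonneg[of n]
  have mixed: "\<exists>P. P \<subseteq> {0..y (Suc n)} \<and> a \<in> P \<and> b \<in> P \<and> connectedin T.\<tau> (Inl ` P) \<and>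
      (\<forall>r\<in>P. \<delta> a r + \<delta> r b = \<delta> a b)"
    if a: "0 \<le> a" "a \<le> y n" and b: "y n < b" "b \<le> y (Suc n)" for a b
  proof -
    obtain P where P: "P \<subseteq> {0..y n}" "a \<in> P" "z n \<in> P" "connectedin T.\<tau> (Inl ` P)"
      "\<forall>r\<in>P. \<delta> a r + \<delta> r (z n) = \<delta> a (z n)"
      using Suc.IH[of a "z n"] a zr by blast
    \<comment> \<open>The parameter \<open>y n\<close> contributes only \<open>z n\<close>, which
      already belongs to P.\<close>
    have un: "Inl ` (P \<union> {y n<..b}) = Inl ` P \<union> seg n ` {y n..b}"
      using P(3) b by (force simp: seg_def image_iff)
    have "connectedin T.\<tau> (Inl ` P \<union> seg n ` {y n..b})"
    proof (rule connectedin_Un[OF P(4) seg_connected])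
      have "seg n (y n) \<in> Inl ` P \<inter> seg n ` {y n..b}"
        using P(3) b by (auto simp: seg_def)
      then show "Inl ` P \<inter> seg n ` {y n..b} \<noteq> {}" by blast
    qed (use b in auto)
    moreover have "\<delta> a r + \<delta> r b = \<delta> a b" if "r \<in> P \<union> {y n<..b}" for r
    proof (cases "r \<in> P")
      case True
      then show ?thesis
        using P(1,5) pre_dist_step[of r n b] pre_dist_step[of a n b] a b by auto
    next
      case False
      then have r: "y n < r" "r \<le> b" using that by auto
      then show ?thesis
        using pre_dist_step[of a n r] pre_dist_step[of a n b] pre_dist_same[of n r b] a b by simp
    qed
    moreover have "P \<union> {y n<..b} \<subseteq> {0..y (Suc n)}"
    proof -
      have "y n \<le> y (Suc n)" by simp
      then show ?thesis using P(1) b yn by force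
    qed
    ultimately show ?thesis using un P(2) b by (intro exI[of _ "P \<union> {y n<..b}"]) simp
  qed
  consider "a \<le> y n" "b \<le> y n" | "a \<le> y n" "y n < b" | "y n < a" "b \<le> y n" | "y n < a" "y n < b"
    by linarith
  then show ?case
  proof cases
    case 1
    then obtain P where P: "P \<subseteq> {0..y n}" "a \<in> P" "b \<in> P" "connectedin T.\<tau> (Inl ` P)"
      "\<forall>r\<in>P. \<delta> a r + \<delta> r b = \<delta> a b"
      using Suc.IH[of a b] Suc.prems by blast
    moreover have "{0..y n} \<subseteq> {0..y (Suc n)}" by simp
    ultimately show ?thesis by blast
  next
    case 2
    then show ?thesis using mixed[of a b] Suc.prems by blast
  next
    case 3
    then obtain P where P: "P \<subseteq> {0..y (Suc n)}" "b \<in> P" "a \<in> P" "connectedin T.\<tau> (Inl ` P)"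
      "\<forall>r\<in>P. \<delta> b r + \<delta> r a = \<delta> b a"
      using mixed[of b a] Suc.prems by blast
    have "\<forall>r\<in>P. \<delta> a r + \<delta> r b = \<delta> a b"
    proof
      fix r assume "r \<in> P"
      then have "\<delta> b r + \<delta> r a = \<delta> b a" using P(5) by blast
      then show "\<delta> a r + \<delta> r b = \<delta> a b"
        using pre_dist_commute[of b r] pre_dist_commute[of r a] pre_dist_commute[of b a] by simp
    qed
    with P show ?thesis by blast
  next
    case 4
    define P where "P = {min a b..max a b}"
    have "seg n ` P = Inl ` P"
      by (rule image_cong) (use 4 in \<open>auto simp: P_def seg_def\<close>)
    moreover have "connectedin T.\<tau> (seg n ` P)"
      unfolding P_def by (rule seg_connected) (use 4 Suc.prems in auto)
    moreover have "\<delta> a r + \<delta> r b = \<delta> a b" if "r \<in> P" for r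
    proof -
      have r: "y n < r" "r \<le> y (Suc n)" "min a b \<le> r" "r \<le> max a b"
        using that 4 Suc.prems unfolding P_def by (auto simp: min_def max_def split: if_splits)
      then have "\<bar>a - r\<bar> + \<bar>r - b\<bar> = \<bar>a - b\<bar>" by (simp add: min_def max_def split: if_splits)
      then show ?thesis
        using pre_dist_same[of n a r] pre_dist_same[of n r b] pre_dist_same[of n a b] r 4 Suc.prems by simp
    qed
    ultimately show ?thesis
      using Suc.prems yn by (intro exI[of _ P]) (auto simp: P_def)
  qed
qed

lemma geodesic:
  assumes "0 \<le> a" "0 \<le> b"
  obtains P where "P \<subseteq> {0..}" "a \<in> P" "b \<in> P" "connectedin T.\<tau> (Inl ` P)"
    "\<And>r. r \<in> P \<Longrightarrow> \<delta> a r \<le> \<delta> a b"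
proof -
  obtain n where n: "a \<le> y n" "b \<le> y n" by (rule common_level[of a b b])
  obtain P where P: "P \<subseteq> {0..y n}" "a \<in> P" "b \<in> P" "connectedin T.\<tau> (Inl ` P)"
    "\<forall>r\<in>P. \<delta> a r + \<delta> r b = \<delta> a b"
    using geodesic_upto[OF assms(1) n(1) assms(2) n(2)] by blast
  have P0: "P \<subseteq> {0..}" using P(1) by auto
  have "\<delta> a r \<le> \<delta> a b" if "r \<in> P" for r
  proof -
    have "\<delta> a r + \<delta> r b = \<delta> a b" using P(5) that by blast
    moreover have "0 \<le> r" using P0 that by auto
    then have "0 \<le> \<delta> r b" using T0.nonneg assms by auto
    ultimately show ?thesis by linarith
  qed
  then show ?thesis using that P P0 by blast
qed

text \<open>The labels in the ball form a union of geodesics starting at s, hence a connected set;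
  it is dense in the ball of the completed tree.\<close>

lemma connected_ball:
  assumes s: "0 \<le> s" and e: "0 < e"
  shows "connectedin T.\<tau> {q\<in>T. dT (Inl s) q < e}"
proof -
  define A :: "tree_point set" where "A = Inl ` {t. 0 \<le> t \<and> \<delta> s t < e}"
  define \<P> where "\<P> = {K. connectedin T.\<tau> K \<and> Inl s \<in> K \<and> K \<subseteq> A}"
  have "A = \<Union>\<P>"
  proof
    show "A \<subseteq> \<Union>\<P>"
    proof
      fix q assume "q \<in> A"
      then obtain t where t: "q = Inl t" "0 \<le> t" "\<delta> s t < e" unfolding A_def by blast
      obtain P where P: "P \<subseteq> {0..}" "s \<in> P" "t \<in> P" "connectedin T.\<tau> (Inl ` P)"
        "\<And>r. r \<in> P \<Longrightarrow> \<delta> s r \<le> \<delta> s t" using geodesic[OF s t(2)] by metis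
      have "Inl ` P \<subseteq> A" unfolding A_def using P(1,5) t(3) by fastforce
      then have "Inl ` P \<in> \<P>" unfolding \<P>_def using P by auto
      then show "q \<in> \<Union>\<P>" using P(3) t(1) by blast
    qed
    show "\<Union>\<P> \<subseteq> A" unfolding \<P>_def by blast
  qed
  moreover have "connectedin T.\<tau> (\<Union>\<P>)"
  proof (rule connectedin_Union)
    have "{Inl s} \<in> \<P>" using s e pre_dist_self unfolding \<P>_def A_def
      by (simp add: T.topspace_pm_topology)
    moreover have "Inl s \<in> \<Inter>\<P>" unfolding \<P>_def by blast
    ultimately show "\<Inter>\<P> \<noteq> {}" by blast
  qed (simp add: \<P>_def)
  ultimately have A: "connectedin T.\<tau> A" by simp
  show ?thesis
  proof (rule T.connectedin_dense[OF A])
    show "A \<subseteq> {q \<in> T. dT (Inl s) q < e}" unfolding A_def by auto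
    fix q e' assume q: "q \<in> {q \<in> T. dT (Inl s) q < e}" and e': "(0::real) < e'"
    obtain t where t: "0 \<le> t" "dT q (Inl t) < min e' (e - dT (Inl s) q)"
      using T_dense[of q "min e' (e - dT (Inl s) q)"] q e' by auto
    have "dT (Inl s) (Inl t) \<le> dT (Inl s) q + dT q (Inl t)"
      by (rule T.triangle) (use s t q in auto)
    then have "Inl t \<in> A" unfolding A_def using t by auto
    then show "\<exists>a\<in>A. dT q a < e'" using t by auto
  qed auto
qed

text \<open>The ball around t whose radius is half the distance from p to q is connected, contains q
  and misses p. This lets labels stand in for the points added by the completion.\<close>

lemma near_same_component:
  assumes "p \<in> T" "q \<in> T" "0 \<le> t" "dT (Inl t) q < dT p q / 2"
  shows "same_component p q (Inl t)"
proof (rule T.connected_component_avoidI)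
  have pos: "0 < dT p q" using assms(4) T.nonneg[of "Inl t" q] assms by auto
  show "connectedin T.\<tau> {r\<in>T. dT (Inl t) r < dT p q / 2}"
    by (rule connected_ball) (use assms pos in auto)
  show "q \<in> {r\<in>T. dT (Inl t) r < dT p q / 2}" using assms by auto
  show "Inl t \<in> {r\<in>T. dT (Inl t) r < dT p q / 2}" using assms pos pre_dist_self by auto
  have "dT p q \<le> dT p (Inl t) + dT (Inl t) q" by (rule T.triangle) (use assms in auto)
  moreover have "dT p (Inl t) = dT (Inl t) p" by (rule T.commute) (use assms in auto)
  ultimately show "p \<notin> {r\<in>T. dT (Inl t) r < dT p q / 2}" using assms(4) by auto
qed

lemma component_contains_Inl:
  assumes "p \<in> T" "q \<in> T" "q \<noteq> p"
  obtains t where "0 \<le> t" "Inl t \<noteq> p" "same_component p q (Inl t)"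
proof -
  have pos: "0 < dT p q" using dT_pos assms by auto
  obtain t where t: "0 \<le> t" "dT q (Inl t) < dT p q / 2" using T_dense[of q "dT p q / 2"] assms pos by auto
  have "dT (Inl t) q = dT q (Inl t)" by (rule T.commute) (use assms t in auto)
  then have "same_component p q (Inl t)" using near_same_component assms t by simp
  moreover have "Inl t \<noteq> p"
    using connected_component_in_topspace[OF calculation] by (auto simp: T.topspace_pm_topology)
  ultimately show ?thesis using that t by blast
qed

text \<open>Give every label r a ball of radius half its distance to s. By
  \<open>code_separates\<close>, balls of labels with different codes are disjoint, so the balls
  split the complement of s into two disjoint open sets, one for the code of t and one for all other
  codes.\<close>

lemma same_component_code:
  assumes s: "0 \<le> s" and t: "0 \<le> t" "t \<noteq> s" and t': "0 \<le> t'" "t' \<noteq> s"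
    and same: "same_component (Inl s) (Inl t) (Inl t')"
  shows "code s t = code s t'"
proof (rule ccontr)
  assume ne: "code s t \<noteq> code s t'"
  obtain K where K: "connectedin T.\<tau> K" "K \<subseteq> T - {Inl s}" "Inl t \<in> K" "Inl t' \<in> K"
    using same unfolding connected_component_of_def by (auto simp: connectedin_subtopology)
  define B where "B r = {q\<in>T. dT (Inl r) q < \<delta> r s / 2}" for r
  define E where "E C = (\<Union>r\<in>{r. 0 \<le> r \<and> r \<noteq> s \<and> code s r \<in> C}. B r)" for C
  have pos: "0 < \<delta> r s" if "0 \<le> r" "r \<noteq> s" for r
    using dT_pos[of "Inl r" "Inl s"] that s by simp
  have "openin T.\<tau> (B r)" if "0 \<le> r" for r
    unfolding B_def by (rule T.openin_ball) (simp add: that)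
  then have op: "openin T.\<tau> (E C)" for C
    unfolding E_def by (intro openin_Union) auto
  have in_E: "Inl r \<in> E C" if "0 \<le> r" "r \<noteq> s" "code s r \<in> C" for r C
    unfolding E_def B_def using that pos[of r] pre_dist_self[of r] by auto
  have "K \<subseteq> E {code s t} \<union> E (- {code s t})"
  proof
    fix q assume "q \<in> K"
    then have q: "q \<in> T" "q \<noteq> Inl s" using K(2) by auto
    have p: "0 < dT q (Inl s)" using dT_pos q s by auto
    \<comment> \<open>A quarter suffices: then \<open>\<delta> r s\<close> exceeds three quarters of
      the distance from q to s, which puts q into the ball of r.\<close>
    obtain r where r: "0 \<le> r" "dT q (Inl r) < dT q (Inl s) / 4"
      using T_dense[of q "dT q (Inl s) / 4"] q p by auto
    have "dT q (Inl s) \<le> dT q (Inl r) + dT (Inl r) (Inl s)"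
      by (rule T.triangle) (use q r s in auto)
    moreover have "dT (Inl r) q = dT q (Inl r)" by (rule T.commute) (use q r in auto)
    ultimately have "dT (Inl r) q < \<delta> r s / 2" using r p by simp
    then have "q \<in> B r" unfolding B_def using q by auto
    moreover have "r \<noteq> s"
    proof
      assume "r = s"
      then show False using r(2) p by simp
    qed
    ultimately show "q \<in> E {code s t} \<union> E (- {code s t})" unfolding E_def using r(1) by auto
  qed
  moreover have "E {code s t} \<inter> E (- {code s t}) \<inter> K = {}"
  proof (rule ccontr)
    assume "\<not> ?thesis"
    then obtain q r r' where q: "q \<in> B r" "q \<in> B r'" and r: "0 \<le> r" "r \<noteq> s" "code s r = code s t"
      and r': "0 \<le> r'" "r' \<noteq> s" "code s r' \<noteq> code s t"
      unfolding E_def by blast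
    have "\<delta> r r' = \<delta> r s + \<delta> s r'" using code_separates[of s r r'] s r r' by simp
    moreover have "dT (Inl r) (Inl r') \<le> dT (Inl r) q + dT q (Inl r')"
      by (rule T.triangle) (use q r r' B_def in auto)
    moreover have "dT q (Inl r') = dT (Inl r') q" by (rule T.commute) (use q r' B_def in auto)
    ultimately show False
      using q pos[of r] pos[of r'] r r' pre_dist_commute[of s r'] unfolding B_def by simp
  qed
  ultimately show False
    using connectedinD[OF K(1) op[of "{code s t}"] op[of "- {code s t}"]]
      in_E[of t "{code s t}"] in_E[of t' "- {code s t}"] K(3,4) t t' ne by auto
qed

text \<open>Added limit points are leaves: the geodesic between two labels consists of labels
  only.\<close>

lemma same_component_limit_point:
  assumes "Inr C \<in> T" "q \<in> T" "q \<noteq> Inr C" "r \<in> T" "r \<noteq> Inr C"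
  shows "same_component (Inr C) q r"
proof -
  obtain t where t: "0 \<le> t" "same_component (Inr C) q (Inl t)"
    using component_contains_Inl assms by metis
  obtain t' where t': "0 \<le> t'" "same_component (Inr C) r (Inl t')"
    using component_contains_Inl assms by metis
  obtain P where P: "P \<subseteq> {0..}" "t \<in> P" "t' \<in> P" "connectedin T.\<tau> (Inl ` P)"
    using geodesic[OF t(1) t'(1)] by metis
  have "same_component (Inr C) (Inl t) (Inl t')"
    by (rule T.connected_component_avoidI[OF P(4)]) (use P in auto)
  then show ?thesis by (rule same_component_trans[OF same_component_trans[OF t(2)] same_component_sym[OF t'(2)]])
qed

end

section \<open>The uniform angle function\<close>

text \<open>General position, shown to hold almost surely in \<open>AE_data\<close>. The conditions
  on angles make the angles around a point distinct from each other and from the angle 0 of the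
  root; injectivity of \<open>x\<close> gives each point at most one own angle. An atom at a tip
  \<open>y j\<close> would contradict itself: nothing continues the tip, yet \<open>ux\<close> is
  prescribed for its continuation.\<close>

locale looptree_data = stick_breaking +
  fixes \<theta> x ux uz :: "nat \<Rightarrow> real"
  assumes x_inj: "inj_on x (atoms \<theta>)"
    and x_nonneg: "\<And>i. i \<in> atoms \<theta> \<Longrightarrow> 0 \<le> x i"
    and x_neq_y: "\<And>i j. i \<in> atoms \<theta> \<Longrightarrow> 1 \<le> j \<Longrightarrow> x i \<noteq> y j"
    and ux_range: "\<And>i. i \<in> atoms \<theta> \<Longrightarrow> 0 < ux i \<and> ux i \<le> 1"
    and uz_range: "\<And>i. 1 \<le> i \<Longrightarrow> 0 < uz i \<and> uz i \<le> 1 \<and> uz i \<noteq> 1/2"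
    and ux_neq_uz: "\<And>i j. i \<in> atoms \<theta> \<Longrightarrow> 1 \<le> j \<Longrightarrow> ux i \<noteq> uz j"
    and uz_inj: "inj_on uz {1..}"
begin

definition own_angle :: "real \<Rightarrow> real" where
  "own_angle s = (if s \<in> x ` atoms \<theta> then ux (inv_into (atoms \<theta>) x s) else 1/2)"

definition code_angle :: "real \<Rightarrow> nat option \<Rightarrow> real" where
  "code_angle s c = (case c of None \<Rightarrow> 0 | Some i \<Rightarrow> if i = 0 then own_angle s else uz i)"

lemma own_angle_atom: "i \<in> atoms \<theta> \<Longrightarrow> own_angle (x i) = ux i"
  unfolding own_angle_def using x_inj by simp

lemma own_angle_cases:
  obtains i where "i \<in> atoms \<theta>" "x i = s" "own_angle s = ux i" | "s \<notin> x ` atoms \<theta>" "own_angle s = 1/2"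
proof (cases "s \<in> x ` atoms \<theta>")
  case True
  then obtain i where "i \<in> atoms \<theta>" "x i = s" by blast
  then show ?thesis using that(1)[of i] own_angle_atom by blast
next
  case False
  then show ?thesis using that(2) unfolding own_angle_def by simp
qed

lemma own_angle_range: "0 < own_angle s \<and> own_angle s \<le> 1 \<and> (\<forall>j\<ge>1. own_angle s \<noteq> uz j)"
proof (rule own_angle_cases[of s])
  fix i assume "i \<in> atoms \<theta>" "own_angle s = ux i"
  then show ?thesis using ux_range[of i] ux_neq_uz[of i] by auto
next
  assume "own_angle s = 1/2"
  then show ?thesis using uz_range by auto
qed

lemma code_angle_range: "0 \<le> code_angle s c \<and> code_angle s c \<le> 1"
  using own_angle_range[of s] uz_range unfolding code_angle_def
  by (auto split: option.splits intro: less_imp_le)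

text \<open>The angle 0 belongs to the root, the own angle to the continuation and
  \<open>uz i\<close> to stick i; the locale makes all of them distinct, whatever sticks are glued
  to s.\<close>

lemma code_angle_inj:
  assumes "code_angle s c = code_angle s c'" shows "c = c'"
proof -
  have uz: "uz i \<noteq> 0" "own_angle s \<noteq> uz i" if "i \<noteq> 0" for i
    using uz_range[of i] own_angle_range[of s] that by auto
  have own: "own_angle s \<noteq> 0" using own_angle_range[of s] by simp
  have inj: "i = j" if "i \<noteq> 0" "j \<noteq> 0" "uz i = uz j" for i j
    using inj_onD[OF uz_inj that(3)] that by simp
  have none: "code_angle s (Some i) \<noteq> code_angle s None" for i
    using own uz(1)[of i] unfolding code_angle_def by simp
  have some: "i = j" if "code_angle s (Some i) = code_angle s (Some j)" for i j
    using that uz(2)[of i] uz(2)[of j] inj[of i j] unfolding code_angle_def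
    by (cases "i = 0"; cases "j = 0") simp_all
  show ?thesis
    using assms none none[symmetric] some by (cases c; cases c') auto
qed

text \<open>A point \<open>y j\<close> with j at least 1 is the tip of its stick, so nothing
  continues it; accordingly no angle is prescribed for a continuation there.\<close>

lemma code_own:
  assumes "0 \<le> t" "code s t = Some 0"
  shows "s \<notin> y ` {1..} \<and> 0 \<le> s"
  using assms
proof (induction t rule: interval_induct)
  case (0 t)
  then show ?case by (simp add: code_0)
next
  case (Suc i t)
  note c = code_step[OF Suc.hyps(1,2), of s]
  consider "s \<le> y i" "z i = s" | "s \<le> y i" "z i \<noteq> s" | "y i < s" "s < t" | "t \<le> s"
    by linarith
  then show ?case
  proof cases
    case 1
    then have "s = 0" using c Suc.prems z0 by auto
    moreover have "0 < y j" if "1 \<le> j" for j using that y_less_iff[of 0 j] y0 by simp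
    ultimately show ?thesis by force
  next
    case 2
    then show ?thesis using c Suc.prems Suc.IH[of "z i"] z_range[of i] by simp
  next
    case 3
    have "s \<noteq> y j" for j
    proof
      assume "s = y j"
      then have "y i < y j" using 3 by linarith
      moreover have "y j < y (Suc i)" using 3 Suc.hyps \<open>s = y j\<close> by linarith
      ultimately show False by simp
    qed
    then show ?thesis using 3 y_nonneg[of i] by auto
  next
    case 4
    then show ?thesis using code_above[of t s] Suc.prems Suc.hyps y_nonneg[of i] by simp
  qed
qed

text \<open>Codes exist for labels only. Any other point borrows the code of a label of its
  component; by \<open>same_component_code\<close> the choice of the label does not matter.\<close>

definition rep :: "tree_point \<Rightarrow> tree_point \<Rightarrow> real" where
  "rep p q = (SOME t. 0 \<le> t \<and> Inl t \<noteq> p \<and> same_component p q (Inl t))"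

text \<open>The complement of a limit point is a single component, the one of the root, hence the
  constant 0.\<close>

definition angle :: "tree_point \<times> tree_point \<Rightarrow> real" where
  "angle = (\<lambda>(p, q)\<in>T \<times> T. case p of
      Inl s \<Rightarrow> if q = p then 0 else code_angle s (code s (rep p q))
    | Inr C \<Rightarrow> 0)"

lemma rep:
  assumes "p \<in> T" "q \<in> T" "q \<noteq> p"
  shows "0 \<le> rep p q" "Inl (rep p q) \<noteq> p" "same_component p q (Inl (rep p q))"
proof -
  have "\<exists>t. 0 \<le> t \<and> Inl t \<noteq> p \<and> same_component p q (Inl t)"
    using component_contains_Inl[OF assms] by metis
  from someI_ex[OF this] show "0 \<le> rep p q" "Inl (rep p q) \<noteq> p" "same_component p q (Inl (rep p q))"
    unfolding rep_def by auto
qed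

lemma angle_near:
  assumes s: "0 \<le> s" and q: "q \<in> T" "q \<noteq> Inl s" and t: "0 \<le> t" "t \<noteq> s"
    and same: "same_component (Inl s) q (Inl t)"
  shows "angle (Inl s, q) = code_angle s (code s t)"
proof -
  have p: "Inl s \<in> T" using s by simp
  note r = rep[OF p q]
  have "same_component (Inl s) (Inl (rep (Inl s) q)) (Inl t)"
    using same_component_trans[OF same_component_sym[OF r(3)] same] .
  then have "code s (rep (Inl s) q) = code s t"
    using same_component_code[OF s r(1) _ t] r(2) by simp
  then show ?thesis unfolding angle_def using p q by simp
qed

lemma angle_Inl:
  assumes "0 \<le> s" "0 \<le> t" "t \<noteq> s"
  shows "angle (Inl s, Inl t) = code_angle s (code s t)"
  by (rule angle_near) (use assms in \<open>simp_all add: same_component_refl\<close>)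

lemma angle_self: "p \<in> T \<Longrightarrow> angle (p, p) = 0"
  unfolding angle_def by (simp split: sum.split)

lemma angle_range:
  assumes "p \<in> T" "q \<in> T" shows "0 \<le> angle (p, q) \<and> angle (p, q) \<le> 1"
  using assms code_angle_range unfolding angle_def by (auto split: sum.split)

lemma same_component_iff_code:
  assumes s: "0 \<le> s" and t: "0 \<le> t" "t \<noteq> s" and t': "0 \<le> t'" "t' \<noteq> s"
  shows "same_component (Inl s) (Inl t) (Inl t') \<longleftrightarrow> code s t = code s t'"
proof
  assume "code s t = code s t'"
  then have "same_component (Inl s) (Inl t') (Inl (code_ref s (code s t)))"
    using same_component_ref[OF t' s] by simp
  then show "same_component (Inl s) (Inl t) (Inl t')"
    using same_component_trans[OF same_component_ref[OF t s] same_component_sym] by blast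
qed (rule same_component_code[OF assms])

lemma angle_function_angle: "angle_function T dT (Inl 0) angle"
  unfolding angle_function_def
proof (intro conjI ballI)
  show "angle \<in> T \<times> T \<rightarrow>\<^sub>E {0..1}"
  proof (rule PiE_I)
    fix pq assume "pq \<in> T \<times> T"
    then show "angle pq \<in> {0..1}" using angle_range[of "fst pq" "snd pq"] by auto
  qed (simp add: angle_def)
  fix p assume p: "p \<in> T"
  show "angle (p, p) = 0" by (rule angle_self[OF p])
  show "angle (p, Inl 0) = 0"
  proof (cases p)
    case (Inl s)
    show ?thesis
    proof (cases "s = 0")
      case False
      then show ?thesis using angle_Inl[of s 0] p Inl by (simp add: code_0 code_angle_def)
    qed (use angle_self[OF p] Inl in simp)
  qed (use p in \<open>simp add: angle_def\<close>)
  fix q r assume q: "q \<in> T - {p}" and r: "r \<in> T - {p}"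
  show "angle (p, q) = angle (p, r) \<longleftrightarrow> same_component p q r"
  proof (cases p)
    case (Inr C)
    then show ?thesis using p q r same_component_limit_point[of C q r] by (simp add: angle_def)
  next
    case (Inl s)
    have s: "0 \<le> s" using p Inl by simp
    have q': "q \<in> T" "q \<noteq> Inl s" and r': "r \<in> T" "r \<noteq> Inl s" and pT: "Inl s \<in> T"
      using q r p Inl by auto
    define t t' where "t = rep (Inl s) q" and "t' = rep (Inl s) r"
    have t: "0 \<le> t" "t \<noteq> s" "same_component (Inl s) q (Inl t)"
      using rep[OF pT q'] unfolding t_def by auto
    have t': "0 \<le> t'" "t' \<noteq> s" "same_component (Inl s) r (Inl t')"
      using rep[OF pT r'] unfolding t'_def by auto
    have "angle (p, q) = code_angle s (code s t)" "angle (p, r) = code_angle s (code s t')"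
      using angle_near[OF s q' t] angle_near[OF s r' t'] Inl by auto
    then have "angle (p, q) = angle (p, r) \<longleftrightarrow> code s t = code s t'"
      using code_angle_inj by auto
    also have "\<dots> \<longleftrightarrow> same_component (Inl s) (Inl t) (Inl t')"
      using same_component_iff_code[OF s t(1,2) t'(1,2)] by simp
    also have "\<dots> \<longleftrightarrow> same_component (Inl s) q r"
    proof
      assume "same_component (Inl s) (Inl t) (Inl t')"
      then show "same_component (Inl s) q r"
        using same_component_trans[OF same_component_trans[OF t(3)] same_component_sym[OF t'(3)]] by blast
    next
      assume "same_component (Inl s) q r"
      then show "same_component (Inl s) (Inl t) (Inl t')"
        using same_component_trans[OF same_component_trans[OF same_component_sym[OF t(3)]] t'(3)] by blast
    qed
    finally show ?thesis using Inl by simp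
  qed
qed

lemma code_next_point:
  assumes s: "0 \<le> s" "s \<notin> y ` {1..}"
  obtains t where "next_point y s = Inl t" "0 \<le> t" "t \<noteq> s" "code s t = Some 0" "code_ref s (Some 0) = t"
proof -
  define t where "t = y (LEAST a. s < y a)"
  have next_eq: "next_point y s = Inl t" "code_ref s (Some 0) = t"
    unfolding next_point_def code_ref_def t_def by auto
  have "0 \<le> t" unfolding t_def by (rule y_nonneg)
  moreover have "s < t \<and> code s t = Some 0"
  proof (rule branch_cases[OF s(1)])
    assume "s = 0"
    have "(LEAST a. s < y a) = Suc 0"
      by (rule next_point_eq) (use \<open>s = 0\<close> y0 y_less_iff[of 0 "Suc 0"] in simp_all)
    then have "t = y (Suc 0)" unfolding t_def by simp
    moreover have "y 0 < y (Suc 0)" by simp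
    ultimately show ?thesis using code_step[of 0 t s] y0 z0 \<open>s = 0\<close> by simp
  next
    fix i assume i: "y i < s" "s \<le> y (Suc i)"
    then have "s < y (Suc i)" using s(2) by (auto simp: less_le)
    moreover from this have "t = y (Suc i)" unfolding t_def using next_point_eq[of i s] i by simp
    ultimately show ?thesis using code_step[of i t s] i by simp
  qed
  ultimately show ?thesis using that[of t] next_eq by auto
qed

lemma angle_conditions: "uniform_angle_conditions \<theta> x y z ux uz angle"
  unfolding uniform_angle_conditions_def
proof (intro conjI ballI allI impI)
  fix i assume i: "i \<in> atoms \<theta>"
  have "x i \<notin> y ` {1..}" using x_neq_y[OF i] by auto
  then obtain t where t: "next_point y (x i) = Inl t" "0 \<le> t" "t \<noteq> x i" "code (x i) t = Some 0"
    using code_next_point[OF x_nonneg[OF i]] by metis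
  then show "angle (Inl (x i), next_point y (x i)) = ux i"
    using angle_Inl[OF x_nonneg[OF i] t(2,3)] own_angle_atom[OF i] by (simp add: code_angle_def)
next
  fix i :: nat assume i: "1 \<le> i"
  have lt: "y i < y (Suc i)" by simp
  have "z i \<noteq> y (Suc i)" using z_range[of i] lt by linarith
  then have "angle (Inl (z i), Inl (y (Suc i))) = code_angle (z i) (code (z i) (y (Suc i)))"
    using angle_Inl[of "z i" "y (Suc i)"] z_range[of i] y_nonneg by simp
  also have "code (z i) (y (Suc i)) = Some i"
    using code_step[of i "y (Suc i)" "z i"] z_range[of i] lt by simp
  finally show "angle (Inl (z i), Inl (y (Suc i))) = uz i" using i by (simp add: code_angle_def)
next
  fix t assume t: "t \<in> {0..} - (x ` atoms \<theta> \<union> y ` {1..})"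
  then obtain t' where t': "next_point y t = Inl t'" "0 \<le> t'" "t' \<noteq> t" "code t t' = Some 0"
    using code_next_point[of t] by auto
  then show "angle (Inl t, next_point y t) = 1/2"
    using angle_Inl[OF _ t'(2,3)] t by (simp add: code_angle_def own_angle_def)
qed

text \<open>Every component of the complement of a point contains the root, where the angle is 0, or
  a reference point \<open>code_ref\<close>, where the angle is prescribed.\<close>

lemma angle_unique:
  assumes u: "angle_function T dT (Inl 0) u" and c: "uniform_angle_conditions \<theta> x y z ux uz u"
  shows "u = angle"
proof (rule extensionalityI)
  show "u \<in> extensional (T \<times> T)" "angle \<in> extensional (T \<times> T)"
    using u angle_function_angle unfolding angle_function_def PiE_def by auto
  have root: "u (p, Inl 0) = 0" and self: "u (p, p) = 0" if "p \<in> T" for p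
    using u that unfolding angle_function_def by auto
  have comp: "u (p, q) = u (p, r)" if "p \<in> T" "q \<in> T - {p}" "r \<in> T - {p}" "same_component p q r" for p q r
    using u that unfolding angle_function_def by blast
  fix pq assume "pq \<in> T \<times> T"
  then obtain p q where pq: "pq = (p, q)" "p \<in> T" "q \<in> T" by auto
  show "u pq = angle pq"
  proof (cases "q = p")
    case True
    then show ?thesis using self angle_self pq by simp
  next
    case False
    show ?thesis
    proof (cases p)
      case (Inr C)
      then have "u (p, q) = u (p, Inl 0)"
        using comp[of p q "Inl 0"] same_component_limit_point[of C q "Inl 0"] pq False by simp
      then show ?thesis using root Inr pq by (simp add: angle_def)
    next
      case (Inl s)
      have s: "0 \<le> s" using pq Inl by simp
      obtain t where t: "0 \<le> t" "t \<noteq> s" "same_component (Inl s) q (Inl t)"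
        using component_contains_Inl[of p q] pq False Inl by auto
      have ref: "same_component (Inl s) (Inl t) (Inl (code_ref s (code s t)))"
        by (rule same_component_ref[OF t(1,2) s])
      have sr: "same_component (Inl s) q (Inl (code_ref s (code s t)))"
        by (rule same_component_trans[OF t(3) ref])
      have "Inl (code_ref s (code s t)) \<in> T - {p}"
        using connected_component_in_topspace[OF sr] Inl by (auto simp: T.topspace_pm_topology)
      then have "u (p, q) = u (p, Inl (code_ref s (code s t)))"
        using comp[of p q] sr pq False Inl by simp
      also have "\<dots> = code_angle s (code s t)"
      proof (cases "code s t")
        case None
        then show ?thesis using root pq by (simp add: code_ref_def code_angle_def)
      next
        case (Some i)
        show ?thesis
        proof (cases "i = 0")
          case False
          then have "z i = s" using code_branch[of t s "i - 1"] t Some by simp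
          then show ?thesis
            using c False Some Inl unfolding uniform_angle_conditions_def
            by (auto simp: code_ref_def code_angle_def)
        next
          case True
          then have sy: "s \<notin> y ` {1..}" using code_own[OF t(1)] Some by simp
          then obtain t' where t': "next_point y s = Inl t'" "code_ref s (Some 0) = t'"
            using code_next_point[OF s] by metis
          have "u (Inl s, next_point y s) = own_angle s"
          proof (rule own_angle_cases[of s])
            fix i assume "i \<in> atoms \<theta>" "x i = s" "own_angle s = ux i"
            then show ?thesis using c unfolding uniform_angle_conditions_def by auto
          next
            assume o: "s \<notin> x ` atoms \<theta>" "own_angle s = 1/2"
            then have "s \<in> {0..} - (x ` atoms \<theta> \<union> y ` {1..})" using sy s by simp
            then show ?thesis using c o(2) unfolding uniform_angle_conditions_def by metis
          qed
          then show ?thesis using t' True Some Inl by (simp add: code_angle_def)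
        qed
      qed
      also have "\<dots> = angle (p, q)"
        using angle_near[OF s _ _ t] pq False Inl by simp
      finally show ?thesis using pq by simp
    qed
  qed
qed

theorem uniform_angle_eq: "uniform_angle \<theta> x y z ux uz = angle"
  unfolding uniform_angle_def
  using angle_function_angle angle_conditions angle_unique by (intro the_equality) blast+

end

section \<open>The looptree for given values of the variables\<close>

lemma torus_dist_facts:
  assumes "0 \<le> a" "a \<le> 1" "0 \<le> b" "b \<le> 1"
  shows "0 \<le> torus_dist a b" "torus_dist a b \<le> 1" "torus_dist a b \<le> \<bar>a - b\<bar>"
  using assms unfolding torus_dist_def by auto

lemma torus_dist_self [simp]: "torus_dist a a = 0"
  unfolding torus_dist_def by simp

lemma torus_dist_commute: "torus_dist a b = torus_dist b a"
  unfolding torus_dist_def by (simp add: abs_minus_commute)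

lemma torus_dist_triangle:
  assumes "0 \<le> a" "a \<le> 1" "0 \<le> b" "b \<le> 1" "0 \<le> c" "c \<le> 1"
  shows "torus_dist a c \<le> torus_dist a b + torus_dist b c"
  using assms unfolding torus_dist_def by (auto simp: min_def abs_if)

lemma ennreal_le_add:
  assumes "a \<le> b + c" "0 \<le> b" "0 \<le> c"
  shows "ennreal a \<le> ennreal b + ennreal c"
  using ennreal_leI[OF assms(1)] assms(2,3) by simp

locale compact_looptree_data = looptree_data +
  assumes \<theta>_nonneg: "\<And>i. 0 \<le> \<theta> i"
    and mass_finite: "\<And>l. emeasure (icrt_mu \<theta> x) {0..l} < \<infinity>"
begin

abbreviation "\<mu> \<equiv> icrt_mu \<theta> x"
abbreviation "DL \<equiv> pre_looptree_dist \<theta> x y z angle"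
abbreviation "PL \<equiv> pre_looptree y z"

lemma PL_iff: "(p, u) \<in> PL \<longleftrightarrow> p \<in> T \<and> 0 \<le> u \<and> u \<le> 1"
  unfolding pre_looptree_def by auto

lemma DL_eq: "DL (p, u) (q, v) = ennreal ((\<theta> 0)\<^sup>2 / 4 * dT p q) +
    (\<Sum>i. ennreal (\<theta> (Suc i) *
        torus_dist (angle3 angle (Inl (x (Suc i))) p u) (angle3 angle (Inl (x (Suc i))) q v)))"
  unfolding pre_looptree_dist_def by simp

lemma \<theta>_pos_atoms: "0 < \<theta> (Suc i) \<longleftrightarrow> Suc i \<in> atoms \<theta>"
  unfolding atoms_def by simp

lemma angle3_range:
  assumes "(p, u) \<in> PL" "i \<in> atoms \<theta>"
  shows "0 \<le> angle3 angle (Inl (x i)) p u \<and> angle3 angle (Inl (x i)) p u \<le> 1"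
  using assms angle_range[of "Inl (x i)" p] x_nonneg[OF assms(2)] unfolding angle3_def PL_iff by auto

lemma DL_commute:
  assumes "P \<in> PL" "Q \<in> PL" shows "DL P Q = DL Q P"
proof -
  obtain p u q v where [simp]: "P = (p, u)" "Q = (q, v)" by (cases P; cases Q)
  have "dT p q = dT q p" by (rule T.commute) (use assms PL_iff in auto)
  then show ?thesis by (simp add: DL_eq torus_dist_commute)
qed

lemma DL_self: "P \<in> PL \<Longrightarrow> DL P P = 0"
  using T.zero by (cases P) (simp add: DL_eq PL_iff)

lemma DL_triangle:
  assumes "P \<in> PL" "Q \<in> PL" "R \<in> PL" shows "DL P R \<le> DL P Q + DL Q R"
proof -
  obtain p u q v r w where [simp]: "P = (p, u)" "Q = (q, v)" "R = (r, w)"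
    by (cases P; cases Q; cases R)
  have T: "p \<in> T" "q \<in> T" "r \<in> T" using assms PL_iff by auto
  define a where "a i = angle3 angle (Inl (x i)) p u" for i
  define b where "b i = angle3 angle (Inl (x i)) q v" for i
  define c where "c i = angle3 angle (Inl (x i)) r w" for i
  have 1: "ennreal (\<theta> (Suc i) * torus_dist (a (Suc i)) (c (Suc i)))
      \<le> ennreal (\<theta> (Suc i) * torus_dist (a (Suc i)) (b (Suc i)))
        + ennreal (\<theta> (Suc i) * torus_dist (b (Suc i)) (c (Suc i)))" for i
  proof (cases "0 < \<theta> (Suc i)")
    case False
    then have "\<theta> (Suc i) = 0" using \<theta>_nonneg[of "Suc i"] by simp
    then show ?thesis by simp
  next
    case True
    then have i: "Suc i \<in> atoms \<theta>" using \<theta>_pos_atoms by simp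
    have range: "0 \<le> a (Suc i)" "a (Suc i) \<le> 1" "0 \<le> b (Suc i)" "b (Suc i) \<le> 1"
      "0 \<le> c (Suc i)" "c (Suc i) \<le> 1"
      unfolding a_def b_def c_def using angle3_range[OF _ i] assms by auto
    have "\<theta> (Suc i) * torus_dist (a (Suc i)) (c (Suc i))
        \<le> \<theta> (Suc i) * (torus_dist (a (Suc i)) (b (Suc i)) + torus_dist (b (Suc i)) (c (Suc i)))"
      by (intro mult_left_mono torus_dist_triangle range \<theta>_nonneg)
    then show ?thesis
      using torus_dist_facts(1)[OF range(1-4)] torus_dist_facts(1)[OF range(3-6)] \<theta>_nonneg[of "Suc i"]
      by (intro ennreal_le_add) (simp_all add: distrib_left)
  qed
  have "(\<theta> 0)\<^sup>2 / 4 * dT p r \<le> (\<theta> 0)\<^sup>2 / 4 * (dT p q + dT q r)"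
    by (intro mult_left_mono T.triangle T) simp
  then have 2: "ennreal ((\<theta> 0)\<^sup>2 / 4 * dT p r)
      \<le> ennreal ((\<theta> 0)\<^sup>2 / 4 * dT p q) + ennreal ((\<theta> 0)\<^sup>2 / 4 * dT q r)"
    using T.nonneg[OF T(1,2)] T.nonneg[OF T(2,3)]
    by (intro ennreal_le_add) (simp_all only: distrib_left, simp_all)
  have "DL P R \<le> (ennreal ((\<theta> 0)\<^sup>2 / 4 * dT p q) + ennreal ((\<theta> 0)\<^sup>2 / 4 * dT q r)) +
      (\<Sum>i. ennreal (\<theta> (Suc i) * torus_dist (a (Suc i)) (b (Suc i)))
        + ennreal (\<theta> (Suc i) * torus_dist (b (Suc i)) (c (Suc i))))"
    unfolding DL_eq \<open>P = (p, u)\<close> \<open>R = (r, w)\<close> a_def[symmetric] c_def[symmetric]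
    by (intro add_mono 2 suminf_le 1 summableI)
  also have "\<dots> = DL P Q + DL Q R"
    unfolding DL_eq \<open>P = (p, u)\<close> \<open>R = (r, w)\<close> \<open>Q = (q, v)\<close>
      a_def[symmetric] b_def[symmetric] c_def[symmetric]
    by (subst suminf_add[symmetric]) (simp_all add: ac_simps)
  finally show ?thesis .
qed

text \<open>Only atoms in I may see the two points under different angles, and each then contributes
  at most its weight, as torus distances are at most 1. The length term is absorbed by the Lebesgue
  part of \<mu>. Keeping I apart from the interval of a and b allows both closed and half-open
  intervals.\<close>

lemma DL_le_mass:
  assumes PQ: "(p, u) \<in> PL" "(q, v) \<in> PL"
    and len: "dT p q \<le> b - a" and I: "I \<in> sets borel" "{a<..b} \<subseteq> I" "0 \<le> a" "a \<le> b"
    and out: "\<And>i. i \<in> atoms \<theta> \<Longrightarrow> x i \<notin> I \<Longrightarrow>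
      angle3 angle (Inl (x i)) p u = angle3 angle (Inl (x i)) q v"
  shows "DL (p, u) (q, v) \<le> emeasure \<mu> I"
proof -
  have "ennreal ((\<theta> 0)\<^sup>2 / 4 * dT p q) \<le> ennreal ((\<theta> 0)\<^sup>2 * (b - a))"
  proof (rule ennreal_leI)
    have "(\<theta> 0)\<^sup>2 / 4 * dT p q \<le> (\<theta> 0)\<^sup>2 * dT p q"
      using T.nonneg[of p q] PQ PL_iff by (intro mult_right_mono) auto
    also have "\<dots> \<le> (\<theta> 0)\<^sup>2 * (b - a)" using len by (intro mult_left_mono) auto
    finally show "(\<theta> 0)\<^sup>2 / 4 * dT p q \<le> (\<theta> 0)\<^sup>2 * (b - a)" .
  qed
  also have "\<dots> = ennreal ((\<theta> 0)\<^sup>2) * emeasure lborel {a<..b}"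
    using I by (simp add: ennreal_mult)
  also have "\<dots> \<le> ennreal ((\<theta> 0)\<^sup>2) * emeasure lborel (I \<inter> {0..})"
    using I by (intro mult_left_mono emeasure_mono) auto
  finally have 1: "ennreal ((\<theta> 0)\<^sup>2 / 4 * dT p q) \<le> ennreal ((\<theta> 0)\<^sup>2) * emeasure lborel (I \<inter> {0..})" .
  have 2: "ennreal (\<theta> (Suc i) *
        torus_dist (angle3 angle (Inl (x (Suc i))) p u) (angle3 angle (Inl (x (Suc i))) q v))
      \<le> ennreal (\<theta> (Suc i)) * indicator I (x (Suc i))" for i
  proof (cases "0 < \<theta> (Suc i)")
    case False
    then have "\<theta> (Suc i) = 0" using \<theta>_nonneg[of "Suc i"] by simp
    then show ?thesis by simp
  next
    case True
    then have i: "Suc i \<in> atoms \<theta>" using \<theta>_pos_atoms by simp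
    show ?thesis
    proof (cases "x (Suc i) \<in> I")
      case False
      then show ?thesis using out[OF i] by simp
    next
      case True
      have "\<theta> (Suc i) * torus_dist (angle3 angle (Inl (x (Suc i))) p u) (angle3 angle (Inl (x (Suc i))) q v)
          \<le> \<theta> (Suc i) * 1"
        using angle3_range[OF PQ(1) i] angle3_range[OF PQ(2) i]
        by (intro mult_left_mono torus_dist_facts \<theta>_nonneg) auto
      then show ?thesis using True by (simp add: ennreal_leI)
    qed
  qed
  show ?thesis
    unfolding DL_eq emeasure_icrt_mu[OF I(1)]
    by (intro add_mono 1 suminf_le 2 summableI)
qed

lemma code_same_branch:
  assumes "0 \<le> r" "y i < s \<or> (i = 0 \<and> s = 0)" "s \<le> t" "t \<le> y (Suc i)" "r \<notin> {s..t}"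
  shows "code r s = code r t"
proof (cases "y i < s")
  case True
  then show ?thesis
    using code_step[of i s r] code_step[of i t r] assms by (auto split: if_splits)
next
  case False
  then have s: "s = 0" using assms by simp
  then have "t \<le> r" using assms by simp
  then show ?thesis using s code_above[of t r] assms by (simp add: code_0)
qed

text \<open>The interval is closed because atoms at s and t themselves are seen under the free
  angles u and v.\<close>

lemma DL_same_branch:
  assumes s: "y i < s \<or> (i = 0 \<and> s = 0)" and st: "s \<le> t" "t \<le> y (Suc i)"
    and u: "0 \<le> u" "u \<le> 1" and v: "0 \<le> v" "v \<le> 1"
  shows "DL (Inl s, u) (Inl t, v) \<le> emeasure \<mu> {s..t}"
proof (rule DL_le_mass[where a = s and b = t])
  have s0: "0 \<le> s" using s y_nonneg[of i] by auto
  show "(Inl s, u) \<in> PL" "(Inl t, v) \<in> PL" using s0 st u v by (simp_all add: PL_iff)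
  show "dT (Inl s) (Inl t) \<le> t - s"
  proof (cases "y i < s")
    case True
    then show ?thesis using pre_dist_same[of i s t] st by simp
  next
    case False
    then have i: "i = 0" "s = 0" using s by auto
    show ?thesis
    proof (cases "t = 0")
      case True
      then show ?thesis using i pre_dist_zero_zero by simp
    next
      case False
      then show ?thesis
        using i pre_dist_step[of 0 0 t] y0 z0 pre_dist_zero_zero st by simp
    qed
  qed
  show "0 \<le> s" by (rule s0)
  fix j assume j: "j \<in> atoms \<theta>" "x j \<notin> {s..t}"
  have "angle (Inl (x j), Inl s) = angle (Inl (x j), Inl t)"
    using angle_Inl[of "x j" s] angle_Inl[of "x j" t] x_nonneg[OF j(1)] s0 st j(2)
      code_same_branch[OF x_nonneg[OF j(1)] s st j(2)] by auto
  moreover have "x j \<noteq> s" "x j \<noteq> t" using j(2) st by auto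
  ultimately show "angle3 angle (Inl (x j)) (Inl s) u = angle3 angle (Inl (x j)) (Inl t) v"
    unfolding angle3_def by simp
qed (use st in auto)

text \<open>The branch \<open>i\<close> is glued at the point \<open>(z i, uz i)\<close> of the loop of \<open>z i\<close>.\<close>

lemma DL_attach:
  assumes i: "1 \<le> i" and t: "y i < t" "t \<le> y (Suc i)" and v: "0 \<le> v" "v \<le> 1"
  shows "DL (Inl (z i), uz i) (Inl t, v) \<le> emeasure \<mu> {y i<..t}"
proof (rule DL_le_mass[where a = "y i" and b = t])
  have t0: "0 \<le> t" using t y_nonneg[of i] by linarith
  have z: "0 \<le> z i" "z i \<le> y i" using z_range[of i] by auto
  show "(Inl (z i), uz i) \<in> PL" "(Inl t, v) \<in> PL"
    using uz_range[OF i] v z t0 by (simp_all add: PL_iff)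
  show "dT (Inl (z i)) (Inl t) \<le> t - y i"
    using pre_dist_step[OF z(2) t] pre_dist_self[OF z(1)] by simp
  show "0 \<le> y i" by (rule y_nonneg)
  fix j assume j: "j \<in> atoms \<theta>" "x j \<notin> {y i<..t}"
  note xj = x_nonneg[OF j(1)]
  have xt: "x j \<noteq> t" using j t by auto
  have at: "angle (Inl (x j), Inl t) = code_angle (x j) (code (x j) t)"
    using angle_Inl[OF xj t0] xt by simp
  show "angle3 angle (Inl (x j)) (Inl (z i)) (uz i) = angle3 angle (Inl (x j)) (Inl t) v"
  proof (cases "x j = z i")
    case True
    have "code (x j) t = Some i" using code_step[OF t, of "x j"] True z by simp
    then show ?thesis using True at xt i unfolding angle3_def by (simp add: code_angle_def)
  next
    case False
    have az: "angle (Inl (x j), Inl (z i)) = code_angle (x j) (code (x j) (z i))"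
      using angle_Inl[OF xj z(1)] False by simp
    have "code (x j) t = code (x j) (z i)"
    proof (cases "x j \<le> y i")
      case True
      then show ?thesis using code_step[OF t, of "x j"] False by simp
    next
      case False
      then have "t < x j" "z i \<le> x j" using j(2) z t by auto
      then show ?thesis using code_above[of t "x j"] code_above[of "z i" "x j"] t0 z by simp
    qed
    then show ?thesis using False at az xt unfolding angle3_def by simp
  qed
qed (use t in auto)

lemma mass_finite': "emeasure \<mu> {a..b} < \<infinity>" "emeasure \<mu> {a<..b} < \<infinity>" "emeasure \<mu> {a..<b} < \<infinity>" if "0 \<le> a"
proof -
  have *: "emeasure \<mu> A < \<infinity>" if "A \<subseteq> {0..b}" for A
    by (rule le_less_trans[OF emeasure_mono[OF that] mass_finite]) simp
  show "emeasure \<mu> {a..b} < \<infinity>" "emeasure \<mu> {a<..b} < \<infinity>" "emeasure \<mu> {a..<b} < \<infinity>"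
    by (rule *, use that in force)+
qed

text \<open>The way to the root uses finitely many sticks, each of finite mass. Limit points escape
  this argument.\<close>

lemma DL_root_finite:
  assumes "0 \<le> t" "0 \<le> v" "v \<le> 1"
  shows "DL (Inl 0, 0) (Inl t, v) < \<infinity>"
  using assms
proof (induction t arbitrary: v rule: interval_induct)
  case (0 t)
  then have "DL (Inl 0, 0) (Inl t, v) \<le> emeasure \<mu> {0..0}"
    using DL_same_branch[of 0 0 0 0 v] y_nonneg by simp
  then show ?case using mass_finite[of 0] by (simp add: le_less_trans)
next
  case (Suc i t)
  show ?case
  proof (cases "i = 0")
    case True
    then have "DL (Inl 0, 0) (Inl t, v) \<le> emeasure \<mu> {0..t}"
      using DL_same_branch[of 0 0 t 0 v] Suc y0 by simp
    then show ?thesis using mass_finite[of t] by (simp add: le_less_trans)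
  next
    case False
    then have i: "1 \<le> i" by simp
    note uz = uz_range[OF i] and z = z_range[of i]
    have t0: "0 \<le> t" using Suc.hyps y_nonneg[of i] by linarith
    have "DL (Inl 0, 0) (Inl t, v) \<le> DL (Inl 0, 0) (Inl (z i), uz i) + DL (Inl (z i), uz i) (Inl t, v)"
      by (rule DL_triangle) (use uz z t0 Suc.prems in \<open>simp_all add: PL_iff\<close>)
    also have "\<dots> \<le> DL (Inl 0, 0) (Inl (z i), uz i) + emeasure \<mu> {y i<..t}"
      by (intro add_left_mono DL_attach i Suc)
    also have "\<dots> < \<infinity>"
      using Suc.IH[of "z i" "uz i"] uz z mass_finite'(2)[OF y_nonneg[of i], of t] by simp
    finally show ?thesis .
  qed
qed

text \<open>
  For points of one branch, closeness of the masses to the left (with and without the point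
  itself) and of the angles implies closeness for the looptree distance; all of these are
  bounded quantities.
\<close>

lemma net_initial:
  assumes e: "0 < e"
  shows "\<exists>K. finite K \<and> K \<subseteq> {0..y n} \<times> {0..1} \<and>
    (\<forall>s\<in>{0..y n}. \<forall>u\<in>{0..1}. \<exists>(t, v)\<in>K. DL (Inl t, v) (Inl s, u) \<le> ennreal e)"
proof -
  define F where "F s = measure \<mu> {0..s}" for s
  define G where "G s = measure \<mu> {0..<s}" for s
  define M where "M = F (y n)"
  \<comment> \<open>Two different points of one branch will cost at most \<open>2 * e'\<close>, two
    angles at one point at most \<open>M * e'\<close>.\<close>
  define e' where "e' = e / (2 + M)"
  have M0: "0 \<le> M" unfolding M_def F_def by simp
  have e': "0 < e'" unfolding e'_def using e M0 by simp
  have fin: "emeasure \<mu> {0..<s} \<noteq> \<infinity>" "emeasure \<mu> {0..s} \<noteq> \<infinity>" "emeasure \<mu> {s} \<noteq> \<infinity>" if "0 \<le> s" for s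
    using mass_finite'(1)[of 0 s] mass_finite'(3)[of 0 s] mass_finite'(1)[of s s] that by auto
  have FG: "measure \<mu> {s..t} = F t - G s" if "0 \<le> s" "s \<le> t" for s t
  proof -
    have "{0..t} = {0..<s} \<union> {s..t}" "{0..<s} \<inter> {s..t} = {}" using that by auto
    moreover have "emeasure \<mu> {s..t} \<noteq> \<infinity>" using mass_finite'(1)[OF that(1), of t] by simp
    ultimately have "F t = G s + measure \<mu> {s..t}"
      unfolding F_def G_def using fin(1)[OF that(1)] measure_Union[of \<mu> "{0..<s}" "{s..t}"] by simp
    then show ?thesis by simp
  qed
  have FG': "F s \<le> G t" if "0 \<le> s" "s < t" for s t
    unfolding F_def G_def
    by (rule measure_mono_fmeasurable) (use that fin(1)[of t] in \<open>auto simp: fmeasurable_def less_top\<close>)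
  have F_le: "F s \<le> M" and G_le: "G s \<le> M" if "0 \<le> s" "s \<le> y n" for s
    unfolding F_def G_def M_def using fin(2)[OF y_nonneg[of n]] that
    by (auto intro!: measure_mono_fmeasurable simp: fmeasurable_def less_top)
  \<comment> \<open>Points with equal keys will be close, and only finitely many keys occur; the net
    takes one point for each key.\<close>
  define \<kappa> where "\<kappa> = (\<lambda>(s, u). (branch s, \<lfloor>F s / e'\<rfloor>, \<lfloor>G s / e'\<rfloor>, \<lfloor>u / e'\<rfloor>))"
  define D where "D = {0..y n} \<times> {0..1::real}"
  have floor_range: "\<lfloor>r / e'\<rfloor> \<in> {0..\<lfloor>R / e'\<rfloor>}" if "0 \<le> r" "r \<le> R" for r R
    using that e' by (auto intro!: floor_mono divide_right_mono)
  have "\<kappa> ` D \<subseteq> {..n} \<times> {0..\<lfloor>M / e'\<rfloor>} \<times> {0..\<lfloor>M / e'\<rfloor>} \<times> {0..\<lfloor>1 / e'\<rfloor>}"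
  proof
    fix k assume "k \<in> \<kappa> ` D"
    then obtain s u where k: "k = \<kappa> (s, u)" "0 \<le> s" "s \<le> y n" "0 \<le> u" "u \<le> 1" unfolding D_def by auto
    have "s \<le> y (Suc n)" using k(3) y_le_iff[of n "Suc n"] by linarith
    then have "branch s \<le> n" by (rule branch_le)
    moreover have "0 \<le> F s" "0 \<le> G s" unfolding F_def G_def by auto
    ultimately show "k \<in> {..n} \<times> {0..\<lfloor>M / e'\<rfloor>} \<times> {0..\<lfloor>M / e'\<rfloor>} \<times> {0..\<lfloor>1 / e'\<rfloor>}"
      using floor_range[of "F s" M] floor_range[of "G s" M] floor_range[of u 1] F_le[of s] G_le[of s] k
      unfolding \<kappa>_def by simp
  qed
  then have fin_k: "finite (\<kappa> ` D)" by (rule finite_subset) auto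
  define K where "K = inv_into D \<kappa> ` (\<kappa> ` D)"
  have "finite K" unfolding K_def using fin_k by simp
  moreover have KD: "K \<subseteq> D" unfolding K_def using inv_into_into[of _ \<kappa> D] by blast
  have close: "\<bar>r - r'\<bar> \<le> e'" if "\<lfloor>r / e'\<rfloor> = \<lfloor>r' / e'\<rfloor>" for r r'
  proof -
    have "\<bar>r / e' - r' / e'\<bar> \<le> 1" using that by linarith
    then have "\<bar>r - r'\<bar> / e' \<le> 1" using e' by (simp add: diff_divide_distrib[symmetric])
    then show ?thesis using e' by (simp add: divide_le_eq)
  qed
  have *: "DL (Inl s, u) (Inl t, v) \<le> ennreal e"
    if st: "s \<le> t" and s: "(s, u) \<in> D" and t: "(t, v) \<in> D" and k: "\<kappa> (s, u) = \<kappa> (t, v)" for s t u v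
  proof (cases "s = t")
    case False
    define i where "i = branch s"
    have i: "branch t = i" using k unfolding \<kappa>_def i_def by simp
    have s0: "0 \<le> s" "s < t" using st s False unfolding D_def by auto
    have "y i < s \<or> (i = 0 \<and> s = 0)"
    proof (cases "s = 0")
      case True
      then have "branch s \<le> 0" using branch_le[of s 0] y_nonneg by simp
      then show ?thesis using True unfolding i_def by simp
    next
      case False
      then show ?thesis using y_branch_less[of s] s0 unfolding i_def by simp
    qed
    then have "DL (Inl s, u) (Inl t, v) \<le> emeasure \<mu> {s..t}"
      using DL_same_branch[of i s t u v] le_y_branch[of t] st s t unfolding i D_def by simp
    also have "\<dots> = ennreal (F t - G s)"
      using FG[of s t] s0 mass_finite'(1)[OF s0(1), of t]
      by (simp add: emeasure_eq_ennreal_measure less_top)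
    also have "F t - G s \<le> e"
    proof -
      have "\<bar>F s - F t\<bar> \<le> e'" "\<bar>G s - G t\<bar> \<le> e'"
        using close k unfolding \<kappa>_def by auto
      \<comment> \<open>This splits \<open>F t - G s\<close> into at most (\<open>F t - F s\<close>)
        + (\<open>G t - G s\<close>), both of which the keys control.\<close>
      moreover have "F s \<le> G t" by (rule FG'[OF s0])
      ultimately have "F t - G s \<le> 2 * e'" by linarith
      also have "\<dots> \<le> (2 + M) * e'" using M0 e' by (intro mult_right_mono) auto
      also have "\<dots> = e" unfolding e'_def using M0 by simp
      finally show ?thesis .
    qed
    finally show ?thesis by (simp add: ennreal_leI)
  next
    case True
    have s0: "0 \<le> s" "s \<le> y n" "0 \<le> u" "u \<le> 1" "0 \<le> v" "v \<le> 1" using s t unfolding D_def by auto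
    have uv: "\<bar>u - v\<bar> \<le> e'" using close k unfolding \<kappa>_def by auto
    \<comment> \<open>At one tree point only an atom at s itself sees the change of angle, and at
      most \<open>e'\<close> times its weight.\<close>
    have 1: "ennreal (\<theta> (Suc i) *
          torus_dist (angle3 angle (Inl (x (Suc i))) (Inl s) u) (angle3 angle (Inl (x (Suc i))) (Inl s) v))
        \<le> ennreal e' * (ennreal (\<theta> (Suc i)) * indicator {0..y n} (x (Suc i)))" for i
    proof (cases "x (Suc i) = s")
      case False
      then show ?thesis by (simp add: angle3_def)
    next
      case True
      have "\<theta> (Suc i) * torus_dist u v \<le> \<theta> (Suc i) * e'"
        by (intro mult_left_mono \<theta>_nonneg order_trans[OF torus_dist_facts(3)] uv s0)
      then show ?thesis
        using True s0 e' \<theta>_nonneg[of "Suc i"]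
        by (simp add: angle3_def ennreal_mult[symmetric] mult.commute ennreal_leI)
    qed
    have "DL (Inl s, u) (Inl s, v) \<le> 0 + (\<Sum>i. ennreal e' * (ennreal (\<theta> (Suc i)) * indicator {0..y n} (x (Suc i))))"
      unfolding DL_eq using pre_dist_self[OF s0(1)]
      by (intro add_mono suminf_le 1 summableI) simp
    also have "\<dots> \<le> ennreal e' * emeasure \<mu> {0..y n}"
      unfolding emeasure_icrt_mu[OF atLeastAtMost_borel] by (simp add: mult_left_mono)
    also have "\<dots> = ennreal (e' * M)"
      unfolding M_def F_def using e' fin(2)[OF y_nonneg[of n]]
      by (simp add: emeasure_eq_ennreal_measure less_top ennreal_mult)
    also have "\<dots> \<le> ennreal e"
    proof (rule ennreal_leI)
      have "e' * M \<le> e' * (2 + M)" using e' by (intro mult_left_mono) auto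
      also have "\<dots> = e" unfolding e'_def using M0 by simp
      finally show "e' * M \<le> e" .
    qed
    finally show ?thesis using True by simp
  qed
  have "\<exists>(t, v)\<in>K. DL (Inl t, v) (Inl s, u) \<le> ennreal e" if su: "s \<in> {0..y n}" "u \<in> {0..1}" for s u
  proof -
    have D: "(s, u) \<in> D" using su unfolding D_def by simp
    obtain t v where tv: "inv_into D \<kappa> (\<kappa> (s, u)) = (t, v)" by (cases "inv_into D \<kappa> (\<kappa> (s, u))")
    have K: "(t, v) \<in> K" unfolding K_def tv[symmetric] using D by blast
    then have tD: "(t, v) \<in> D" using KD by blast
    have k: "\<kappa> (t, v) = \<kappa> (s, u)" unfolding tv[symmetric] by (rule f_inv_into_f) (use D in blast)
    have PL: "(Inl t, v) \<in> PL" "(Inl s, u) \<in> PL" using D tD unfolding D_def PL_iff by auto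
    have "DL (Inl t, v) (Inl s, u) \<le> ennreal e"
    proof (cases "t \<le> s")
      case True
      then show ?thesis by (rule *[OF _ tD D k])
    next
      case False
      then show ?thesis using *[OF _ D tD k[symmetric]] DL_commute[OF PL] by simp
    qed
    then show ?thesis using K by blast
  qed
  ultimately show ?thesis using KD unfolding D_def by blast
qed

text \<open>The line of descent starts with i and ends in the fixed point 0 (as
  \<open>z 0 = 0\<close>), so the range of the iterates is finite.\<close>

definition ancestors :: "nat \<Rightarrow> nat set" where
  "ancestors i = range (\<lambda>k. ((\<lambda>j. branch (z j)) ^^ k) i)"

lemma ancestors_eq: "ancestors i = insert i (ancestors (branch (z i)))"
proof -
  have "ancestors i = (\<lambda>k. ((\<lambda>j. branch (z j)) ^^ k) i) ` insert 0 (range Suc)"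
    unfolding ancestors_def by (simp add: UNIV_nat_eq[symmetric])
  then show ?thesis
    unfolding ancestors_def by (simp add: image_image funpow_Suc_right del: funpow.simps)
qed

lemma ancestors_le: "j \<in> ancestors i \<Longrightarrow> j \<le> i"
proof -
  have "((\<lambda>j. branch (z j)) ^^ k) i \<le> i" for k
  proof (induction k)
    case (Suc k)
    then show ?case using branch_z_le[of "((\<lambda>j. branch (z j)) ^^ k) i"] by simp
  qed simp
  then show "j \<in> ancestors i \<Longrightarrow> j \<le> i" unfolding ancestors_def by auto
qed

lemma finite_ancestors [simp]: "finite (ancestors i)"
  by (rule finite_subset[of _ "{..i}"]) (auto dest: ancestors_le)

definition chain_mass :: "nat \<Rightarrow> nat \<Rightarrow> real" where
  "chain_mass n i = (\<Sum>j\<in>ancestors i \<inter> {n..}. measure \<mu> {y j<..y (Suc j)})"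

text \<open>With n at least 1 the stick 0, its own parent, is kept out of the recursion.\<close>

lemma chain_mass_step:
  assumes "1 \<le> n" "n \<le> i"
  shows "chain_mass n i = measure \<mu> {y i<..y (Suc i)} + chain_mass n (branch (z i))"
proof -
  have "i \<notin> ancestors (branch (z i))"
    using ancestors_le[of i "branch (z i)"] branch_z_less[of i] assms by auto
  moreover have "ancestors i \<inter> {n..} = insert i (ancestors (branch (z i)) \<inter> {n..})"
    using assms ancestors_eq[of i] by auto
  ultimately show ?thesis unfolding chain_mass_def by simp
qed

lemma chain_mass_nonneg: "0 \<le> chain_mass n i"
  unfolding chain_mass_def by (simp add: sum_nonneg)

text \<open>Descend from t along the attachment points until a label in [0, \<open>y n\<close>] is
  reached; every stick crossed has index at least n and costs at most its mass by
  \<open>DL_attach\<close>.\<close>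

lemma DL_chain:
  assumes n: "1 \<le> n" and t: "0 \<le> t" and v: "0 \<le> v" "v \<le> 1"
  shows "\<exists>s u. 0 \<le> s \<and> s \<le> y n \<and> 0 \<le> u \<and> u \<le> 1 \<and>
    DL (Inl s, u) (Inl t, v) \<le> ennreal (chain_mass n (branch t))"
  using t v
proof (induction t arbitrary: v rule: interval_induct)
  case (0 t)
  then have "(Inl t, v) \<in> PL" by (simp add: PL_iff)
  then have "DL (Inl t, v) (Inl t, v) = 0" by (rule DL_self)
  then show ?case using 0 y_nonneg[of n] by (intro exI[of _ t] exI[of _ v]) simp
next
  case (Suc i t)
  have t0: "0 \<le> t" using Suc.hyps y_nonneg[of i] by linarith
  have br: "branch t = i" by (rule branch_eq[OF Suc.hyps(1,2)])
  have tPL: "(Inl t, v) \<in> PL" using t0 Suc.prems by (simp add: PL_iff)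
  show ?case
  proof (cases "i < n")
    case True
    then have "y (Suc i) \<le> y n" by simp
    then have "t \<le> y n" using Suc.hyps by linarith
    then show ?thesis using DL_self[OF tPL] t0 Suc.prems by (intro exI[of _ t] exI[of _ v]) simp
  next
    case False
    then have i: "1 \<le> i" "n \<le> i" using n by auto
    note uz = uz_range[OF i(1)] and z = z_range[of i]
    obtain s u where su: "0 \<le> s" "s \<le> y n" "0 \<le> u" "u \<le> 1"
      "DL (Inl s, u) (Inl (z i), uz i) \<le> ennreal (chain_mass n (branch (z i)))"
      using Suc.IH[of "z i" "uz i"] uz z by auto
    have "emeasure \<mu> {y i<..t} \<le> emeasure \<mu> {y i<..y (Suc i)}"
      using Suc.hyps by (intro emeasure_mono) auto
    also have "\<dots> = ennreal (measure \<mu> {y i<..y (Suc i)})"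
      using mass_finite'(2)[OF y_nonneg[of i], of "y (Suc i)"] by (simp add: emeasure_eq_ennreal_measure less_top)
    finally have m: "emeasure \<mu> {y i<..t} \<le> ennreal (measure \<mu> {y i<..y (Suc i)})" .
    have "DL (Inl s, u) (Inl t, v) \<le> DL (Inl s, u) (Inl (z i), uz i) + DL (Inl (z i), uz i) (Inl t, v)"
      by (rule DL_triangle) (use uz z t0 Suc.prems su in \<open>simp_all add: PL_iff\<close>)
    also have "\<dots> \<le> ennreal (chain_mass n (branch (z i))) + ennreal (measure \<mu> {y i<..y (Suc i)})"
      by (intro add_mono su(5) order_trans[OF DL_attach m] i Suc.hyps Suc.prems)
    also have "\<dots> = ennreal (chain_mass n i)"
      using chain_mass_step[OF n i(2)] chain_mass_nonneg[of n "branch (z i)"] by (simp add: add.commute)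
    finally show ?thesis using su br by auto
  qed
qed

text \<open>Angles seen from a fixed point are locally constant, so Fatou's lemma for sums applies.\<close>

lemma DL_limit_point:
  assumes p: "Inr C \<in> T" and v: "0 \<le> v" "v \<le> 1" and b: "(q, w) \<in> PL" and e: "0 < e"
    and t: "\<And>k. 0 \<le> t k" "\<And>k. dT (Inr C) (Inl (t k)) < inverse (real (Suc k))"
    and inf: "infinite {k. DL (q, w) (Inl (t k), v) \<le> ennreal e}"
  shows "DL (q, w) (Inr C, v) \<le> ennreal (2 * e)"
proof -
  define f where "f P i = ennreal (\<theta> (Suc i) *
        torus_dist (angle3 angle (Inl (x (Suc i))) q w) (angle3 angle (Inl (x (Suc i))) (fst P) (snd P)))" for P i
  have DLf: "DL (q, w) P = ennreal ((\<theta> 0)\<^sup>2 / 4 * dT q (fst P)) + (\<Sum>i. f P i)" for P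
    unfolding f_def by (cases P) (simp add: DL_eq)
  have lim: "\<forall>\<^sub>F k in sequentially. dT (Inr C) (Inl (t k)) < r" if "0 < r" for r
  proof -
    have "\<forall>\<^sub>F k in sequentially. inverse (real (Suc k)) < r"
      using order_tendstoD(2)[OF LIMSEQ_inverse_real_of_nat that] .
    then show ?thesis by eventually_elim (use t(2) in \<open>meson less_trans\<close>)
  qed
  have ev: "\<forall>\<^sub>F k in sequentially. f (Inl (t k), v) i = f (Inr C, v) i" for i
  proof (cases "0 < \<theta> (Suc i)")
    case False
    then have "\<theta> (Suc i) = 0" using \<theta>_nonneg[of "Suc i"] by simp
    then show ?thesis by (simp add: f_def)
  next
    case True
    then have "Suc i \<in> atoms \<theta>" using \<theta>_pos_atoms by simp
    then have x0: "0 \<le> x (Suc i)" by (rule x_nonneg)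
    define \<delta>x where "\<delta>x = dT (Inl (x (Suc i))) (Inr C)"
    have "0 < \<delta>x / 2" unfolding \<delta>x_def using dT_pos[of "Inl (x (Suc i))" "Inr C"] p x0 by simp
    from lim[OF this] show ?thesis
    proof eventually_elim
      case (elim k)
      have c: "dT (Inl (t k)) (Inr C) = dT (Inr C) (Inl (t k))" by (rule T.commute) (use t p in auto)
      have near: "same_component (Inl (x (Suc i))) (Inr C) (Inl (t k))"
        by (rule near_same_component) (use elim c x0 p t(1) \<delta>x_def in simp_all)
      have ne: "t k \<noteq> x (Suc i)"
        using connected_component_in_topspace[OF near] by (auto simp: T.topspace_pm_topology)
      have "angle (Inl (x (Suc i)), Inr C) = angle (Inl (x (Suc i)), Inl (t k))"
        using angle_near[OF x0 p _ t(1) ne near] angle_Inl[OF x0 t(1) ne] by simp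
      then show ?case using ne unfolding f_def angle3_def by simp
    qed
  qed
  show ?thesis
    unfolding DLf
  proof (subst add.commute, rule ennreal_suminf_bound_add)
    fix N
    have "\<forall>\<^sub>F k in sequentially. \<forall>i<N. f (Inl (t k), v) i = f (Inr C, v) i"
      using ev by (simp add: eventually_all_finite flip: Ball_def lessThan_iff) (auto intro!: eventually_ball_finite)
    \<comment> \<open>Moving the tree point by r changes the length term by at most e; the summand 1
      keeps the denominator positive when \<open>\<theta> 0 = 0\<close>.\<close>
    moreover define r where "r = e / (1 + (\<theta> 0)\<^sup>2)"
    have r: "0 < r" unfolding r_def using e by (intro divide_pos_pos) (auto intro: add_pos_nonneg)
    moreover note lim[OF r]
    ultimately have "\<forall>\<^sub>F k in sequentially. (\<forall>i<N. f (Inl (t k), v) i = f (Inr C, v) i) \<and> dT (Inr C) (Inl (t k)) < r"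
      using eventually_conj by blast
    then obtain k0 where k0: "\<And>k. k \<ge> k0 \<Longrightarrow> (\<forall>i<N. f (Inl (t k), v) i = f (Inr C, v) i) \<and> dT (Inr C) (Inl (t k)) < r"
      unfolding eventually_sequentially by blast
    \<comment> \<open>Infinitely many indices satisfy the bound, so one of them lies beyond
      \<open>k0\<close>, where the first N summands agree with those of the limit.\<close>
    obtain k where k: "k \<ge> k0" "DL (q, w) (Inl (t k), v) \<le> ennreal e"
      using inf unfolding infinite_nat_iff_unbounded_le by blast
    have qT: "q \<in> T" using b PL_iff by simp
    have c: "dT (Inl (t k)) (Inr C) = dT (Inr C) (Inl (t k))" by (rule T.commute) (use t p in auto)
    have "dT q (Inr C) \<le> dT q (Inl (t k)) + dT (Inl (t k)) (Inr C)"
      by (rule T.triangle) (use qT t p in auto)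
    also have "\<dots> \<le> dT q (Inl (t k)) + r" using k0[OF k(1)] c by simp
    finally have "(\<theta> 0)\<^sup>2 / 4 * dT q (Inr C) \<le> (\<theta> 0)\<^sup>2 / 4 * (dT q (Inl (t k)) + r)"
      by (intro mult_left_mono) auto
    also have "\<dots> \<le> (\<theta> 0)\<^sup>2 / 4 * dT q (Inl (t k)) + e"
    proof -
      have "(\<theta> 0)\<^sup>2 / 4 * r \<le> (1 + (\<theta> 0)\<^sup>2) * r" using r by (intro mult_right_mono) auto
      also have "\<dots> = e" unfolding r_def using add_pos_nonneg[OF zero_less_one zero_le_power2[of "\<theta> 0"]]
        by (simp add: less_imp_neq[symmetric])
      finally show ?thesis by (simp add: distrib_left)
    qed
    finally have d: "ennreal ((\<theta> 0)\<^sup>2 / 4 * dT q (Inr C)) \<le> ennreal ((\<theta> 0)\<^sup>2 / 4 * dT q (Inl (t k))) + ennreal e"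
      using T.nonneg[of q "Inl (t k)"] qT t(1) e by (intro ennreal_le_add) auto
    have "(\<Sum>i<N. f (Inr C, v) i) = (\<Sum>i<N. f (Inl (t k), v) i)"
      using k0[OF k(1)] by (intro sum.cong) auto
    also have "\<dots> \<le> (\<Sum>i. f (Inl (t k), v) i)" by (rule sum_le_suminf) auto
    finally have "(\<Sum>i<N. f (Inr C, v) i) + ennreal ((\<theta> 0)\<^sup>2 / 4 * dT q (fst (Inr C, v)))
        \<le> (\<Sum>i. f (Inl (t k), v) i) + (ennreal ((\<theta> 0)\<^sup>2 / 4 * dT q (Inl (t k))) + ennreal e)"
      using d by (intro add_mono) auto
    also have "\<dots> = DL (q, w) (Inl (t k), v) + ennreal e" unfolding DLf by (simp add: ac_simps)
    also have "\<dots> \<le> ennreal e + ennreal e" using k(2) by (intro add_right_mono)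
    also have "\<dots> = ennreal (2 * e)" using e by (simp flip: ennreal_plus)
    finally show "(\<Sum>i<N. f (Inr C, v) i) + ennreal ((\<theta> 0)\<^sup>2 / 4 * dT q (fst (Inr C, v))) \<le> ennreal (2 * e)" .
  qed
qed

section \<open>Total boundedness and compactness of the looptree\<close>

context
  assumes small: "\<And>e. 0 < e \<Longrightarrow> \<exists>n\<ge>1. \<forall>i. chain_mass n i \<le> e"
begin

text \<open>For labels, e / 4 is spent on the descent to [0, \<open>y n\<close>] and e / 4 on the
  net there. The other half of e is kept for limit points, where \<open>DL_limit_point\<close>
  doubles the radius.\<close>

lemma net:
  assumes e: "0 < e"
  shows "\<exists>K. finite K \<and> K \<subseteq> {0..} \<times> {0..1} \<and>
    (\<forall>(p, v)\<in>PL. \<exists>(s, u)\<in>K. DL (Inl s, u) (p, v) \<le> ennreal e)"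
proof -
  have e4: "0 < e/4" using e by simp
  obtain n where n: "1 \<le> n" "\<And>i. chain_mass n i \<le> e/4" using small[OF e4] by blast
  obtain K where K: "finite K" "K \<subseteq> {0..y n} \<times> {0..1}"
    "\<forall>s\<in>{0..y n}. \<forall>u\<in>{0..1}. \<exists>(t, v)\<in>K. DL (Inl t, v) (Inl s, u) \<le> ennreal (e/4)"
    using net_initial[OF e4, of n] by auto
  have KPL: "(Inl s, u) \<in> PL" if "(s, u) \<in> K" for s u using K(2) that by (auto simp: PL_iff)
  have real: "\<exists>(s, u)\<in>K. DL (Inl s, u) (Inl t, v) \<le> ennreal (e/2)" if t: "0 \<le> t" "0 \<le> v" "v \<le> 1" for t v
  proof -
    obtain s u where su: "0 \<le> s" "s \<le> y n" "0 \<le> u" "u \<le> 1"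
      "DL (Inl s, u) (Inl t, v) \<le> ennreal (chain_mass n (branch t))"
      using DL_chain[OF n(1) t] by blast
    obtain s' u' where su': "(s', u') \<in> K" "DL (Inl s', u') (Inl s, u) \<le> ennreal (e/4)"
      using K(3)[rule_format, of s u] su by auto
    have "DL (Inl s', u') (Inl t, v) \<le> DL (Inl s', u') (Inl s, u) + DL (Inl s, u) (Inl t, v)"
      by (rule DL_triangle) (use KPL[OF su'(1)] su t in \<open>simp_all add: PL_iff\<close>)
    also have "\<dots> \<le> ennreal (e/4) + ennreal (e/4)"
      by (intro add_mono su'(2) order_trans[OF su(5)] ennreal_leI n(2))
    also have "\<dots> = ennreal (e/2)" using e by (simp flip: ennreal_plus)
    finally show ?thesis using su'(1) by blast
  qed
  have "\<exists>(s, u)\<in>K. DL (Inl s, u) (p, v) \<le> ennreal e" if pv: "(p, v) \<in> PL" for p v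
  proof (cases p)
    case (Inl t)
    have "ennreal (e/2) \<le> ennreal e" using e by (intro ennreal_leI) simp
    moreover obtain s u where "(s, u) \<in> K" "DL (Inl s, u) (p, v) \<le> ennreal (e/2)"
      using real[of t v] pv Inl by (auto simp: PL_iff)
    ultimately show ?thesis using order_trans by blast
  next
    case (Inr C)
    have v: "0 \<le> v" "v \<le> 1" and pT: "Inr C \<in> T" using pv Inr by (simp_all add: PL_iff)
    have "\<exists>t. 0 \<le> t \<and> dT (Inr C) (Inl t) < inverse (real (Suc k))" for k
      using T_dense[OF pT, of "inverse (real (Suc k))"] by (metis inverse_positive_iff_positive of_nat_0_less_iff zero_less_Suc)
    then obtain t where t: "\<And>k. 0 \<le> t k" "\<And>k. dT (Inr C) (Inl (t k)) < inverse (real (Suc k))"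
      by metis
    have "\<exists>b\<in>K. DL (Inl (fst b), snd b) (Inl (t k), v) \<le> ennreal (e/2)" for k
      using real[OF t(1) v, of k] by force
    then obtain b where b: "\<And>k. b k \<in> K" "\<And>k. DL (Inl (fst (b k)), snd (b k)) (Inl (t k), v) \<le> ennreal (e/2)"
      by metis
    \<comment> \<open>The net is finite, so a single net point is close to infinitely many labels of
      the approximating sequence.\<close>
    obtain k0 where "infinite {k. b k = b k0}"
      using pigeonhole_infinite[of UNIV b] K(1) b(1) by (auto intro: finite_subset)
    moreover obtain s u where su: "b k0 = (s, u)" by (cases "b k0")
    moreover have "{k. b k = b k0} \<subseteq> {k. DL (Inl s, u) (Inl (t k), v) \<le> ennreal (e/2)}"
      using b(2) su by (metis (mono_tags, lifting) fst_conv mem_Collect_eq snd_conv subsetI)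
    ultimately have inf: "infinite {k. DL (Inl s, u) (Inl (t k), v) \<le> ennreal (e/2)}"
      using infinite_super by blast
    have suK: "(s, u) \<in> K" using b(1)[of k0] su by simp
    have "DL (Inl s, u) (Inr C, v) \<le> ennreal (2 * (e/2))"
      by (rule DL_limit_point[OF pT v KPL[OF suK] _ t inf]) (use e in simp)
    then show ?thesis using suK Inr by auto
  qed
  then show ?thesis using K(1,2) by (intro exI[of _ K]) auto
qed

text \<open>Every point is within distance 1 of a net point, and net points are labels, at finite
  distance from the root.\<close>

lemma DL_finite:
  assumes "P \<in> PL" "Q \<in> PL" shows "DL P Q < \<infinity>"
proof -
  have root: "(Inl 0, 0) \<in> PL" by (simp add: PL_iff)
  have *: "DL (Inl 0, 0) P < \<infinity>" if P: "P \<in> PL" for P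
  proof -
    obtain K where K: "K \<subseteq> {0..} \<times> {0..1}" "\<forall>(p, v)\<in>PL. \<exists>(s, u)\<in>K. DL (Inl s, u) (p, v) \<le> ennreal 1"
      using net[of 1] by auto
    obtain s u where su: "(s, u) \<in> K" "DL (Inl s, u) P \<le> ennreal 1"
      using bspec[OF K(2) P] by (cases P) auto
    have s: "0 \<le> s" "0 \<le> u" "u \<le> 1" using su K by auto
    have "DL (Inl 0, 0) P \<le> DL (Inl 0, 0) (Inl s, u) + DL (Inl s, u) P"
      by (rule DL_triangle) (use root s P in \<open>simp_all add: PL_iff\<close>)
    also have "\<dots> < \<infinity>" using DL_root_finite[OF s] le_less_trans[OF su(2)] by simp
    finally show ?thesis .
  qed
  have "DL P Q \<le> DL P (Inl 0, 0) + DL (Inl 0, 0) Q" by (rule DL_triangle) (use assms root in auto)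
  also have "\<dots> < \<infinity>" using *[OF assms(1)] *[OF assms(2)] DL_commute[OF assms(1) root] by simp
  finally show ?thesis .
qed

theorem compact_looptree:
  "compact_pseudometric_space (looptree \<theta> x y z angle) (looptree_dist \<theta> x y z angle)"
proof -
  define d where "d P Q = enn2real (DL P Q)" for P Q
  have ennd: "DL P Q = ennreal (d P Q)" if "P \<in> PL" "Q \<in> PL" for P Q
    unfolding d_def using DL_finite[OF that] by simp
  have "pseudometric_on PL d"
    unfolding pseudometric_on_def
  proof (intro conjI ballI)
    fix P Q R assume P: "P \<in> PL" and Q: "Q \<in> PL" and R: "R \<in> PL"
    show "0 \<le> d P Q" unfolding d_def by simp
    show "d P Q = d Q P" unfolding d_def using DL_commute[OF P Q] by simp
    show "d P P = 0" unfolding d_def using DL_self[OF P] by simp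
    have d0: "0 \<le> d P Q" "0 \<le> d Q R" unfolding d_def by simp_all
    have "ennreal (d P R) \<le> ennreal (d P Q + d Q R)"
      using DL_triangle[OF P Q R] unfolding ennd[OF P Q] ennd[OF Q R] ennd[OF P R] ennreal_plus[OF d0] .
    then show "d P R \<le> d P Q + d Q R" using ennreal_le_iff[OF add_nonneg_nonneg[OF d0]] by blast
  qed
  then interpret L: pseudometric_space PL d by (rule pseudometric_space.intro)
  have "compact_pseudometric_space (completion_carrier PL d) (completion_dist d)"
  proof (rule L.compact_completion)
    fix e :: real assume e: "0 < e"
    then obtain K where K: "finite K" "K \<subseteq> {0..} \<times> {0..1}"
      "\<forall>(p, v)\<in>PL. \<exists>(s, u)\<in>K. DL (Inl s, u) (p, v) \<le> ennreal (e/2)"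
      using net[of "e/2"] by auto
    show "\<exists>K. finite K \<and> K \<subseteq> PL \<and> (\<forall>P\<in>PL. \<exists>Q\<in>K. d P Q < e)"
    proof (intro exI[of _ "(\<lambda>(s, u). (Inl s, u)) ` K"] conjI ballI)
      show "finite ((\<lambda>(s, u). (Inl s, u)) ` K)" using K(1) by simp
      show sub: "(\<lambda>(s, u). (Inl s, u)) ` K \<subseteq> PL" using K(2) by (auto simp: PL_iff)
      fix P assume P: "P \<in> PL"
      then obtain s u where su: "(s, u) \<in> K" "DL (Inl s, u) P \<le> ennreal (e/2)"
        using bspec[OF K(3) P] by (cases P) auto
      have "(Inl s, u) \<in> PL" using sub su by force
      then have "d P (Inl s, u) \<le> e/2"
        using ennd[OF \<open>(Inl s, u) \<in> PL\<close> P] su(2) e L.commute[OF P \<open>(Inl s, u) \<in> PL\<close>]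
        by (simp add: ennreal_le_iff)
      then show "\<exists>Q\<in>(\<lambda>(s, u). (Inl s, u)) ` K. d P Q < e" using su(1) e by force
    qed
  qed
  moreover have "d = (\<lambda>P Q. enn2real (DL P Q))" unfolding d_def by (intro ext) simp
  ultimately show ?thesis unfolding looptree_def looptree_dist_def by simp
qed

end

end

section \<open>Conditioning\<close>

context prob_space
begin

lemma space_generated_by [simp]: "space (generated_by M V) = space M"
  unfolding generated_by_def by (rule space_measure_of) auto

lemma generated_by_measurable:
  assumes "f \<in> V" shows "f \<in> borel_measurable (generated_by M V)"
proof (rule measurableI)
  fix A :: "real set" assume "A \<in> sets borel"
  then show "f -` A \<inter> space (generated_by M V) \<in> sets (generated_by M V)"
    unfolding space_generated_by unfolding generated_by_def using assms by (intro in_measure_of) auto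
qed auto

lemma subalgebra_generated_by:
  assumes "\<And>f. f \<in> V \<Longrightarrow> random_variable borel f"
  shows "subalgebra M (generated_by M V)"
  unfolding subalgebra_def space_generated_by
proof
  show "sets (generated_by M V) \<subseteq> sets M"
    unfolding generated_by_def
    by (rule sigma_le_sets[THEN iffD2]) (auto intro!: measurable_sets[OF assms])
qed simp

lemma subalgebra_finite_measure:
  assumes "subalgebra M F" shows "sigma_finite_subalgebra M F"
  by (rule finite_measure_subalgebra_is_sigma_finite)
     (simp add: finite_measure_subalgebra_def finite_measure_subalgebra_axioms_def finite_measure_axioms assms)

text \<open>Turns a conditional probability into an identity of nonnegative integrals over events of
  F, the only form in which the conditional laws are used below.\<close>

lemma emeasure_Int_cond_exp:
  assumes F: "subalgebra M F" and E: "E \<in> sets M" and A: "A \<in> sets F"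
    and g: "AE \<omega> in M. real_cond_exp M F (indicat_real E) \<omega> = g \<omega>"
    and gm: "g \<in> borel_measurable M" and g0: "\<And>\<omega>. 0 \<le> g \<omega>"
  shows "emeasure M (A \<inter> E) = (\<integral>\<^sup>+\<omega>\<in>A. ennreal (g \<omega>) \<partial>M)"
proof -
  interpret F: sigma_finite_subalgebra M F by (rule subalgebra_finite_measure[OF F])
  have AM: "A \<in> sets M" using A F unfolding subalgebra_def by auto
  have int: "integrable M (indicat_real E)" using E by (simp add: integrable_indicator_iff emeasure_eq_measure)
  have "(\<integral>\<omega>. indicat_real (A \<inter> E) \<omega> \<partial>M) = (\<integral>\<omega>\<in>A. indicat_real E \<omega> \<partial>M)"
    unfolding set_lebesgue_integral_def by (intro Bochner_Integration.integral_cong) (auto simp: indicator_def)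
  also have "\<dots> = (\<integral>\<omega>\<in>A. real_cond_exp M F (indicat_real E) \<omega> \<partial>M)"
    by (rule F.real_cond_exp_intA[OF int A])
  also have "\<dots> = (\<integral>\<omega>\<in>A. g \<omega> \<partial>M)"
    unfolding set_lebesgue_integral_def
    by (rule integral_cong_AE) (use g gm AM in auto)
  finally have eq: "prob (A \<inter> E) = (\<integral>\<omega>\<in>A. g \<omega> \<partial>M)"
    using E AM by simp
  have "integrable M (\<lambda>\<omega>. indicator A \<omega> *\<^sub>R g \<omega>)"
  proof (rule integrable_cong_AE_imp)
    show "integrable M (\<lambda>\<omega>. indicator A \<omega> *\<^sub>R real_cond_exp M F (indicat_real E) \<omega>)"
      by (rule integrable_mult_indicator[OF AM]) (rule F.real_cond_exp_int[OF int])
  qed (use g gm AM in auto)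
  then have "(\<integral>\<^sup>+\<omega>. ennreal (indicator A \<omega> *\<^sub>R g \<omega>) \<partial>M) = ennreal (\<integral>\<omega>\<in>A. g \<omega> \<partial>M)"
    unfolding set_lebesgue_integral_def by (rule nn_integral_eq_integral) (use g0 in auto)
  moreover have "ennreal (indicator A \<omega> *\<^sub>R g \<omega>) = ennreal (g \<omega>) * indicator A \<omega>" for \<omega>
    by (simp add: indicator_def)
  ultimately show ?thesis using eq by (simp add: emeasure_eq_measure)
qed

lemma AE_of_emeasure_le:
  assumes A: "A \<in> sets M" and le: "\<And>n::nat. emeasure M A \<le> c * ennreal (1 / 2 ^ n)" and c: "c < \<infinity>"
  shows "AE \<omega> in M. \<omega> \<notin> A"
proof -
  obtain r where r: "c = ennreal r" "0 \<le> r" using c by (cases c) auto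
  have "(\<lambda>n. r * (1 / 2 ^ n)) \<longlonglongrightarrow> r * 0"
    by (intro tendsto_mult tendsto_const) real_asymp
  then have "(\<lambda>n. ennreal (r * (1 / 2 ^ n))) \<longlonglongrightarrow> ennreal 0"
    by (intro tendsto_ennrealI) simp
  then have "emeasure M A \<le> ennreal 0"
  proof (rule LIMSEQ_le_const)
    have "emeasure M A \<le> ennreal (r * (1 / 2 ^ n))" for n
      using le[of n] unfolding r(1) by (subst ennreal_mult) (use r in auto)
    then show "\<exists>N. \<forall>n\<ge>N. emeasure M A \<le> ennreal (r * (1 / 2 ^ n))" by blast
  qed
  then have "A \<in> null_sets M" using A by (auto simp: null_sets_def)
  then show ?thesis by (rule AE_not_in)
qed

lemma AE_eventually_not:
  assumes A: "\<And>k. A k \<in> sets M" and le: "\<And>k. k \<ge> K \<Longrightarrow> prob (A k) \<le> b k" and b: "summable b"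
  shows "AE \<omega> in M. \<forall>\<^sub>F k in sequentially. \<omega> \<notin> A k"
proof -
  have "summable (\<lambda>k. prob (A k))"
    by (rule summable_comparison_test_ev[OF _ b]) (use le in \<open>auto simp: eventually_sequentially\<close>)
  then have "AE \<omega> in M. \<forall>\<^sub>F k in sequentially. \<omega> \<in> space M - A k"
    by (intro borel_cantelli_AE1) (use A in \<open>auto simp: emeasure_eq_measure\<close>)
  then show ?thesis by (auto elim!: eventually_mono)
qed

text \<open>By Fubini the diagonal is null for the product law as soon as one factor has no
  atoms.\<close>

lemma AE_indep_neq:
  assumes ind: "indep_var borel U borel V" and V: "\<And>c. emeasure (distr M borel V) {c :: real} = 0"
  shows "AE \<omega> in M. U \<omega> \<noteq> V \<omega>"
proof -
  have rv [measurable]: "random_variable borel U" "random_variable borel V"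
    using indep_var_rv1[OF ind] indep_var_rv2[OF ind] by auto
  interpret DU: prob_space "distr M borel U" by (rule prob_space_distr) simp
  interpret DV: prob_space "distr M borel V" by (rule prob_space_distr) simp
  interpret P: pair_sigma_finite "distr M borel U" "distr M borel V" ..
  define D where "D = {p \<in> space (borel \<Otimes>\<^sub>M borel). fst p = (snd p :: real)}"
  have D: "D \<in> sets (borel \<Otimes>\<^sub>M borel)" unfolding D_def by measurable
  have "sets (distr M borel U \<Otimes>\<^sub>M distr M borel V) = sets (borel \<Otimes>\<^sub>M borel)"
    by (rule sets_pair_measure_cong) simp_all
  then have D': "D \<in> sets (distr M borel U \<Otimes>\<^sub>M distr M borel V)" using D by simp
  have pre: "{\<omega>\<in>space M. U \<omega> = V \<omega>} = (\<lambda>\<omega>. (U \<omega>, V \<omega>)) -` D \<inter> space M"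
    unfolding D_def by (auto simp: space_pair_measure)
  have "emeasure M {\<omega>\<in>space M. U \<omega> = V \<omega>}
      = emeasure (distr M (borel \<Otimes>\<^sub>M borel) (\<lambda>\<omega>. (U \<omega>, V \<omega>))) D"
    unfolding pre by (rule emeasure_distr[symmetric]) (simp_all add: D)
  also have "\<dots> = emeasure (distr M borel U \<Otimes>\<^sub>M distr M borel V) D"
    using ind unfolding indep_var_distribution_eq by simp
  also have "\<dots> = (\<integral>\<^sup>+a. emeasure (distr M borel V) (Pair a -` D) \<partial>distr M borel U)"
    by (rule DV.emeasure_pair_measure_alt[OF D'])
  also have "\<dots> = (\<integral>\<^sup>+a. emeasure (distr M borel V) {a} \<partial>distr M borel U)"
  proof (rule nn_integral_cong)
    fix a :: real
    have "Pair a -` D = {a}" unfolding D_def by (auto simp: space_pair_measure)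
    then show "emeasure (distr M borel V) (Pair a -` D) = emeasure (distr M borel V) {a}" by simp
  qed
  also have "\<dots> = 0" using V by simp
  finally have "{\<omega>\<in>space M. U \<omega> = V \<omega>} \<in> null_sets M"
    by (intro null_setsI) (auto intro!: borel_measurable_eq)
  then show ?thesis by (rule AE_I') auto
qed

end

section \<open>The random measure\<close>

locale icrt_process = icrt_variables +
  assumes \<theta>_nonneg: "\<And>i. 0 \<le> \<theta> i" and \<theta>_sums: "(\<lambda>i. (\<theta> i)\<^sup>2) sums 1"
begin

abbreviation "\<mu> \<omega> \<equiv> icrt_mu \<theta> (\<lambda>i. X i \<omega>)"

abbreviation "FX \<equiv> generated_by M (X ` atoms \<theta>)"
abbreviation "FXY \<equiv> generated_by M (X ` atoms \<theta> \<union> Y ` {1..})"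

lemma atoms_Suc: "Suc i \<in> atoms \<theta> \<longleftrightarrow> 0 < \<theta> (Suc i)"
  unfolding atoms_def by simp

lemma atoms_pos: "i \<in> atoms \<theta> \<Longrightarrow> 0 < \<theta> i"
  unfolding atoms_def by simp

lemma X_measurable: "i \<in> atoms \<theta> \<Longrightarrow> random_variable borel (X i)"
  using distributed_measurable[OF X_law] by simp

lemma subalgebra_FX: "subalgebra M FX"
  by (rule subalgebra_generated_by) (use X_measurable in auto)

lemma subalgebra_FXY: "subalgebra M FXY"
  by (rule subalgebra_generated_by) (use X_measurable Y_measurable in auto)

lemma sets_FX: "A \<in> sets FX \<Longrightarrow> A \<in> sets M"
  using subalgebra_FX unfolding subalgebra_def by auto

lemma sets_FXY: "A \<in> sets FXY \<Longrightarrow> A \<in> sets M"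
  using subalgebra_FXY unfolding subalgebra_def by auto

text \<open>Set to 0 outside \<open>atoms \<theta>\<close>, where \<open>X\<close> is not known to
  be measurable; the value of \<mu> is not affected, because the weight is 0 there.\<close>

definition atom_mass :: "nat \<Rightarrow> real set \<Rightarrow> 'a \<Rightarrow> ennreal" where
  "atom_mass i A \<omega> = (if Suc i \<in> atoms \<theta> then ennreal (\<theta> (Suc i)) * indicator A (X (Suc i) \<omega>) else 0)"

lemma emeasure_\<mu>:
  assumes "A \<in> sets borel"
  shows "emeasure (\<mu> \<omega>) A = ennreal ((\<theta> 0)\<^sup>2) * emeasure lborel (A \<inter> {0..}) + (\<Sum>i. atom_mass i A \<omega>)"
proof -
  have "ennreal (\<theta> (Suc i)) * indicator A (X (Suc i) \<omega>) = atom_mass i A \<omega>" for i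
    using \<theta>_nonneg[of "Suc i"] unfolding atom_mass_def atoms_Suc by (cases "0 < \<theta> (Suc i)") auto
  then show ?thesis unfolding emeasure_icrt_mu[OF assms] by simp
qed

abbreviation "mass \<omega> t \<equiv> emeasure (\<mu> \<omega>) {0..t}"

lemma mass_eq: "mass \<omega> t = ennreal ((\<theta> 0)\<^sup>2) * ennreal t + (\<Sum>i. atom_mass i {0..t} \<omega>)"
proof -
  have "emeasure lborel ({0..t} \<inter> {0..}) = ennreal t"
    by (cases "0 \<le> t") (auto simp: ennreal_neg)
  then show ?thesis by (simp add: emeasure_\<mu>)
qed

lemma measurable_term [measurable]:
  assumes "\<And>i. i \<in> atoms \<theta> \<Longrightarrow> X i \<in> borel_measurable G" and A: "A \<in> sets borel"
  shows "atom_mass i A \<in> borel_measurable G"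
proof (cases "Suc i \<in> atoms \<theta>")
  case True
  have [measurable]: "X (Suc i) \<in> borel_measurable G" by (rule assms(1)[OF True])
  have "(\<lambda>\<omega>. ennreal (\<theta> (Suc i)) * indicator A (X (Suc i) \<omega>)) \<in> borel_measurable G"
    using A by measurable
  then show ?thesis using True unfolding atom_mass_def[abs_def] by simp
qed (simp add: atom_mass_def[abs_def])

text \<open>Joint measurability in the time allows random times such as \<open>Y j\<close> to be
  inserted and the rate to be integrated over time.\<close>

lemma measurable_mass_pair:
  assumes "\<And>i. i \<in> atoms \<theta> \<Longrightarrow> X i \<in> borel_measurable G"
  shows "(\<lambda>(\<omega>, t). mass \<omega> t) \<in> borel_measurable (G \<Otimes>\<^sub>M borel)"
proof -
  have "(\<lambda>(\<omega>, t). atom_mass i {0..t} \<omega>) \<in> borel_measurable (G \<Otimes>\<^sub>M borel)" for i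
  proof (cases "Suc i \<in> atoms \<theta>")
    case True
    have [measurable]: "X (Suc i) \<in> borel_measurable G" by (rule assms(1)[OF True])
    have "(\<lambda>(\<omega>, t). ennreal (\<theta> (Suc i)) * (if 0 \<le> X (Suc i) \<omega> \<and> X (Suc i) \<omega> \<le> t then 1 else 0))
        \<in> borel_measurable (G \<Otimes>\<^sub>M borel)"
      by measurable
    moreover have "(if 0 \<le> X (Suc i) \<omega> \<and> X (Suc i) \<omega> \<le> t then 1 else 0) = (indicator {0..t} (X (Suc i) \<omega>) :: ennreal)" for \<omega> t
      by (simp add: indicator_def)
    ultimately show ?thesis using True unfolding atom_mass_def by simp
  qed (simp add: atom_mass_def)
  then have "(\<lambda>p. \<Sum>i. atom_mass i {0..snd p} (fst p)) \<in> borel_measurable (G \<Otimes>\<^sub>M borel)"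
    by (intro borel_measurable_suminf_order) (simp add: case_prod_beta')
  then show ?thesis unfolding mass_eq case_prod_beta' by measurable
qed

lemma measurable_mass:
  assumes "\<And>i. i \<in> atoms \<theta> \<Longrightarrow> X i \<in> borel_measurable G" and B: "B \<in> borel_measurable G"
  shows "(\<lambda>\<omega>. mass \<omega> (B \<omega>)) \<in> borel_measurable G"
  using measurable_compose[OF measurable_Pair[OF measurable_ident B] measurable_mass_pair[OF assms(1)]]
  by simp

lemma X_FX: "i \<in> atoms \<theta> \<Longrightarrow> X i \<in> borel_measurable FX"
  by (rule generated_by_measurable) simp

lemma X_FXY: "i \<in> atoms \<theta> \<Longrightarrow> X i \<in> borel_measurable FXY"
  by (rule generated_by_measurable) simp

lemma Y_FXY: "1 \<le> i \<Longrightarrow> Y i \<in> borel_measurable FXY"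
  by (rule generated_by_measurable) simp

section \<open>The law of the atoms and the mean of the mass\<close>

lemma prob_X_Ioc:
  assumes i: "i \<in> atoms \<theta>" and ab: "0 \<le> a" "a \<le> b"
  shows "prob {\<omega>\<in>space M. X i \<omega> \<in> {a<..b}} = exp (- \<theta> i * a) - exp (- \<theta> i * b)"
proof -
  note [measurable] = X_measurable[OF i]
  have "{\<omega>\<in>space M. a < X i \<omega>} = {\<omega>\<in>space M. X i \<omega> \<in> {a<..b}} \<union> {\<omega>\<in>space M. b < X i \<omega>}"
    using ab by auto
  then have "prob {\<omega>\<in>space M. a < X i \<omega>} = prob {\<omega>\<in>space M. X i \<omega> \<in> {a<..b}} + prob {\<omega>\<in>space M. b < X i \<omega>}"
    by (simp add: measure_Union[symmetric] emeasure_eq_measure disjoint_iff)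
  then show ?thesis
    using exponential_distributedD_gt[OF X_law[OF i] ab(1) atoms_pos[OF i]]
      exponential_distributedD_gt[OF X_law[OF i] _ atoms_pos[OF i], of b] ab
    by (simp add: mult.commute)
qed

lemma prob_X_neg: 
  assumes i: "i \<in> atoms \<theta>" shows "prob {\<omega>\<in>space M. X i \<omega> \<le> 0} = 0"
  using exponential_distributedD_le[OF X_law[OF i] order_refl atoms_pos[OF i]] by simp

lemma prob_X_Icc:
  assumes i: "i \<in> atoms \<theta>" and b: "0 \<le> b"
  shows "prob {\<omega>\<in>space M. X i \<omega> \<in> {0..b}} = 1 - exp (- \<theta> i * b)"
proof -
  note [measurable] = X_measurable[OF i]
  have "prob {\<omega>\<in>space M. X i \<omega> \<in> {0..b}} \<le> prob {\<omega>\<in>space M. X i \<omega> \<le> b}"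
    by (intro finite_measure_mono) auto
  also have "\<dots> = 1 - exp (- \<theta> i * b)"
    using exponential_distributedD_le[OF X_law[OF i] b atoms_pos[OF i]] by (simp add: mult.commute)
  finally have 1: "prob {\<omega>\<in>space M. X i \<omega> \<in> {0..b}} \<le> 1 - exp (- \<theta> i * b)" .
  have "prob {\<omega>\<in>space M. X i \<omega> \<in> {0<..b}} \<le> prob {\<omega>\<in>space M. X i \<omega> \<in> {0..b}}"
    by (intro finite_measure_mono) auto
  then show ?thesis using 1 prob_X_Ioc[OF i order_refl b] by simp
qed

text \<open>The mean of \<mu>[0,l], see \<open>nn_integral_mass\<close>. It is concave in l, with
  slope 1 at 0 because the squares sum to 1; this is what lies behind \<open>mean_mass_le\<close>
  and \<open>mean_mass_4\<close>.\<close>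

definition mean_mass :: "real \<Rightarrow> real" where
  "mean_mass l = (\<theta> 0)\<^sup>2 * l + (\<Sum>i. \<theta> (Suc i) * (1 - exp (- \<theta> (Suc i) * l)))"

lemma summable_\<theta>2: "summable (\<lambda>i. (\<theta> (Suc i))\<^sup>2)"
  using summable_Suc_iff[of "\<lambda>i. (\<theta> i)\<^sup>2"] \<theta>_sums by (auto simp: sums_iff)

lemma \<theta>2_sum: "(\<theta> 0)\<^sup>2 + (\<Sum>i. (\<theta> (Suc i))\<^sup>2) = 1"
  using suminf_split_head[of "\<lambda>i. (\<theta> i)\<^sup>2"] \<theta>_sums by (auto simp: sums_iff)

lemma mean_term:
  assumes "0 \<le> l"
  shows "0 \<le> \<theta> i * (1 - exp (- \<theta> i * l))" "\<theta> i * (1 - exp (- \<theta> i * l)) \<le> (\<theta> i)\<^sup>2 * l"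
proof -
  have "1 - exp (- \<theta> i * l) \<le> \<theta> i * l" using exp_ge_add_one_self[of "- \<theta> i * l"] by simp
  then show "\<theta> i * (1 - exp (- \<theta> i * l)) \<le> (\<theta> i)\<^sup>2 * l"
    using mult_left_mono[OF _ \<theta>_nonneg[of i]] by (simp add: power2_eq_square mult.assoc)
  show "0 \<le> \<theta> i * (1 - exp (- \<theta> i * l))" using \<theta>_nonneg[of i] assms by (intro mult_nonneg_nonneg) auto
qed

lemma summable_mean:
  assumes "0 \<le> l"
  shows "summable (\<lambda>i. \<theta> (Suc i) * (1 - exp (- \<theta> (Suc i) * l)))"
  by (rule summable_comparison_test'[OF summable_mult2[OF summable_\<theta>2, of l], of 0])
     (use mean_term[OF assms] in auto)

lemma mean_mass_le: assumes "0 \<le> l" shows "mean_mass l \<le> l"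
proof -
  have "(\<Sum>i. \<theta> (Suc i) * (1 - exp (- \<theta> (Suc i) * l))) \<le> (\<Sum>i. (\<theta> (Suc i))\<^sup>2 * l)"
    by (intro suminf_le summable_mean summable_mult2 summable_\<theta>2 mean_term assms)
  also have "\<dots> = (\<Sum>i. (\<theta> (Suc i))\<^sup>2) * l" by (rule suminf_mult2[symmetric]) (rule summable_\<theta>2)
  finally have "mean_mass l \<le> ((\<theta> 0)\<^sup>2 + (\<Sum>i. (\<theta> (Suc i))\<^sup>2)) * l"
    unfolding mean_mass_def by (simp add: distrib_right)
  then show ?thesis unfolding \<theta>2_sum by simp
qed

lemma mean_mass_mono:
  assumes "0 \<le> l" "l \<le> l'" shows "mean_mass l \<le> mean_mass l'"
  unfolding mean_mass_def
proof (intro add_mono suminf_le summable_mean)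
  fix i show "\<theta> (Suc i) * (1 - exp (- \<theta> (Suc i) * l)) \<le> \<theta> (Suc i) * (1 - exp (- \<theta> (Suc i) * l'))"
    using assms \<theta>_nonneg[of "Suc i"] by (intro mult_left_mono) (auto intro: mult_left_mono)
qed (use assms in \<open>auto intro: mult_left_mono\<close>)

lemma mean_mass_nonneg: "0 \<le> l \<Longrightarrow> 0 \<le> mean_mass l"
  unfolding mean_mass_def by (intro add_nonneg_nonneg suminf_nonneg summable_mean mean_term) auto

lemma mean_mass_pos: assumes "0 < l" shows "0 < mean_mass l"
proof -
  have l: "0 \<le> l" using assms by simp
  have s0: "0 \<le> (\<Sum>i. \<theta> (Suc i) * (1 - exp (- \<theta> (Suc i) * l)))"
    by (intro suminf_nonneg summable_mean mean_term l)
  show ?thesis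
  proof (cases "\<theta> 0 = 0")
    case False
    then show ?thesis unfolding mean_mass_def using s0 assms by (intro add_pos_nonneg mult_pos_pos) auto
  next
    case True
    have "\<exists>i. 0 < \<theta> (Suc i)"
    proof (rule ccontr)
      assume "\<not> ?thesis"
      then have "\<theta> (Suc i) = 0" for i using \<theta>_nonneg[of "Suc i"] by (auto simp: not_less intro: antisym)
      then show False using \<theta>2_sum True by simp
    qed
    then obtain i where "0 < \<theta> (Suc i)" by blast
    then have "0 < \<theta> (Suc i) * (1 - exp (- \<theta> (Suc i) * l))" using assms by simp
    then have "0 < (\<Sum>i. \<theta> (Suc i) * (1 - exp (- \<theta> (Suc i) * l)))"
      by (intro suminf_pos2[OF summable_mean[OF l]] mean_term l)
    then show ?thesis unfolding mean_mass_def using True by simp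
  qed
qed

text \<open>With q = exp (- \<theta> i l), the claim for one atom is 1 - q^4 \<le> 4 (1 - q). The
  factor 4 covers branches that start below 2^(k+1): they end before 4 * 2^k.\<close>

lemma mean_mass_4: assumes "0 \<le> l" shows "mean_mass (4 * l) \<le> 4 * mean_mass l"
proof -
  have *: "1 - exp (- \<theta> i * (4 * l)) \<le> 4 * (1 - exp (- \<theta> i * l))" for i
  proof -
    define q where "q = exp (- \<theta> i * l)"
    have q: "0 \<le> q" "q \<le> 1" unfolding q_def using \<theta>_nonneg[of i] assms by auto
    have "exp (- \<theta> i * (4 * l)) = q ^ 4"
      unfolding q_def exp_of_nat_mult[symmetric] by (simp add: algebra_simps)
    moreover have "1 - q ^ 4 = (1 - q) * (1 + q + q ^ 2 + q ^ 3)" by (simp add: algebra_simps eval_nat_numeral)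
    moreover have "(1 - q) * (1 + q + q ^ 2 + q ^ 3) \<le> (1 - q) * 4"
    proof (rule mult_left_mono)
      have "q ^ 2 \<le> 1" "q ^ 3 \<le> 1" using q by (auto intro: power_le_one)
      then show "1 + q + q\<^sup>2 + q ^ 3 \<le> 4" using q by linarith
    qed (use q in auto)
    ultimately show ?thesis unfolding q_def[symmetric] by simp
  qed
  have "(\<Sum>i. \<theta> (Suc i) * (1 - exp (- \<theta> (Suc i) * (4 * l)))) \<le> (\<Sum>i. 4 * (\<theta> (Suc i) * (1 - exp (- \<theta> (Suc i) * l))))"
  proof (intro suminf_le summable_mult summable_mean)
    fix i show "\<theta> (Suc i) * (1 - exp (- \<theta> (Suc i) * (4 * l))) \<le> 4 * (\<theta> (Suc i) * (1 - exp (- \<theta> (Suc i) * l)))"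
      using mult_left_mono[OF *[of "Suc i"] \<theta>_nonneg[of "Suc i"]] by (simp add: mult.left_commute)
  qed (use assms in auto)
  also have "\<dots> = 4 * (\<Sum>i. \<theta> (Suc i) * (1 - exp (- \<theta> (Suc i) * l)))"
    by (rule suminf_mult[OF summable_mean[OF assms]])
  finally show ?thesis unfolding mean_mass_def by simp
qed

lemma nn_integral_term:
  assumes A: "A \<in> sets borel"
  shows "(\<integral>\<^sup>+\<omega>. atom_mass i A \<omega> \<partial>M)
    = (if Suc i \<in> atoms \<theta> then ennreal (\<theta> (Suc i) * prob {\<omega>\<in>space M. X (Suc i) \<omega> \<in> A}) else 0)"
proof (cases "Suc i \<in> atoms \<theta>")
  case True
  note [measurable] = X_measurable[OF True]
  have S: "{\<omega>\<in>space M. X (Suc i) \<omega> \<in> A} \<in> sets M" using A by measurable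
  have "(\<integral>\<^sup>+\<omega>. atom_mass i A \<omega> \<partial>M) = (\<integral>\<^sup>+\<omega>. ennreal (\<theta> (Suc i)) * indicator {\<omega>\<in>space M. X (Suc i) \<omega> \<in> A} \<omega> \<partial>M)"
    unfolding atom_mass_def using True by (intro nn_integral_cong) (auto simp: indicator_def)
  also have "\<dots> = ennreal (\<theta> (Suc i)) * emeasure M {\<omega>\<in>space M. X (Suc i) \<omega> \<in> A}"
    by (rule nn_integral_cmult_indicator[OF S])
  finally show ?thesis using True \<theta>_nonneg[of "Suc i"] by (simp add: emeasure_eq_measure ennreal_mult)
qed (simp add: atom_mass_def)

lemma measurable_term_M [measurable]: "A \<in> sets borel \<Longrightarrow> atom_mass i A \<in> borel_measurable M"
  by (rule measurable_term[OF X_measurable])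

lemma mass_measurable [measurable]: "(\<lambda>\<omega>. mass \<omega> l) \<in> borel_measurable M"
  by (rule measurable_mass[OF X_measurable]) auto

lemma nn_integral_mass:
  assumes l: "0 \<le> l" shows "(\<integral>\<^sup>+\<omega>. mass \<omega> l \<partial>M) = ennreal (mean_mass l)"
proof -
  have 1: "(\<integral>\<^sup>+\<omega>. mass \<omega> l \<partial>M) = ennreal ((\<theta> 0)\<^sup>2 * l) + (\<Sum>i. \<integral>\<^sup>+\<omega>. atom_mass i {0..l} \<omega> \<partial>M)"
    unfolding mass_eq
    by (subst nn_integral_add) (auto simp: nn_integral_suminf emeasure_space_1 ennreal_mult l)
  have "(\<integral>\<^sup>+\<omega>. atom_mass i {0..l} \<omega> \<partial>M) = ennreal (\<theta> (Suc i) * (1 - exp (- \<theta> (Suc i) * l)))" for i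
    using nn_integral_term[of "{0..l}" i] prob_X_Icc[OF _ l, of "Suc i"] \<theta>_nonneg[of "Suc i"]
    unfolding atoms_Suc by (cases "0 < \<theta> (Suc i)") auto
  then have "(\<Sum>i. \<integral>\<^sup>+\<omega>. atom_mass i {0..l} \<omega> \<partial>M) = (\<Sum>i. ennreal (\<theta> (Suc i) * (1 - exp (- \<theta> (Suc i) * l))))"
    by presburger
  also have "\<dots> = ennreal (\<Sum>i. \<theta> (Suc i) * (1 - exp (- \<theta> (Suc i) * l)))"
    by (rule suminf_ennreal2[OF _ summable_mean[OF l]]) (rule mean_term[OF l])
  finally show ?thesis
    unfolding mean_mass_def 1 using l suminf_nonneg[OF summable_mean[OF l] mean_term(1)[OF l]]
    by simp
qed

lemma mass_mono: "l \<le> l' \<Longrightarrow> mass \<omega> l \<le> mass \<omega> l'"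
  by (intro emeasure_mono) auto

lemma AE_mass_finite: "AE \<omega> in M. \<forall>l. mass \<omega> l < \<infinity>"
proof -
  have "AE \<omega> in M. mass \<omega> (real n) \<noteq> \<infinity>" for n
    by (rule nn_integral_PInf_AE) (simp_all add: nn_integral_mass)
  then have "AE \<omega> in M. \<forall>n. mass \<omega> (real n) \<noteq> \<infinity>" by (simp add: AE_all_countable)
  then show ?thesis
  proof eventually_elim
    case (elim \<omega>)
    show ?case
    proof
      fix l
      obtain n where "l \<le> real n" using real_arch_simple by blast
      then have "mass \<omega> l \<le> mass \<omega> (real n)" by (rule mass_mono)
      also have "\<dots> < \<infinity>" using elim by (simp add: less_top)
      finally show "mass \<omega> l < \<infinity>" .
    qed
  qed
qed

end

text \<open>Serves the lower tail: with p = 1 - exp (- x) it turns exp (- (x - p)) into exp (- x p /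
  2). The difference of the two sides vanishes at 0 and has derivative (1 - (1 + t) exp (- t)) /
  2.\<close>

lemma exp_ineq_lower:
  fixes x :: real
  assumes "0 \<le> x"
  shows "x * (1 - exp (- x)) / 2 \<le> x - (1 - exp (- x))"
proof -
  define f where "f = (\<lambda>x::real. x / 2 - 1 + exp (- x) * (1 + x / 2))"
  have "f 0 \<le> f x"
  proof (rule DERIV_nonneg_imp_nondecreasing[OF assms])
    fix t :: real assume t: "0 \<le> t" "t \<le> x"
    have "DERIV f t :> (1 - (1 + t) * exp (- t)) / 2"
      unfolding f_def by (auto intro!: derivative_eq_intros simp: field_simps)
    moreover have "(1 + t) * exp (- t) \<le> exp t * exp (- t)"
      by (intro mult_right_mono exp_ge_add_one_self) simp
    then have "0 \<le> (1 - (1 + t) * exp (- t)) / 2" by (simp add: exp_minus)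
    ultimately show "\<exists>y. DERIV f t :> y \<and> 0 \<le> y" by blast
  qed
  then show ?thesis unfolding f_def by (simp add: field_simps)
qed

text \<open>Equivalent to x \<le> 2 sinh (x / 2). Serves the upper tail.\<close>

lemma exp_ineq_upper:
  fixes x :: real
  assumes "0 \<le> x"
  shows "x * exp (- x / 2) \<le> 1 - exp (- x)"
proof -
  define f where "f = (\<lambda>x::real. exp (x / 2) - exp (- x / 2) - x)"
  have "f 0 \<le> f x"
  proof (rule DERIV_nonneg_imp_nondecreasing[OF assms])
    fix t :: real
    have "DERIV f t :> (exp (t / 2) + exp (- t / 2)) / 2 - 1"
      unfolding f_def by (auto intro!: derivative_eq_intros simp: field_simps)
    moreover have "0 \<le> (exp (t / 2) + exp (- t / 2)) / 2 - 1"
      using add_mono[OF exp_ge_add_one_self[of "t / 2"] exp_ge_add_one_self[of "- t / 2"]] by simp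
    ultimately show "\<exists>y. DERIV f t :> y \<and> 0 \<le> y" by blast
  qed
  then have "x \<le> exp (x / 2) - exp (- x / 2)" unfolding f_def by simp
  then have "x * exp (- x / 2) \<le> (exp (x / 2) - exp (- x / 2)) * exp (- x / 2)"
    by (intro mult_right_mono) auto
  also have "\<dots> = 1 - exp (- x)" by (simp add: left_diff_distrib mult_exp_exp)
  finally show ?thesis .
qed

section \<open>Exponential moments and tails of the random measure\<close>

context icrt_process
begin

text \<open>The indicators are independent Bernoulli variables. The sign of \<open>s i\<close> is
  left open: the upper tail takes positive weights, the lower tail negative ones.\<close>

lemma exp_moment:
  assumes J: "finite J" "J \<subseteq> atoms \<theta>" and A: "A \<in> sets borel"
  shows "(\<integral>\<^sup>+\<omega>. ennreal (exp (\<Sum>i\<in>J. s i * indicator A (X i \<omega>))) \<partial>M)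
    = ennreal (\<Prod>i\<in>J. 1 + prob {\<omega>\<in>space M. X i \<omega> \<in> A} * (exp (s i) - 1))"
proof -
  have single: "(\<integral>\<^sup>+\<omega>. ennreal (exp (s i * indicator A (X i \<omega>))) \<partial>M)
      = ennreal (1 + prob {\<omega>\<in>space M. X i \<omega> \<in> A} * (exp (s i) - 1))" if "i \<in> J" for i
  proof -
    have [measurable]: "random_variable borel (X i)" using X_measurable that J by auto
    define E where "E = {\<omega>\<in>space M. X i \<omega> \<in> A}"
    have E: "E \<in> sets M" unfolding E_def using A by measurable
    have "(\<integral>\<^sup>+\<omega>. ennreal (exp (s i * indicator A (X i \<omega>))) \<partial>M)
        = (\<integral>\<^sup>+\<omega>. ennreal (exp (s i)) * indicator E \<omega> + 1 * indicator (space M - E) \<omega> \<partial>M)"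
      unfolding E_def by (intro nn_integral_cong) (auto simp: indicator_def)
    also have "\<dots> = ennreal (exp (s i)) * emeasure M E + emeasure M (space M - E)"
      using E by (subst nn_integral_add) (auto simp: nn_integral_cmult_indicator)
    also have "\<dots> = ennreal (exp (s i) * prob E) + ennreal (1 - prob E)"
      using E by (simp add: emeasure_eq_measure prob_compl ennreal_mult)
    also have "\<dots> = ennreal (exp (s i) * prob E + (1 - prob E))"
      by (rule ennreal_plus[symmetric]) auto
    finally show ?thesis unfolding E_def by (simp add: algebra_simps)
  qed
  have "indep_vars (\<lambda>_. borel) (\<lambda>i \<omega>. ennreal (exp (s i * indicator A (X i \<omega>)))) J"
    by (rule indep_vars_compose2[OF indep_vars_subset[OF X_indep J(2)]]) (use A in measurable)
  then have "(\<integral>\<^sup>+\<omega>. (\<Prod>i\<in>J. ennreal (exp (s i * indicator A (X i \<omega>)))) \<partial>M)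
      = (\<Prod>i\<in>J. \<integral>\<^sup>+\<omega>. ennreal (exp (s i * indicator A (X i \<omega>))) \<partial>M)"
    by (intro indep_vars_nn_integral J(1)) auto
  also have "\<dots> = (\<Prod>i\<in>J. ennreal (1 + prob {\<omega>\<in>space M. X i \<omega> \<in> A} * (exp (s i) - 1)))"
    by (rule prod.cong[OF refl single])
  also have "\<dots> = ennreal (\<Prod>i\<in>J. 1 + prob {\<omega>\<in>space M. X i \<omega> \<in> A} * (exp (s i) - 1))"
  proof (rule prod_ennreal)
    fix i
    have "- 1 \<le> prob {\<omega>\<in>space M. X i \<omega> \<in> A} * (exp (s i) - 1)"
    proof (cases "0 \<le> s i")
      case True
      then have "0 \<le> prob {\<omega>\<in>space M. X i \<omega> \<in> A} * (exp (s i) - 1)" by simp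
      then show ?thesis by linarith
    next
      case False
      have "prob {\<omega>\<in>space M. X i \<omega> \<in> A} * (1 - exp (s i)) \<le> 1 * 1"
        using False by (intro mult_mono) auto
      then show ?thesis by (simp add: algebra_simps)
    qed
    then show "0 \<le> 1 + prob {\<omega>\<in>space M. X i \<omega> \<in> A} * (exp (s i) - 1)" by linarith
  qed
  also have "(\<integral>\<^sup>+\<omega>. (\<Prod>i\<in>J. ennreal (exp (s i * indicator A (X i \<omega>)))) \<partial>M)
      = (\<integral>\<^sup>+\<omega>. ennreal (exp (\<Sum>i\<in>J. s i * indicator A (X i \<omega>))) \<partial>M)"
    by (simp add: prod_ennreal exp_sum[OF J(1)])
  finally show ?thesis .
qed

lemma chernoff:
  assumes J: "finite J" "J \<subseteq> atoms \<theta>" and A: "A \<in> sets borel"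
    and E: "E \<in> sets M" "\<And>\<omega>. \<omega> \<in> E \<Longrightarrow> t \<le> (\<Sum>i\<in>J. s i * indicator A (X i \<omega>))"
    and b: "\<And>i. i \<in> J \<Longrightarrow> 1 + prob {\<omega>\<in>space M. X i \<omega> \<in> A} * (exp (s i) - 1) \<le> exp (b i)"
      "\<And>i. i \<in> J \<Longrightarrow> 0 \<le> 1 + prob {\<omega>\<in>space M. X i \<omega> \<in> A} * (exp (s i) - 1)"
  shows "prob E \<le> exp ((\<Sum>i\<in>J. b i) - t)"
proof -
  have [measurable]: "i \<in> J \<Longrightarrow> random_variable borel (X i)" for i using X_measurable J by auto
  have m: "(\<lambda>\<omega>. ennreal (exp (\<Sum>i\<in>J. s i * indicator A (X i \<omega>)))) \<in> borel_measurable M"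
    using A by measurable
  have "emeasure M E = (\<integral>\<^sup>+\<omega>. indicator E \<omega> \<partial>M)" using E by simp
  also have "\<dots> \<le> (\<integral>\<^sup>+\<omega>. ennreal (exp (- t)) * ennreal (exp (\<Sum>i\<in>J. s i * indicator A (X i \<omega>))) \<partial>M)"
  proof (rule nn_integral_mono)
    fix \<omega>
    show "indicator E \<omega> \<le> ennreal (exp (- t)) * ennreal (exp (\<Sum>i\<in>J. s i * indicator A (X i \<omega>)))"
    proof (cases "\<omega> \<in> E")
      case True
      then have "1 \<le> exp (- t + (\<Sum>i\<in>J. s i * indicator A (X i \<omega>)))" using E(2)[OF True] by simp
      then show ?thesis using True by (simp add: ennreal_mult[symmetric] mult_exp_exp)
    qed simp
  qed
  also have "\<dots> = ennreal (exp (- t)) * ennreal (\<Prod>i\<in>J. 1 + prob {\<omega>\<in>space M. X i \<omega> \<in> A} * (exp (s i) - 1))"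
    using m by (simp add: nn_integral_cmult exp_moment[OF J A])
  also have "\<dots> \<le> ennreal (exp (- t)) * ennreal (\<Prod>i\<in>J. exp (b i))"
    by (intro mult_left_mono ennreal_leI prod_mono) (use b in auto)
  also have "\<dots> = ennreal (exp ((\<Sum>i\<in>J. b i) - t))"
    by (simp add: ennreal_mult[symmetric] exp_sum[OF J(1), symmetric] mult_exp_exp)
  finally show ?thesis by (simp add: emeasure_eq_measure)
qed

text \<open>Chernoff bounds are proved for finitely many atoms and then passed to the limit in
  N.\<close>

definition first_atoms :: "nat \<Rightarrow> nat set" where
  "first_atoms N = Suc ` {i. i < N \<and> Suc i \<in> atoms \<theta>}"

lemma first_atoms: "finite (first_atoms N)" "first_atoms N \<subseteq> atoms \<theta>"
  unfolding first_atoms_def by auto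

lemma sum_first_atoms:
  assumes "\<And>i. \<theta> i = 0 \<Longrightarrow> f i = 0"
  shows "(\<Sum>i\<in>first_atoms N. f i) = (\<Sum>i<N. (f (Suc i) :: real))"
proof -
  have "(\<Sum>i\<in>first_atoms N. f i) = (\<Sum>i\<in>{i. i < N \<and> Suc i \<in> atoms \<theta>}. f (Suc i))"
    unfolding first_atoms_def by (rule sum.reindex_cong[of Suc]) auto
  also have "\<dots> = (\<Sum>i<N. f (Suc i))"
  proof (rule sum.mono_neutral_left)
    show "\<forall>i\<in>{..<N} - {i. i < N \<and> Suc i \<in> atoms \<theta>}. f (Suc i) = 0"
    proof
      fix i assume "i \<in> {..<N} - {i. i < N \<and> Suc i \<in> atoms \<theta>}"
      then have "\<theta> (Suc i) = 0" using \<theta>_nonneg[of "Suc i"] by (simp add: atoms_Suc)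
      then show "f (Suc i) = 0" by (rule assms)
    qed
  qed auto
  finally show ?thesis .
qed

lemma sum_atom_mass:
  "(\<Sum>i<N. atom_mass i A \<omega>) = ennreal (\<Sum>i\<in>first_atoms N. \<theta> i * indicator A (X i \<omega>))"
proof -
  have "atom_mass i A \<omega> = ennreal (\<theta> (Suc i) * indicator A (X (Suc i) \<omega>))" for i
    using \<theta>_nonneg[of "Suc i"] unfolding atom_mass_def atoms_Suc by (auto simp: indicator_def)
  then have "(\<Sum>i<N. atom_mass i A \<omega>) = (\<Sum>i<N. ennreal (\<theta> (Suc i) * indicator A (X (Suc i) \<omega>)))"
    by simp
  also have "\<dots> = ennreal (\<Sum>i<N. \<theta> (Suc i) * indicator A (X (Suc i) \<omega>))"
    by (rule sum_ennreal) (use \<theta>_nonneg in auto)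
  also have "(\<Sum>i<N. \<theta> (Suc i) * indicator A (X (Suc i) \<omega>)) = (\<Sum>i\<in>first_atoms N. \<theta> i * indicator A (X i \<omega>))"
    by (rule sum_first_atoms[symmetric]) simp
  finally show ?thesis .
qed

lemma measurable_\<mu>:
  assumes A: "A \<in> sets borel" shows "(\<lambda>\<omega>. emeasure (\<mu> \<omega>) A) \<in> borel_measurable M"
proof -
  have [measurable]: "atom_mass i A \<in> borel_measurable M" for i by (rule measurable_term_M[OF A])
  show ?thesis unfolding emeasure_\<mu>[OF A] by measurable
qed

lemma sets_less_\<mu>:
  assumes A: "A \<in> sets borel"
  shows "{\<omega>\<in>space M. e < emeasure (\<mu> \<omega>) A} \<in> sets M" "{\<omega>\<in>space M. emeasure (\<mu> \<omega>) A \<le> e} \<in> sets M"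
proof -
  note [measurable] = measurable_\<mu>[OF A]
  show "{\<omega>\<in>space M. e < emeasure (\<mu> \<omega>) A} \<in> sets M" "{\<omega>\<in>space M. emeasure (\<mu> \<omega>) A \<le> e} \<in> sets M"
    by measurable
qed

text \<open>Exponential Markov inequality with parameter \<open>l/2\<close>: the weights \<open>exp (- \<theta> i * l)\<close> absorb the exponential moments of large atoms.\<close>

lemma prob_mass_Ioc:
  assumes l: "0 < l" "l \<le> c" and h: "0 \<le> h" and e: "0 \<le> e"
  shows "prob {\<omega>\<in>space M. ennreal e < emeasure (\<mu> \<omega>) {c<..c + h}} \<le> exp (h * mean_mass l / 2 - l * e / 2)"
proof -
  define A where "A = {c<..c + h}"
  have A: "A \<in> sets borel" unfolding A_def by simp
  define P where "P i = prob {\<omega>\<in>space M. X i \<omega> \<in> A}" for i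
  define S where "S N \<omega> = (\<theta> 0)\<^sup>2 * h + (\<Sum>i\<in>first_atoms N. \<theta> i * indicator A (X i \<omega>))" for N \<omega>
  have P: "0 \<le> P i * (exp (l / 2 * \<theta> i) - 1)"
      "P i * (exp (l / 2 * \<theta> i) - 1) \<le> h / 2 * (\<theta> i * (1 - exp (- \<theta> i * l)))" if i: "i \<in> atoms \<theta>" for i
  proof -
    note \<theta>i = atoms_pos[OF i]
    have "P i = exp (- \<theta> i * c) * (1 - exp (- \<theta> i * h))"
      unfolding P_def A_def using prob_X_Ioc[OF i, of c "c + h"] l h
      by (simp add: algebra_simps mult_exp_exp)
    also have "\<dots> \<le> exp (- \<theta> i * l) * (\<theta> i * h)"
    proof (rule mult_mono)
      show "exp (- \<theta> i * c) \<le> exp (- \<theta> i * l)" using \<theta>i l by simp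
      show "1 - exp (- \<theta> i * h) \<le> \<theta> i * h" using exp_ge_add_one_self[of "- \<theta> i * h"] by simp
    qed (use \<theta>i h in auto)
    finally have Pi: "P i \<le> exp (- \<theta> i * l) * (\<theta> i * h)" .
    define a where "a = l / 2 * \<theta> i"
    have a: "0 \<le> a" unfolding a_def using l \<theta>i by simp
    have "1 - a \<le> exp (- a)" using exp_ge_add_one_self[of "- a"] by simp
    then have "(1 - a) * exp a \<le> exp (- a) * exp a" by (intro mult_right_mono) auto
    then have ea: "exp a - 1 \<le> a * exp a" by (simp add: algebra_simps mult_exp_exp)
    have "P i * (exp a - 1) \<le> exp (- \<theta> i * l) * (\<theta> i * h) * (a * exp a)"
      by (rule mult_mono[OF Pi ea]) (use a \<theta>i h in auto)
    also have "\<dots> = h / 2 * (\<theta> i * ((\<theta> i * l) * (exp (- \<theta> i * l) * exp a)))"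
      unfolding a_def by (simp add: ac_simps)
    \<comment> \<open>Half of the decay from being an atom beyond l pays for the exponential moment;
      \<open>exp_ineq_upper\<close> turns the other half into a summand of the mean mass.\<close>
    also have "exp (- \<theta> i * l) * exp a = exp (- (\<theta> i * l) / 2)"
      unfolding a_def mult_exp_exp by (rule arg_cong[of _ _ exp]) (simp add: field_simps)
    also have "h / 2 * (\<theta> i * ((\<theta> i * l) * exp (- (\<theta> i * l) / 2))) \<le> h / 2 * (\<theta> i * (1 - exp (- (\<theta> i * l))))"
      using exp_ineq_upper[of "\<theta> i * l"] \<theta>i l h by (intro mult_left_mono) auto
    finally show "P i * (exp (l / 2 * \<theta> i) - 1) \<le> h / 2 * (\<theta> i * (1 - exp (- \<theta> i * l)))"
      unfolding a_def by simp
    show "0 \<le> P i * (exp (l / 2 * \<theta> i) - 1)"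
      unfolding P_def using a unfolding a_def by (intro mult_nonneg_nonneg) auto
  qed
  have SE: "{\<omega>\<in>space M. e < S N \<omega>} \<in> sets M" for N
  proof -
    have [measurable]: "random_variable borel (X i)" if "i \<in> first_atoms N" for i
      using X_measurable first_atoms that by auto
    have "(\<lambda>\<omega>. S N \<omega>) \<in> borel_measurable M" unfolding S_def using A by measurable
    then show ?thesis by measurable
  qed
  have bound: "prob {\<omega>\<in>space M. e < S N \<omega>} \<le> exp (h * mean_mass l / 2 - l * e / 2)" for N
  proof -
    have "prob {\<omega>\<in>space M. e < S N \<omega>}
        \<le> exp ((\<Sum>i\<in>first_atoms N. h / 2 * (\<theta> i * (1 - exp (- \<theta> i * l)))) - (l / 2 * (e - (\<theta> 0)\<^sup>2 * h)))"
    proof (rule chernoff[OF first_atoms A SE, where s = "\<lambda>i. l / 2 * \<theta> i"])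
      fix \<omega> assume "\<omega> \<in> {\<omega>\<in>space M. e < S N \<omega>}"
      then have "e - (\<theta> 0)\<^sup>2 * h \<le> (\<Sum>i\<in>first_atoms N. \<theta> i * indicator A (X i \<omega>))" unfolding S_def by simp
      then have "l / 2 * (e - (\<theta> 0)\<^sup>2 * h) \<le> l / 2 * (\<Sum>i\<in>first_atoms N. \<theta> i * indicator A (X i \<omega>))"
        using l by (intro mult_left_mono) auto
      then show "l / 2 * (e - (\<theta> 0)\<^sup>2 * h) \<le> (\<Sum>i\<in>first_atoms N. l / 2 * \<theta> i * indicator A (X i \<omega>))"
        by (simp add: sum_distrib_left mult.assoc)
    next
      fix i assume "i \<in> first_atoms N"
      then have i: "i \<in> atoms \<theta>" using first_atoms by auto
      have "1 + P i * (exp (l / 2 * \<theta> i) - 1) \<le> exp (P i * (exp (l / 2 * \<theta> i) - 1))"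
        by (rule exp_ge_add_one_self)
      also have "\<dots> \<le> exp (h / 2 * (\<theta> i * (1 - exp (- \<theta> i * l))))" using P(2)[OF i] by simp
      finally show "1 + prob {\<omega>\<in>space M. X i \<omega> \<in> A} * (exp (l / 2 * \<theta> i) - 1)
          \<le> exp (h / 2 * (\<theta> i * (1 - exp (- \<theta> i * l))))" unfolding P_def .
      show "0 \<le> 1 + prob {\<omega>\<in>space M. X i \<omega> \<in> A} * (exp (l / 2 * \<theta> i) - 1)"
        using P(1)[OF i] unfolding P_def by simp
    qed
    also have "(\<Sum>i\<in>first_atoms N. h / 2 * (\<theta> i * (1 - exp (- \<theta> i * l))))
        = h / 2 * (\<Sum>i<N. \<theta> (Suc i) * (1 - exp (- \<theta> (Suc i) * l)))"
      unfolding sum_distrib_left[symmetric] by (subst sum_first_atoms) auto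
    also have "exp (h / 2 * (\<Sum>i<N. \<theta> (Suc i) * (1 - exp (- \<theta> (Suc i) * l))) - (l / 2 * (e - (\<theta> 0)\<^sup>2 * h)))
        \<le> exp (h / 2 * (mean_mass l - (\<theta> 0)\<^sup>2 * l) - (l / 2 * (e - (\<theta> 0)\<^sup>2 * h)))"
    proof -
      have "(\<Sum>i<N. \<theta> (Suc i) * (1 - exp (- \<theta> (Suc i) * l))) \<le> mean_mass l - (\<theta> 0)\<^sup>2 * l"
        unfolding mean_mass_def using sum_le_suminf[OF summable_mean, of l "{..<N}"] mean_term l by simp
      then show ?thesis using h by (simp add: mult_left_mono)
    qed
    also have "h / 2 * (mean_mass l - (\<theta> 0)\<^sup>2 * l) - (l / 2 * (e - (\<theta> 0)\<^sup>2 * h)) = h * mean_mass l / 2 - l * e / 2"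
      by (simp add: field_simps)
    finally show ?thesis .
  qed
  \<comment> \<open>The mass is the increasing limit of its truncations, so continuity from below
    carries the bound over to all atoms.\<close>
  have partial: "emeasure (\<mu> \<omega>) A = (SUP N. ennreal (S N \<omega>))" for \<omega>
  proof -
    have "A \<inter> {0..} = {c<..c + h}" unfolding A_def using l by auto
    then have "emeasure (\<mu> \<omega>) A = ennreal ((\<theta> 0)\<^sup>2 * h) + (SUP N. \<Sum>i<N. atom_mass i A \<omega>)"
      using h by (simp add: emeasure_\<mu>[OF A] suminf_eq_SUP ennreal_mult)
    also have "\<dots> = (SUP N. ennreal ((\<theta> 0)\<^sup>2 * h) + (\<Sum>i<N. atom_mass i A \<omega>))"
      by (rule ennreal_SUP_add_right) simp
    also have "\<dots> = (SUP N. ennreal (S N \<omega>))"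
      unfolding S_def sum_atom_mass using h \<theta>_nonneg
      by (intro SUP_cong refl ennreal_plus[symmetric]) (auto intro!: sum_nonneg)
    finally show ?thesis .
  qed
  have "{\<omega>\<in>space M. ennreal e < emeasure (\<mu> \<omega>) A} = (\<Union>N. {\<omega>\<in>space M. e < S N \<omega>})"
    unfolding partial less_SUP_iff using e by (auto simp: ennreal_less_iff)
  moreover have "incseq (\<lambda>N. {\<omega>\<in>space M. e < S N \<omega>})"
  proof (rule incseq_SucI)
    fix N
    have "S N \<omega> \<le> S (Suc N) \<omega>" for \<omega>
      unfolding S_def using \<theta>_nonneg first_atoms
      by (intro add_left_mono sum_mono2) (auto simp: first_atoms_def)
    then show "{\<omega>\<in>space M. e < S N \<omega>} \<subseteq> {\<omega>\<in>space M. e < S (Suc N) \<omega>}" using less_le_trans by blast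
  qed
  then have "(\<lambda>N. prob {\<omega>\<in>space M. e < S N \<omega>}) \<longlonglongrightarrow> prob (\<Union>N. {\<omega>\<in>space M. e < S N \<omega>})"
    using SE by (intro finite_Lim_measure_incseq) auto
  then have "prob (\<Union>N. {\<omega>\<in>space M. e < S N \<omega>}) \<le> exp (h * mean_mass l / 2 - l * e / 2)"
    by (rule LIMSEQ_le_const2) (use bound in auto)
  ultimately show ?thesis unfolding A_def by simp
qed

text \<open>Exponential Markov inequality with parameter - l. For this parameter 1 - exp (- l
  \<theta> i) is exactly the probability p of an atom in [0,l], so the moment of one atom is 1 -
  p^2, which \<open>exp_ineq_lower\<close> compares with the mean.\<close>

lemma prob_mass_small:
  assumes l: "0 < l"
  shows "prob {\<omega>\<in>space M. mass \<omega> l \<le> ennreal (mean_mass l / 4)} \<le> exp (- l * mean_mass l / 4)"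
proof -
  define A where "A = {0..l}"
  have A: "A \<in> sets borel" unfolding A_def by simp
  define E where "E = {\<omega>\<in>space M. mass \<omega> l \<le> ennreal (mean_mass l / 4)}"
  have E: "E \<in> sets M" unfolding E_def by (rule sets_less_\<mu>) simp
  have l0: "0 \<le> l" using l by simp
  define Q where "Q N = (\<Sum>i<N. \<theta> (Suc i) * (1 - exp (- \<theta> (Suc i) * l)))" for N
  have bound: "prob E \<le> exp (- (l / 2) * Q N - (- l * (mean_mass l / 4 - (\<theta> 0)\<^sup>2 * l)))" for N
  proof -
    have "prob E \<le> exp ((\<Sum>i\<in>first_atoms N. - (l / 2) * (\<theta> i * (1 - exp (- \<theta> i * l))))
        - (- l * (mean_mass l / 4 - (\<theta> 0)\<^sup>2 * l)))"
    proof (rule chernoff[OF first_atoms A E, where s = "\<lambda>i. - l * \<theta> i"])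
      fix \<omega> assume "\<omega> \<in> E"
      then have "ennreal ((\<theta> 0)\<^sup>2) * ennreal l + (\<Sum>i<N. atom_mass i A \<omega>) \<le> ennreal (mean_mass l / 4)"
        unfolding E_def mass_eq A_def
        by (auto elim!: order_trans[rotated] intro!: add_left_mono sum_le_suminf)
      then have "ennreal ((\<theta> 0)\<^sup>2 * l + (\<Sum>i\<in>first_atoms N. \<theta> i * indicator A (X i \<omega>))) \<le> ennreal (mean_mass l / 4)"
        unfolding sum_atom_mass using l \<theta>_nonneg
        by (simp add: ennreal_mult sum_nonneg)
      then have "(\<theta> 0)\<^sup>2 * l + (\<Sum>i\<in>first_atoms N. \<theta> i * indicator A (X i \<omega>)) \<le> mean_mass l / 4"
        using mean_mass_nonneg[OF l0] by (subst (asm) ennreal_le_iff) auto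
      then have "l * (\<Sum>i\<in>first_atoms N. \<theta> i * indicator A (X i \<omega>)) \<le> l * (mean_mass l / 4 - (\<theta> 0)\<^sup>2 * l)"
        using l by (intro mult_left_mono) auto
      then show "- l * (mean_mass l / 4 - (\<theta> 0)\<^sup>2 * l) \<le> (\<Sum>i\<in>first_atoms N. - l * \<theta> i * indicator A (X i \<omega>))"
        by (simp add: sum_distrib_left sum_negf mult.assoc)
    next
      fix i assume "i \<in> first_atoms N"
      then have i: "i \<in> atoms \<theta>" using first_atoms by auto
      define a where "a = \<theta> i * l"
      have a: "0 \<le> a" unfolding a_def using l \<theta>_nonneg[of i] by simp
      define p where "p = 1 - exp (- a)"
      have p: "prob {\<omega>\<in>space M. X i \<omega> \<in> A} = p" "exp (- l * \<theta> i) - 1 = - p"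
        unfolding A_def p_def a_def using prob_X_Icc[OF i l0] by (simp_all add: mult.commute)
      have p01: "0 \<le> p" "p \<le> 1" unfolding p_def using a by auto
      have "1 + p * (- p) = exp (- a) * (1 + p)" unfolding p_def by (simp add: algebra_simps)
      also have "\<dots> \<le> exp (- a) * exp p" by (intro mult_left_mono exp_ge_add_one_self) simp
      also have "\<dots> = exp (- (a - p))" by (simp add: mult_exp_exp)
      also have "\<dots> \<le> exp (- (a * p / 2))" using exp_ineq_lower[OF a] unfolding p_def by simp
      also have "- (a * p / 2) = - (l / 2) * (\<theta> i * (1 - exp (- \<theta> i * l)))"
        unfolding p_def a_def by (simp add: mult.commute)
      finally show "1 + prob {\<omega>\<in>space M. X i \<omega> \<in> A} * (exp (- l * \<theta> i) - 1)
          \<le> exp (- (l / 2) * (\<theta> i * (1 - exp (- \<theta> i * l))))" unfolding p .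
      show "0 \<le> 1 + prob {\<omega>\<in>space M. X i \<omega> \<in> A} * (exp (- l * \<theta> i) - 1)"
        unfolding p using mult_le_one[OF p01(2) p01] by simp
    qed
    also have "(\<Sum>i\<in>first_atoms N. - (l / 2) * (\<theta> i * (1 - exp (- \<theta> i * l)))) = - (l / 2) * Q N"
      unfolding sum_distrib_left[symmetric] Q_def by (subst sum_first_atoms) auto
    finally show ?thesis .
  qed
  have "Q \<longlonglongrightarrow> mean_mass l - (\<theta> 0)\<^sup>2 * l"
    using summable_LIMSEQ[OF summable_mean[OF l0]] unfolding Q_def[abs_def] mean_mass_def by simp
  then have "(\<lambda>N. exp (- (l / 2) * Q N - (- l * (mean_mass l / 4 - (\<theta> 0)\<^sup>2 * l))))
      \<longlonglongrightarrow> exp (- (l / 2) * (mean_mass l - (\<theta> 0)\<^sup>2 * l) - (- l * (mean_mass l / 4 - (\<theta> 0)\<^sup>2 * l)))"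
    by (intro tendsto_intros)
  then have "prob E \<le> exp (- (l / 2) * (mean_mass l - (\<theta> 0)\<^sup>2 * l) - (- l * (mean_mass l / 4 - (\<theta> 0)\<^sup>2 * l)))"
    by (rule LIMSEQ_le_const) (use bound in blast)
  also have "\<dots> \<le> exp (- l * mean_mass l / 4)"
  proof -
    \<comment> \<open>The drift leaves this nonnegative surplus, with a minus sign, in the exponent;
      it is dropped.\<close>
    have "0 \<le> l * ((\<theta> 0)\<^sup>2 * l) / 2" using l by simp
    then show ?thesis by (simp add: field_simps)
  qed
  finally show ?thesis unfolding E_def .
qed

lemma prob_mass_large:
  assumes l: "0 \<le> l" and c: "0 < c"
  shows "prob {\<omega>\<in>space M. ennreal (c * mean_mass l) < mass \<omega> l} \<le> 1 / c"
proof (cases "mean_mass l = 0")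
  case True
  have "AE \<omega> in M. mass \<omega> l = 0"
    using nn_integral_0_iff_AE[of "\<lambda>\<omega>. mass \<omega> l" M] nn_integral_mass[OF l] True by simp
  then have "prob {\<omega>\<in>space M. 0 < mass \<omega> l} = 0"
    by (subst prob_eq_0) (auto simp: sets_less_\<mu>)
  then show ?thesis using True c by simp
next
  case False
  then have m: "0 < mean_mass l" using mean_mass_nonneg[OF l] by simp
  define a where "a = 1 / (c * mean_mass l)"
  have a: "0 < a" "a * (c * mean_mass l) = 1" unfolding a_def using c m by simp_all
  have "emeasure M {\<omega>\<in>space M. ennreal (c * mean_mass l) < mass \<omega> l}
      \<le> emeasure M {\<omega>\<in>space M. 1 \<le> ennreal a * mass \<omega> l}"
  proof (rule emeasure_mono)
    show "{\<omega>\<in>space M. ennreal (c * mean_mass l) < mass \<omega> l} \<subseteq> {\<omega>\<in>space M. 1 \<le> ennreal a * mass \<omega> l}"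
    proof safe
      fix \<omega> assume "ennreal (c * mean_mass l) < mass \<omega> l"
      then have "ennreal a * ennreal (c * mean_mass l) \<le> ennreal a * mass \<omega> l" by (intro mult_left_mono) auto
      then show "1 \<le> ennreal a * mass \<omega> l" using a c m by (simp add: ennreal_mult[symmetric])
    qed
  qed measurable
  also have "\<dots> \<le> ennreal a * (\<integral>\<^sup>+\<omega>. mass \<omega> l * indicator (space M) \<omega> \<partial>M)"
    by (rule nn_integral_Markov_inequality) auto
  also have "(\<integral>\<^sup>+\<omega>. mass \<omega> l * indicator (space M) \<omega> \<partial>M) = ennreal (mean_mass l)"
    unfolding nn_integral_mass[OF l, symmetric] by (intro nn_integral_cong) simp
  also have "ennreal a * ennreal (mean_mass l) = ennreal (1 / c)"
    using a m c unfolding a_def by (simp add: ennreal_mult[symmetric])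
  finally show ?thesis using c by (simp add: emeasure_eq_measure)
qed

end

section \<open>The Poisson process\<close>

text \<open>Markov's inequality for a Poisson variable of mean v: since a (n + 1) = v / (n + 1) * a
  n, the tail beyond N is at most v / (N + 1) times the full series.\<close>

lemma poisson_tail:
  fixes v :: real
  assumes v: "0 \<le> v"
  shows "1 - v / real (Suc N) \<le> (\<Sum>n\<le>N. v ^ n / fact n * exp (- v))"
proof -
  define a where "a n = v ^ n / fact n" for n
  have a0: "0 \<le> a n" for n unfolding a_def using v by simp
  have sum_a: "summable a" "suminf a = exp v"
    using exp_converges[of v] unfolding a_def[abs_def] sums_iff by (auto simp: divide_inverse mult.commute)
  have step: "a (Suc n) \<le> v / real (Suc N) * a n" if "N \<le> n" for n
  proof -
    have "a (Suc n) = v / real (Suc n) * a n" unfolding a_def by (simp add: field_simps)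
    also have "\<dots> \<le> v / real (Suc N) * a n"
      using that v a0[of n] by (intro mult_right_mono divide_left_mono) auto
    finally show ?thesis .
  qed
  have s1: "summable (\<lambda>n. a (n + Suc N))" "summable (\<lambda>n. a (n + N))"
    by (rule summable_ignore_initial_segment[OF sum_a(1)])+
  have "(\<Sum>n. a (n + Suc N)) \<le> (\<Sum>n. v / real (Suc N) * a (n + N))"
    by (intro suminf_le s1 summable_mult) (use step in simp)
  also have "\<dots> = v / real (Suc N) * (\<Sum>n. a (n + N))" by (rule suminf_mult[OF s1(2)])
  also have "\<dots> \<le> v / real (Suc N) * exp v"
  proof (rule mult_left_mono)
    have "exp v = (\<Sum>n. a (n + N)) + (\<Sum>n<N. a n)"
      using suminf_split_initial_segment[OF sum_a(1), of N] sum_a(2) by simp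
    moreover have "0 \<le> (\<Sum>n<N. a n)" by (intro sum_nonneg a0)
    ultimately show "(\<Sum>n. a (n + N)) \<le> exp v" by linarith
  qed (use v in auto)
  finally have "exp v - v / real (Suc N) * exp v \<le> (\<Sum>n<Suc N. a n)"
    using suminf_split_initial_segment[OF sum_a(1), of "Suc N"] sum_a(2) by simp
  then have "(exp v - v / real (Suc N) * exp v) * exp (- v) \<le> (\<Sum>n<Suc N. a n) * exp (- v)"
    by (intro mult_right_mono) auto
  then show ?thesis
    unfolding a_def by (simp add: left_diff_distrib mult_exp_exp sum_distrib_right lessThan_Suc_atMost mult.assoc)
qed

lemma sum_le_of_unique_nonzero:
  fixes f :: "'i \<Rightarrow> ennreal"
  assumes "finite J" "\<And>j. j \<in> J \<Longrightarrow> f j \<le> c"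
    and "\<And>j j'. j \<in> J \<Longrightarrow> j' \<in> J \<Longrightarrow> f j \<noteq> 0 \<Longrightarrow> f j' \<noteq> 0 \<Longrightarrow> j = j'"
  shows "sum f J \<le> c"
proof (cases "\<exists>j\<in>J. f j \<noteq> 0")
  case True
  then obtain j where j: "j \<in> J" "f j \<noteq> 0" by blast
  have "sum f J = sum f {j}"
    by (rule sum.mono_neutral_right) (use assms j in auto)
  then show ?thesis using assms(2)[OF j(1)] by simp
next
  case False
  then have "sum f J = 0" by (intro sum.neutral) blast
  then show ?thesis by simp
qed

context icrt_process
begin

abbreviation "\<nu> \<omega> \<equiv> icrt_rate \<theta> (\<lambda>i. X i \<omega>)"

lemma measurable_mass_time [measurable]: "(\<lambda>t. mass \<omega> t) \<in> borel_measurable borel"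
proof -
  have "(\<lambda>t. indicator {0..t} r :: ennreal) = (\<lambda>t. if 0 \<le> r \<and> r \<le> t then 1 else 0)" for r :: real
    by (auto simp: indicator_def)
  then have [measurable]: "(\<lambda>t. indicator {0..t} r :: ennreal) \<in> borel_measurable borel" for r :: real
    by simp
  show ?thesis unfolding mass_eq atom_mass_def by measurable
qed

lemma emeasure_\<nu>: "B \<in> sets borel \<Longrightarrow> emeasure (\<nu> \<omega>) B = (\<integral>\<^sup>+t\<in>B. mass \<omega> t \<partial>lborel)"
  unfolding icrt_rate_def by (subst emeasure_density) auto

lemma measurable_\<nu>_FX:
  assumes B: "B \<in> sets borel" shows "(\<lambda>\<omega>. emeasure (\<nu> \<omega>) B) \<in> borel_measurable FX"
proof -
  have [measurable]: "(\<lambda>(\<omega>, t). mass \<omega> t) \<in> borel_measurable (FX \<Otimes>\<^sub>M lborel)"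
    using measurable_mass_pair[of FX, OF X_FX] by (simp cong: measurable_cong_sets sets_pair_measure_cong)
  have "(\<lambda>(\<omega>, t). mass \<omega> t * indicator B t) \<in> borel_measurable (FX \<Otimes>\<^sub>M lborel)"
    using B by measurable
  then have "(\<lambda>\<omega>. \<integral>\<^sup>+t\<in>B. mass \<omega> t \<partial>lborel) \<in> borel_measurable FX"
    by (rule lborel.borel_measurable_nn_integral)
  then show ?thesis by (simp add: emeasure_\<nu>[OF B])
qed

lemma measurable_FX_M: "f \<in> borel_measurable FX \<Longrightarrow> f \<in> borel_measurable M"
  using measurable_from_subalg[OF subalgebra_FX] .

lemma measurable_FXY_M: "f \<in> borel_measurable FXY \<Longrightarrow> f \<in> borel_measurable M"
  using measurable_from_subalg[OF subalgebra_FXY] .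

lemma \<nu>_le: assumes "0 \<le> h" shows "emeasure (\<nu> \<omega>) {c<..c + h} \<le> ennreal h * mass \<omega> (c + h)"
proof -
  have "emeasure (\<nu> \<omega>) {c<..c + h} \<le> (\<integral>\<^sup>+t. mass \<omega> (c + h) * indicator {c<..c + h} t \<partial>lborel)"
    by (subst emeasure_\<nu>) (auto intro!: nn_integral_mono simp: indicator_def mass_mono)
  also have "\<dots> = ennreal h * mass \<omega> (c + h)"
    by (subst nn_integral_cmult_indicator) (simp_all add: assms mult.commute)
  finally show ?thesis .
qed

lemma \<nu>_Icc_le: assumes "0 \<le> l" shows "emeasure (\<nu> \<omega>) {0..l} \<le> ennreal l * mass \<omega> l"
proof -
  have "emeasure (\<nu> \<omega>) {0..l} \<le> (\<integral>\<^sup>+t. mass \<omega> l * indicator {0..l} t \<partial>lborel)"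
    by (subst emeasure_\<nu>) (auto intro!: nn_integral_mono simp: indicator_def mass_mono)
  also have "\<dots> = ennreal l * mass \<omega> l"
    by (subst nn_integral_cmult_indicator) (simp_all add: assms mult.commute)
  finally show ?thesis .
qed

lemma \<nu>_ge: assumes "0 \<le> h" shows "ennreal h * mass \<omega> c \<le> emeasure (\<nu> \<omega>) {c<..c + h}"
proof -
  have "ennreal h * mass \<omega> c = (\<integral>\<^sup>+t. mass \<omega> c * indicator {c<..c + h} t \<partial>lborel)"
    by (subst nn_integral_cmult_indicator) (simp_all add: assms mult.commute)
  also have "\<dots> \<le> emeasure (\<nu> \<omega>) {c<..c + h}"
    by (subst emeasure_\<nu>) (auto intro!: nn_integral_mono simp: indicator_def mass_mono)
  finally show ?thesis .
qed

definition points :: "real set \<Rightarrow> 'a \<Rightarrow> nat set" where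
  "points B \<omega> = {i. 1 \<le> i \<and> Y i \<omega> \<in> B}"

lemma sets_points:
  assumes B: "B \<in> sets borel"
  shows "{\<omega>\<in>space M. finite (points B \<omega>) \<and> card (points B \<omega>) = n} \<in> sets M"
proof -
  note [measurable] = Y_measurable
  have c: "countable {F :: nat set. finite F \<and> card F = n}"
    by (rule countable_subset[OF _ countable_Collect_finite]) auto
  have "{\<omega>\<in>space M. points B \<omega> = F} \<in> sets M" for F
  proof -
    have "{\<omega>\<in>space M. points B \<omega> = F} = {\<omega>\<in>space M. \<forall>i. (1 \<le> i \<and> Y i \<omega> \<in> B) = (i \<in> F)}"
      unfolding points_def by auto
    also have "\<dots> \<in> sets M" using B by measurable
    finally show ?thesis .
  qed
  then have "(\<Union>F\<in>{F. finite F \<and> card F = n}. {\<omega>\<in>space M. points B \<omega> = F}) \<in> sets M"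
    by (intro sets.countable_UN'[OF c]) auto
  also have "(\<Union>F\<in>{F. finite F \<and> card F = n}. {\<omega>\<in>space M. points B \<omega> = F})
      = {\<omega>\<in>space M. finite (points B \<omega>) \<and> card (points B \<omega>) = n}" by auto
  finally show ?thesis .
qed

lemma count_law:
  assumes B: "B \<in> sets borel" "bounded B" and A: "A \<in> sets FX"
  shows "emeasure M (A \<inter> {\<omega>\<in>space M. finite (points B \<omega>) \<and> card (points B \<omega>) = n})
    = (\<integral>\<^sup>+\<omega>\<in>A. ennreal (measure (\<nu> \<omega>) B ^ n / fact n * exp (- measure (\<nu> \<omega>) B)) \<partial>M)"
proof (rule emeasure_Int_cond_exp[OF subalgebra_FX sets_points[OF B(1)] A])
  have ev: "{\<omega> \<in> space M. \<forall>j\<in>{0::nat}. finite {i. 1 \<le> i \<and> Y i \<omega> \<in> B} \<and> card {i. 1 \<le> i \<and> Y i \<omega> \<in> B} = n}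
      = {\<omega>\<in>space M. finite (points B \<omega>) \<and> card (points B \<omega>) = n}"
    unfolding points_def by simp
  have "AE \<omega> in M. real_cond_exp M FX
             (indicat_real {\<omega> \<in> space M. \<forall>j\<in>{0::nat}.
                finite {i. 1 \<le> i \<and> Y i \<omega> \<in> B} \<and> card {i. 1 \<le> i \<and> Y i \<omega> \<in> B} = n}) \<omega>
           = (\<Prod>j\<in>{0::nat}. measure (\<nu> \<omega>) B ^ n / fact n * exp (- measure (\<nu> \<omega>) B))"
    using Y_law[unfolded conditional_Poisson_process_def, rule_format, of "{0}" "\<lambda>_. B" "\<lambda>_. n"] B
    by (simp add: disjoint_family_on_def)
  then show "AE \<omega> in M. real_cond_exp M FX (indicat_real {\<omega>\<in>space M. finite (points B \<omega>) \<and> card (points B \<omega>) = n}) \<omega>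
      = measure (\<nu> \<omega>) B ^ n / fact n * exp (- measure (\<nu> \<omega>) B)"
    unfolding ev by simp
  have [measurable]: "(\<lambda>\<omega>. measure (\<nu> \<omega>) B) \<in> borel_measurable M"
    unfolding measure_def using measurable_FX_M[OF measurable_\<nu>_FX[OF B(1)]] by measurable
  show "(\<lambda>\<omega>. measure (\<nu> \<omega>) B ^ n / fact n * exp (- measure (\<nu> \<omega>) B)) \<in> borel_measurable M"
    by measurable
qed simp

text \<open>\<open>finite\<close> rules out infinite sets of points, whose \<open>card\<close> is 0
  as well. The form matches \<open>count_law\<close> with n = 0.\<close>

definition void :: "real set \<Rightarrow> 'a set" where
  "void B = {\<omega>\<in>space M. finite (points B \<omega>) \<and> card (points B \<omega>) = 0}"

lemma void_eq: "void B = {\<omega>\<in>space M. \<forall>i\<ge>1. Y i \<omega> \<notin> B}"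
proof -
  have "(finite S \<and> card S = 0) = (S = {})" for S :: "nat set" by (cases "finite S") auto
  then show ?thesis unfolding void_def points_def by auto
qed

lemma sets_void: "B \<in> sets borel \<Longrightarrow> void B \<in> sets M"
  unfolding void_def by (rule sets_points)

text \<open>The mass grows with time, so on A the cell has rate at least h m.\<close>

lemma prob_void:
  assumes A: "A \<in> sets FX" and h: "0 \<le> h" and m: "\<And>\<omega>. \<omega> \<in> A \<Longrightarrow> ennreal m \<le> mass \<omega> c" and m0: "0 \<le> m"
  shows "prob (A \<inter> void {c<..c + h}) \<le> exp (- h * m)"
proof -
  have B: "{c<..c + h} \<in> sets borel" "bounded {c<..c + h}" by simp_all
  have "emeasure M (A \<inter> void {c<..c + h}) = (\<integral>\<^sup>+\<omega>\<in>A. ennreal (exp (- measure (\<nu> \<omega>) {c<..c + h})) \<partial>M)"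
    unfolding void_def by (subst count_law[OF B A]) simp
  also have "\<dots> \<le> (\<integral>\<^sup>+\<omega>. ennreal (exp (- h * m)) \<partial>M)"
  proof (rule nn_integral_mono_AE)
    show "AE \<omega> in M. ennreal (exp (- measure (\<nu> \<omega>) {c<..c + h})) * indicator A \<omega> \<le> ennreal (exp (- h * m))"
      using AE_mass_finite
    proof eventually_elim
      case (elim \<omega>)
      show ?case
      proof (cases "\<omega> \<in> A")
        case True
        have "emeasure (\<nu> \<omega>) {c<..c + h} < \<infinity>"
          by (rule le_less_trans[OF \<nu>_le[OF h]]) (use elim in \<open>simp add: ennreal_mult_less_top\<close>)
        then have fin: "emeasure (\<nu> \<omega>) {c<..c + h} = ennreal (measure (\<nu> \<omega>) {c<..c + h})"
          by (simp add: emeasure_eq_ennreal_measure)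
        have "ennreal (h * m) \<le> ennreal h * mass \<omega> c"
          using m[OF True] h m0 by (simp add: ennreal_mult mult_left_mono)
        also have "\<dots> \<le> ennreal (measure (\<nu> \<omega>) {c<..c + h})" unfolding fin[symmetric] by (rule \<nu>_ge[OF h])
        finally have "h * m \<le> measure (\<nu> \<omega>) {c<..c + h}" by (simp add: ennreal_le_iff)
        then show ?thesis using True by (simp add: ennreal_leI)
      qed simp
    qed
  qed
  also have "\<dots> = ennreal (exp (- h * m))" by (simp add: emeasure_space_1)
  finally show ?thesis by (simp add: emeasure_eq_measure)
qed

text \<open>Integrates 1 - exp (- r) \<le> r over the rate r; where the rate is infinite there is
  nothing to prove.\<close>

lemma prob_not_void_le:
  assumes A: "A \<in> sets FX" and B: "B \<in> sets borel" "bounded B"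
  shows "emeasure M (A - void B) \<le> (\<integral>\<^sup>+\<omega>\<in>A. emeasure (\<nu> \<omega>) B \<partial>M)"
proof -
  have AM: "A \<in> sets M" by (rule sets_FX[OF A])
  have [measurable]: "(\<lambda>\<omega>. emeasure (\<nu> \<omega>) B) \<in> borel_measurable M"
    by (rule measurable_FX_M[OF measurable_\<nu>_FX[OF B(1)]])
  have "emeasure M A = emeasure M (A \<inter> void B) + emeasure M (A - void B)"
    using AM sets_void[OF B(1)] by (subst plus_emeasure) (auto simp: Int_Diff_Un)
  moreover have "emeasure M A \<le> emeasure M (A \<inter> void B) + (\<integral>\<^sup>+\<omega>\<in>A. emeasure (\<nu> \<omega>) B \<partial>M)"
  proof -
    have "emeasure M A = (\<integral>\<^sup>+\<omega>. indicator A \<omega> \<partial>M)" using AM by simp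
    also have "\<dots> \<le> (\<integral>\<^sup>+\<omega>. ennreal (exp (- measure (\<nu> \<omega>) B)) * indicator A \<omega> + emeasure (\<nu> \<omega>) B * indicator A \<omega> \<partial>M)"
    proof (rule nn_integral_mono)
      fix \<omega>
      show "indicator A \<omega> \<le> ennreal (exp (- measure (\<nu> \<omega>) B)) * indicator A \<omega> + emeasure (\<nu> \<omega>) B * indicator A \<omega>"
      proof (cases "\<omega> \<in> A \<and> emeasure (\<nu> \<omega>) B < \<infinity>")
        case True
        then have "emeasure (\<nu> \<omega>) B = ennreal (measure (\<nu> \<omega>) B)"
          by (intro emeasure_eq_ennreal_measure) auto
        moreover have "1 \<le> exp (- measure (\<nu> \<omega>) B) + measure (\<nu> \<omega>) B"
          using exp_ge_add_one_self[of "- measure (\<nu> \<omega>) B"] by simp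
        ultimately show ?thesis using True ennreal_le_add[of 1] by simp
      qed (auto simp: less_top[symmetric] indicator_def)
    qed
    also have "\<dots> = (\<integral>\<^sup>+\<omega>\<in>A. ennreal (exp (- measure (\<nu> \<omega>) B)) \<partial>M) + (\<integral>\<^sup>+\<omega>\<in>A. emeasure (\<nu> \<omega>) B \<partial>M)"
      by (rule nn_integral_add) (use AM in \<open>auto simp: measure_def\<close>)
    also have "(\<integral>\<^sup>+\<omega>\<in>A. ennreal (exp (- measure (\<nu> \<omega>) B)) \<partial>M) = emeasure M (A \<inter> void B)"
      unfolding void_def by (subst count_law[OF B A]) simp
    finally show ?thesis .
  qed
  ultimately have "emeasure M (A \<inter> void B) + emeasure M (A - void B)
      \<le> emeasure M (A \<inter> void B) + (\<integral>\<^sup>+\<omega>\<in>A. emeasure (\<nu> \<omega>) B \<partial>M)" by simp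
  then show ?thesis by (simp add: ennreal_add_left_cancel_le emeasure_eq_measure)
qed

text \<open>\<open>poisson_tail\<close> averaged over X, where the mean rate of [0,l] is at most l
  times the mean mass. The event includes infinitely many points in [0,l]; this is how
  \<open>AE_count\<close> excludes accumulation of Y.\<close>

lemma prob_count_large:
  assumes l: "0 \<le> l"
  shows "prob (space M - (\<Union>n\<le>N. {\<omega>\<in>space M. finite (points {0..l} \<omega>) \<and> card (points {0..l} \<omega>) = n}))
    \<le> l * mean_mass l / real (Suc N)"
proof -
  define E where "E n = {\<omega>\<in>space M. finite (points {0..l} \<omega>) \<and> card (points {0..l} \<omega>) = n}" for n
  define r where "r \<omega> = measure (\<nu> \<omega>) {0..l}" for \<omega>
  have B: "{0..l} \<in> sets borel" "bounded {0..l}" by simp_all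
  have r0: "0 \<le> r \<omega>" for \<omega> unfolding r_def by simp
  have [measurable]: "r \<in> borel_measurable M"
    unfolding r_def[abs_def] measure_def using measurable_FX_M[OF measurable_\<nu>_FX[OF B(1)]] by measurable
  have E: "E n \<in> sets M" for n unfolding E_def by (rule sets_points) simp
  have "emeasure M (E n) = (\<integral>\<^sup>+\<omega>. ennreal (r \<omega> ^ n / fact n * exp (- r \<omega>)) \<partial>M)" for n
  proof -
    have "space FX \<in> sets FX" by (rule sets.top)
    then have S: "space M \<in> sets FX" by simp
    have "emeasure M (space M \<inter> E n) = (\<integral>\<^sup>+\<omega>\<in>space M. ennreal (r \<omega> ^ n / fact n * exp (- r \<omega>)) \<partial>M)"
      unfolding E_def r_def by (rule count_law[OF B S])
    also have "space M \<inter> E n = E n" using sets.sets_into_space[OF E] by auto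
    also have "(\<integral>\<^sup>+\<omega>\<in>space M. ennreal (r \<omega> ^ n / fact n * exp (- r \<omega>)) \<partial>M)
        = (\<integral>\<^sup>+\<omega>. ennreal (r \<omega> ^ n / fact n * exp (- r \<omega>)) \<partial>M)"
      by (intro nn_integral_cong) simp
    finally show ?thesis .
  qed
  then have "emeasure M (\<Union>n\<le>N. E n) = (\<Sum>n\<le>N. \<integral>\<^sup>+\<omega>. ennreal (r \<omega> ^ n / fact n * exp (- r \<omega>)) \<partial>M)"
    using E by (subst sum_emeasure[symmetric]) (auto simp: disjoint_family_on_def E_def)
  also have "\<dots> = (\<integral>\<^sup>+\<omega>. (\<Sum>n\<le>N. ennreal (r \<omega> ^ n / fact n * exp (- r \<omega>))) \<partial>M)"
    by (rule nn_integral_sum[symmetric]) measurable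
  finally have UE: "emeasure M (\<Union>n\<le>N. E n) = (\<integral>\<^sup>+\<omega>. (\<Sum>n\<le>N. ennreal (r \<omega> ^ n / fact n * exp (- r \<omega>))) \<partial>M)" .
  have "1 = (\<integral>\<^sup>+\<omega>. 1 \<partial>M)" by (simp add: emeasure_space_1)
  also have "\<dots> \<le> (\<integral>\<^sup>+\<omega>. (\<Sum>n\<le>N. ennreal (r \<omega> ^ n / fact n * exp (- r \<omega>))) + ennreal (l / real (Suc N)) * mass \<omega> l \<partial>M)"
  proof (rule nn_integral_mono_AE)
    show "AE \<omega> in M. 1 \<le> (\<Sum>n\<le>N. ennreal (r \<omega> ^ n / fact n * exp (- r \<omega>))) + ennreal (l / real (Suc N)) * mass \<omega> l"
      using AE_mass_finite
    proof eventually_elim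
      case (elim \<omega>)
      define m where "m = measure (\<mu> \<omega>) {0..l}"
      have m: "mass \<omega> l = ennreal m" "0 \<le> m" unfolding m_def using elim[rule_format, of l]
        by (auto intro!: emeasure_eq_ennreal_measure)
      have "ennreal (r \<omega>) \<le> emeasure (\<nu> \<omega>) {0..l}"
        unfolding r_def measure_def by (rule ennreal_enn2real_if[THEN ord_eq_le_trans]) auto
      also have "\<dots> \<le> ennreal (l * m)" using \<nu>_Icc_le[OF l, of \<omega>] l m by (simp add: ennreal_mult)
      finally have rm: "r \<omega> \<le> l * m" using l m by (simp add: ennreal_le_iff)
      have "1 - r \<omega> / real (Suc N) \<le> (\<Sum>n\<le>N. r \<omega> ^ n / fact n * exp (- r \<omega>))" by (rule poisson_tail[OF r0])
      moreover have "r \<omega> / real (Suc N) \<le> l * m / real (Suc N)" using rm by (rule divide_right_mono) simp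
      ultimately have "1 \<le> (\<Sum>n\<le>N. r \<omega> ^ n / fact n * exp (- r \<omega>)) + l / real (Suc N) * m" by simp
      then have "ennreal 1 \<le> ennreal (\<Sum>n\<le>N. r \<omega> ^ n / fact n * exp (- r \<omega>)) + ennreal (l / real (Suc N) * m)"
        by (rule ennreal_le_add) (use r0 l m in \<open>auto intro!: sum_nonneg\<close>)
      moreover have "ennreal (\<Sum>n\<le>N. r \<omega> ^ n / fact n * exp (- r \<omega>)) = (\<Sum>n\<le>N. ennreal (r \<omega> ^ n / fact n * exp (- r \<omega>)))"
        by (rule sum_ennreal[symmetric]) (use r0 in auto)
      moreover have "ennreal (l / real (Suc N) * m) = ennreal (l / real (Suc N)) * mass \<omega> l"
        unfolding m(1) by (rule ennreal_mult) (use l m in auto)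
      ultimately show ?case by simp
    qed
  qed
  also have "\<dots> = emeasure M (\<Union>n\<le>N. E n) + ennreal (l / real (Suc N)) * ennreal (mean_mass l)"
    unfolding UE nn_integral_mass[OF l, symmetric]
    by (subst nn_integral_add) (auto simp: nn_integral_cmult)
  also have "\<dots> = ennreal (prob (\<Union>n\<le>N. E n) + l / real (Suc N) * mean_mass l)"
    using l mean_mass_nonneg[OF l] by (simp add: emeasure_eq_measure ennreal_mult[symmetric])
  finally have "ennreal 1 \<le> ennreal (prob (\<Union>n\<le>N. E n) + l / real (Suc N) * mean_mass l)" by simp
  then have "1 \<le> prob (\<Union>n\<le>N. E n) + l / real (Suc N) * mean_mass l"
    by (subst (asm) ennreal_le_iff) (use l mean_mass_nonneg[OF l] in \<open>auto intro!: add_nonneg_nonneg\<close>)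
  moreover have "prob (space M - (\<Union>n\<le>N. E n)) = 1 - prob (\<Union>n\<le>N. E n)"
    by (rule prob_compl) (use E in auto)
  ultimately show ?thesis unfolding E_def by simp
qed

text \<open>\<open>Y_increasing\<close> leaves \<open>Y 1 \<omega> = 0\<close> possible; it is
  excluded because the single point 0 has rate 0.\<close>

lemma AE_Y_pos: "AE \<omega> in M. \<forall>i\<ge>1. Y i \<omega> \<noteq> 0"
proof -
  have "space FX \<in> sets FX" by (rule sets.top)
  then have S: "space M \<in> sets FX" by simp
  have "emeasure (\<nu> \<omega>) {0} = 0" for \<omega>
  proof -
    have "emeasure (\<nu> \<omega>) {0} \<le> ennreal 0 * mass \<omega> 0" using \<nu>_Icc_le[of 0 \<omega>] by simp
    then show ?thesis by simp
  qed
  then have "emeasure M (space M - void {0}) = 0"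
    using prob_not_void_le[OF S, of "{0}"] by simp
  then have "space M - void {0} \<in> null_sets M" using sets_void[of "{0}"] by (intro null_setsI) auto
  then have "AE \<omega> in M. \<omega> \<notin> space M - void {0}" by (rule AE_not_in)
  then show ?thesis
    using AE_space by eventually_elim (auto simp: void_eq)
qed

text \<open>
  Given \<open>X\<close>, a cell of mesh \<open>2 ^ -n\<close> contains a point of \<open>Y\<close> with probability at most \<open>2 ^ -n\<close>
  times its rate; on \<open>D\<close> one of the few eligible cells \<open>Q n j\<close> must contain one, for every \<open>n\<close>.
\<close>

lemma AE_not_in_grid:
  assumes D: "D \<in> sets M"
    and Q: "\<And>n j. Q n j \<in> sets FX"
    and sum: "\<And>n \<omega>. (\<Sum>j<l * 2 ^ n. indicator (Q n j) \<omega> * mass \<omega> (real j / 2 ^ n + 1 / 2 ^ n)) \<le> mass \<omega> (real l)"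
    and sub: "\<And>n. D \<subseteq> (\<Union>j<l * 2 ^ n. Q n j - void {real j / 2 ^ n<..real j / 2 ^ n + 1 / 2 ^ n})"
  shows "AE \<omega> in M. \<omega> \<notin> D"
proof (rule AE_of_emeasure_le[OF D])
  fix n :: nat
  define c where "c j = real j / 2 ^ n" for j
  define h :: real where "h = 1 / 2 ^ n"
  have h: "0 \<le> h" unfolding h_def by simp
  have QM: "Q n j \<in> sets M" for j by (rule sets_FX[OF Q])
  have "emeasure M D \<le> emeasure M (\<Union>j<l * 2 ^ n. Q n j - void {c j<..c j + h})"
    using sub[of n] QM sets_void unfolding c_def h_def by (intro emeasure_mono) auto
  also have "\<dots> \<le> (\<Sum>j<l * 2 ^ n. emeasure M (Q n j - void {c j<..c j + h}))"
    by (rule emeasure_subadditive_finite) (use QM sets_void in auto)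
  also have "\<dots> \<le> (\<Sum>j<l * 2 ^ n. \<integral>\<^sup>+\<omega>. ennreal h * (indicator (Q n j) \<omega> * mass \<omega> (c j + h)) \<partial>M)"
  proof (rule sum_mono)
    fix j
    have "emeasure M (Q n j - void {c j<..c j + h}) \<le> (\<integral>\<^sup>+\<omega>\<in>Q n j. emeasure (\<nu> \<omega>) {c j<..c j + h} \<partial>M)"
      by (rule prob_not_void_le[OF Q]) auto
    also have "\<dots> \<le> (\<integral>\<^sup>+\<omega>. ennreal h * (indicator (Q n j) \<omega> * mass \<omega> (c j + h)) \<partial>M)"
      using \<nu>_le[OF h] by (intro nn_integral_mono) (auto simp: indicator_def)
    finally show "emeasure M (Q n j - void {c j<..c j + h})
        \<le> (\<integral>\<^sup>+\<omega>. ennreal h * (indicator (Q n j) \<omega> * mass \<omega> (c j + h)) \<partial>M)" .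
  qed
  also have "\<dots> = (\<integral>\<^sup>+\<omega>. (\<Sum>j<l * 2 ^ n. ennreal h * (indicator (Q n j) \<omega> * mass \<omega> (c j + h))) \<partial>M)"
    by (intro nn_integral_sum[symmetric] borel_measurable_times_ennreal borel_measurable_const
          borel_measurable_indicator mass_measurable QM)
  also have "\<dots> \<le> (\<integral>\<^sup>+\<omega>. ennreal h * mass \<omega> (real l) \<partial>M)"
    using sum[of n] unfolding c_def h_def
    by (intro nn_integral_mono) (simp add: sum_distrib_left[symmetric] mult_left_mono)
  also have "\<dots> = ennreal (mean_mass (real l)) * ennreal (1 / 2 ^ n)"
    by (simp add: nn_integral_cmult nn_integral_mass h_def mult.commute)
  finally show "emeasure M D \<le> ennreal (mean_mass (real l)) * ennreal (1 / 2 ^ n)" .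
qed simp

lemma grid_index:
  assumes t: "0 < t" "t \<le> real l"
  shows "\<exists>j<l * 2 ^ n. t \<in> {real j / 2 ^ n<..real j / 2 ^ n + 1 / 2 ^ n}"
proof -
  define k where "k = \<lceil>t * 2 ^ n\<rceil>"
  have k: "of_int k - 1 < t * 2 ^ n" "t * 2 ^ n \<le> of_int k" unfolding k_def by linarith+
  have "0 < t * 2 ^ n" using t by simp
  then have k1: "1 \<le> k" using k by linarith
  define j where "j = nat (k - 1)"
  have j: "real j = of_int k - 1" unfolding j_def using k1 by simp
  have "t * 2 ^ n \<le> real l * 2 ^ n" using t by (intro mult_right_mono) auto
  then have "real j < real l * 2 ^ n" using k j by linarith
  then have "j < l * 2 ^ n" using of_nat_less_iff[of j "l * 2 ^ n", where 'a = real] by simp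
  moreover have "real j / 2 ^ n < t" using k j by (simp add: field_simps)
  moreover have "t \<le> real j / 2 ^ n + 1 / 2 ^ n" using k j by (simp add: field_simps)
  ultimately show ?thesis by auto
qed

lemma grid_unique:
  assumes "t \<in> {real j / 2 ^ n<..real j / 2 ^ n + 1 / 2 ^ n}" "t \<in> {real j' / 2 ^ n<..real j' / 2 ^ n + 1 / 2 ^ n}"
  shows "j = j'"
proof -
  have "real j < t * 2 ^ n" "t * 2 ^ n \<le> real j + 1" "real j' < t * 2 ^ n" "t * 2 ^ n \<le> real j' + 1"
    using assms by (auto simp: field_simps)
  then show ?thesis by linarith
qed

lemma grid_le: "j < l * 2 ^ n \<Longrightarrow> real j / 2 ^ n + 1 / 2 ^ n \<le> real l"
proof -
  assume "j < l * 2 ^ n"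
  then have "real (Suc j) \<le> real (l * 2 ^ n)" unfolding of_nat_le_iff by simp
  then show ?thesis by (simp add: field_simps)
qed

text \<open>For each mesh, the only eligible cell in \<open>AE_not_in_grid\<close> is the one
  containing \<open>X i\<close>.\<close>

lemma AE_X_neq_Y: "AE \<omega> in M. \<forall>i\<in>atoms \<theta>. \<forall>a\<ge>1. X i \<omega> \<noteq> Y a \<omega>"
proof -
  note [measurable] = Y_measurable
  have "AE \<omega> in M. \<omega> \<notin> {\<omega>\<in>space M. \<exists>a\<ge>1. X i \<omega> = Y a \<omega> \<and> 0 < X i \<omega> \<and> X i \<omega> \<le> real l}"
    if i: "i \<in> atoms \<theta>" for i l
  proof (rule AE_not_in_grid[where Q = "\<lambda>n j. {\<omega>\<in>space M. X i \<omega> \<in> {real j / 2 ^ n<..real j / 2 ^ n + 1 / 2 ^ n}}" and l = l])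
    note [measurable] = X_measurable[OF i]
    show "{\<omega>\<in>space M. \<exists>a\<ge>1. X i \<omega> = Y a \<omega> \<and> 0 < X i \<omega> \<and> X i \<omega> \<le> real l} \<in> sets M" by measurable
    fix n j
    have [measurable]: "X i \<in> borel_measurable FX" by (rule X_FX[OF i])
    have "{\<omega>\<in>space FX. X i \<omega> \<in> {real j / 2 ^ n<..real j / 2 ^ n + 1 / 2 ^ n}} \<in> sets FX" by measurable
    then show "{\<omega>\<in>space M. X i \<omega> \<in> {real j / 2 ^ n<..real j / 2 ^ n + 1 / 2 ^ n}} \<in> sets FX"
      unfolding space_generated_by .
  next
    fix n \<omega>
    show "(\<Sum>j<l * 2 ^ n. indicator {\<omega>\<in>space M. X i \<omega> \<in> {real j / 2 ^ n<..real j / 2 ^ n + 1 / 2 ^ n}} \<omega>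
        * mass \<omega> (real j / 2 ^ n + 1 / 2 ^ n)) \<le> mass \<omega> (real l)"
    proof (rule sum_le_of_unique_nonzero)
      fix j assume "j \<in> {..<l * 2 ^ n}"
      then have "mass \<omega> (real j / 2 ^ n + 1 / 2 ^ n) \<le> mass \<omega> (real l)" by (intro mass_mono grid_le) simp
      then show "indicator {\<omega>\<in>space M. X i \<omega> \<in> {real j / 2 ^ n<..real j / 2 ^ n + 1 / 2 ^ n}} \<omega>
        * mass \<omega> (real j / 2 ^ n + 1 / 2 ^ n) \<le> mass \<omega> (real l)" by (simp add: indicator_def)
    next
      fix j j' assume "indicator {\<omega>\<in>space M. X i \<omega> \<in> {real j / 2 ^ n<..real j / 2 ^ n + 1 / 2 ^ n}} \<omega>
        * mass \<omega> (real j / 2 ^ n + 1 / 2 ^ n) \<noteq> 0"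
        "indicator {\<omega>\<in>space M. X i \<omega> \<in> {real j' / 2 ^ n<..real j' / 2 ^ n + 1 / 2 ^ n}} \<omega>
        * mass \<omega> (real j' / 2 ^ n + 1 / 2 ^ n) \<noteq> 0"
      then have "X i \<omega> \<in> {real j / 2 ^ n<..real j / 2 ^ n + 1 / 2 ^ n}" "X i \<omega> \<in> {real j' / 2 ^ n<..real j' / 2 ^ n + 1 / 2 ^ n}"
        by (auto simp: indicator_def split: if_splits)
      then show "j = j'" by (rule grid_unique)
    qed simp
  next
    fix n
    show "{\<omega>\<in>space M. \<exists>a\<ge>1. X i \<omega> = Y a \<omega> \<and> 0 < X i \<omega> \<and> X i \<omega> \<le> real l}
      \<subseteq> (\<Union>j<l * 2 ^ n. {\<omega>\<in>space M. X i \<omega> \<in> {real j / 2 ^ n<..real j / 2 ^ n + 1 / 2 ^ n}}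
        - void {real j / 2 ^ n<..real j / 2 ^ n + 1 / 2 ^ n})"
    proof
      fix \<omega> assume "\<omega> \<in> {\<omega>\<in>space M. \<exists>a\<ge>1. X i \<omega> = Y a \<omega> \<and> 0 < X i \<omega> \<and> X i \<omega> \<le> real l}"
      then obtain a where a: "\<omega> \<in> space M" "1 \<le> a" "X i \<omega> = Y a \<omega>" "0 < X i \<omega>" "X i \<omega> \<le> real l" by blast
      obtain j where j: "j < l * 2 ^ n" "X i \<omega> \<in> {real j / 2 ^ n<..real j / 2 ^ n + 1 / 2 ^ n}"
        using grid_index[OF a(4,5), of n] by blast
      then have "\<omega> \<notin> void {real j / 2 ^ n<..real j / 2 ^ n + 1 / 2 ^ n}"
        using a unfolding void_eq by auto
      then show "\<omega> \<in> (\<Union>j<l * 2 ^ n. {\<omega>\<in>space M. X i \<omega> \<in> {real j / 2 ^ n<..real j / 2 ^ n + 1 / 2 ^ n}}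
        - void {real j / 2 ^ n<..real j / 2 ^ n + 1 / 2 ^ n})" using j a by blast
    qed
  qed
  then have "AE \<omega> in M. \<forall>i\<in>atoms \<theta>. \<forall>l. \<omega> \<notin> {\<omega>\<in>space M. \<exists>a\<ge>1. X i \<omega> = Y a \<omega> \<and> 0 < X i \<omega> \<and> X i \<omega> \<le> real l}"
    by (intro AE_ball_countable[THEN iffD2] countableI_type ballI AE_all_countable[THEN iffD2] allI) simp
  moreover have "AE \<omega> in M. \<forall>i\<in>atoms \<theta>. 0 < X i \<omega>"
  proof -
    have "AE \<omega> in M. \<omega> \<notin> {\<omega>\<in>space M. X i \<omega> \<le> 0}" if i: "i \<in> atoms \<theta>" for i
    proof -
      note [measurable] = X_measurable[OF i]
      have "{\<omega>\<in>space M. X i \<omega> \<le> 0} \<in> null_sets M"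
        using prob_X_neg[OF i] by (intro null_setsI) (auto simp: emeasure_eq_measure)
      then show ?thesis by (rule AE_not_in)
    qed
    then have "AE \<omega> in M. \<forall>i\<in>atoms \<theta>. \<omega> \<notin> {\<omega>\<in>space M. X i \<omega> \<le> 0}"
      by (intro AE_ball_countable[THEN iffD2] countableI_type ballI)
    then show ?thesis using AE_space by eventually_elim auto
  qed
  ultimately show ?thesis
    using AE_space
  proof eventually_elim
    case (elim \<omega>)
    show ?case
    proof (intro ballI allI impI notI)
      fix i a assume i: "i \<in> atoms \<theta>" and a: "1 \<le> a" "X i \<omega> = Y a \<omega>"
      obtain l where l: "X i \<omega> \<le> real l" using real_arch_simple by blast
      have "0 < X i \<omega>" using elim(2) i by blast
      then have "\<omega> \<in> {\<omega>\<in>space M. \<exists>a\<ge>1. X i \<omega> = Y a \<omega> \<and> 0 < X i \<omega> \<and> X i \<omega> \<le> real l}"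
        using elim(3) a l by blast
      then show False using elim(1) i by blast
    qed
  qed
qed

text \<open>Makes the normalisation in \<open>icrt_p\<close> meaningful. Eligible cells have mass 0
  up to their left end; at most one of them has positive mass up to its right end, namely the one
  where the mass starts.\<close>

lemma AE_mass_Y_pos: "AE \<omega> in M. \<forall>a\<ge>1. 0 < Y a \<omega> \<longrightarrow> 0 < mass \<omega> (Y a \<omega>)"
proof -
  note [measurable] = Y_measurable
  have mY [measurable]: "(\<lambda>\<omega>. mass \<omega> (Y a \<omega>)) \<in> borel_measurable M" for a
    by (rule measurable_mass[OF X_measurable Y_measurable])
  have "AE \<omega> in M. \<omega> \<notin> {\<omega>\<in>space M. \<exists>a\<ge>1. mass \<omega> (Y a \<omega>) = 0 \<and> 0 < Y a \<omega> \<and> Y a \<omega> \<le> real l}" for l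
  proof (rule AE_not_in_grid[where Q = "\<lambda>n j. {\<omega>\<in>space M. mass \<omega> (real j / 2 ^ n) = 0}" and l = l])
    show "{\<omega>\<in>space M. \<exists>a\<ge>1. mass \<omega> (Y a \<omega>) = 0 \<and> 0 < Y a \<omega> \<and> Y a \<omega> \<le> real l} \<in> sets M" by measurable
    fix n j
    have [measurable]: "(\<lambda>\<omega>. mass \<omega> (real j / 2 ^ n)) \<in> borel_measurable FX"
      by (rule measurable_mass[OF X_FX]) auto
    have "{\<omega>\<in>space FX. mass \<omega> (real j / 2 ^ n) = 0} \<in> sets FX" by measurable
    then show "{\<omega>\<in>space M. mass \<omega> (real j / 2 ^ n) = 0} \<in> sets FX"
      unfolding space_generated_by .
  next
    fix n \<omega>
    define Q where "Q j = {\<omega>\<in>space M. mass \<omega> (real j / 2 ^ n) = 0}" for j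
    define f where "f j = indicator (Q j) \<omega> * mass \<omega> (real j / 2 ^ n + 1 / 2 ^ n)" for j
    have lt: False if "f j \<noteq> 0" "f j' \<noteq> 0" "j < j'" for j j'
    proof -
      have "mass \<omega> (real j / 2 ^ n + 1 / 2 ^ n) \<noteq> 0" "mass \<omega> (real j' / 2 ^ n) = 0"
        using that unfolding f_def Q_def by (auto simp: indicator_def split: if_splits)
      moreover have "real j + 1 \<le> real j'" using that(3) by simp
      then have "real j / 2 ^ n + 1 / 2 ^ n \<le> real j' / 2 ^ n"
        unfolding add_divide_distrib[symmetric] by (rule divide_right_mono) simp
      then have "mass \<omega> (real j / 2 ^ n + 1 / 2 ^ n) \<le> mass \<omega> (real j' / 2 ^ n)" by (rule mass_mono)
      ultimately show False by simp
    qed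
    have "sum f {..<l * 2 ^ n} \<le> mass \<omega> (real l)"
    proof (rule sum_le_of_unique_nonzero)
      fix j assume "j \<in> {..<l * 2 ^ n}"
      then have "mass \<omega> (real j / 2 ^ n + 1 / 2 ^ n) \<le> mass \<omega> (real l)" by (intro mass_mono grid_le) simp
      then show "f j \<le> mass \<omega> (real l)" unfolding f_def by (simp add: indicator_def)
    next
      fix j j' assume "f j \<noteq> 0" "f j' \<noteq> 0"
      then show "j = j'" using lt[of j j'] lt[of j' j] by (cases j j' rule: linorder_cases) auto
    qed simp
    then show "(\<Sum>j<l * 2 ^ n. indicator {\<omega>\<in>space M. mass \<omega> (real j / 2 ^ n) = 0} \<omega>
        * mass \<omega> (real j / 2 ^ n + 1 / 2 ^ n)) \<le> mass \<omega> (real l)"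
      unfolding f_def Q_def .
  next
    fix n
    show "{\<omega>\<in>space M. \<exists>a\<ge>1. mass \<omega> (Y a \<omega>) = 0 \<and> 0 < Y a \<omega> \<and> Y a \<omega> \<le> real l}
      \<subseteq> (\<Union>j<l * 2 ^ n. {\<omega>\<in>space M. mass \<omega> (real j / 2 ^ n) = 0}
        - void {real j / 2 ^ n<..real j / 2 ^ n + 1 / 2 ^ n})"
    proof
      fix \<omega> assume "\<omega> \<in> {\<omega>\<in>space M. \<exists>a\<ge>1. mass \<omega> (Y a \<omega>) = 0 \<and> 0 < Y a \<omega> \<and> Y a \<omega> \<le> real l}"
      then obtain a where a: "\<omega> \<in> space M" "1 \<le> a" "mass \<omega> (Y a \<omega>) = 0" "0 < Y a \<omega>" "Y a \<omega> \<le> real l" by blast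
      obtain j where j: "j < l * 2 ^ n" "Y a \<omega> \<in> {real j / 2 ^ n<..real j / 2 ^ n + 1 / 2 ^ n}"
        using grid_index[OF a(4,5), of n] by blast
      then have "\<omega> \<notin> void {real j / 2 ^ n<..real j / 2 ^ n + 1 / 2 ^ n}"
        using a unfolding void_eq by auto
      moreover have "mass \<omega> (real j / 2 ^ n) \<le> mass \<omega> (Y a \<omega>)" using j by (intro mass_mono) simp
      then have "mass \<omega> (real j / 2 ^ n) = 0" using a by simp
      ultimately show "\<omega> \<in> (\<Union>j<l * 2 ^ n. {\<omega>\<in>space M. mass \<omega> (real j / 2 ^ n) = 0}
        - void {real j / 2 ^ n<..real j / 2 ^ n + 1 / 2 ^ n})" using j a by blast
    qed
  qed
  then have "AE \<omega> in M. \<forall>l. \<omega> \<notin> {\<omega>\<in>space M. \<exists>a\<ge>1. mass \<omega> (Y a \<omega>) = 0 \<and> 0 < Y a \<omega> \<and> Y a \<omega> \<le> real l}"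
    by (intro AE_all_countable[THEN iffD2] allI)
  then show ?thesis
    using AE_space
  proof eventually_elim
    case (elim \<omega>)
    show ?case
    proof (intro allI impI)
      fix a assume a: "1 \<le> a" "0 < Y a \<omega>"
      obtain l where l: "Y a \<omega> \<le> real l" using real_arch_simple by blast
      have "mass \<omega> (Y a \<omega>) \<noteq> 0"
      proof
        assume "mass \<omega> (Y a \<omega>) = 0"
        then have "\<omega> \<in> {\<omega>\<in>space M. \<exists>a\<ge>1. mass \<omega> (Y a \<omega>) = 0 \<and> 0 < Y a \<omega> \<and> Y a \<omega> \<le> real l}"
          by (intro CollectI conjI exI[of _ a]) (simp_all only: elim(2) a l)
        then show False using elim(1)[rule_format, of l] by contradiction
      qed
      then show "0 < mass \<omega> (Y a \<omega>)" by (simp add: zero_less_iff_neq_zero)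
    qed
  qed
qed

end

section \<open>The attachment points\<close>

text \<open>Taking predecessors is a bijection from C without its minimum onto C without its
  maximum.\<close>

lemma prod_pred_reindex:
  fixes q :: "nat \<Rightarrow> 'b :: comm_monoid_mult"
  assumes "finite C" "C \<noteq> {}"
  shows "(\<Prod>j\<in>C - {Min C}. q (Max {c\<in>C. c < j})) = (\<Prod>c\<in>C - {Max C}. q c)"
  using assms
proof (induction C rule: finite_linorder_max_induct)
  case (insert b A)
  show ?case
  proof (cases "A = {}")
    case False
    note A = insert.hyps(1) False
    have bA: "b \<notin> A" using insert.hyps(2) by auto
    have mins: "Min (insert b A) = Min A" "Max (insert b A) = b"
      using A insert.hyps(2) Min_in[OF A] by (auto simp: Min_insert Max_insert min_def max_def not_less[symmetric])
    have "insert b A - {Min (insert b A)} = insert b (A - {Min A})"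
      unfolding mins using bA Min_in[OF A] by auto
    moreover have "{c \<in> insert b A. c < b} = A" using insert.hyps(2) by auto
    moreover have "{c \<in> insert b A. c < j} = {c \<in> A. c < j}" if "j \<in> A" for j
      using insert.hyps(2) that by auto
    ultimately have "(\<Prod>j\<in>insert b A - {Min (insert b A)}. q (Max {c\<in>insert b A. c < j}))
        = q (Max A) * (\<Prod>j\<in>A - {Min A}. q (Max {c\<in>A. c < j}))"
      using bA A by simp
    also have "\<dots> = q (Max A) * (\<Prod>c\<in>A - {Max A}. q c)" using insert.IH[OF False] by simp
    also have "\<dots> = (\<Prod>c\<in>A. q c)" using A by (simp add: prod.remove[OF A(1) Max_in[OF A]])
    also have "\<dots> = (\<Prod>c\<in>insert b A - {Max (insert b A)}. q c)" unfolding mins using bA by simp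
    finally show ?thesis .
  qed simp
qed simp

context prob_space
begin

text \<open>
  Rounding the \<open>F\<close>-measurable end points up to dyadic numbers reduces random intervals to fixed ones.
\<close>

lemma random_interval:
  fixes Z C B :: "'a \<Rightarrow> real" and N :: "'a \<Rightarrow> real measure"
  assumes F: "subalgebra M F" and W: "W \<in> sets M" and Z: "Z \<in> borel_measurable M"
    and CB: "C \<in> borel_measurable F" "B \<in> borel_measurable F"
    and V: "V \<in> borel_measurable M" "\<And>\<omega>. V \<omega> \<le> (1 :: ennreal)"
    and N: "\<And>\<omega>. sets (N \<omega>) = sets borel" "\<And>\<omega> S. emeasure (N \<omega>) S \<le> 1"
      "\<And>S. S \<in> sets borel \<Longrightarrow> (\<lambda>\<omega>. emeasure (N \<omega>) S) \<in> borel_measurable F"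
    and H: "\<And>A S. A \<in> sets F \<Longrightarrow> S \<in> sets borel \<Longrightarrow>
      emeasure M (A \<inter> W \<inter> {\<omega>\<in>space M. Z \<omega> \<in> S}) = (\<integral>\<^sup>+\<omega>\<in>A. V \<omega> * emeasure (N \<omega>) S \<partial>M)"
  shows "(\<lambda>\<omega>. emeasure (N \<omega>) {C \<omega><..B \<omega>}) \<in> borel_measurable F"
    and "A \<in> sets F \<Longrightarrow> emeasure M (A \<inter> W \<inter> {\<omega>\<in>space M. Z \<omega> \<in> {C \<omega><..B \<omega>}})
      = (\<integral>\<^sup>+\<omega>\<in>A. V \<omega> * emeasure (N \<omega>) {C \<omega><..B \<omega>} \<partial>M)"
proof -
  \<comment> \<open>The rounding is strictly upwards (floor plus 1). At z = C this excludes z and at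
    z = B it includes z, so the indicators of the rounded intervals converge pointwise to that of
    the half-open interval.\<close>
  define up :: "nat \<Rightarrow> real \<Rightarrow> real" where "up n r = of_int (\<lfloor>r * 2 ^ n\<rfloor> + 1) / 2 ^ n" for n r
  have up_gt: "r < up n r" and up_le: "up n r \<le> r + 1 / 2 ^ n" for n r
  proof -
    have "r * 2 ^ n < of_int (\<lfloor>r * 2 ^ n\<rfloor> + 1)" "of_int (\<lfloor>r * 2 ^ n\<rfloor> + 1) \<le> r * 2 ^ n + 1" by linarith+
    then show "r < up n r" "up n r \<le> r + 1 / 2 ^ n"
      unfolding up_def by (simp_all add: field_simps)
  qed
  have up_lim: "(\<lambda>n. up n r) \<longlonglongrightarrow> r" for r
  proof (rule real_tendsto_sandwich[OF _ _ tendsto_const])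
    have "(\<lambda>n. r + 1 / 2 ^ n) \<longlonglongrightarrow> r + 0" by (intro tendsto_intros) real_asymp
    then show "(\<lambda>n. r + 1 / 2 ^ n) \<longlonglongrightarrow> r" by simp
    show "\<forall>\<^sub>F n in sequentially. r \<le> up n r" using less_imp_le[OF up_gt] by simp
    show "\<forall>\<^sub>F n in sequentially. up n r \<le> r + 1 / 2 ^ n" using up_le by simp
  qed
  define S where "S n m = {of_int (int_decode (fst (prod_decode m)) + 1) / 2 ^ n
      <..of_int (int_decode (snd (prod_decode m)) + 1) / (2 ^ n :: real)}" for n m
  \<comment> \<open>Both rounded end points are coded in one natural number, so the random interval
    takes countably many values.\<close>
  define f where "f n \<omega> = prod_encode (int_encode \<lfloor>C \<omega> * 2 ^ n\<rfloor>, int_encode \<lfloor>B \<omega> * 2 ^ n\<rfloor>)" for n :: nat and \<omega>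
  have Sf: "S n (f n \<omega>) = {up n (C \<omega>)<..up n (B \<omega>)}" for n \<omega>
    unfolding S_def f_def up_def by simp
  have S: "S n m \<in> sets borel" for n m unfolding S_def by simp
  have fF: "f n \<in> measurable F (count_space UNIV)" for n
  proof -
    note [measurable] = CB
    have "(\<lambda>\<omega>. (\<lambda>c b. prod_encode (int_encode c, int_encode b)) \<lfloor>C \<omega> * 2 ^ n\<rfloor> \<lfloor>B \<omega> * 2 ^ n\<rfloor>)
        \<in> measurable F (count_space UNIV)"
      by measurable
    then show ?thesis unfolding f_def .
  qed
  have fM: "f n \<in> measurable M (count_space UNIV)" for n
    by (rule measurable_from_subalg[OF F fF])
  have spF: "space F = space M" using F unfolding subalgebra_def by simp
  have ind_lim: "(\<lambda>n. indicator (S n (f n \<omega>)) z :: ennreal) \<longlonglongrightarrow> indicator {C \<omega><..B \<omega>} z" for \<omega> z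
  proof (rule tendsto_eventually)
    have 1: "\<forall>\<^sub>F n in sequentially. up n (C \<omega>) < z" if "C \<omega> < z"
      using order_tendstoD(2)[OF up_lim that] .
    have 2: "\<forall>\<^sub>F n in sequentially. up n (B \<omega>) < z" if "B \<omega> < z"
      using order_tendstoD(2)[OF up_lim that] .
    consider "z \<le> C \<omega>" | "C \<omega> < z" "z \<le> B \<omega>" | "B \<omega> < z" by linarith
    then show "\<forall>\<^sub>F n in sequentially. indicator (S n (f n \<omega>)) z = (indicator {C \<omega><..B \<omega>} z :: ennreal)"
    proof cases
      case 1
      then have "z < up n (C \<omega>)" for n using up_gt[of "C \<omega>" n] by linarith
      then show ?thesis using 1 unfolding Sf by (intro always_eventually) (auto simp: indicator_def less_imp_le not_less)
    next
      case c: 2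
      have "z < up n (B \<omega>)" for n using up_gt[of "B \<omega>" n] c by linarith
      then show ?thesis using 1[OF c(1)] c unfolding Sf
        by (auto elim!: eventually_mono simp: indicator_def less_imp_le)
    next
      case 3
      then show ?thesis using 2[OF 3] unfolding Sf
        by (auto elim!: eventually_mono simp: indicator_def)
    qed
  qed
  have N_lim: "(\<lambda>n. emeasure (N \<omega>) (S n (f n \<omega>))) \<longlonglongrightarrow> emeasure (N \<omega>) {C \<omega><..B \<omega>}" for \<omega>
  proof -
    have "(\<lambda>n. \<integral>\<^sup>+z. indicator (S n (f n \<omega>)) z \<partial>N \<omega>) \<longlonglongrightarrow> (\<integral>\<^sup>+z. indicator {C \<omega><..B \<omega>} z \<partial>N \<omega>)"
    proof (rule nn_integral_dominated_convergence[where w = "\<lambda>_. 1"])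
      show "(\<integral>\<^sup>+z. 1 \<partial>N \<omega>) < \<infinity>" using N(2)[of \<omega> "space (N \<omega>)"] by (simp add: le_less_trans)
      show "indicator (S n (f n \<omega>)) \<in> borel_measurable (N \<omega>)" for n
        by (rule borel_measurable_indicator) (simp add: N(1) S)
      show "indicator {C \<omega><..B \<omega>} \<in> borel_measurable (N \<omega>)"
        by (rule borel_measurable_indicator) (simp add: N(1))
      show "AE z in N \<omega>. (\<lambda>n. indicator (S n (f n \<omega>)) z :: ennreal) \<longlonglongrightarrow> indicator {C \<omega><..B \<omega>} z"
        by (rule AE_I2) (rule ind_lim)
    qed (auto simp: indicator_def)
    then show ?thesis using S N(1) by simp
  qed
  have NF: "(\<lambda>\<omega>. emeasure (N \<omega>) (S n (f n \<omega>))) \<in> borel_measurable F" for n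
    by (rule measurable_compose_countable[OF N(3)[OF S] fF])
  show meas: "(\<lambda>\<omega>. emeasure (N \<omega>) {C \<omega><..B \<omega>}) \<in> borel_measurable F"
    by (rule borel_measurable_LIMSEQ_order[OF N_lim NF])
  assume A: "A \<in> sets F"
  have AM: "A \<in> sets M" using A F unfolding subalgebra_def by auto
  have step: "emeasure M (A \<inter> W \<inter> {\<omega>\<in>space M. Z \<omega> \<in> S n (f n \<omega>)})
      = (\<integral>\<^sup>+\<omega>\<in>A. V \<omega> * emeasure (N \<omega>) (S n (f n \<omega>)) \<partial>M)" for n
  proof -
    \<comment> \<open>On \<open>Am m\<close> the rounded interval is the fixed set
      \<open>S n m\<close>, and \<open>H\<close> applies.\<close>
    define Am where "Am m = A \<inter> (f n -` {m} \<inter> space F)" for m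
    have Am: "Am m \<in> sets F" for m
      unfolding Am_def by (intro sets.Int A measurable_sets[OF fF]) simp
    define D where "D m = Am m \<inter> W \<inter> {\<omega>\<in>space M. Z \<omega> \<in> S n m}" for m
    have D: "D m \<in> sets M" for m
    proof -
      have "Am m \<in> sets M" using Am F unfolding subalgebra_def by auto
      moreover have "{\<omega>\<in>space M. Z \<omega> \<in> S n m} \<in> sets M" using Z S by measurable
      ultimately show ?thesis unfolding D_def using W by auto
    qed
    have "A \<inter> W \<inter> {\<omega>\<in>space M. Z \<omega> \<in> S n (f n \<omega>)} = (\<Union>m. D m)"
      unfolding D_def Am_def spF by auto
    also have "emeasure M \<dots> = (\<Sum>m. emeasure M (D m))"
      by (rule suminf_emeasure[symmetric]) (use D in \<open>auto simp: disjoint_family_on_def D_def Am_def\<close>)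
    also have "\<dots> = (\<Sum>m. \<integral>\<^sup>+\<omega>. V \<omega> * emeasure (N \<omega>) (S n m) * indicator (Am m) \<omega> \<partial>M)"
      unfolding D_def by (simp add: H[OF Am S])
    also have "\<dots> = (\<integral>\<^sup>+\<omega>. (\<Sum>m. V \<omega> * emeasure (N \<omega>) (S n m) * indicator (Am m) \<omega>) \<partial>M)"
    proof (rule nn_integral_suminf[symmetric])
      fix m
      have "(\<lambda>\<omega>. emeasure (N \<omega>) (S n m)) \<in> borel_measurable M" by (rule measurable_from_subalg[OF F N(3)[OF S]])
      moreover have "Am m \<in> sets M" using Am F unfolding subalgebra_def by auto
      ultimately show "(\<lambda>\<omega>. V \<omega> * emeasure (N \<omega>) (S n m) * indicator (Am m) \<omega>) \<in> borel_measurable M"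
        using V(1) by measurable
    qed
    also have "\<dots> = (\<integral>\<^sup>+\<omega>\<in>A. V \<omega> * emeasure (N \<omega>) (S n (f n \<omega>)) \<partial>M)"
    proof (rule nn_integral_cong)
      fix \<omega> assume \<omega>: "\<omega> \<in> space M"
      have "(\<Sum>m. V \<omega> * emeasure (N \<omega>) (S n m) * indicator (Am m) \<omega>)
          = (\<Sum>m\<in>{f n \<omega>}. V \<omega> * emeasure (N \<omega>) (S n m) * indicator (Am m) \<omega>)"
        by (rule suminf_finite) (auto simp: Am_def)
      then show "(\<Sum>m. V \<omega> * emeasure (N \<omega>) (S n m) * indicator (Am m) \<omega>)
          = V \<omega> * emeasure (N \<omega>) (S n (f n \<omega>)) * indicator A \<omega>"
        using \<omega> by (simp add: Am_def spF indicator_def)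
    qed
    finally show ?thesis .
  qed
  have mE: "A \<inter> W \<inter> {\<omega>\<in>space M. Z \<omega> \<in> S n (f n \<omega>)} \<in> sets M" for n
  proof -
    have "{\<omega>\<in>space M. up n (C \<omega>) < Z \<omega> \<and> Z \<omega> \<le> up n (B \<omega>)} \<in> sets M"
    proof -
      note [measurable] = measurable_from_subalg[OF F CB(1)] measurable_from_subalg[OF F CB(2)] Z
      show ?thesis unfolding up_def by measurable
    qed
    then show ?thesis using AM W unfolding Sf by (auto simp: greaterThanAtMost_iff)
  qed
  have mE': "A \<inter> W \<inter> {\<omega>\<in>space M. Z \<omega> \<in> {C \<omega><..B \<omega>}} \<in> sets M"
  proof -
    note [measurable] = measurable_from_subalg[OF F CB(1)] measurable_from_subalg[OF F CB(2)] Z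
    have "{\<omega>\<in>space M. C \<omega> < Z \<omega> \<and> Z \<omega> \<le> B \<omega>} \<in> sets M" by measurable
    then show ?thesis using AM W by (auto simp: greaterThanAtMost_iff)
  qed
  have "(\<lambda>n. \<integral>\<^sup>+\<omega>. indicator (A \<inter> W \<inter> {\<omega>\<in>space M. Z \<omega> \<in> S n (f n \<omega>)}) \<omega> \<partial>M)
      \<longlonglongrightarrow> (\<integral>\<^sup>+\<omega>. indicator (A \<inter> W \<inter> {\<omega>\<in>space M. Z \<omega> \<in> {C \<omega><..B \<omega>}}) \<omega> \<partial>M)"
  proof (rule nn_integral_dominated_convergence[where w = "\<lambda>_. 1"])
    show "AE \<omega> in M. (\<lambda>n. indicator (A \<inter> W \<inter> {\<omega>\<in>space M. Z \<omega> \<in> S n (f n \<omega>)}) \<omega> :: ennreal)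
        \<longlonglongrightarrow> indicator (A \<inter> W \<inter> {\<omega>\<in>space M. Z \<omega> \<in> {C \<omega><..B \<omega>}}) \<omega>"
    proof (rule AE_I2)
      fix \<omega> assume \<omega>: "\<omega> \<in> space M"
      have eq: "indicator (A \<inter> W \<inter> {\<omega>\<in>space M. Z \<omega> \<in> D \<omega>}) \<omega> = (indicator (A \<inter> W) \<omega> * indicator (D \<omega>) (Z \<omega>) :: ennreal)" for D
        using \<omega> by (simp add: indicator_def)
      show "(\<lambda>n. indicator (A \<inter> W \<inter> {\<omega>\<in>space M. Z \<omega> \<in> S n (f n \<omega>)}) \<omega> :: ennreal)
        \<longlonglongrightarrow> indicator (A \<inter> W \<inter> {\<omega>\<in>space M. Z \<omega> \<in> {C \<omega><..B \<omega>}}) \<omega>"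
        unfolding eq by (intro tendsto_mult_ennreal tendsto_const ind_lim) (auto simp: indicator_def)
    qed
    show "(\<integral>\<^sup>+\<omega>. 1 \<partial>M) < \<infinity>" by (simp add: emeasure_space_1)
    show "indicator (A \<inter> W \<inter> {\<omega>\<in>space M. Z \<omega> \<in> S n (f n \<omega>)}) \<in> borel_measurable M" for n
      by (rule borel_measurable_indicator[OF mE])
    show "indicator (A \<inter> W \<inter> {\<omega>\<in>space M. Z \<omega> \<in> {C \<omega><..B \<omega>}}) \<in> borel_measurable M"
      by (rule borel_measurable_indicator[OF mE'])
  qed (auto simp: indicator_def)
  then have L1: "(\<lambda>n. emeasure M (A \<inter> W \<inter> {\<omega>\<in>space M. Z \<omega> \<in> S n (f n \<omega>)}))
      \<longlonglongrightarrow> emeasure M (A \<inter> W \<inter> {\<omega>\<in>space M. Z \<omega> \<in> {C \<omega><..B \<omega>}})"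
    using mE mE' by simp
  have le1: "V \<omega> * emeasure (N \<omega>) R * indicator A \<omega> \<le> 1" for \<omega> R
    using mult_mono[OF V(2)[of \<omega>] N(2)[of \<omega> R]] by (simp add: indicator_def)
  have L2: "(\<lambda>n. \<integral>\<^sup>+\<omega>\<in>A. V \<omega> * emeasure (N \<omega>) (S n (f n \<omega>)) \<partial>M)
      \<longlonglongrightarrow> (\<integral>\<^sup>+\<omega>\<in>A. V \<omega> * emeasure (N \<omega>) {C \<omega><..B \<omega>} \<partial>M)"
  proof (rule nn_integral_dominated_convergence[where w = "\<lambda>_. 1"])
    fix n
    note [measurable] = measurable_from_subalg[OF F NF] measurable_from_subalg[OF F meas] V(1) AM
    show "(\<lambda>\<omega>. V \<omega> * emeasure (N \<omega>) (S n (f n \<omega>)) * indicator A \<omega>) \<in> borel_measurable M"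
      "(\<lambda>\<omega>. V \<omega> * emeasure (N \<omega>) {C \<omega><..B \<omega>} * indicator A \<omega>) \<in> borel_measurable M"
      by measurable
    show "AE \<omega> in M. (\<lambda>n. V \<omega> * emeasure (N \<omega>) (S n (f n \<omega>)) * indicator A \<omega>)
        \<longlonglongrightarrow> V \<omega> * emeasure (N \<omega>) {C \<omega><..B \<omega>} * indicator A \<omega>"
    proof (rule AE_I2)
      fix \<omega>
      have "V \<omega> \<noteq> \<top>" using V(2)[of \<omega>] by (auto simp: top_unique)
      moreover have "emeasure (N \<omega>) {C \<omega><..B \<omega>} \<noteq> \<top>" using N(2)[of \<omega> "{C \<omega><..B \<omega>}"] by (auto simp: top_unique)
      ultimately show "(\<lambda>n. V \<omega> * emeasure (N \<omega>) (S n (f n \<omega>)) * indicator A \<omega>)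
        \<longlonglongrightarrow> V \<omega> * emeasure (N \<omega>) {C \<omega><..B \<omega>} * indicator A \<omega>"
        by (intro tendsto_mult_ennreal tendsto_const N_lim) (auto simp: indicator_def ennreal_mult_eq_top_iff)
    qed
    show "(\<integral>\<^sup>+\<omega>. 1 \<partial>M) < \<infinity>" by (simp add: emeasure_space_1)
  qed (use le1 in auto)
  show "emeasure M (A \<inter> W \<inter> {\<omega>\<in>space M. Z \<omega> \<in> {C \<omega><..B \<omega>}})
      = (\<integral>\<^sup>+\<omega>\<in>A. V \<omega> * emeasure (N \<omega>) {C \<omega><..B \<omega>} \<partial>M)"
    by (rule LIMSEQ_unique[OF L1]) (use L2 in \<open>simp only: step\<close>)
qed

end

section \<open>Attachment points, conditionally on the atoms and the branch points\<close>

context icrt_process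
begin

abbreviation "pZ j \<omega> \<equiv> icrt_p \<theta> (\<lambda>i. X i \<omega>) (Y j \<omega>)"

lemma sets_pZ: "sets (pZ j \<omega>) = sets borel"
  unfolding icrt_p_def by simp

lemma emeasure_pZ: "S \<in> sets borel \<Longrightarrow> emeasure (pZ j \<omega>) S = emeasure (\<mu> \<omega>) ({0..Y j \<omega>} \<inter> S) / mass \<omega> (Y j \<omega>)"
  unfolding icrt_p_def by (rule emeasure_uniform_measure) auto

lemma emeasure_pZ_le_1: "emeasure (pZ j \<omega>) S \<le> 1"
proof (cases "S \<in> sets borel")
  case True
  have "emeasure (pZ j \<omega>) S \<le> mass \<omega> (Y j \<omega>) / mass \<omega> (Y j \<omega>)"
    unfolding emeasure_pZ[OF True] by (intro divide_right_mono_ennreal emeasure_mono) auto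
  also have "\<dots> \<le> 1" by (cases "mass \<omega> (Y j \<omega>) = 0 \<or> mass \<omega> (Y j \<omega>) = \<top>") (auto simp: less_top)
  finally show ?thesis .
next
  case False
  then show ?thesis using sets_pZ[of \<omega> j] by (simp add: emeasure_notin_sets)
qed

text \<open>The Lebesgue part of a set with a random end point is written as the integral of a
  jointly measurable indicator.\<close>

lemma measurable_pZ:
  assumes S: "S \<in> sets borel" and j: "1 \<le> j"
  shows "(\<lambda>\<omega>. emeasure (pZ j \<omega>) S) \<in> borel_measurable FXY"
proof -
  note [measurable] = Y_FXY[OF j] S
  have 1: "(\<lambda>\<omega>. mass \<omega> (Y j \<omega>)) \<in> borel_measurable FXY"
    by (rule measurable_mass[OF X_FXY]) measurable
  have "(\<lambda>(\<omega>, t). indicator S t * (if 0 \<le> t \<and> t \<le> Y j \<omega> then 1 else 0) :: ennreal) \<in> borel_measurable (FXY \<Otimes>\<^sub>M lborel)"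
    by measurable
  then have "(\<lambda>\<omega>. \<integral>\<^sup>+t. indicator S t * (if 0 \<le> t \<and> t \<le> Y j \<omega> then 1 else 0) \<partial>lborel) \<in> borel_measurable FXY"
    by (rule lborel.borel_measurable_nn_integral)
  moreover have "(\<integral>\<^sup>+t. indicator S t * (if 0 \<le> t \<and> t \<le> Y j \<omega> then 1 else 0) \<partial>lborel)
      = emeasure lborel ({0..Y j \<omega>} \<inter> S \<inter> {0..})" for \<omega>
  proof -
    have "(\<integral>\<^sup>+t. indicator S t * (if 0 \<le> t \<and> t \<le> Y j \<omega> then 1 else 0) \<partial>lborel)
        = (\<integral>\<^sup>+t. indicator ({0..Y j \<omega>} \<inter> S \<inter> {0..}) t \<partial>lborel)"
      by (intro nn_integral_cong) (auto simp: indicator_def)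
    then show ?thesis by simp
  qed
  ultimately have 2: "(\<lambda>\<omega>. emeasure lborel ({0..Y j \<omega>} \<inter> S \<inter> {0..})) \<in> borel_measurable FXY" by simp
  have 3: "(\<lambda>\<omega>. atom_mass i ({0..Y j \<omega>} \<inter> S) \<omega>) \<in> borel_measurable FXY" for i
  proof (cases "Suc i \<in> atoms \<theta>")
    case True
    note [measurable] = X_FXY[OF True]
    have "(\<lambda>\<omega>. ennreal (\<theta> (Suc i)) * (if 0 \<le> X (Suc i) \<omega> \<and> X (Suc i) \<omega> \<le> Y j \<omega> \<and> X (Suc i) \<omega> \<in> S then 1 else 0)) \<in> borel_measurable FXY"
      by measurable
    moreover have "(if 0 \<le> X (Suc i) \<omega> \<and> X (Suc i) \<omega> \<le> Y j \<omega> \<and> X (Suc i) \<omega> \<in> S then 1 else 0)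
        = (indicator ({0..Y j \<omega>} \<inter> S) (X (Suc i) \<omega>) :: ennreal)" for \<omega>
      by (simp add: indicator_def)
    ultimately show ?thesis using True unfolding atom_mass_def by simp
  qed (simp add: atom_mass_def)
  have B: "{0..Y j \<omega>} \<inter> S \<in> sets borel" for \<omega> using S by auto
  show ?thesis
    unfolding emeasure_pZ[OF S] emeasure_\<mu>[OF B]
    by (intro borel_measurable_divide_ennreal borel_measurable_add borel_measurable_times_ennreal
        borel_measurable_const borel_measurable_suminf_order 1 2 3)
qed

lemma Z_fixed:
  assumes J: "finite J" "J \<subseteq> {1..}" and S: "\<And>j. j \<in> J \<Longrightarrow> S j \<in> sets borel" and A: "A \<in> sets FXY"
  shows "emeasure M (A \<inter> {\<omega>\<in>space M. \<forall>j\<in>J. Z j \<omega> \<in> S j})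
    = (\<integral>\<^sup>+\<omega>\<in>A. (\<Prod>j\<in>J. emeasure (pZ j \<omega>) (S j)) \<partial>M)"
proof -
  note [measurable] = Z_measurable
  have eq: "emeasure (pZ j \<omega>) (S j) = ennreal (measure (pZ j \<omega>) (S j))" for j \<omega>
    by (rule emeasure_eq_ennreal_measure) (use emeasure_pZ_le_1[of \<omega> j "S j"] in \<open>auto simp: top_unique\<close>)
  have "emeasure M (A \<inter> {\<omega>\<in>space M. \<forall>j\<in>J. Z j \<omega> \<in> S j})
      = (\<integral>\<^sup>+\<omega>\<in>A. ennreal (\<Prod>j\<in>J. measure (pZ j \<omega>) (S j)) \<partial>M)"
  proof (rule emeasure_Int_cond_exp[OF subalgebra_FXY _ A])
    show "{\<omega>\<in>space M. \<forall>j\<in>J. Z j \<omega> \<in> S j} \<in> sets M"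
      using J S by (intro sets.sets_Collect_finite_All) (auto intro!: measurable_sets_Collect simp: pred_def)
    show "AE \<omega> in M. real_cond_exp M FXY (indicat_real {\<omega>\<in>space M. \<forall>j\<in>J. Z j \<omega> \<in> S j}) \<omega>
        = (\<Prod>j\<in>J. measure (pZ j \<omega>) (S j))"
      using Z_law[unfolded conditionally_independent_with_laws_def, rule_format, of J S] J S by simp
    show "(\<lambda>\<omega>. \<Prod>j\<in>J. measure (pZ j \<omega>) (S j)) \<in> borel_measurable M"
    proof (rule borel_measurable_prod)
      fix j assume j: "j \<in> J"
      have "(\<lambda>\<omega>. emeasure (pZ j \<omega>) (S j)) \<in> borel_measurable M"
        by (rule measurable_FXY_M[OF measurable_pZ]) (use S J j in auto)
      then show "(\<lambda>\<omega>. measure (pZ j \<omega>) (S j)) \<in> borel_measurable M" unfolding measure_def by measurable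
    qed
  qed (simp add: prod_nonneg)
  then show ?thesis by (simp add: eq prod_ennreal)
qed

text \<open>Induction on the indices with random intervals. \<open>J2\<close> stays general so that
  the next index can first be given a fixed set and then be released by
  \<open>random_interval\<close>; measurability comes along because the following step needs
  it.\<close>

lemma Z_random:
  assumes J1: "finite J1" "J1 \<subseteq> {1..}"
    and CB: "\<And>j. j \<in> J1 \<Longrightarrow> C j \<in> borel_measurable FXY" "\<And>j. j \<in> J1 \<Longrightarrow> B j \<in> borel_measurable FXY"
    and J2: "finite J2" "J2 \<subseteq> {1..}" "J1 \<inter> J2 = {}" and S: "\<And>j. j \<in> J2 \<Longrightarrow> S j \<in> sets borel"
    and A: "A \<in> sets FXY"
  shows "(\<forall>j\<in>J1. (\<lambda>\<omega>. emeasure (pZ j \<omega>) {C j \<omega><..B j \<omega>}) \<in> borel_measurable FXY) \<and>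
    emeasure M (A \<inter> {\<omega>\<in>space M. (\<forall>j\<in>J1. Z j \<omega> \<in> {C j \<omega><..B j \<omega>}) \<and> (\<forall>j\<in>J2. Z j \<omega> \<in> S j)})
    = (\<integral>\<^sup>+\<omega>\<in>A. (\<Prod>j\<in>J1. emeasure (pZ j \<omega>) {C j \<omega><..B j \<omega>}) * (\<Prod>j\<in>J2. emeasure (pZ j \<omega>) (S j)) \<partial>M)"
  using J1 CB J2 S A
proof (induction J1 arbitrary: J2 S A rule: finite_induct)
  case empty
  then show ?case using Z_fixed[of J2 S A] by simp
next
  case (insert j J1)
  note [measurable] = Z_measurable
  have j: "1 \<le> j" "j \<notin> J2" using insert.prems by auto
  define W where "W = {\<omega>\<in>space M. (\<forall>i\<in>J1. Z i \<omega> \<in> {C i \<omega><..B i \<omega>}) \<and> (\<forall>i\<in>J2. Z i \<omega> \<in> S i)}"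
  define V where "V \<omega> = (\<Prod>i\<in>J1. emeasure (pZ i \<omega>) {C i \<omega><..B i \<omega>}) * (\<Prod>i\<in>J2. emeasure (pZ i \<omega>) (S i))" for \<omega>
  have spM: "space M \<in> sets FXY" using sets.top[of FXY] unfolding space_generated_by .
  have IH: "(\<forall>i\<in>J1. (\<lambda>\<omega>. emeasure (pZ i \<omega>) {C i \<omega><..B i \<omega>}) \<in> borel_measurable FXY) \<and>
    emeasure M (A \<inter> {\<omega>\<in>space M. (\<forall>i\<in>J1. Z i \<omega> \<in> {C i \<omega><..B i \<omega>}) \<and> (\<forall>i\<in>J2'. Z i \<omega> \<in> S' i)})
    = (\<integral>\<^sup>+\<omega>\<in>A. (\<Prod>i\<in>J1. emeasure (pZ i \<omega>) {C i \<omega><..B i \<omega>}) * (\<Prod>i\<in>J2'. emeasure (pZ i \<omega>) (S' i)) \<partial>M)"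
    if "finite J2'" "J2' \<subseteq> {1..}" "J1 \<inter> J2' = {}" "\<And>i. i \<in> J2' \<Longrightarrow> S' i \<in> sets borel" "A \<in> sets FXY" for J2' S' A
    by (rule insert.IH) (use insert.prems that in auto)
  have mJ1: "(\<lambda>\<omega>. emeasure (pZ i \<omega>) {C i \<omega><..B i \<omega>}) \<in> borel_measurable FXY" if "i \<in> J1" for i
    using IH[OF finite.emptyI _ _ _ spM, THEN conjunct1] that by blast
  have V1: "V \<omega> \<le> 1" for \<omega>
  proof -
    have "(\<Prod>i\<in>J1. emeasure (pZ i \<omega>) {C i \<omega><..B i \<omega>}) \<le> (\<Prod>i\<in>J1. 1)"
      by (rule prod_mono_ennreal) (rule emeasure_pZ_le_1)
    moreover have "(\<Prod>i\<in>J2. emeasure (pZ i \<omega>) (S i)) \<le> (\<Prod>i\<in>J2. 1)"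
      by (rule prod_mono_ennreal) (rule emeasure_pZ_le_1)
    ultimately show ?thesis unfolding V_def using mult_mono[of _ "1 :: ennreal" _ 1] by simp
  qed
  have VM: "V \<in> borel_measurable M"
    unfolding V_def[abs_def]
  proof (intro borel_measurable_times_ennreal borel_measurable_prod_ennreal measurable_FXY_M)
    fix i assume "i \<in> J2"
    then show "(\<lambda>\<omega>. emeasure (pZ i \<omega>) (S i)) \<in> borel_measurable FXY"
      by (intro measurable_pZ) (use insert.prems in auto)
  qed (rule mJ1)
  have CBM: "i \<in> insert j J1 \<Longrightarrow> C i \<in> borel_measurable M" "i \<in> insert j J1 \<Longrightarrow> B i \<in> borel_measurable M" for i
    by (rule measurable_FXY_M, rule insert.prems, assumption)+
  have WM: "W \<in> sets M"
  proof -
    have "{\<omega>\<in>space M. Z i \<omega> \<in> {C i \<omega><..B i \<omega>}} \<in> sets M" if "i \<in> J1" for i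
    proof -
      have i: "i \<in> insert j J1" using that by simp
      note [measurable] = CBM(1)[OF i] CBM(2)[OF i] Z_measurable[of i]
      have "{\<omega>\<in>space M. C i \<omega> < Z i \<omega> \<and> Z i \<omega> \<le> B i \<omega>} \<in> sets M" by measurable
      then show ?thesis by (simp add: greaterThanAtMost_iff)
    qed
    moreover have "{\<omega>\<in>space M. Z i \<omega> \<in> S i} \<in> sets M" if "i \<in> J2" for i
      using insert.prems(7)[OF that] by measurable
    ultimately show ?thesis
      unfolding W_def using insert.hyps(1) insert.prems(4)
      by (intro sets.sets_Collect_conj sets.sets_Collect_finite_All) auto
  qed
  \<comment> \<open>With j moved to the indices with fixed sets, the induction hypothesis is exactly
    the premise of \<open>random_interval\<close>.\<close>
  have H: "emeasure M (A' \<inter> W \<inter> {\<omega>\<in>space M. Z j \<omega> \<in> R}) = (\<integral>\<^sup>+\<omega>\<in>A'. V \<omega> * emeasure (pZ j \<omega>) R \<partial>M)"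
    if A': "A' \<in> sets FXY" and R: "R \<in> sets borel" for A' R
  proof -
    define S' where "S' i = (if i = j then R else S i)" for i
    have S': "S' j = R" "i \<in> J2 \<Longrightarrow> S' i = S i" for i unfolding S'_def using j(2) by auto
    have 0: "A' \<inter> W \<inter> {\<omega>\<in>space M. Z j \<omega> \<in> R}
        = A' \<inter> {\<omega>\<in>space M. (\<forall>i\<in>J1. Z i \<omega> \<in> {C i \<omega><..B i \<omega>}) \<and> (\<forall>i\<in>insert j J2. Z i \<omega> \<in> S' i)}"
      unfolding W_def by (auto simp: S')
    have 1: "emeasure M (A' \<inter> W \<inter> {\<omega>\<in>space M. Z j \<omega> \<in> R})
        = (\<integral>\<^sup>+\<omega>\<in>A'. (\<Prod>i\<in>J1. emeasure (pZ i \<omega>) {C i \<omega><..B i \<omega>})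
        * (\<Prod>i\<in>insert j J2. emeasure (pZ i \<omega>) (S' i)) \<partial>M)"
      unfolding 0
    proof (rule IH[THEN conjunct2])
      show "finite (insert j J2)" "insert j J2 \<subseteq> {1..}" "J1 \<inter> insert j J2 = {}"
        using insert.prems(4-6) insert.hyps(2) j(1) by auto
      show "S' i \<in> sets borel" if "i \<in> insert j J2" for i
        unfolding S'_def using insert.prems(7)[of i] R that by (cases "i = j") simp_all
    qed (rule A')
    have 2: "(\<Prod>i\<in>insert j J2. emeasure (pZ i \<omega>) (S' i))
        = emeasure (pZ j \<omega>) R * (\<Prod>i\<in>J2. emeasure (pZ i \<omega>) (S i))" for \<omega>
    proof -
      have "(\<Prod>i\<in>J2. emeasure (pZ i \<omega>) (S' i)) = (\<Prod>i\<in>J2. emeasure (pZ i \<omega>) (S i))"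
        by (rule prod.cong[OF refl]) (simp only: S'(2))
      then show ?thesis unfolding prod.insert[OF insert.prems(4) j(2)] by (simp only: S'(1))
    qed
    show ?thesis
      unfolding 1 2 V_def mult.assoc mult.commute[of "emeasure (pZ j _) R"] ..
  qed
  note ri = random_interval[OF subalgebra_FXY WM Z_measurable insert.prems(2,3)[OF insertI1] VM V1 sets_pZ
      emeasure_pZ_le_1 measurable_pZ[OF _ j(1)] H]
  have "A \<inter> {\<omega>\<in>space M. (\<forall>i\<in>insert j J1. Z i \<omega> \<in> {C i \<omega><..B i \<omega>}) \<and> (\<forall>i\<in>J2. Z i \<omega> \<in> S i)}
      = A \<inter> W \<inter> {\<omega>\<in>space M. Z j \<omega> \<in> {C j \<omega><..B j \<omega>}}"
    unfolding W_def by auto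
  also have "emeasure M \<dots> = (\<integral>\<^sup>+\<omega>\<in>A. V \<omega> * emeasure (pZ j \<omega>) {C j \<omega><..B j \<omega>} \<partial>M)"
    by (rule ri(2)) (assumption | rule insert.prems(8))+
  also have "\<dots> = (\<integral>\<^sup>+\<omega>\<in>A. (\<Prod>i\<in>insert j J1. emeasure (pZ i \<omega>) {C i \<omega><..B i \<omega>}) * (\<Prod>i\<in>J2. emeasure (pZ i \<omega>) (S i)) \<partial>M)"
    using insert.hyps by (simp add: V_def ac_simps)
  finally have eq: "emeasure M (A \<inter> {\<omega>\<in>space M. (\<forall>i\<in>insert j J1. Z i \<omega> \<in> {C i \<omega><..B i \<omega>}) \<and> (\<forall>i\<in>J2. Z i \<omega> \<in> S i)})
      = (\<integral>\<^sup>+\<omega>\<in>A. (\<Prod>i\<in>insert j J1. emeasure (pZ i \<omega>) {C i \<omega><..B i \<omega>}) * (\<Prod>i\<in>J2. emeasure (pZ i \<omega>) (S i)) \<partial>M)" .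
  have "(\<lambda>\<omega>. emeasure (pZ j \<omega>) {C j \<omega><..B j \<omega>}) \<in> borel_measurable FXY"
    by (rule ri(1)) assumption+
  then show ?case using eq mJ1 by (intro conjI ballI) (auto simp only: insert_iff)
qed

end

lemma ennreal_inverse_antimono:
  fixes a b :: ennreal
  assumes "a \<le> b" shows "inverse b \<le> inverse a"
proof (cases "a = 0 \<or> b = \<top>")
  case False
  then have "b < \<top>" by (simp add: less_top)
  then have "a < \<top>" using assms by (rule le_less_trans[rotated])
  obtain r where r: "a = ennreal r" "0 < r"
    using False \<open>a < \<top>\<close> by (cases a) (auto simp: less_le)
  obtain s where s: "b = ennreal s" "0 \<le> s" using \<open>b < \<top>\<close> by (cases b) auto
  have "r \<le> s" using assms s unfolding r(1) s(1) by (simp add: ennreal_le_iff)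
  then have "0 < s" "inverse s \<le> inverse r" using r(2) by (auto intro: le_imp_inverse_le)
  then show ?thesis using r s by (simp add: inverse_ennreal ennreal_leI)
qed auto

text \<open>Deleting the maximum, for which there are at most \<open>card I\<close> values, leaves a
  set of at least r elements. Weighting it by exp (card C - r) \<ge> 1 allows the sum to run over
  all subsets, where it becomes the product of the factors 1 + e q, each at most exp (3 q) because e
  \<le> 3.\<close>

lemma sum_chains_le:
  fixes q :: "nat \<Rightarrow> real"
  assumes I: "finite I" and q: "\<And>c. c \<in> I \<Longrightarrow> 0 \<le> q c"
  shows "(\<Sum>C\<in>{C. C \<subseteq> I \<and> r < card C}. \<Prod>c\<in>C - {Max C}. q c) \<le> card I * exp (3 * sum q I - real r)"
proof -
  define \<C> where "\<C> = {C. C \<subseteq> I \<and> r < card C}"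
  define \<D> where "\<D> = {C. C \<subseteq> I \<and> r \<le> card C}"
  define g where "g C = (Max C, C - {Max C})" for C :: "nat set"
  define f where "f = (\<lambda>p :: nat \<times> nat set. \<Prod>c\<in>snd p. q c)"
  have fin: "finite \<C>" "finite \<D>" unfolding \<C>_def \<D>_def using I by auto
  have C: "finite C" "Max C \<in> C" if "C \<in> \<C>" for C
  proof -
    show "finite C" using that I finite_subset unfolding \<C>_def by blast
    moreover have "C \<noteq> {}" using that unfolding \<C>_def by auto
    ultimately show "Max C \<in> C" by simp
  qed
  have inj: "inj_on g \<C>"
  proof (rule inj_onI)
    fix C C' assume "C \<in> \<C>" "C' \<in> \<C>" "g C = g C'"
    then show "C = C'" unfolding g_def using C(2)[of C] C(2)[of C'] by (metis insert_Diff prod.inject)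
  qed
  have sub: "g ` \<C> \<subseteq> I \<times> \<D>"
  proof
    fix p assume "p \<in> g ` \<C>"
    then obtain C where CC: "C \<in> \<C>" "p = g C" by blast
    have "card (C - {Max C}) = card C - 1" using C[OF CC(1)] by simp
    then show "p \<in> I \<times> \<D>" using CC C[OF CC(1)] unfolding g_def \<C>_def \<D>_def by auto
  qed
  have f0: "0 \<le> f p" if "p \<in> I \<times> \<D>" for p
    using that q unfolding f_def \<D>_def by (auto intro!: prod_nonneg)
  have "(\<Sum>C\<in>\<C>. \<Prod>c\<in>C - {Max C}. q c) = (\<Sum>C\<in>\<C>. f (g C))" unfolding f_def g_def by simp
  also have "\<dots> = sum f (g ` \<C>)" using sum.reindex[OF inj, of f] by simp
  also have "\<dots> \<le> sum f (I \<times> \<D>)" using I fin sub f0 by (intro sum_mono2) auto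
  also have "\<dots> = card I * (\<Sum>C\<in>\<D>. \<Prod>c\<in>C. q c)"
    using sum.cartesian_product[of "\<lambda>_ C. \<Prod>c\<in>C. q c" \<D> I] unfolding f_def by (simp add: case_prod_beta')
  also have "\<dots> \<le> card I * exp (3 * sum q I - real r)"
  proof (rule mult_left_mono)
    have "(\<Sum>C\<in>\<D>. \<Prod>c\<in>C. q c) \<le> (\<Sum>C\<in>\<D>. exp (- real r) * (\<Prod>c\<in>C. exp 1 * q c))"
    proof (rule sum_mono)
      fix C assume C: "C \<in> \<D>"
      have "1 \<le> exp (real (card C) - real r)" using C unfolding \<D>_def by simp
      moreover have "0 \<le> (\<Prod>c\<in>C. q c)" using C q unfolding \<D>_def by (auto intro!: prod_nonneg)
      ultimately have "(\<Prod>c\<in>C. q c) \<le> exp (real (card C) - real r) * (\<Prod>c\<in>C. q c)"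
        using mult_right_mono[of 1 "exp (real (card C) - real r)" "\<Prod>c\<in>C. q c"] by simp
      also have "exp (real (card C) - real r) = exp (- real r) * exp 1 ^ card C"
        by (simp add: exp_of_nat_mult[symmetric] mult_exp_exp)
      finally show "(\<Prod>c\<in>C. q c) \<le> exp (- real r) * (\<Prod>c\<in>C. exp 1 * q c)"
        by (simp add: prod.distrib mult.assoc)
    qed
    also have "\<dots> \<le> (\<Sum>C\<in>Pow I. exp (- real r) * (\<Prod>c\<in>C. exp 1 * q c))"
    proof (rule sum_mono2)
      fix C assume "C \<in> Pow I - \<D>"
      then show "0 \<le> exp (- real r) * (\<Prod>c\<in>C. exp 1 * q c)"
        using q by (intro mult_nonneg_nonneg prod_nonneg) auto
    qed (use I in \<open>auto simp: \<D>_def\<close>)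
    also have "\<dots> = exp (- real r) * (\<Prod>c\<in>I. exp 1 * q c + 1)"
      by (simp add: prod_add[OF I] sum_distrib_left)
    also have "\<dots> \<le> exp (- real r) * (\<Prod>c\<in>I. exp (3 * q c))"
    proof (intro mult_left_mono prod_mono conjI)
      fix c assume c: "c \<in> I"
      show "0 \<le> exp 1 * q c + 1" using q[OF c] by simp
      have "exp 1 * q c + 1 \<le> exp (exp 1 * q c)" using exp_ge_add_one_self[of "exp 1 * q c"] by linarith
      also have "\<dots> \<le> exp (3 * q c)" using exp_le q[OF c] by (simp add: mult_right_mono)
      finally show "exp 1 * q c + 1 \<le> exp (3 * q c)" .
    qed simp
    also have "\<dots> = exp (3 * sum q I - real r)"
      by (simp add: exp_sum[OF I, symmetric] sum_distrib_left mult_exp_exp)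
    finally show "(\<Sum>C\<in>\<D>. \<Prod>c\<in>C. q c) \<le> exp (3 * sum q I - real r)" .
  qed simp
  finally show ?thesis unfolding \<C>_def .
qed

section \<open>Chains of attachments within one scale\<close>

context icrt_process
begin

lemma AE_Y_facts: "AE \<omega> in M. Y 0 \<omega> = 0 \<and> strict_mono (\<lambda>i. Y i \<omega>) \<and> (\<forall>i\<ge>1. 0 < Y i \<omega>)"
  using Y_increasing AE_Y_pos AE_space
proof eventually_elim
  case (elim \<omega>)
  have 1: "0 < Y 1 \<omega>" using elim(1,2) by force
  have "Y i \<omega> < Y (Suc i) \<omega>" for i using elim 1 Y_0[of \<omega>] by (cases i) auto
  then have sm: "strict_mono (\<lambda>i. Y i \<omega>)" by (simp add: strict_mono_Suc_iff)
  have "0 < Y i \<omega>" if "1 \<le> i" for i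
    using strict_monoD[OF sm, of 0 i] that Y_0[of \<omega>] elim(3) by simp
  then show ?case using sm Y_0 elim(3) by simp
qed

text \<open>\<open>Z_random\<close> speaks of left-open intervals; the left end - 1 keeps the point
  0 inside.\<close>

lemma AE_pZ_prob: "AE \<omega> in M. \<forall>i\<ge>1. emeasure (pZ i \<omega>) {- 1<..Y i \<omega>} = 1"
  using AE_Y_facts AE_mass_finite AE_mass_Y_pos
proof eventually_elim
  case (elim \<omega>)
  show ?case
  proof (intro allI impI)
    fix i :: nat assume i: "1 \<le> i"
    have "{0..Y i \<omega>} \<inter> {- 1<..Y i \<omega>} = {0..Y i \<omega>}" by auto
    moreover have "0 < mass \<omega> (Y i \<omega>)" "mass \<omega> (Y i \<omega>) < \<infinity>" using elim i by auto
    ultimately show "emeasure (pZ i \<omega>) {- 1<..Y i \<omega>} = 1" by (simp add: emeasure_pZ)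
  qed
qed

lemma AE_Z_range: "AE \<omega> in M. \<forall>i\<ge>1. 0 \<le> Z i \<omega> \<and> Z i \<omega> \<le> Y i \<omega>"
proof -
  have spM: "space M \<in> sets FXY" using sets.top[of FXY] unfolding space_generated_by .
  have "AE \<omega> in M. 0 \<le> Z i \<omega> \<and> Z i \<omega> \<le> Y i \<omega>" if i: "1 \<le> i" for i
  proof -
    note [measurable] = Z_measurable Y_measurable
    have "emeasure M (space M \<inter> {\<omega>\<in>space M. (\<forall>j\<in>{i}. Z j \<omega> \<in> {- 1<..Y j \<omega>}) \<and> (\<forall>j\<in>{}. Z j \<omega> \<in> {})})
      = (\<integral>\<^sup>+\<omega>\<in>space M. (\<Prod>j\<in>{i}. emeasure (pZ j \<omega>) {- 1<..Y j \<omega>}) * (\<Prod>j\<in>{}. emeasure (pZ j \<omega>) {}) \<partial>M)"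
      by (rule Z_random[THEN conjunct2]) (use i spM Y_FXY[OF i] in auto)
    also have "\<dots> = (\<integral>\<^sup>+\<omega>. 1 \<partial>M)"
      by (rule nn_integral_cong_AE) (use AE_pZ_prob AE_space in \<open>eventually_elim, use i in auto\<close>)
    also have "\<dots> = 1" by (simp add: emeasure_space_1)
    finally have "emeasure M {\<omega>\<in>space M. - 1 < Z i \<omega> \<and> Z i \<omega> \<le> Y i \<omega>} = 1"
      by (simp add: Int_def conj_commute)
    then have 1: "AE \<omega> in M. - 1 < Z i \<omega> \<and> Z i \<omega> \<le> Y i \<omega>"
      by (subst AE_iff_emeasure_eq_1) auto
    have "emeasure M (space M \<inter> {\<omega>\<in>space M. \<forall>j\<in>{i}. Z j \<omega> \<in> {..<0}})
      = (\<integral>\<^sup>+\<omega>\<in>space M. (\<Prod>j\<in>{i}. emeasure (pZ j \<omega>) {..<0}) \<partial>M)"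
      by (rule Z_fixed) (use i spM in auto)
    also have "\<dots> = 0"
    proof -
      have "{0..Y i \<omega>} \<inter> {..<0} = {}" for \<omega> by auto
      then show ?thesis by (simp add: emeasure_pZ)
    qed
    finally have "emeasure M {\<omega>\<in>space M. Z i \<omega> < 0} = 0" by (simp add: Int_def)
    then have "{\<omega>\<in>space M. Z i \<omega> < 0} \<in> null_sets M" by (intro null_setsI) auto
    then have "AE \<omega> in M. \<omega> \<notin> {\<omega>\<in>space M. Z i \<omega> < 0}" by (rule AE_not_in)
    then show ?thesis using 1 AE_space by eventually_elim auto
  qed
  then show ?thesis by (subst AE_all_countable) (auto simp: AE_all_countable)
qed

lemma measurable_\<mu>_Ioc:
  assumes C: "C \<in> borel_measurable FXY" and B: "B \<in> borel_measurable FXY"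
  shows "(\<lambda>\<omega>. emeasure (\<mu> \<omega>) {C \<omega><..B \<omega>}) \<in> borel_measurable FXY"
proof -
  note [measurable] = C B
  have "(\<lambda>(\<omega>, t). (if C \<omega> < t \<and> t \<le> B \<omega> \<and> 0 \<le> t then 1 else 0) :: ennreal) \<in> borel_measurable (FXY \<Otimes>\<^sub>M lborel)"
    by measurable
  then have "(\<lambda>\<omega>. \<integral>\<^sup>+t. (if C \<omega> < t \<and> t \<le> B \<omega> \<and> 0 \<le> t then 1 else 0) \<partial>lborel) \<in> borel_measurable FXY"
    by (rule lborel.borel_measurable_nn_integral)
  moreover have "(\<integral>\<^sup>+t. (if C \<omega> < t \<and> t \<le> B \<omega> \<and> 0 \<le> t then 1 else 0) \<partial>lborel)
      = emeasure lborel ({C \<omega><..B \<omega>} \<inter> {0..})" for \<omega>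
  proof -
    have "(\<integral>\<^sup>+t. (if C \<omega> < t \<and> t \<le> B \<omega> \<and> 0 \<le> t then 1 else 0) \<partial>lborel)
        = (\<integral>\<^sup>+t. indicator ({C \<omega><..B \<omega>} \<inter> {0..}) t \<partial>lborel)"
      by (intro nn_integral_cong) (auto simp: indicator_def)
    then show ?thesis by simp
  qed
  ultimately have 2: "(\<lambda>\<omega>. emeasure lborel ({C \<omega><..B \<omega>} \<inter> {0..})) \<in> borel_measurable FXY" by simp
  have 3: "(\<lambda>\<omega>. atom_mass i {C \<omega><..B \<omega>} \<omega>) \<in> borel_measurable FXY" for i
  proof (cases "Suc i \<in> atoms \<theta>")
    case True
    note [measurable] = X_FXY[OF True]
    have "(\<lambda>\<omega>. ennreal (\<theta> (Suc i)) * (if C \<omega> < X (Suc i) \<omega> \<and> X (Suc i) \<omega> \<le> B \<omega> then 1 else 0)) \<in> borel_measurable FXY"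
      by measurable
    moreover have "(if C \<omega> < X (Suc i) \<omega> \<and> X (Suc i) \<omega> \<le> B \<omega> then 1 else 0)
        = (indicator {C \<omega><..B \<omega>} (X (Suc i) \<omega>) :: ennreal)" for \<omega>
      by (simp add: indicator_def)
    ultimately show ?thesis using True unfolding atom_mass_def by simp
  qed (simp add: atom_mass_def)
  have S: "{C \<omega><..B \<omega>} \<in> sets borel" for \<omega> by simp
  show ?thesis
    unfolding emeasure_\<mu>[OF S]
    by (intro borel_measurable_add borel_measurable_times_ennreal borel_measurable_const
        borel_measurable_suminf_order 2 3)
qed

definition branch_mass :: "nat \<Rightarrow> 'a \<Rightarrow> ennreal" where
  "branch_mass c \<omega> = emeasure (\<mu> \<omega>) {Y c \<omega><..Y (Suc c) \<omega>}"

lemma measurable_branch_mass: "1 \<le> c \<Longrightarrow> branch_mass c \<in> borel_measurable FXY"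
  unfolding branch_mass_def[abs_def] by (intro measurable_\<mu>_Ioc Y_FXY) auto

definition scale :: "real \<Rightarrow> real \<Rightarrow> 'a \<Rightarrow> nat set" where
  "scale L0 L1 \<omega> = {c. L0 \<le> Y c \<omega> \<and> Y c \<omega> < L1}"

text \<open>On \<open>chain C\<close> each element of \<open>C\<close> is glued to the branch of its predecessor in \<open>C\<close>.\<close>

definition chain :: "nat set \<Rightarrow> 'a set" where
  "chain C = {\<omega>\<in>space M. \<forall>j\<in>C - {Min C}.
     Z j \<omega> \<in> {Y (Max {c\<in>C. c < j}) \<omega><..Y (Suc (Max {c\<in>C. c < j})) \<omega>}}"

lemma pred_in:
  fixes C :: "nat set"
  assumes "finite C" "j \<in> C - {Min C}"
  shows "Max {c\<in>C. c < j} \<in> C" "Max {c\<in>C. c < j} < j"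
proof -
  have "C \<noteq> {}" using assms(2) by auto
  then have "Min C \<in> {c\<in>C. c < j}" using assms Min_in[of C] Min_le[of C j] by (auto simp: less_le)
  then have "Max {c\<in>C. c < j} \<in> {c\<in>C. c < j}" using assms(1) by (intro Max_in) auto
  then show "Max {c\<in>C. c < j} \<in> C" "Max {c\<in>C. c < j} < j" by auto
qed

lemma sets_chain:
  assumes "C \<subseteq> {1..N}" shows "chain C \<in> sets M"
proof -
  note [measurable] = Z_measurable Y_measurable
  have "finite C" using assms finite_subset by blast
  then have "{\<omega>\<in>space M. \<forall>j\<in>C - {Min C}. Y (Max {c\<in>C. c < j}) \<omega> < Z j \<omega> \<and> Z j \<omega> \<le> Y (Suc (Max {c\<in>C. c < j})) \<omega>} \<in> sets M"
    by measurable
  then show ?thesis unfolding chain_def by (simp add: greaterThanAtMost_iff)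
qed

text \<open>The bounds on the gluing probabilities then sum to at most \<rho>. The event is
  determined by X and Y, so gluing can still be conditioned on it; the cutoff N leaves finitely many
  chains.\<close>

definition chain_good :: "real \<Rightarrow> real \<Rightarrow> real \<Rightarrow> nat \<Rightarrow> 'a set" where
  "chain_good L0 L1 \<rho> N = {\<omega>\<in>space M. 0 < mass \<omega> L0 \<and> mass \<omega> L0 < \<infinity> \<and>
     (\<Sum>c\<in>{1..N}. branch_mass c \<omega> * indicator {L0..<L1} (Y c \<omega>)) \<le> ennreal \<rho> * mass \<omega> L0}"

lemma chain_good_FXY: "chain_good L0 L1 \<rho> N \<in> sets FXY"
proof -
  have [measurable]: "(\<lambda>\<omega>. mass \<omega> L0) \<in> borel_measurable FXY" by (rule measurable_mass[OF X_FXY]) auto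
  have [measurable]: "(\<lambda>\<omega>. \<Sum>c\<in>{1..N}. branch_mass c \<omega> * indicator {L0..<L1} (Y c \<omega>)) \<in> borel_measurable FXY"
  proof (rule borel_measurable_sum)
    fix c assume "c \<in> {1..N}"
    then have c: "1 \<le> c" by simp
    note [measurable] = measurable_branch_mass[OF c] Y_FXY[OF c]
    show "(\<lambda>\<omega>. branch_mass c \<omega> * indicator {L0..<L1} (Y c \<omega>)) \<in> borel_measurable FXY" by measurable
  qed
  have "{\<omega>\<in>space FXY. 0 < mass \<omega> L0 \<and> mass \<omega> L0 < \<infinity> \<and>
     (\<Sum>c\<in>{1..N}. branch_mass c \<omega> * indicator {L0..<L1} (Y c \<omega>)) \<le> ennreal \<rho> * mass \<omega> L0} \<in> sets FXY"
    by measurable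
  then show ?thesis unfolding chain_good_def space_generated_by .
qed

text \<open>The gluings are conditionally independent. As \<open>L0 \<le> Y j\<close>, the
  normalising mass for j is at least \<open>mass \<omega> L0\<close>; the product over predecessors
  is then reindexed by the branches that receive a gluing.\<close>

lemma emeasure_chain_le:
  assumes C: "C \<subseteq> {1..N}" "C \<noteq> {}"
  shows "emeasure M (chain_good L0 L1 \<rho> N \<inter> {\<omega>\<in>space M. C \<subseteq> scale L0 L1 \<omega>} \<inter> chain C)
    \<le> (\<integral>\<^sup>+\<omega>. indicator (chain_good L0 L1 \<rho> N \<inter> {\<omega>\<in>space M. C \<subseteq> scale L0 L1 \<omega>}) \<omega>
        * (\<Prod>c\<in>C - {Max C}. branch_mass c \<omega> / mass \<omega> L0) \<partial>M)"
proof -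
  have fC: "finite C" using C finite_subset by blast
  define pr where "pr j = Max {c\<in>C. c < j}" for j
  have pr: "pr j \<in> C" if "j \<in> C - {Min C}" for j using pred_in[OF fC that] unfolding pr_def by auto
  have pr1: "1 \<le> pr j" if "j \<in> C - {Min C}" for j using pr[OF that] C by auto
  define A where "A = chain_good L0 L1 \<rho> N \<inter> {\<omega>\<in>space M. C \<subseteq> scale L0 L1 \<omega>}"
  have A: "A \<in> sets FXY"
  proof -
    have "{\<omega>\<in>space FXY. \<forall>c\<in>C. L0 \<le> Y c \<omega> \<and> Y c \<omega> < L1} \<in> sets FXY"
    proof (rule sets.sets_Collect_finite_All[OF _ fC])
      fix c assume "c \<in> C"
      then have c: "1 \<le> c" using C by auto
      note [measurable] = Y_FXY[OF c]
      show "{\<omega>\<in>space FXY. L0 \<le> Y c \<omega> \<and> Y c \<omega> < L1} \<in> sets FXY" by measurable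
    qed
    also have "{\<omega>\<in>space FXY. \<forall>c\<in>C. L0 \<le> Y c \<omega> \<and> Y c \<omega> < L1} = {\<omega>\<in>space M. C \<subseteq> scale L0 L1 \<omega>}"
      unfolding scale_def space_generated_by by auto
    finally show ?thesis unfolding A_def using chain_good_FXY by (intro sets.Int)
  qed
  have "A \<inter> chain C = A \<inter> {\<omega>\<in>space M. (\<forall>j\<in>C - {Min C}. Z j \<omega> \<in> {Y (pr j) \<omega><..Y (Suc (pr j)) \<omega>}) \<and> (\<forall>j\<in>{}. Z j \<omega> \<in> {})}"
    unfolding chain_def pr_def by simp
  also have "emeasure M \<dots> = (\<integral>\<^sup>+\<omega>\<in>A. (\<Prod>j\<in>C - {Min C}. emeasure (pZ j \<omega>) {Y (pr j) \<omega><..Y (Suc (pr j)) \<omega>})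
      * (\<Prod>j\<in>{}. emeasure (pZ j \<omega>) {}) \<partial>M)"
  proof (rule Z_random[THEN conjunct2])
    show "finite (C - {Min C})" "C - {Min C} \<subseteq> {1..}" using fC C by auto
    show "Y (pr j) \<in> borel_measurable FXY" if "j \<in> C - {Min C}" for j by (rule Y_FXY[OF pr1[OF that]])
    show "Y (Suc (pr j)) \<in> borel_measurable FXY" for j by (rule Y_FXY) simp
  qed (use A in auto)
  also have "\<dots> \<le> (\<integral>\<^sup>+\<omega>. indicator A \<omega> * (\<Prod>c\<in>C - {Max C}. branch_mass c \<omega> / mass \<omega> L0) \<partial>M)"
  proof (rule nn_integral_mono)
    fix \<omega>
    show "(\<Prod>j\<in>C - {Min C}. emeasure (pZ j \<omega>) {Y (pr j) \<omega><..Y (Suc (pr j)) \<omega>}) * (\<Prod>j\<in>{}. emeasure (pZ j \<omega>) {}) * indicator A \<omega>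
        \<le> indicator A \<omega> * (\<Prod>c\<in>C - {Max C}. branch_mass c \<omega> / mass \<omega> L0)"
    proof (cases "\<omega> \<in> A")
      case True
      have "(\<Prod>j\<in>C - {Min C}. emeasure (pZ j \<omega>) {Y (pr j) \<omega><..Y (Suc (pr j)) \<omega>})
          \<le> (\<Prod>j\<in>C - {Min C}. branch_mass (pr j) \<omega> / mass \<omega> L0)"
      proof (rule prod_mono_ennreal)
        fix j assume j: "j \<in> C - {Min C}"
        have "L0 \<le> Y j \<omega>" using True j unfolding A_def scale_def by auto
        then have "mass \<omega> L0 \<le> mass \<omega> (Y j \<omega>)" by (rule mass_mono)
        moreover have "emeasure (\<mu> \<omega>) ({0..Y j \<omega>} \<inter> {Y (pr j) \<omega><..Y (Suc (pr j)) \<omega>}) \<le> branch_mass (pr j) \<omega>"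
          unfolding branch_mass_def by (intro emeasure_mono) auto
        ultimately show "emeasure (pZ j \<omega>) {Y (pr j) \<omega><..Y (Suc (pr j)) \<omega>} \<le> branch_mass (pr j) \<omega> / mass \<omega> L0"
          by (subst emeasure_pZ) (simp_all add: divide_ennreal_def mult_mono ennreal_inverse_antimono)
      qed
      also have "\<dots> = (\<Prod>c\<in>C - {Max C}. branch_mass c \<omega> / mass \<omega> L0)"
        unfolding pr_def by (rule prod_pred_reindex[OF fC C(2)])
      finally show ?thesis using True by simp
    qed simp
  qed
  finally show ?thesis unfolding A_def .
qed

text \<open>Union bound over all chains. \<open>sum_chains_le\<close> is applied pointwise under the
  integral, since the labels of the scale and their masses are random.\<close>

lemma emeasure_chains_le:
  assumes \<rho>: "0 \<le> \<rho>"
  shows "emeasure M (\<Union>C\<in>{C. C \<subseteq> {1..N} \<and> r < card C}.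
      chain_good L0 L1 \<rho> N \<inter> {\<omega>\<in>space M. C \<subseteq> scale L0 L1 \<omega>} \<inter> chain C)
    \<le> ennreal (real N * exp (3 * \<rho> - real r))"
proof -
  define \<C> where "\<C> = {C. C \<subseteq> {1..N} \<and> r < card C}"
  have fin: "finite \<C>" unfolding \<C>_def by simp
  define G where "G = chain_good L0 L1 \<rho> N"
  define A where "A C = G \<inter> {\<omega>\<in>space M. C \<subseteq> scale L0 L1 \<omega>}" for C
  have AM: "A C \<in> sets M" if "C \<in> \<C>" for C
  proof -
    note [measurable] = Y_measurable
    have "finite C" using that finite_subset unfolding \<C>_def by blast
    then have "{\<omega>\<in>space M. \<forall>c\<in>C. L0 \<le> Y c \<omega> \<and> Y c \<omega> < L1} \<in> sets M" by measurable
    then have "{\<omega>\<in>space M. C \<subseteq> scale L0 L1 \<omega>} \<in> sets M" unfolding scale_def by (simp add: subset_iff Ball_def)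
    then show ?thesis unfolding A_def G_def using sets_FXY[OF chain_good_FXY] by auto
  qed
  have "emeasure M (\<Union>C\<in>\<C>. A C \<inter> chain C) \<le> (\<Sum>C\<in>\<C>. emeasure M (A C \<inter> chain C))"
  proof (rule emeasure_subadditive_finite[OF fin])
    show "(\<lambda>C. A C \<inter> chain C) ` \<C> \<subseteq> sets M"
      using AM sets_chain[of _ N] unfolding \<C>_def by blast
  qed
  also have "\<dots> \<le> (\<Sum>C\<in>\<C>. \<integral>\<^sup>+\<omega>. indicator (A C) \<omega> * (\<Prod>c\<in>C - {Max C}. branch_mass c \<omega> / mass \<omega> L0) \<partial>M)"
  proof (rule sum_mono)
    fix C assume "C \<in> \<C>"
    then have "C \<subseteq> {1..N}" "C \<noteq> {}" unfolding \<C>_def by auto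
    then show "emeasure M (A C \<inter> chain C) \<le> (\<integral>\<^sup>+\<omega>. indicator (A C) \<omega> * (\<Prod>c\<in>C - {Max C}. branch_mass c \<omega> / mass \<omega> L0) \<partial>M)"
      unfolding A_def G_def by (rule emeasure_chain_le)
  qed
  also have "\<dots> = (\<integral>\<^sup>+\<omega>. (\<Sum>C\<in>\<C>. indicator (A C) \<omega> * (\<Prod>c\<in>C - {Max C}. branch_mass c \<omega> / mass \<omega> L0)) \<partial>M)"
  proof (rule nn_integral_sum[symmetric])
    fix C assume C: "C \<in> \<C>"
    have "branch_mass c \<in> borel_measurable M" if "c \<in> C - {Max C}" for c
      by (rule measurable_FXY_M[OF measurable_branch_mass]) (use that C \<C>_def in auto)
    then show "(\<lambda>\<omega>. indicator (A C) \<omega> * (\<Prod>c\<in>C - {Max C}. branch_mass c \<omega> / mass \<omega> L0)) \<in> borel_measurable M"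
      by (intro borel_measurable_times_ennreal borel_measurable_indicator AM C borel_measurable_prod_ennreal
          borel_measurable_divide_ennreal mass_measurable)
  qed
  also have "\<dots> \<le> (\<integral>\<^sup>+\<omega>. ennreal (real N * exp (3 * \<rho> - real r)) \<partial>M)"
  proof (rule nn_integral_mono)
    fix \<omega>
    show "(\<Sum>C\<in>\<C>. indicator (A C) \<omega> * (\<Prod>c\<in>C - {Max C}. branch_mass c \<omega> / mass \<omega> L0))
        \<le> ennreal (real N * exp (3 * \<rho> - real r))"
    proof (cases "\<omega> \<in> G")
      case False
      then have "(\<Sum>C\<in>\<C>. indicator (A C) \<omega> * (\<Prod>c\<in>C - {Max C}. branch_mass c \<omega> / mass \<omega> L0)) = 0"
        unfolding A_def by (intro sum.neutral) auto
      then show ?thesis by simp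
    next
      case True
      define I where "I = {1..N} \<inter> scale L0 L1 \<omega>"
      have fI: "finite I" "card I \<le> N" unfolding I_def using card_mono[of "{1..N}" "{1..N} \<inter> scale L0 L1 \<omega>"] by auto
      obtain m where m: "mass \<omega> L0 = ennreal m" "0 < m"
        using True unfolding G_def chain_good_def by (cases "mass \<omega> L0") auto
      have S: "(\<Sum>c\<in>I. branch_mass c \<omega>) \<le> ennreal (\<rho> * m)"
      proof -
        have "(\<Sum>c\<in>I. branch_mass c \<omega>) = (\<Sum>c\<in>I. branch_mass c \<omega> * indicator {L0..<L1} (Y c \<omega>))"
          by (intro sum.cong) (auto simp: I_def scale_def)
        also have "\<dots> \<le> (\<Sum>c\<in>{1..N}. branch_mass c \<omega> * indicator {L0..<L1} (Y c \<omega>))"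
          by (intro sum_mono2) (auto simp: I_def)
        also have "\<dots> \<le> ennreal \<rho> * mass \<omega> L0" using True unfolding G_def chain_good_def by simp
        finally show ?thesis unfolding m(1) using \<rho> m(2) by (simp add: ennreal_mult)
      qed
      define b where "b c = enn2real (branch_mass c \<omega>)" for c
      have b: "branch_mass c \<omega> = ennreal (b c)" "0 \<le> b c" if c: "c \<in> I" for c
      proof -
        have "branch_mass c \<omega> \<le> (\<Sum>c\<in>I. branch_mass c \<omega>)" using fI c by (intro member_le_sum) auto
        also note S
        also have "ennreal (\<rho> * m) < \<top>" by simp
        finally have "branch_mass c \<omega> < \<top>" .
        then show "branch_mass c \<omega> = ennreal (b c)" "0 \<le> b c" unfolding b_def by auto
      qed
      have bs: "sum b I \<le> \<rho> * m"
      proof -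
        have "ennreal (sum b I) = (\<Sum>c\<in>I. branch_mass c \<omega>)"
          using b by (subst sum_ennreal[symmetric]) auto
        then have "ennreal (sum b I) \<le> ennreal (\<rho> * m)" using S by metis
        then show ?thesis using \<rho> m(2) by (subst (asm) ennreal_le_iff) auto
      qed
      define q where "q c = b c / m" for c
      have q: "branch_mass c \<omega> / mass \<omega> L0 = ennreal (q c)" "0 \<le> q c" if "c \<in> I" for c
        unfolding q_def m(1) b(1)[OF that] using b(2)[OF that] m(2) by (simp_all add: divide_ennreal)
      have qs: "sum q I \<le> \<rho>"
        unfolding q_def sum_divide_distrib[symmetric] using bs m(2) by (simp add: divide_le_eq)
      \<comment> \<open>Sets with a label off the scale contribute nothing, so the random set I
        replaces {1..N}.\<close>
      have "(\<Sum>C\<in>\<C>. indicator (A C) \<omega> * (\<Prod>c\<in>C - {Max C}. branch_mass c \<omega> / mass \<omega> L0))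
          = (\<Sum>C\<in>{C. C \<subseteq> I \<and> r < card C}. indicator (A C) \<omega> * (\<Prod>c\<in>C - {Max C}. branch_mass c \<omega> / mass \<omega> L0))"
      proof (rule sum.mono_neutral_right[OF fin])
        show "{C. C \<subseteq> I \<and> r < card C} \<subseteq> \<C>" unfolding I_def \<C>_def by auto
        show "\<forall>C\<in>\<C> - {C. C \<subseteq> I \<and> r < card C}.
            indicator (A C) \<omega> * (\<Prod>c\<in>C - {Max C}. branch_mass c \<omega> / mass \<omega> L0) = 0"
        proof
          fix C assume "C \<in> \<C> - {C. C \<subseteq> I \<and> r < card C}"
          then have "\<not> C \<subseteq> scale L0 L1 \<omega>" unfolding \<C>_def I_def by auto
          then show "indicator (A C) \<omega> * (\<Prod>c\<in>C - {Max C}. branch_mass c \<omega> / mass \<omega> L0) = 0"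
            unfolding A_def by simp
        qed
      qed
      also have "\<dots> = (\<Sum>C\<in>{C. C \<subseteq> I \<and> r < card C}. ennreal (\<Prod>c\<in>C - {Max C}. q c))"
      proof (rule sum.cong[OF refl])
        fix C assume "C \<in> {C. C \<subseteq> I \<and> r < card C}"
        then have C: "C \<subseteq> I" by simp
        have "\<omega> \<in> space M" using True unfolding G_def chain_good_def by simp
        then have "\<omega> \<in> A C" using C True unfolding A_def I_def by auto
        moreover have "(\<Prod>c\<in>C - {Max C}. branch_mass c \<omega> / mass \<omega> L0) = (\<Prod>c\<in>C - {Max C}. ennreal (q c))"
          by (rule prod.cong[OF refl]) (use q C in auto)
        moreover have "(\<Prod>c\<in>C - {Max C}. ennreal (q c)) = ennreal (\<Prod>c\<in>C - {Max C}. q c)"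
          by (rule prod_ennreal) (use q(2) C in auto)
        ultimately show "indicator (A C) \<omega> * (\<Prod>c\<in>C - {Max C}. branch_mass c \<omega> / mass \<omega> L0) = ennreal (\<Prod>c\<in>C - {Max C}. q c)"
          by simp
      qed
      also have "\<dots> = ennreal (\<Sum>C\<in>{C. C \<subseteq> I \<and> r < card C}. \<Prod>c\<in>C - {Max C}. q c)"
        by (rule sum_ennreal) (use q in \<open>auto intro!: prod_nonneg\<close>)
      also have "\<dots> \<le> ennreal (real N * exp (3 * \<rho> - real r))"
      proof (rule ennreal_leI)
        have "(\<Sum>C\<in>{C. C \<subseteq> I \<and> r < card C}. \<Prod>c\<in>C - {Max C}. q c) \<le> card I * exp (3 * sum q I - real r)"
          by (rule sum_chains_le[OF fI(1) q(2)])
        also have "\<dots> \<le> real N * exp (3 * \<rho> - real r)"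
          using fI(2) qs by (intro mult_mono) auto
        finally show "(\<Sum>C\<in>{C. C \<subseteq> I \<and> r < card C}. \<Prod>c\<in>C - {Max C}. q c) \<le> real N * exp (3 * \<rho> - real r)" .
      qed
      finally show ?thesis .
    qed
  qed
  also have "\<dots> = ennreal (real N * exp (3 * \<rho> - real r))" by (simp add: emeasure_space_1)
  finally show ?thesis unfolding A_def G_def \<C>_def .
qed

end

section \<open>Branches at dyadic scales\<close>

lemma ex_dyadic:
  fixes t :: real assumes "1 \<le> t" shows "\<exists>k. 2 ^ k \<le> t \<and> t < 2 ^ Suc k"
proof -
  define m where "m = (LEAST m. t < 2 ^ m)"
  obtain m0 where "t < 2 ^ m0" using real_arch_pow[of 2 t] by auto
  then have m: "t < 2 ^ m" unfolding m_def by (rule LeastI)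
  then have "m \<noteq> 0" using assms by (intro notI) simp
  then obtain k where k: "m = Suc k" by (cases m) auto
  have "\<not> t < 2 ^ k" by (rule not_less_Least) (use k in \<open>simp add: m_def\<close>)
  then show ?thesis using m k by (intro exI[of _ k]) simp
qed

section \<open>Ancestors within one scale, for given values of the variables\<close>

context compact_looptree_data
begin

lemma ancestors_less:
  assumes "c \<in> ancestors i" "j \<in> ancestors i" "c < j"
  shows "branch (z j) \<in> ancestors i" "c \<in> ancestors (branch (z j))"
proof -
  let ?f = "\<lambda>j. branch (z j)"
  obtain m where m: "c = (?f ^^ m) i" using assms(1) unfolding ancestors_def by blast
  obtain k where k: "j = (?f ^^ k) i" using assms(2) unfolding ancestors_def by blast
  have "?f j = (?f ^^ Suc k) i" unfolding k by simp
  then show "?f j \<in> ancestors i" unfolding ancestors_def by (rule range_eqI)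
  have "k < m"
  proof (rule ccontr)
    assume "\<not> k < m"
    then have "k = (k - m) + m" by simp
    then have "j = (?f ^^ (k - m)) c" unfolding k m by (metis comp_apply funpow_add)
    then have "j \<in> ancestors c" unfolding ancestors_def by (rule range_eqI)
    then show False using ancestors_le[of j c] assms(3) by simp
  qed
  then have "m = (m - Suc k) + Suc k" by simp
  then have "c = (?f ^^ (m - Suc k)) ((?f ^^ Suc k) i)" unfolding m by (metis comp_apply funpow_add)
  then have "c = (?f ^^ (m - Suc k)) (?f j)" unfolding k by simp
  then show "c \<in> ancestors (?f j)" unfolding ancestors_def by (rule range_eqI)
qed

text \<open>All ancestors below j are at most the parent of j, so the parent is the next smaller
  element of C: the ancestors within a scale form a \<open>chain\<close>. As L0 is positive, the
  parent is not branch 0, whence \<open>z j\<close> is positive and lies on a half-open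
  stick.\<close>

lemma ancestors_pred:
  assumes "0 < L0" and C: "C = {j\<in>ancestors i. L0 \<le> y j \<and> y j < L1}" and j: "j \<in> C - {Min C}"
  shows "z j \<in> {y (Max {c\<in>C. c < j})<..y (Suc (Max {c\<in>C. c < j}))}"
proof -
  let ?p = "branch (z j)"
  have fin: "finite C" unfolding C by simp
  have "C \<noteq> {}" using j by auto
  have m: "Min C \<in> C" "Min C < j"
    using Min_in[OF fin \<open>C \<noteq> {}\<close>] Min_le[OF fin, of j] j by (auto simp: less_le)
  have le: "c \<le> ?p" if "c \<in> C" "c < j" for c
    using ancestors_le[OF ancestors_less(2)[of c i j]] that j unfolding C by simp
  have mp: "L0 \<le> y ?p"
  proof -
    have "L0 \<le> y (Min C)" using m(1) by (subst (asm) C) simp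
    also have "\<dots> \<le> y ?p" using le[OF m] by simp
    finally show ?thesis .
  qed
  have pj: "?p < j" using m(2) by (intro branch_z_less) simp
  have p: "?p \<in> C"
  proof -
    have "?p \<in> ancestors i" by (rule ancestors_less(1)[of "Min C" i j]) (use m j in \<open>auto simp: C\<close>)
    moreover have "y ?p < L1"
    proof -
      have "y ?p < y j" using pj by simp
      also have "\<dots> < L1" using j unfolding C by simp
      finally show ?thesis .
    qed
    ultimately show ?thesis using mp unfolding C by simp
  qed
  have "Max {c\<in>C. c < j} = ?p" using fin p pj le by (intro Max_eqI) auto
  moreover have "0 < z j"
  proof (rule ccontr)
    assume "\<not> 0 < z j"
    then have "z j = 0" using z_range[of j] by simp
    then have "?p \<le> 0" using branch_le[of "z j" 0] y_nonneg by simp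
    then show False using mp y0 assms(1) by simp
  qed
  ultimately show ?thesis using y_branch_less[of "z j"] le_y_branch[of "z j"] by simp
qed

text \<open>Group the ancestors by dyadic scale: scale k costs at most \<open>r k * a k\<close>, and
  a tail of this series is small uniformly in i.\<close>

lemma chain_mass_small:
  fixes a :: "nat \<Rightarrow> real"
  assumes few: "\<And>k i. K \<le> k \<Longrightarrow> card {j\<in>ancestors i. 2 ^ k \<le> y j \<and> y j < 2 ^ Suc k} \<le> r k"
    and light: "\<And>k j. K \<le> k \<Longrightarrow> 2 ^ k \<le> y j \<Longrightarrow> y j < 2 ^ Suc k \<Longrightarrow> measure \<mu> {y j<..y (Suc j)} \<le> a k"
    and sum: "summable (\<lambda>k. real (r k) * a k)" and a0: "\<And>k. 0 \<le> a k" and e: "0 < e"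
  shows "\<exists>n\<ge>1. \<forall>i. chain_mass n i \<le> e"
proof -
  let ?g = "\<lambda>k. real (r k) * a k"
  have g0: "0 \<le> ?g k" for k using a0 by simp
  obtain K0 where K0: "\<And>m n. K0 \<le> m \<Longrightarrow> norm (sum ?g {m..<n}) < e"
    using sum e unfolding summable_Cauchy by blast
  define K1 where "K1 = max K K0"
  \<comment> \<open>Every stick of index at least n then starts at a scale from \<open>K1\<close>
    on.\<close>
  obtain n where n: "2 ^ K1 < y n" using y_unbounded by blast
  obtain \<kappa> where \<kappa>: "\<And>t::real. 1 \<le> t \<Longrightarrow> 2 ^ \<kappa> t \<le> t \<and> t < 2 ^ Suc (\<kappa> t)"
    using ex_dyadic by metis
  have "n \<noteq> 0" using n y0 by (intro notI) (simp add: not_less)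
  moreover have "chain_mass n i \<le> e" for i
  proof -
    define S where "S = ancestors i \<inter> {n..}"
    define m where "m = (\<lambda>j. measure \<mu> {y j<..y (Suc j)})"
    have fin: "finite S" unfolding S_def by simp
    have y2: "2 ^ K1 < y j" if "j \<in> S" for j
    proof -
      have "y n \<le> y j" using that unfolding S_def by simp
      then show ?thesis using n by linarith
    qed
    have \<kappa>y: "2 ^ \<kappa> (y j) \<le> y j" "y j < 2 ^ Suc (\<kappa> (y j))" "K1 \<le> \<kappa> (y j)" if "j \<in> S" for j
    proof -
      have "(1::real) \<le> 2 ^ K1" by simp
      then have "1 \<le> y j" using y2[OF that] by linarith
      from \<kappa>[OF this] show 1: "2 ^ \<kappa> (y j) \<le> y j" "y j < 2 ^ Suc (\<kappa> (y j))" by auto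
      have "(2::real) ^ K1 < 2 ^ Suc (\<kappa> (y j))" using y2[OF that] 1(2) by linarith
      then have "K1 < Suc (\<kappa> (y j))" by (rule power_less_imp_less_exp[rotated]) simp
      then show "K1 \<le> \<kappa> (y j)" by simp
    qed
    define I where "I = (\<lambda>j. \<kappa> (y j)) ` S"
    have I: "finite I" "\<And>k. k \<in> I \<Longrightarrow> K1 \<le> k" unfolding I_def using fin \<kappa>y(3) by auto
    have "chain_mass n i = sum m S" unfolding chain_mass_def S_def m_def ..
    also have "\<dots> = (\<Sum>k\<in>I. sum m {j\<in>S. \<kappa> (y j) = k})"
      unfolding I_def by (rule sum.image_gen[OF fin])
    also have "\<dots> \<le> sum ?g I"
    proof (rule sum_mono)
      fix k assume "k \<in> I"
      then have k: "K \<le> k" using I(2) unfolding K1_def by fastforce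
      have "sum m {j\<in>S. \<kappa> (y j) = k} \<le> real (card {j\<in>S. \<kappa> (y j) = k}) * a k"
      proof (rule sum_bounded_above)
        fix j assume "j \<in> {j\<in>S. \<kappa> (y j) = k}"
        then show "m j \<le> a k" unfolding m_def using light[OF k, of j] \<kappa>y(1,2)[of j] by auto
      qed
      also have "\<dots> \<le> ?g k"
      proof (rule mult_right_mono)
        have "card {j\<in>S. \<kappa> (y j) = k} \<le> card {j\<in>ancestors i. 2 ^ k \<le> y j \<and> y j < 2 ^ Suc k}"
        proof (rule card_mono)
          show "{j\<in>S. \<kappa> (y j) = k} \<subseteq> {j\<in>ancestors i. 2 ^ k \<le> y j \<and> y j < 2 ^ Suc k}"
          proof
            fix j assume j: "j \<in> {j\<in>S. \<kappa> (y j) = k}"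
            then show "j \<in> {j\<in>ancestors i. 2 ^ k \<le> y j \<and> y j < 2 ^ Suc k}"
              using \<kappa>y(1,2)[of j] unfolding S_def by auto
          qed
        qed simp
        then show "real (card {j\<in>S. \<kappa> (y j) = k}) \<le> real (r k)" using few[OF k, of i] by linarith
      qed (rule a0)
      finally show "sum m {j\<in>S. \<kappa> (y j) = k} \<le> ?g k" .
    qed
    \<comment> \<open>The inserted 0 gives \<open>Max\<close> a meaning when no ancestor is
      left.\<close>
    also have "\<dots> \<le> sum ?g {K1..<Suc (Max (insert 0 I))}"
    proof (rule sum_mono2)
      show "I \<subseteq> {K1..<Suc (Max (insert 0 I))}"
      proof
        fix k assume "k \<in> I"
        then show "k \<in> {K1..<Suc (Max (insert 0 I))}"
          using I(2)[of k] Max_ge[of "insert 0 I" k] I(1) by (simp add: less_Suc_eq_le)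
      qed
    qed (use g0 in auto)
    also have "sum ?g {K1..<Suc (Max (insert 0 I))} \<le> e" using K0[of K1 "Suc (Max (insert 0 I))"] unfolding K1_def by simp
    finally show ?thesis .
  qed
  ultimately show ?thesis by (intro exI[of _ n]) simp
qed

end

section \<open>Almost sure bounds at scale 2^k\<close>

context icrt_process
begin

abbreviation "mb k \<equiv> mean_mass (2 ^ k)"

text \<open>The mesh at scale k. Once \<mu>[0,2^k] is at least \<open>mb k / 4\<close>, the rate of
  a cell is at least k^2 / 4, and exp (- k^2 / 4) beats the number of cells.\<close>

definition gap :: "nat \<Rightarrow> real" where "gap k = (real k)\<^sup>2 / mb k"

definition cell :: "nat \<Rightarrow> nat \<Rightarrow> real set" where
  "cell k q = {2 ^ k + real q * gap k<..2 ^ k + real q * gap k + gap k}"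

lemma mb_pos: "0 < mb k" by (rule mean_mass_pos) simp

lemma gap_nonneg: "0 \<le> gap k" using mb_pos[of k] unfolding gap_def by simp

lemma gap_mb: "gap k * mb k = (real k)\<^sup>2" using mb_pos[of k] unfolding gap_def by simp

lemma mb_mono: "mb 0 \<le> mb k" by (rule mean_mass_mono) auto

lemma cell_borel [simp]: "cell k q \<in> sets borel" unfolding cell_def by simp

lemma summable_bigo_squares:
  fixes f :: "nat \<Rightarrow> real"
  assumes "f \<in> O(\<lambda>k. 1 / (real k)\<^sup>2)" shows "summable f"
proof (rule summable_comparison_test_bigo[OF _ assms])
  show "summable (\<lambda>k. norm (1 / (real k)\<^sup>2))"
    using inverse_power_summable[of 2, where 'a = real] by (simp add: field_simps)
qed

text \<open>As \<open>mb k \<le> 2 ^ k\<close>, the mesh is at least 2^-k for k at least 1, so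
  branches of the scale start at cell positions q up to 4^k; cell q + 1 is used as well.\<close>

lemma prob_cells:
  fixes A :: "nat \<Rightarrow> 'a set"
  assumes "\<And>q. q \<le> 4 ^ k + 1 \<Longrightarrow> A q \<in> sets M" "\<And>q. q \<le> 4 ^ k + 1 \<Longrightarrow> prob (A q) \<le> b"
  shows "(\<Union>q\<in>{..4 ^ k + 1}. A q) \<in> sets M" "prob (\<Union>q\<in>{..4 ^ k + 1}. A q) \<le> (4 ^ k + 2) * b"
proof -
  show "(\<Union>q\<in>{..4 ^ k + 1}. A q) \<in> sets M" using assms(1) by (intro sets.finite_UN) auto
  have "prob (\<Union>q\<in>{..4 ^ k + 1}. A q) \<le> (\<Sum>q\<in>{..4 ^ k + 1}. prob (A q))"
    by (rule finite_measure_subadditive_finite) (use assms(1) in auto)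
  also have "\<dots> \<le> real (card {..4 ^ k + (1::nat)}) * b"
    by (rule sum_bounded_above) (use assms(2) in auto)
  also have "\<dots> = (4 ^ k + 2) * b" by simp
  finally show "prob (\<Union>q\<in>{..4 ^ k + 1}. A q) \<le> (4 ^ k + 2) * b" .
qed

lemma summable_cells:
  fixes c :: real assumes "0 < c" shows "summable (\<lambda>k. (4 ^ k + 2) * exp (- c * (real k)\<^sup>2))"
  by (rule summable_bigo_squares) (use assms in real_asymp)

lemma AE_mass_ge: "AE \<omega> in M. \<forall>\<^sub>F k in sequentially. ennreal (mb k / 4) < mass \<omega> (2 ^ k)"
proof -
  let ?A = "\<lambda>k. {\<omega>\<in>space M. mass \<omega> (2 ^ k) \<le> ennreal (mb k / 4)}"
  have "AE \<omega> in M. \<forall>\<^sub>F k in sequentially. \<omega> \<notin> ?A k"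
  proof (rule AE_eventually_not)
    show "?A k \<in> sets M" for k by measurable
    fix k :: nat
    have "prob (?A k) \<le> exp (- (2 ^ k) * mb k / 4)" using prob_mass_small[of "2 ^ k"] by simp
    also have "\<dots> \<le> exp (- (mb 0 / 4) * 2 ^ k)" using mb_mono[of k] by simp
    finally show "prob (?A k) \<le> exp (- (mb 0 / 4) * 2 ^ k)" .
  next
    define c where "c = mb 0 / 4"
    have "0 < c" using mb_pos[of 0] unfolding c_def by simp
    then have "(\<lambda>k. exp (- c * 2 ^ k)) \<in> O(\<lambda>k. 1 / (real k)\<^sup>2)" by real_asymp
    then show "summable (\<lambda>k. exp (- (mb 0 / 4) * 2 ^ k))" unfolding c_def by (rule summable_bigo_squares)
  qed
  then show ?thesis using AE_space
    by eventually_elim (auto elim!: eventually_mono)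
qed

text \<open>The bound on the mass is a premise because it depends on X only: the void probability is
  computed conditionally on X.\<close>

lemma AE_not_void:
  "AE \<omega> in M. \<forall>\<^sub>F k in sequentially. \<forall>q\<le>4 ^ k + 1. ennreal (mb k / 4) < mass \<omega> (2 ^ k) \<longrightarrow> (\<exists>i\<ge>1. Y i \<omega> \<in> cell k q)"
proof -
  let ?E = "\<lambda>k. {\<omega>\<in>space M. ennreal (mb k / 4) < mass \<omega> (2 ^ k)}"
  let ?A = "\<lambda>k q. ?E k \<inter> void (cell k q)"
  have E: "?E k \<in> sets FX" for k
  proof -
    have [measurable]: "(\<lambda>\<omega>. mass \<omega> (2 ^ k)) \<in> borel_measurable FX" by (rule measurable_mass[OF X_FX]) auto
    have "{\<omega>\<in>space FX. ennreal (mb k / 4) < mass \<omega> (2 ^ k)} \<in> sets FX" by measurable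
    then show ?thesis unfolding space_generated_by .
  qed
  have A: "?A k q \<in> sets M" for k q using sets_FX[OF E] sets_void[of "cell k q"] by simp
  have p: "prob (?A k q) \<le> exp (- (1/4) * (real k)\<^sup>2)" for k q
  proof -
    have "prob (?A k q) \<le> exp (- gap k * (mb k / 4))"
      unfolding cell_def
    proof (rule prob_void[OF E gap_nonneg])
      fix \<omega> assume "\<omega> \<in> ?E k"
      then have "ennreal (mb k / 4) \<le> mass \<omega> (2 ^ k)" by (auto intro: less_imp_le)
      also have "\<dots> \<le> mass \<omega> (2 ^ k + real q * gap k)" using gap_nonneg by (intro mass_mono) simp
      finally show "ennreal (mb k / 4) \<le> mass \<omega> (2 ^ k + real q * gap k)" .
    qed (use mb_pos[of k] in simp)
    also have "- gap k * (mb k / 4) = - (1/4) * (real k)\<^sup>2" using gap_mb[of k] by simp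
    finally show ?thesis .
  qed
  have "AE \<omega> in M. \<forall>\<^sub>F k in sequentially. \<omega> \<notin> (\<Union>q\<in>{..4 ^ k + 1}. ?A k q)"
    by (rule AE_eventually_not[OF prob_cells(1)[OF A p] prob_cells(2)[OF A p] summable_cells]) auto
  then show ?thesis using AE_space
  proof eventually_elim
    case (elim \<omega>)
    from elim(1) show ?case
    proof eventually_elim
      case (elim k)
      with \<open>\<omega> \<in> space M\<close> show ?case unfolding void_eq by auto
    qed
  qed
qed

text \<open>\<open>prob_mass_Ioc\<close> with l = 2^k and h = \<open>gap k\<close> gives the
  exponent k^2 / 2 - k^2 for this threshold.\<close>

lemma AE_cell_mass:
  "AE \<omega> in M. \<forall>\<^sub>F k in sequentially. \<forall>q\<le>4 ^ k + 1. emeasure (\<mu> \<omega>) (cell k q) \<le> ennreal (2 * (real k)\<^sup>2 / 2 ^ k)"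
proof -
  let ?A = "\<lambda>k q. {\<omega>\<in>space M. ennreal (2 * (real k)\<^sup>2 / 2 ^ k) < emeasure (\<mu> \<omega>) (cell k q)}"
  have A: "?A k q \<in> sets M" for k q by (rule sets_less_\<mu>) simp
  have p: "prob (?A k q) \<le> exp (- (1/2) * (real k)\<^sup>2)" for k q
  proof -
    have "prob (?A k q) \<le> exp (gap k * mb k / 2 - 2 ^ k * (2 * (real k)\<^sup>2 / 2 ^ k) / 2)"
      unfolding cell_def using gap_nonneg by (intro prob_mass_Ioc) auto
    also have "gap k * mb k / 2 - 2 ^ k * (2 * (real k)\<^sup>2 / 2 ^ k) / 2 = - (1/2) * (real k)\<^sup>2"
      unfolding gap_mb by simp
    finally show ?thesis .
  qed
  have "AE \<omega> in M. \<forall>\<^sub>F k in sequentially. \<omega> \<notin> (\<Union>q\<in>{..4 ^ k + 1}. ?A k q)"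
    by (rule AE_eventually_not[OF prob_cells(1)[OF A p] prob_cells(2)[OF A p] summable_cells]) auto
  then show ?thesis using AE_space
  proof eventually_elim
    case (elim \<omega>)
    from elim(1) show ?case
    proof eventually_elim
      case (elim k)
      with \<open>\<omega> \<in> space M\<close> show ?case by (auto simp: not_less)
    qed
  qed
qed

text \<open>Markov's inequality is enough here; the factor k^2 makes its bounds summable.\<close>

lemma AE_mass_growth:
  "AE \<omega> in M. \<forall>\<^sub>F k in sequentially. mass \<omega> (4 * 2 ^ k) \<le> ennreal ((real k)\<^sup>2 * (4 * mb k))"
proof -
  let ?A = "\<lambda>k. {\<omega>\<in>space M. ennreal ((real k)\<^sup>2 * mean_mass (4 * 2 ^ k)) < mass \<omega> (4 * 2 ^ k)}"
  have "AE \<omega> in M. \<forall>\<^sub>F k in sequentially. \<omega> \<notin> ?A k"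
  proof (rule AE_eventually_not)
    show "?A k \<in> sets M" for k by measurable
    show "prob (?A k) \<le> 1 / (real k)\<^sup>2" if "1 \<le> k" for k
      by (rule prob_mass_large) (use that in auto)
    show "summable (\<lambda>k. 1 / (real k)\<^sup>2)" using inverse_power_summable[of 2, where 'a = real] by (simp add: field_simps)
  qed
  then show ?thesis using AE_space
  proof eventually_elim
    case (elim \<omega>)
    from elim(1) show ?case
    proof eventually_elim
      case (elim k)
      with \<open>\<omega> \<in> space M\<close> have "mass \<omega> (4 * 2 ^ k) \<le> ennreal ((real k)\<^sup>2 * mean_mass (4 * 2 ^ k))"
        by (simp add: not_less)
      also have "\<dots> \<le> ennreal ((real k)\<^sup>2 * (4 * mb k))"
        by (intro ennreal_leI mult_left_mono mean_mass_4) auto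
      finally show ?case .
    qed
  qed
qed

text \<open>The mean number of points is at most 2^(k+1) * 2^(k+1) = 4 * 4^k, so the threshold 16^k
  is exceeded with probability at most 4 * 4^-k.\<close>

lemma AE_count:
  "AE \<omega> in M. \<forall>\<^sub>F k in sequentially. finite (points {0..2 ^ Suc k} \<omega>) \<and> card (points {0..2 ^ Suc k} \<omega>) \<le> 16 ^ k"
proof -
  let ?E = "\<lambda>k n. {\<omega>\<in>space M. finite (points {0..2 ^ Suc k} \<omega>) \<and> card (points {0..2 ^ Suc k} \<omega>) = n}"
  let ?A = "\<lambda>k. space M - (\<Union>n\<le>16 ^ k. ?E k n)"
  have "AE \<omega> in M. \<forall>\<^sub>F k in sequentially. \<omega> \<notin> ?A k"
  proof (rule AE_eventually_not)
    fix k :: nat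
    have "?E k n \<in> sets M" for n by (rule sets_points) simp
    then show "?A k \<in> sets M" by (intro sets.Diff sets.top sets.finite_UN) auto
    have l: "(0::real) \<le> 2 ^ Suc k" by simp
    have "prob (?A k) \<le> 2 ^ Suc k * mean_mass (2 ^ Suc k) / real (Suc (16 ^ k))" by (rule prob_count_large[OF l])
    also have "\<dots> \<le> 2 ^ Suc k * 2 ^ Suc k / 16 ^ k"
    proof (rule frac_le)
      show "2 ^ Suc k * mean_mass (2 ^ Suc k) \<le> 2 ^ Suc k * 2 ^ Suc k"
        by (rule mult_left_mono[OF mean_mass_le[OF l] l])
    qed auto
    also have "\<dots> = 4 * (1/4) ^ k"
    proof -
      have "(16::real) ^ k = 2 ^ k * 2 ^ k * 4 ^ k" by (simp flip: power_mult_distrib)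
      then show ?thesis by (simp add: field_simps)
    qed
    finally show "prob (?A k) \<le> 4 * (1/4) ^ k" .
  next
    show "summable (\<lambda>k. 4 * (1/4 :: real) ^ k)" by (intro summable_mult summable_geometric) simp
  qed
  then show ?thesis using AE_space
  proof eventually_elim
    case (elim \<omega>)
    from elim(1) show ?case
    proof eventually_elim
      case (elim k)
      with \<open>\<omega> \<in> space M\<close> show ?case by auto
    qed
  qed
qed

text \<open>\<open>emeasure_chains_le\<close> with N = 16^k, \<rho> = 16 k^2 and r = k^3 leaves 16^k
  exp (48 k^2 - k^3), which is summable.\<close>

lemma AE_chains:
  "AE \<omega> in M. \<forall>\<^sub>F k in sequentially. \<forall>C. C \<subseteq> {1..16 ^ k} \<longrightarrow> C \<subseteq> scale (2 ^ k) (2 ^ Suc k) \<omega> \<longrightarrow>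
     \<omega> \<in> chain_good (2 ^ k) (2 ^ Suc k) (16 * (real k)\<^sup>2) (16 ^ k) \<longrightarrow> \<omega> \<in> chain C \<longrightarrow> card C \<le> k ^ 3"
proof -
  let ?B = "\<lambda>k C. chain_good (2 ^ k) (2 ^ Suc k) (16 * (real k)\<^sup>2) (16 ^ k) \<inter>
      {\<omega>\<in>space M. C \<subseteq> scale (2 ^ k) (2 ^ Suc k) \<omega>} \<inter> chain C"
  let ?A = "\<lambda>k. \<Union>C\<in>{C. C \<subseteq> {1..16 ^ k} \<and> k ^ 3 < card C}. ?B k C"
  have "AE \<omega> in M. \<forall>\<^sub>F k in sequentially. \<omega> \<notin> ?A k"
  proof (rule AE_eventually_not)
    fix k :: nat
    have "?B k C \<in> sets M" if C: "C \<subseteq> {1..16 ^ k}" for C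
    proof -
      note [measurable] = Y_measurable
      have "finite C" using C finite_subset by blast
      then have "{\<omega>\<in>space M. \<forall>c\<in>C. 2 ^ k \<le> Y c \<omega> \<and> Y c \<omega> < 2 ^ Suc k} \<in> sets M" by measurable
      also have "{\<omega>\<in>space M. \<forall>c\<in>C. 2 ^ k \<le> Y c \<omega> \<and> Y c \<omega> < 2 ^ Suc k} = {\<omega>\<in>space M. C \<subseteq> scale (2 ^ k) (2 ^ Suc k) \<omega>}"
        unfolding scale_def by blast
      finally show ?thesis using sets_FXY[OF chain_good_FXY] sets_chain[OF C] by (intro sets.Int)
    qed
    then show "?A k \<in> sets M" by (intro sets.finite_UN) (auto intro: finite_subset[of _ "Pow {1..16 ^ k}"])
    have "emeasure M (?A k) \<le> ennreal (real (16 ^ k) * exp (3 * (16 * (real k)\<^sup>2) - real (k ^ 3)))"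
      by (rule emeasure_chains_le) simp
    then show "prob (?A k) \<le> 16 ^ k * exp (48 * (real k)\<^sup>2 - real k ^ 3)"
      unfolding emeasure_eq_measure by (subst (asm) ennreal_le_iff) simp_all
  next
    show "summable (\<lambda>k. 16 ^ k * exp (48 * (real k)\<^sup>2 - real k ^ 3))"
      by (rule summable_bigo_squares) real_asymp
  qed
  then show ?thesis using AE_space
  proof eventually_elim
    case (elim \<omega>)
    from elim(1) show ?case
    proof eventually_elim
      case (elim k)
      with \<open>\<omega> \<in> space M\<close> show ?case by (auto simp: not_less[symmetric])
    qed
  qed
qed

end

section \<open>The data are almost surely in general position\<close>

lemma (in prob_space) AE_indep_vars_neq:
  fixes V :: "'i \<Rightarrow> 'a \<Rightarrow> real"
  assumes ind: "indep_vars (\<lambda>_. borel) V I" and ij: "i \<in> I" "j \<in> I" "i \<noteq> j"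
    and V: "\<And>c. emeasure (distr M borel (V j)) {c} = 0"
  shows "AE \<omega> in M. V i \<omega> \<noteq> V j \<omega>"
proof (rule AE_indep_neq[OF _ V])
  have "indep_var borel ((\<lambda>f. f i) \<circ> (\<lambda>\<omega>. restrict (\<lambda>i. V i \<omega>) {i})) borel ((\<lambda>f. f j) \<circ> (\<lambda>\<omega>. restrict (\<lambda>i. V i \<omega>) {j}))"
  proof (rule indep_var_compose[OF indep_var_restrict[OF ind, of "{i}" "{j}"]])
    show "(\<lambda>f. f i) \<in> (\<Pi>\<^sub>M i\<in>{i}. borel) \<rightarrow>\<^sub>M borel" by (rule measurable_component_singleton) simp
    show "(\<lambda>f. f j) \<in> (\<Pi>\<^sub>M i\<in>{j}. borel) \<rightarrow>\<^sub>M borel" by (rule measurable_component_singleton) simp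
  qed (use ij in auto)
  moreover have "((\<lambda>f. f i) \<circ> (\<lambda>\<omega>. restrict (\<lambda>i. V i \<omega>) {i})) = V i"
    "((\<lambda>f. f j) \<circ> (\<lambda>\<omega>. restrict (\<lambda>i. V i \<omega>) {j})) = V j" by (auto simp: fun_eq_iff)
  ultimately show "indep_var borel (V i) borel (V j)" by simp
qed

lemma uniform_no_atoms: "emeasure (uniform_measure lborel {0..1 :: real}) {c} = 0"
proof -
  have "emeasure lborel ({0..1} \<inter> {c}) \<le> emeasure lborel {c}" by (rule emeasure_mono) auto
  then have "emeasure lborel ({0..1} \<inter> {c}) = 0" by simp
  then show ?thesis by (simp add: emeasure_uniform_measure)
qed

context icrt_process
begin

lemma X_no_atoms: assumes i: "i \<in> atoms \<theta>" shows "emeasure (distr M borel (X i)) {c} = 0"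
proof -
  note [measurable] = X_measurable[OF i]
  have "emeasure (distr M borel (X i)) {c} = emeasure M (X i -` {c} \<inter> space M)"
    by (rule emeasure_distr) simp_all
  also have "\<dots> = (\<integral>\<^sup>+x. ennreal (exponential_density (\<theta> i) x) * indicator {c} x \<partial>lborel)"
    by (rule distributed_emeasure[OF X_law[OF i]]) simp
  also have "\<dots> = (\<integral>\<^sup>+(x::real). 0 \<partial>lborel)"
  proof (rule nn_integral_cong_AE)
    show "AE x in lborel. ennreal (exponential_density (\<theta> i) x) * indicator {c} x = 0"
      using AE_lborel_singleton[of c] by eventually_elim (simp add: indicator_def)
  qed
  finally show ?thesis by simp
qed

lemma AE_X_inj: "AE \<omega> in M. inj_on (\<lambda>i. X i \<omega>) (atoms \<theta>)"
proof -
  have "AE \<omega> in M. i \<in> atoms \<theta> \<longrightarrow> j \<in> atoms \<theta> \<longrightarrow> i \<noteq> j \<longrightarrow> X i \<omega> \<noteq> X j \<omega>" for i j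
    using AE_indep_vars_neq[OF X_indep, of i j] X_no_atoms[of j]
    by (cases "i \<in> atoms \<theta> \<and> j \<in> atoms \<theta> \<and> i \<noteq> j") auto
  then have "AE \<omega> in M. \<forall>i j. i \<in> atoms \<theta> \<longrightarrow> j \<in> atoms \<theta> \<longrightarrow> i \<noteq> j \<longrightarrow> X i \<omega> \<noteq> X j \<omega>"
    by (simp add: AE_all_countable)
  then show ?thesis
  proof eventually_elim
    case (elim \<omega>)
    then show ?case by (intro inj_onI) blast
  qed
qed

lemma AE_X_nonneg: "AE \<omega> in M. \<forall>i\<in>atoms \<theta>. 0 \<le> X i \<omega>"
proof -
  have "AE \<omega> in M. i \<in> atoms \<theta> \<longrightarrow> 0 \<le> X i \<omega>" for i
  proof (cases "i \<in> atoms \<theta>")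
    case True
    note [measurable] = X_measurable[OF True]
    have "AE \<omega> in M. \<not> X i \<omega> \<le> 0"
      by (rule AE_I[of _ _ "{\<omega>\<in>space M. X i \<omega> \<le> 0}"]) (use prob_X_neg[OF True] in \<open>auto simp: emeasure_eq_measure\<close>)
    then show ?thesis by eventually_elim simp
  qed simp
  then show ?thesis by (simp add: AE_all_countable Ball_def)
qed

lemma U_measurable:
  assumes "1 \<le> i" shows "random_variable borel (UX i)" "random_variable borel (UZ i)"
proof -
  have "random_variable borel (case_sum UX UZ v)" if "v \<in> Inl ` {1..} \<union> Inr ` {1..}" for v
    using U_indep that unfolding indep_vars_def by blast
  from this[of "Inl i"] this[of "Inr i"] show "random_variable borel (UX i)" "random_variable borel (UZ i)"
    using assms by auto
qed

lemma AE_U_range: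
  "AE \<omega> in M. \<forall>i\<ge>1. (0 < UX i \<omega> \<and> UX i \<omega> \<le> 1) \<and> (0 < UZ i \<omega> \<and> UZ i \<omega> \<le> 1 \<and> UZ i \<omega> \<noteq> 1/2)"
proof -
  let ?P = "\<lambda>u::real. 0 < u \<and> u \<le> 1 \<and> u \<noteq> 1/2"
  have *: "AE \<omega> in M. ?P (V \<omega>)" if [measurable]: "random_variable borel V"
    and "distr M borel V = uniform_measure lborel {0..1}" for V
  proof -
    have "AE u in lborel. u \<in> {0..1} \<longrightarrow> ?P u"
      using AE_lborel_singleton[of 0] AE_lborel_singleton[of "1/2"] by eventually_elim auto
    then have "AE u in uniform_measure lborel {0..1}. ?P u" by (intro AE_uniform_measureI) auto
    then have "AE u in distr M borel V. ?P u" by (subst that(2))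
    then show ?thesis by (rule AE_distrD[rotated]) simp
  qed
  have "AE \<omega> in M. 1 \<le> i \<longrightarrow> ?P (UX i \<omega>) \<and> ?P (UZ i \<omega>)" for i
  proof (cases "1 \<le> i")
    case True
    show ?thesis using *[OF U_measurable(1)[OF True] U_law(1)[OF True]] *[OF U_measurable(2)[OF True] U_law(2)[OF True]]
      by eventually_elim simp
  qed simp
  then have "AE \<omega> in M. \<forall>i. 1 \<le> i \<longrightarrow> ?P (UX i \<omega>) \<and> ?P (UZ i \<omega>)" by (simp add: AE_all_countable)
  then show ?thesis by eventually_elim blast
qed

lemma AE_U_distinct:
  "AE \<omega> in M. (\<forall>i\<ge>1. \<forall>j\<ge>1. UX i \<omega> \<noteq> UZ j \<omega>) \<and> inj_on (\<lambda>i. UZ i \<omega>) {1..}"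
proof -
  have atoms: "emeasure (distr M borel (case_sum UX UZ (Inr j))) {c} = 0" if "1 \<le> j" for j c
    using U_law(2)[OF that] uniform_no_atoms by simp
  have 1: "AE \<omega> in M. 1 \<le> i \<longrightarrow> 1 \<le> j \<longrightarrow> UX i \<omega> \<noteq> UZ j \<omega>" for i j
  proof (cases "1 \<le> i \<and> 1 \<le> j")
    case True
    then show ?thesis using AE_indep_vars_neq[OF U_indep, of "Inl i" "Inr j"] atoms[of j] by simp
  qed auto
  have 2: "AE \<omega> in M. 1 \<le> i \<longrightarrow> 1 \<le> j \<longrightarrow> i \<noteq> j \<longrightarrow> UZ i \<omega> \<noteq> UZ j \<omega>" for i j
  proof (cases "1 \<le> i \<and> 1 \<le> j \<and> i \<noteq> j")
    case True
    then show ?thesis using AE_indep_vars_neq[OF U_indep, of "Inr i" "Inr j"] atoms[of j] by simp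
  qed auto
  have "AE \<omega> in M. \<forall>i j. 1 \<le> i \<longrightarrow> 1 \<le> j \<longrightarrow> UX i \<omega> \<noteq> UZ j \<omega>" using 1 by (simp add: AE_all_countable)
  moreover have "AE \<omega> in M. \<forall>i j. 1 \<le> i \<longrightarrow> 1 \<le> j \<longrightarrow> i \<noteq> j \<longrightarrow> UZ i \<omega> \<noteq> UZ j \<omega>"
    using 2 by (simp add: AE_all_countable)
  ultimately show ?thesis
  proof eventually_elim
    case (elim \<omega>)
    have "inj_on (\<lambda>i. UZ i \<omega>) {1..}" by (rule inj_onI) (use elim(2) in fastforce)
    then show ?case using elim(1) by blast
  qed
qed

text \<open>A bound on Y would put infinitely many points into some [0, 2^(k+1)].\<close>

lemma AE_Y_unbounded: "AE \<omega> in M. \<forall>t. \<exists>n. t < Y n \<omega>"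
  using AE_count AE_Y_facts
proof eventually_elim
  case (elim \<omega>)
  show ?case
  proof (rule ccontr)
    assume "\<not> (\<forall>t. \<exists>n. t < Y n \<omega>)"
    then obtain t where t: "\<And>n. Y n \<omega> \<le> t" by (auto simp: not_less)
    have "\<forall>\<^sub>F k in sequentially. t \<le> 2 ^ Suc k" by real_asymp
    with elim(1) have "\<forall>\<^sub>F k in sequentially. t \<le> 2 ^ Suc k \<and> finite (points {0..2 ^ Suc k} \<omega>)"
      by eventually_elim simp
    then obtain k where k: "t \<le> 2 ^ Suc k" "finite (points {0..2 ^ Suc k} \<omega>)"
      by (auto simp only: eventually_sequentially)
    have "{1..} \<subseteq> points {0..2 ^ Suc k} \<omega>"
    proof
      fix n :: nat assume "n \<in> {1..}"
      then have "1 \<le> n" "0 < Y n \<omega>" using elim(2) by auto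
      moreover have "Y n \<omega> \<le> 2 ^ Suc k" using t[of n] k(1) by linarith
      ultimately show "n \<in> points {0..2 ^ Suc k} \<omega>" unfolding points_def by simp
    qed
    then have "finite {1::nat..}" using k(2) finite_subset by blast
    then show False using infinite_Ici by blast
  qed
qed

lemma AE_data:
  "AE \<omega> in M. compact_looptree_data (\<lambda>i. Y i \<omega>) (\<lambda>i. Z i \<omega>) \<theta> (\<lambda>i. X i \<omega>) (\<lambda>i. UX i \<omega>) (\<lambda>i. UZ i \<omega>)"
  using AE_X_inj AE_X_nonneg AE_U_range AE_U_distinct AE_Y_unbounded AE_Y_facts AE_Z_range AE_X_neq_Y
    AE_mass_finite AE_space
proof eventually_elim
  case (elim \<omega>)
  have at: "1 \<le> i" if "i \<in> atoms \<theta>" for i using that unfolding atoms_def by simp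
  show ?case
  proof unfold_locales
    show "Y 0 \<omega> = 0" "strict_mono (\<lambda>i. Y i \<omega>)" using elim(6) by auto
    show "\<exists>n. t < Y n \<omega>" for t using elim(5) by blast
    show "0 \<le> Z i \<omega> \<and> Z i \<omega> \<le> Y i \<omega>" for i
      using elim(7) Z_0[OF elim(10)] Y_0[OF elim(10)] by (cases "i = 0") auto
    show "inj_on (\<lambda>i. X i \<omega>) (atoms \<theta>)" by (rule elim(1))
    show "0 \<le> X i \<omega>" if "i \<in> atoms \<theta>" for i using elim(2) that by blast
    show "X i \<omega> \<noteq> Y j \<omega>" if "i \<in> atoms \<theta>" "1 \<le> j" for i j using elim(8) that by blast
    show "0 < UX i \<omega> \<and> UX i \<omega> \<le> 1" if "i \<in> atoms \<theta>" for i using elim(3) at[OF that] by blast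
    show "0 < UZ i \<omega> \<and> UZ i \<omega> \<le> 1 \<and> UZ i \<omega> \<noteq> 1/2" if "1 \<le> i" for i using elim(3) that by blast
    show "UX i \<omega> \<noteq> UZ j \<omega>" if "i \<in> atoms \<theta>" "1 \<le> j" for i j using elim(4) at[OF that(1)] that(2) by blast
    show "inj_on (\<lambda>i. UZ i \<omega>) {1..}" using elim(4) by blast
    show "0 \<le> \<theta> i" for i by (rule \<theta>_nonneg)
    show "mass \<omega> l < \<infinity>" for l using elim(9) by blast
  qed
qed

section \<open>The branches at a dyadic scale are short and light\<close>

lemma gap_eventually_le: "\<forall>\<^sub>F k in sequentially. gap k \<le> 2 ^ k"
proof -
  define c where "c = mb 0"
  have c: "0 < c" unfolding c_def by (rule mb_pos)
  then have "\<forall>\<^sub>F k in sequentially. (real k)\<^sup>2 / c \<le> 2 ^ k" by real_asymp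
  then show ?thesis
  proof eventually_elim
    case (elim k)
    have "gap k \<le> (real k)\<^sup>2 / c"
      unfolding gap_def c_def using mb_mono[of k] mb_pos[of 0] by (intro divide_left_mono) auto
    then show ?case using elim by linarith
  qed
qed

text \<open>If Y c lies at position q of the grid, cell q + 1 contains a point of Y beyond it, so
  the branch c is covered by the cells q and q + 1. This bounds its end and its mass.\<close>

lemma AE_scales:
  "AE \<omega> in M. \<forall>\<^sub>F k in sequentially. \<forall>c. 2 ^ k \<le> Y c \<omega> \<longrightarrow> Y c \<omega> < 2 ^ Suc k \<longrightarrow>
     c \<in> {1..16 ^ k} \<and> Y (Suc c) \<omega> \<le> 4 * 2 ^ k \<and> branch_mass c \<omega> \<le> ennreal (4 * (real k)\<^sup>2 / 2 ^ k)"
  using AE_mass_ge AE_not_void AE_cell_mass AE_count AE_Y_facts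
proof eventually_elim
  case (elim \<omega>)
  have Y0: "Y 0 \<omega> = 0" and mono: "strict_mono (\<lambda>i. Y i \<omega>)" and pos: "\<And>i. 1 \<le> i \<Longrightarrow> 0 < Y i \<omega>"
    using elim(5) by auto
  have Yle: "Y i \<omega> \<le> Y j \<omega> \<longleftrightarrow> i \<le> j" for i j using strict_mono_less_eq[OF mono] .
  have Yless: "Y i \<omega> < Y j \<omega> \<longleftrightarrow> i < j" for i j using strict_mono_less[OF mono] .
  have "\<forall>\<^sub>F k in sequentially. 1 \<le> k" by (rule eventually_ge_at_top)
  with elim(1-4) gap_eventually_le show ?case
  proof eventually_elim
    case (elim k)
    have k: "1 \<le> k" by (rule elim(6))
    have gap: "0 < gap k" "gap k \<le> 2 ^ k" using k mb_pos[of k] elim(5) unfolding gap_def by simp_all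
    show ?case
    proof (intro allI impI)
      fix c assume c: "2 ^ k \<le> Y c \<omega>" "Y c \<omega> < 2 ^ Suc k"
      have "c \<noteq> 0"
      proof
        assume "c = 0"
        then have "(2::real) ^ k \<le> 0" using c(1) Y0 by simp
        moreover have "(0::real) < 2 ^ k" by simp
        ultimately show False by linarith
      qed
      have "{1..c} \<subseteq> points {0..2 ^ Suc k} \<omega>"
      proof
        fix i assume i: "i \<in> {1..c}"
        then have "Y i \<omega> \<le> Y c \<omega>" unfolding Yle by simp
        then have "Y i \<omega> \<le> 2 ^ Suc k" using c(2) by linarith
        then show "i \<in> points {0..2 ^ Suc k} \<omega>" using i pos[of i] unfolding points_def by simp
      qed
      then have "card {1..c} \<le> card (points {0..2 ^ Suc k} \<omega>)" using elim(4) card_mono by blast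
      moreover have "card (points {0..2 ^ Suc k} \<omega>) \<le> 16 ^ k" using elim(4) by blast
      ultimately have "c \<le> 16 ^ k" by simp
      \<comment> \<open>The position of Y c in units of the mesh, counted from 2^k.\<close>
      define s where "s = (Y c \<omega> - 2 ^ k) / gap k"
      define q where "q = nat \<lfloor>s\<rfloor>"
      have s0: "0 \<le> s" unfolding s_def using c(1) gap(1) by simp
      then have q: "real q \<le> s" "s < real q + 1" unfolding q_def by linarith+
      have ys: "Y c \<omega> = 2 ^ k + s * gap k" unfolding s_def using gap(1) by simp
      \<comment> \<open>Keeps q and q + 1 within the range of cells controlled by the union
        bounds.\<close>
      have "s \<le> 4 ^ k"
      proof -
        have "mb k \<le> 2 ^ k" by (rule mean_mass_le) simp
        moreover have "1 \<le> (real k)\<^sup>2" using k by simp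
        ultimately have "mb k * 1 \<le> 2 ^ k * (real k)\<^sup>2" using mb_pos[of k] by (intro mult_mono) auto
        then have g: "1 / 2 ^ k \<le> gap k" unfolding gap_def using mb_pos[of k] by (simp add: field_simps)
        have "s \<le> 2 ^ k / gap k" unfolding s_def using c(2) gap(1) by (intro divide_right_mono) auto
        also have "\<dots> \<le> 2 ^ k / (1 / 2 ^ k)" using g gap(1) by (intro divide_left_mono) auto
        also have "\<dots> = 4 ^ k" by (simp flip: power_mult_distrib)
        finally show ?thesis .
      qed
      then have "real q \<le> 4 ^ k" using q(1) by linarith
      then have q4: "q \<le> 4 ^ k" by simp
      \<comment> \<open>This point lies beyond Y c, so branch c ends there at the latest.\<close>
      obtain i where i: "1 \<le> i" "Y i \<omega> \<in> cell k (q + 1)"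
        using elim(1,2) q4 by (metis add_le_mono1)
      have qg: "real q * gap k \<le> s * gap k" "s * gap k < (real q + 1) * gap k"
        using q gap(1) by simp_all
      have ri: "2 ^ k + (real q + 1) * gap k < Y i \<omega>" "Y i \<omega> \<le> 2 ^ k + (real q + 1) * gap k + gap k"
        using i(2) unfolding cell_def by (simp_all add: algebra_simps)
      have "Y c \<omega> < Y i \<omega>" using ri(1) qg(2) ys by linarith
      then have "Suc c \<le> i" unfolding Yless by simp
      then have "Y (Suc c) \<omega> \<le> Y i \<omega>" unfolding Yle .
      then have Yi: "Y (Suc c) \<omega> \<le> 2 ^ k + (real q + 1) * gap k + gap k" using ri(2) by linarith
      have "(real q + 1) * gap k = real q * gap k + gap k" by (simp add: algebra_simps)
      then have "Y (Suc c) \<omega> \<le> Y c \<omega> + 2 * gap k" using Yi ys qg(1) by linarith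
      then have le: "Y (Suc c) \<omega> \<le> 4 * 2 ^ k" using c(2) gap(2) by simp
      \<comment> \<open>Y c may be the excluded left end of cell q; the branch starts strictly after
        Y c, so the cover is not affected.\<close>
      have sub: "{Y c \<omega><..Y (Suc c) \<omega>} \<subseteq> cell k q \<union> cell k (q + 1)"
      proof
        fix t assume "t \<in> {Y c \<omega><..Y (Suc c) \<omega>}"
        then have "2 ^ k + real q * gap k < t" "t \<le> 2 ^ k + (real q + 1) * gap k + gap k"
          using ys qg(1) Yi by auto
        then show "t \<in> cell k q \<union> cell k (q + 1)" unfolding cell_def by (auto simp: algebra_simps)
      qed
      have "branch_mass c \<omega> \<le> emeasure (\<mu> \<omega>) (cell k q \<union> cell k (q + 1))"
        unfolding branch_mass_def by (rule emeasure_mono[OF sub]) (use sets.Un[OF cell_borel cell_borel] in simp)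
      also have "\<dots> \<le> emeasure (\<mu> \<omega>) (cell k q) + emeasure (\<mu> \<omega>) (cell k (q + 1))"
        by (rule emeasure_subadditive) simp_all
      also have "\<dots> \<le> ennreal (2 * (real k)\<^sup>2 / 2 ^ k) + ennreal (2 * (real k)\<^sup>2 / 2 ^ k)"
        using elim(3) q4 by (intro add_mono) simp_all
      also have "\<dots> = ennreal (4 * (real k)\<^sup>2 / 2 ^ k)" by (simp flip: ennreal_plus)
      finally show "c \<in> {1..16 ^ k} \<and> Y (Suc c) \<omega> \<le> 4 * 2 ^ k \<and> branch_mass c \<omega> \<le> ennreal (4 * (real k)\<^sup>2 / 2 ^ k)"
        using \<open>c \<noteq> 0\<close> \<open>c \<le> 16 ^ k\<close> le by simp
    qed
  qed
qed

text \<open>Branches are disjoint, so those of the scale have total mass at most \<mu>[0, 4 * 2^k],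
  which is at most 4 k^2 \<open>mb k\<close>. Dividing by the lower bound \<open>mb k / 4\<close> of
  \<mu>[0,2^k] gives the constant 16 k^2.\<close>

lemma AE_chain_good:
  "AE \<omega> in M. \<forall>\<^sub>F k in sequentially. \<omega> \<in> chain_good (2 ^ k) (2 ^ Suc k) (16 * (real k)\<^sup>2) (16 ^ k)"
  using AE_mass_ge AE_mass_growth AE_scales AE_Y_facts AE_mass_finite AE_space
proof eventually_elim
  case (elim \<omega>)
  have Y0: "Y 0 \<omega> = 0" and mono: "strict_mono (\<lambda>i. Y i \<omega>)" and pos: "\<And>i. 1 \<le> i \<Longrightarrow> 0 < Y i \<omega>"
    using elim(4) by auto
  have Yle: "Y i \<omega> \<le> Y j \<omega> \<longleftrightarrow> i \<le> j" for i j using strict_mono_less_eq[OF mono] .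
  have fin: "mass \<omega> t < \<infinity>" for t using elim(5) by blast
  have sp: "\<omega> \<in> space M" by (rule elim(6))
  from elim(1-3) show ?case
  proof eventually_elim
    case (elim k)
    define S where "S = {c\<in>{1..16 ^ k}. 2 ^ k \<le> Y c \<omega> \<and> Y c \<omega> < 2 ^ Suc k}"
    define B where "B = (\<lambda>c. {Y c \<omega><..Y (Suc c) \<omega>})"
    have dis: "disjoint_family_on B S"
      unfolding disjoint_family_on_def
    proof (intro ballI impI)
      fix c d :: nat assume "c \<noteq> d"
      then have "Suc c \<le> d \<or> Suc d \<le> c" by linarith
      then have "Y (Suc c) \<omega> \<le> Y d \<omega> \<or> Y (Suc d) \<omega> \<le> Y c \<omega>" unfolding Yle .
      then show "B c \<inter> B d = {}" unfolding B_def by fastforce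
    qed
    have B: "B ` S \<subseteq> sets (\<mu> \<omega>)" and S: "finite S" unfolding B_def S_def by auto
    have sub: "(\<Union>c\<in>S. B c) \<subseteq> {0..4 * 2 ^ k}"
    proof
      fix t assume "t \<in> (\<Union>c\<in>S. B c)"
      then obtain c where c: "c \<in> S" "t \<in> B c" by blast
      have "Y (Suc c) \<omega> \<le> 4 * 2 ^ k" "0 < Y c \<omega>" using elim(3) c(1) pos[of c] unfolding S_def by auto
      then show "t \<in> {0..4 * 2 ^ k}" using c(2) unfolding B_def by auto
    qed
    have "(\<Sum>c\<in>{1..16 ^ k}. branch_mass c \<omega> * indicator {2 ^ k..<2 ^ Suc k} (Y c \<omega>)) = (\<Sum>c\<in>S. branch_mass c \<omega>)"
      by (rule sum.mono_neutral_cong_right) (auto simp: S_def indicator_def)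
    also have "\<dots> = emeasure (\<mu> \<omega>) (\<Union>c\<in>S. B c)"
      unfolding branch_mass_def sum_emeasure[OF B dis S, symmetric] by (simp add: B_def)
    also have "\<dots> \<le> mass \<omega> (4 * 2 ^ k)" by (rule emeasure_mono[OF sub]) simp
    also have "\<dots> \<le> ennreal ((real k)\<^sup>2 * (4 * mb k))" by (rule elim(2))
    also have "\<dots> = ennreal (16 * (real k)\<^sup>2 * (mb k / 4))" by (rule arg_cong[of _ _ ennreal]) simp
    also have "\<dots> = ennreal (16 * (real k)\<^sup>2) * ennreal (mb k / 4)"
      using mb_pos[of k] by (intro ennreal_mult) simp_all
    also have "\<dots> \<le> ennreal (16 * (real k)\<^sup>2) * mass \<omega> (2 ^ k)"
      by (rule mult_left_mono[OF less_imp_le[OF elim(1)]]) simp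
    finally have "(\<Sum>c\<in>{1..16 ^ k}. branch_mass c \<omega> * indicator {2 ^ k..<2 ^ Suc k} (Y c \<omega>))
      \<le> ennreal (16 * (real k)\<^sup>2) * mass \<omega> (2 ^ k)" .
    moreover have "0 < mass \<omega> (2 ^ k)" by (rule le_less_trans[OF _ elim(1)]) simp
    ultimately show ?case using sp fin[of "2 ^ k"] unfolding chain_good_def by simp
  qed
qed

lemma AE_chain_mass_small:
  "AE \<omega> in M. \<forall>e>0. \<exists>n\<ge>1. \<forall>i. compact_looptree_data.chain_mass (\<lambda>i. Y i \<omega>) (\<lambda>i. Z i \<omega>) \<theta> (\<lambda>i. X i \<omega>) n i \<le> e"
  using AE_data AE_scales AE_chain_good AE_chains AE_space
proof eventually_elim
  case (elim \<omega>)
  interpret D: compact_looptree_data "\<lambda>i. Y i \<omega>" "\<lambda>i. Z i \<omega>" \<theta> "\<lambda>i. X i \<omega>" "\<lambda>i. UX i \<omega>" "\<lambda>i. UZ i \<omega>"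
    by (rule elim(1))
  have "\<forall>\<^sub>F k in sequentially.
     (\<forall>i. card {j\<in>D.ancestors i. 2 ^ k \<le> Y j \<omega> \<and> Y j \<omega> < 2 ^ Suc k} \<le> k ^ 3) \<and>
     (\<forall>j. 2 ^ k \<le> Y j \<omega> \<longrightarrow> Y j \<omega> < 2 ^ Suc k \<longrightarrow> branch_mass j \<omega> \<le> ennreal (4 * (real k)\<^sup>2 / 2 ^ k))"
    using elim(2-4)
  proof eventually_elim
    case (elim k)
    show ?case
    proof (intro conjI allI impI)
      fix i
      define C where "C = {j\<in>D.ancestors i. 2 ^ k \<le> Y j \<omega> \<and> Y j \<omega> < 2 ^ Suc k}"
      have "C \<subseteq> {1..16 ^ k}" unfolding C_def using elim(1) by auto
      moreover have "C \<subseteq> scale (2 ^ k) (2 ^ Suc k) \<omega>" unfolding C_def scale_def by auto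
      moreover have "\<omega> \<in> chain C"
      proof -
        have L0: "(0::real) < 2 ^ k" by simp
        show ?thesis unfolding chain_def using D.ancestors_pred[OF L0 C_def] \<open>\<omega> \<in> space M\<close> by blast
      qed
      ultimately show "card C \<le> k ^ 3" using elim(2,3) by blast
    next
      fix j assume "2 ^ k \<le> Y j \<omega>" "Y j \<omega> < 2 ^ Suc k"
      then show "branch_mass j \<omega> \<le> ennreal (4 * (real k)\<^sup>2 / 2 ^ k)" using elim(1) by blast
    qed
  qed
  then obtain K where
    K: "\<And>k i. K \<le> k \<Longrightarrow> card {j\<in>D.ancestors i. 2 ^ k \<le> Y j \<omega> \<and> Y j \<omega> < 2 ^ Suc k} \<le> k ^ 3"
       "\<And>k j. K \<le> k \<Longrightarrow> 2 ^ k \<le> Y j \<omega> \<Longrightarrow> Y j \<omega> < 2 ^ Suc k \<Longrightarrow> branch_mass j \<omega> \<le> ennreal (4 * (real k)\<^sup>2 / 2 ^ k)"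
    unfolding eventually_sequentially by blast
  have m: "measure (\<mu> \<omega>) {Y j \<omega><..Y (Suc j) \<omega>} \<le> 4 * (real k)\<^sup>2 / 2 ^ k"
    if "K \<le> k" "2 ^ k \<le> Y j \<omega>" "Y j \<omega> < 2 ^ Suc k" for k j
    using enn2real_mono[OF K(2)[OF that]] unfolding measure_def branch_mass_def by simp
  have s: "summable (\<lambda>k. real (k ^ 3) * (4 * (real k)\<^sup>2 / 2 ^ k))"
    by (rule summable_bigo_squares) real_asymp
  show ?case using D.chain_mass_small[OF K(1) m s] by simp
qed

end

theorem theorem2p1:
  fixes \<theta> :: "nat \<Rightarrow> real"
    and M :: "'a measure"
    and X Y Z UX UZ :: "nat \<Rightarrow> 'a \<Rightarrow> real"
  assumes "\<And>i. 0 \<le> \<theta> i"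
    and "(\<lambda>i. (\<theta> i)\<^sup>2) sums 1"
    and "\<And>i. 1 \<le> i \<Longrightarrow> \<theta> (Suc i) \<le> \<theta> i"
    and "icrt_variables M \<theta> X Y Z UX UZ"
  shows "AE \<omega> in M.
    let x = (\<lambda>i. X i \<omega>); y = (\<lambda>i. Y i \<omega>); z = (\<lambda>i. Z i \<omega>);
        U = uniform_angle \<theta> x y z (\<lambda>i. UX i \<omega>) (\<lambda>i. UZ i \<omega>)
    in (\<forall>p \<in> pre_looptree y z. \<forall>q \<in> pre_looptree y z. pre_looptree_dist \<theta> x y z U p q < \<infinity>) \<and>
       compact_pseudometric_space (looptree \<theta> x y z U) (looptree_dist \<theta> x y z U)"
proof -
  interpret icrt_process M \<theta> X Y Z UX UZ
    by (intro icrt_process.intro icrt_process_axioms.intro assms)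
  show ?thesis
    using AE_data AE_chain_mass_small
  proof eventually_elim
    case (elim \<omega>)
    interpret D: compact_looptree_data "\<lambda>i. Y i \<omega>" "\<lambda>i. Z i \<omega>" \<theta> "\<lambda>i. X i \<omega>" "\<lambda>i. UX i \<omega>" "\<lambda>i. UZ i \<omega>"
      by (rule elim(1))
    have small: "\<exists>n\<ge>1. \<forall>i. D.chain_mass n i \<le> e" if "0 < e" for e
      by (rule elim(2)[rule_format, OF that])
    \<comment> \<open>Almost surely the definite description \<open>uniform_angle\<close> denotes
      the explicit function \<open>D.angle\<close>, to which the deterministic results
      apply.\<close>
    show ?case
      unfolding Let_def D.uniform_angle_eq
    proof (intro conjI ballI)
      fix p q assume "p \<in> pre_looptree (\<lambda>i. Y i \<omega>) (\<lambda>i. Z i \<omega>)" "q \<in> pre_looptree (\<lambda>i. Y i \<omega>) (\<lambda>i. Z i \<omega>)"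
      then show "pre_looptree_dist \<theta> (\<lambda>i. X i \<omega>) (\<lambda>i. Y i \<omega>) (\<lambda>i. Z i \<omega>) D.angle p q < \<infinity>"
        by (intro D.DL_finite small)
    qed (intro D.compact_looptree small)
  qed
qed

end
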